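(* Let $\Omega\in\mathbb R$, $\Omega\neq0$. The Cauchy problem for the rotating Euler equations $$\begin{cases}\partial_tu+\Omega e_3\times u+u\cdot\nabla u+\nabla P=0,& (t,x)\in\mathbb R^+\times\mathbb R^3,\\ \mathrm{div}\,u=0,\\ u(0,x)=u_0(x),\end{cases}$$ or equivalently, after eliminating the pressure, $\partial_tu+u\cdot\nabla u=-\mathbf P(\Omega e_3\times u)+\mathbf Q(u\cdot\nabla u)$, $\mathrm{div}\,u=0$, $u(0,\cdot)=u_0$, is mildly ill-posed in $W^{1,\infty}(\mathbb R^3)$ and in $C^1(\mathbb R^3)$.
   Context: $e_3=(0,0,1)$ and $e_3\times u=(-u_2,u_1,0)$. $\mathbf P=\mathrm{Id}+(-\Delta)^{-1}\nabla\,\mathrm{div}$ is the Leray projection and $\mathbf Q=\mathrm{Id}-\mathbf P$. $\|f\|_{W^{1,\infty}}=\|f\|_{L^\infty}+\|\nabla f\|_{L^\infty}$; $C^1(\mathbb R^3)$ is the space of $C^1$ functions bounded with bounded first derivatives, with the same norm. A Cauchy problem $\partial_tf=F(f)$, $f(0,x)=f_0(x)$, is called mildly ill-posed in a Banach space $X$ if there exist a Banach space $Y$ continuously embedded in $X$ and a constant $c>0$ such that for any $\varepsilon,\delta>0$ there exists $f_0\in Y$ with $\|f_0\|_X\le\varepsilon$ for which there exists a unique local solution $f\in L^\infty([0,T];Y)$ for some $T>0$, and $\|f(t)\|_X\ge c$ for some $0<t<\delta$. Here the initial data and solutions are divergence-free vector fields. *)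

theory Defs
  imports "HOL-Analysis.Analysis" "HOL-Probability.Essential_Supremum"
begin

type_synonym vfield = "real^3 \<Rightarrow> real^3"

section \<open>Test functions and classical differential operators\<close>

primrec Ck :: "nat \<Rightarrow> ('a::euclidean_space \<Rightarrow> 'b::real_normed_vector) \<Rightarrow> bool" where
  "Ck 0 f \<longleftrightarrow> continuous_on UNIV f"
| "Ck (Suc k) f \<longleftrightarrow> (\<forall>x. f differentiable (at x)) \<and>
     (\<forall>b\<in>Basis. Ck k (\<lambda>x. frechet_derivative f (at x) b))"

definition test_fun :: "('a::euclidean_space \<Rightarrow> 'b::real_normed_vector) \<Rightarrow> bool" where
  "test_fun \<phi> \<longleftrightarrow> (\<forall>k. Ck k \<phi>) \<and> compact (closure {x. \<phi> x \<noteq> 0})"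

definition pd :: "3 \<Rightarrow> (real^3 \<Rightarrow> 'b::real_normed_vector) \<Rightarrow> real^3 \<Rightarrow> 'b" where
  "pd i f x = frechet_derivative f (at x) (axis i 1)"

definition grad :: "(real^3 \<Rightarrow> real) \<Rightarrow> vfield" where
  "grad g x = (\<chi> i. pd i g x)"

definition dvg :: "vfield \<Rightarrow> real^3 \<Rightarrow> real" where
  "dvg f x = (\<Sum>i\<in>UNIV. pd i f x $ i)"

text \<open>The inverse of the negative Laplacian on test functions: convolution with the Newtonian
  kernel. The integrand has the junk value 0 at the single point \<open>y = x\<close>.\<close>
definition inv_neg_laplacian :: "vfield \<Rightarrow> vfield" where
  "inv_neg_laplacian g x = (LINT y|lebesgue. (1 / (4 * pi * norm (x - y))) *\<^sub>R g y)"

definition leray_P :: "vfield \<Rightarrow> vfield" where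
  "leray_P \<phi> x = \<phi> x + inv_neg_laplacian (grad (dvg \<phi>)) x"

definition leray_Q :: "vfield \<Rightarrow> vfield" where
  "leray_Q \<phi> x = \<phi> x - leray_P \<phi> x"

section \<open>Weak derivatives\<close>

definition loc_integrable :: "(real^3 \<Rightarrow> 'b::{banach, second_countable_topology}) \<Rightarrow> bool" where
  "loc_integrable f \<longleftrightarrow> (\<forall>K. compact K \<longrightarrow> set_integrable lebesgue K f)"

definition pairing :: "vfield \<Rightarrow> vfield \<Rightarrow> real" where
  "pairing f \<phi> = (LINT x|lebesgue. f x \<bullet> \<phi> x)"

definition weak_pd ::
  "3 \<Rightarrow> (real^3 \<Rightarrow> 'b::{banach, second_countable_topology}) \<Rightarrow> (real^3 \<Rightarrow> 'b) \<Rightarrow> bool" where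
  "weak_pd i f g \<longleftrightarrow> loc_integrable f \<and> loc_integrable g \<and>
     (\<forall>\<phi> :: real^3 \<Rightarrow> real. test_fun \<phi> \<longrightarrow>
        (LINT x|lebesgue. pd i \<phi> x *\<^sub>R f x) = - (LINT x|lebesgue. \<phi> x *\<^sub>R g x))"

text \<open>Jacobian convention: the entry in row \<open>j\<close>, column \<open>i\<close> is the \<open>i\<close>-th partial derivative of
  the \<open>j\<close>-th component, so that \<open>u \<cdot> \<nabla>u\<close> is the matrix-vector product of the Jacobian with \<open>u\<close>.\<close>
definition has_weak_jac :: "vfield \<Rightarrow> (real^3 \<Rightarrow> real^3^3) \<Rightarrow> bool" where
  "has_weak_jac f J \<longleftrightarrow> (\<forall>i. weak_pd i f (\<lambda>x. column i (J x)))"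

text \<open>Determined only up to a null set, and meaningful only if a weak Jacobian exists.\<close>
definition weak_jac :: "vfield \<Rightarrow> real^3 \<Rightarrow> real^3^3" where
  "weak_jac f = (SOME J. has_weak_jac f J)"

definition advect :: "vfield \<Rightarrow> vfield" where
  "advect u x = weak_jac u x *v u x"

definition weakly_div_free :: "vfield \<Rightarrow> bool" where
  "weakly_div_free f \<longleftrightarrow> loc_integrable f \<and>
     (\<forall>\<phi> :: real^3 \<Rightarrow> real. test_fun \<phi> \<longrightarrow> pairing f (grad \<phi>) = 0)"

section \<open>The spaces \<open>W\<^sup>1\<^sup>,\<^sup>\<infinity>\<close> and \<open>C\<^sup>1\<close>\<close>

definition ess_bounded :: "(real^3 \<Rightarrow> 'b::real_normed_vector) \<Rightarrow> bool" where
  "ess_bounded f \<longleftrightarrow> f \<in> borel_measurable lebesgue \<and>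
     esssup lebesgue (\<lambda>x. ereal (norm (f x))) < \<infinity>"

definition Linf_norm :: "(real^3 \<Rightarrow> 'b::real_normed_vector) \<Rightarrow> real" where
  "Linf_norm f = real_of_ereal (esssup lebesgue (\<lambda>x. ereal (norm (f x))))"

definition W1inf :: "vfield set" where
  "W1inf = {f. ess_bounded f \<and> (\<exists>J. has_weak_jac f J \<and> ess_bounded J)}"

definition W1inf_norm :: "vfield \<Rightarrow> real" where
  "W1inf_norm f = Linf_norm f + Linf_norm (weak_jac f)"

definition C1b :: "vfield set" where
  "C1b = {f. Ck 1 f \<and> bounded (range f) \<and> bounded (range (\<lambda>x. jacobian f (at x)))}"

section \<open>Mild ill-posedness\<close>

text \<open>Function spaces are represented by sets of functions whose elements are identified when they
  agree almost everywhere: \<open>N\<close> is a norm on the resulting classes, and completeness is that of the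
  quotient. For continuous functions the identification is equality. Since a Banach space
  continuously embedded in a function space may be replaced by its image with the transported
  norm, quantifying over such \<open>Y\<close> and \<open>N\<close> is quantifying over all of them.\<close>
definition banach_fields :: "vfield set \<Rightarrow> (vfield \<Rightarrow> real) \<Rightarrow> bool" where
  "banach_fields Y N \<longleftrightarrow>
     (\<lambda>x. 0) \<in> Y \<and>
     (\<forall>f\<in>Y. \<forall>g\<in>Y. (\<lambda>x. f x + g x) \<in> Y \<and> N (\<lambda>x. f x + g x) \<le> N f + N g) \<and>
     (\<forall>f\<in>Y. \<forall>a::real. (\<lambda>x. a *\<^sub>R f x) \<in> Y \<and> N (\<lambda>x. a *\<^sub>R f x) = \<bar>a\<bar> * N f) \<and>
     (\<forall>f\<in>Y. 0 \<le> N f \<and> (N f = 0 \<longleftrightarrow> (AE x in lebesgue. f x = 0))) \<and>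
     (\<forall>F. (\<forall>n::nat. F n \<in> Y) \<and>
          (\<forall>e>0. \<exists>n0. \<forall>m\<ge>n0. \<forall>n\<ge>n0. N (\<lambda>x. F m x - F n x) < e) \<longrightarrow>
          (\<exists>f\<in>Y. (\<lambda>n. N (\<lambda>x. F n x - f x)) \<longlonglongrightarrow> 0))"

definition cont_embedded ::
  "vfield set \<Rightarrow> (vfield \<Rightarrow> real) \<Rightarrow> vfield set \<Rightarrow> (vfield \<Rightarrow> real) \<Rightarrow> bool" where
  "cont_embedded Y N X NX \<longleftrightarrow> Y \<subseteq> X \<and> (\<exists>C. \<forall>f\<in>Y. NX f \<le> C * N f)"

text \<open>Bochner space of essentially bounded, strongly measurable functions from \<open>[0,T]\<close> to \<open>Y\<close>.\<close>
definition Linf_in_time ::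
  "real \<Rightarrow> vfield set \<Rightarrow> (vfield \<Rightarrow> real) \<Rightarrow> (real \<Rightarrow> vfield) \<Rightarrow> bool" where
  "Linf_in_time T Y N u \<longleftrightarrow>
     (\<exists>M. AE t in lebesgue_on {0..T}. u t \<in> Y \<and> N (u t) \<le> M) \<and>
     (\<exists>s :: nat \<Rightarrow> real \<Rightarrow> vfield.
        (\<forall>n. finite (s n ` {0..T}) \<and> s n ` {0..T} \<subseteq> Y \<and>
             (\<forall>g. {t \<in> {0..T}. s n t = g} \<in> sets lebesgue)) \<and>
        (AE t in lebesgue_on {0..T}. (\<lambda>n. N (\<lambda>x. u t x - s n t x)) \<longlonglongrightarrow> 0))"

text \<open>A Cauchy problem is given by the relation \<open>sol T u0 u\<close>: \<open>u\<close> is a solution on \<open>[0,T]\<close> with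
  initial datum \<open>u0\<close>. The relations used below determine \<open>u t\<close> up to a null set for every \<open>t\<close>
  (not just for almost every \<open>t\<close>), so evaluation at a single time is meaningful. At exceptional
  times, where \<open>u t \<notin> Y\<close> is possible, membership in \<open>X\<close> has to be asked for
  before its norm is taken.\<close>
definition mildly_ill_posed ::
  "vfield set \<Rightarrow> (vfield \<Rightarrow> real) \<Rightarrow> (real \<Rightarrow> vfield \<Rightarrow> (real \<Rightarrow> vfield) \<Rightarrow> bool) \<Rightarrow> bool" where
  "mildly_ill_posed X NX sol \<longleftrightarrow>
     (\<exists>Y N. banach_fields Y N \<and> cont_embedded Y N X NX \<and>
       (\<exists>c>0. \<forall>\<epsilon>>0. \<forall>\<delta>>0. \<exists>u0\<in>Y. NX u0 \<le> \<epsilon> \<and>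
         (\<exists>T>0. \<exists>u.
            Linf_in_time T Y N u \<and> sol T u0 u \<and>
            (\<forall>v. Linf_in_time T Y N v \<and> sol T u0 v \<longrightarrow>
                 (\<forall>t\<in>{0..T}. AE x in lebesgue. v t x = u t x)) \<and>
            (\<exists>t. 0 < t \<and> t < \<delta> \<and> t \<le> T \<and> u t \<in> X \<and> c \<le> NX (u t)))))"

section \<open>The rotating Euler equations\<close>

definition e3 :: "real^3" where
  "e3 = axis 3 1"

definition coriolis :: "real \<Rightarrow> vfield \<Rightarrow> vfield" where
  "coriolis \<Omega> u x = \<Omega> *\<^sub>R cross3 e3 (u x)"

text \<open>Requirements common to both forms of the equations. The divergence condition at time 0
  forces the initial datum to be divergence-free, since \<open>u 0\<close> and \<open>u0\<close> agree almost everywhere by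
  the equation tested at \<open>t = 0\<close>.\<close>
definition admissible :: "real \<Rightarrow> vfield \<Rightarrow> (real \<Rightarrow> vfield) \<Rightarrow> bool" where
  "admissible T u0 u \<longleftrightarrow> loc_integrable u0 \<and> (\<forall>t\<in>{0..T}. weakly_div_free (u t)) \<and>
     (AE t in lebesgue_on {0..T}. u t \<in> W1inf)"

text \<open>The system with pressure, in the sense of distributions in space and integrated in time.
  The term \<open>- p * dvg \<phi>\<close> is the pressure gradient tested against \<open>\<phi>\<close>.\<close>
definition rot_euler_pressure :: "real \<Rightarrow> real \<Rightarrow> vfield \<Rightarrow> (real \<Rightarrow> vfield) \<Rightarrow> bool" where
  "rot_euler_pressure \<Omega> T u0 u \<longleftrightarrow> admissible T u0 u \<and>
     (\<exists>p :: real \<Rightarrow> real^3 \<Rightarrow> real.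
        (AE t in lebesgue_on {0..T}. loc_integrable (p t)) \<and>
        (\<forall>\<phi> :: vfield. test_fun \<phi> \<longrightarrow>
          (let F = (\<lambda>s. pairing (coriolis \<Omega> (u s)) \<phi> + pairing (advect (u s)) \<phi>
                        - (LINT x|lebesgue. p s x * dvg \<phi> x))
           in set_integrable lebesgue {0..T} F \<and>
              (\<forall>t\<in>{0..T}. pairing (u t) \<phi> = pairing u0 \<phi> - (LINT s:{0..t}|lebesgue. F s)))))"

text \<open>The system without pressure. The operators \<open>P\<close> and \<open>Q\<close> are symmetric and
  act on a non-smooth field \<open>f\<close> by duality: \<open>P f\<close> tested against \<open>\<phi>\<close> is \<open>f\<close> tested against
  \<open>P \<phi>\<close>. As \<open>P \<phi>\<close> is not compactly supported but only decays like \<open>1/|x|\<^sup>3\<close>, boundedness of \<open>f\<close>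
  does not suffice for this, and integrability is part of the definition.\<close>
definition rot_euler_projected :: "real \<Rightarrow> real \<Rightarrow> vfield \<Rightarrow> (real \<Rightarrow> vfield) \<Rightarrow> bool" where
  "rot_euler_projected \<Omega> T u0 u \<longleftrightarrow> admissible T u0 u \<and>
     (\<forall>\<phi> :: vfield. test_fun \<phi> \<longrightarrow>
        (AE t in lebesgue_on {0..T}.
           integrable lebesgue (\<lambda>x. coriolis \<Omega> (u t) x \<bullet> leray_P \<phi> x) \<and>
           integrable lebesgue (\<lambda>x. advect (u t) x \<bullet> leray_Q \<phi> x)) \<and>
        (let G = (\<lambda>s. - pairing (advect (u s)) \<phi>
                      - pairing (coriolis \<Omega> (u s)) (leray_P \<phi>)
                      + pairing (advect (u s)) (leray_Q \<phi>))
         in set_integrable lebesgue {0..T} G \<and>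
            (\<forall>t\<in>{0..T}. pairing (u t) \<phi> = pairing u0 \<phi> + (LINT s:{0..t}|lebesgue. G s))))"

end

theory Submission
 imports Defs "HOL-Probability.Characteristic_Functions" "HOL-Real_Asymp.Real_Asymp"
begin

text \<open>The projected Coriolis operator \<open>u \<mapsto> P (e3 \<times> u)\<close> is of order zero and unbounded on bounded fields.
The initial datum exploits this: it is \<open>s\<close> times a sum of \<open>n\<close> dilates, by the factors \<open>\<eta> / 2^j\<close>, of one
solenoidal profile \<open>U\<close> with \<open>|U x| \<le> C min (|x|, 1/|x|)\<close>. The decay at both ends keeps the sup
norm of the sum below a multiple of \<open>s\<close> for all \<open>n\<close> (\<open>hart_lacunary_bound\<close>). The
operator commutes with dilations and \<open>P (e3 \<times> U)\<close> does not vanish at the origin, so there the \<open>n\<close>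
contributions add up (\<open>hart_lacunary_coriolis\<close>), and the solution grows like \<open>t |\<Omega>| n s\<close>. All frequencies
are at most \<open>\<eta>\<close>, which is chosen after \<open>n\<close>; so gradients are small and the nonlinearity does
not interfere (\<open>first_order\<close>, \<open>lacunary_inflation\<close>).

Fields are written as \<open>hart g\<close>, the real-valued Hartley integral of a density \<open>g\<close> on frequency space. For
a density supported in \<open>|k| \<le> \<eta>\<close> the solution is a power series in time. Its \<open>n\<close>-th coefficient is
supported in \<open>|k| \<le> \<eta> (n + 1)\<close>, so that the derivative in the nonlinearity costs a factor \<open>n + 1\<close>, which
the integration in time gives back; the series converges on an interval depending only on \<open>\<Omega>\<close>
(locale \<open>euler_series\<close>). The space \<open>Y\<close> consists of the solenoidal fields with density
\<open>O(|k| exp (- |k|))\<close>, and the series is a Lipschitz curve in it. The Leray projection, given by a Newtonian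
potential, acts on such fields as the expected Fourier multiplier (\<open>leray_P_adjoint\<close>).

Uniqueness in \<open>Y\<close> is an energy estimate in \<open>L^2\<close>. Both forms of the equations are only used against
solenoidal test fields, where pressure and projection disappear, and the difference of two solutions is
a limit of such fields (\<open>solenoidal_test_fields_dense\<close>). The estimate is available for almost every time
only; Gronwall's argument is run on a dense set of times, and weak continuity in time gives the
rest (\<open>solenoidal_uniqueness\<close>).\<close>

section \<open>Calculus of smooth functions\<close>

lemma Ck_SucI:
 fixes f :: "'a::euclidean_space => 'b::real_normed_vector"
 assumes "!!x. (f has_derivative f' x) (at x)" and "!!b. b \<in> Basis ==> Ck k (%x. f' x b)"
 shows "Ck (Suc k) f"
proof -
 have "frechet_derivative f (at x) = f' x" for x using assms(1) by (metis frechet_derivative_at)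
 then show ?thesis using assms by (auto simp: differentiable_def)
qed

lemma Ck_has_derivative:
 "Ck (Suc k) f ==> (f has_derivative frechet_derivative f (at x)) (at x)" by (simp add: frechet_derivative_works)

lemma Ck_Suc_imp: "Ck (Suc k) f ==> Ck k f"
proof (induction k arbitrary: f)
 case 0
 then show ?case by (metis Ck_has_derivative Ck.simps(1) continuous_at_imp_continuous_on has_derivative_continuous)
next
 case (Suc k)
 then show ?case by (metis Ck.simps(2))
qed

lemma Ck_mono: "Ck m f ==> k <= m ==> Ck k f" by (induction m) (metis le_zero_eq, metis Ck_Suc_imp le_Suc_eq)

lemma Ck_const: "Ck k (%x::'a::euclidean_space. c)" by (induction k arbitrary: c) (auto simp del: Ck.simps(2) intro!: Ck_SucI[where f'="%_ _. 0"])

lemma Ck_add: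
 fixes f g :: "'a::euclidean_space => 'b::real_normed_vector"
 assumes "Ck k f" "Ck k g" shows "Ck k (%x. f x + g x)" using assms
proof (induction k arbitrary: f g)
 case 0 then show ?case by (simp add: continuous_on_add)
next
 case (Suc k)
 show ?case by (rule Ck_SucI, rule has_derivative_add[OF Suc.prems[THEN Ck_has_derivative]])
    (use Suc in simp)
qed

lemma Ck_bounded_linear:
 fixes f :: "'a::euclidean_space => 'b::real_normed_vector"
 assumes "bounded_linear L" "Ck k f" shows "Ck k (%x. L (f x))" using assms(2)
proof (induction k arbitrary: f)
 case 0 then show ?case
  using bounded_linear.continuous_on[OF assms(1), of UNIV f] by simp
next
 case (Suc k)
 show ?case by (rule Ck_SucI, rule bounded_linear.has_derivative[OF assms(1) Suc.prems[THEN Ck_has_derivative]])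
    (use Suc in simp)
qed

lemma Ck_linear: "bounded_linear L ==> Ck k (L :: 'a::euclidean_space => 'b::real_normed_vector)"
proof (cases k)
 case 0 then show "bounded_linear L ==> ?thesis" by (simp add: linear_continuous_on)
next
 case (Suc m)
 then show "bounded_linear L ==> ?thesis" by (auto simp del: Ck.simps intro!: Ck_SucI[where f'="%_. L"] Ck_const bounded_linear_imp_has_derivative)
qed

text \<open>Induction over the order: by the product rule the derivative is a sum of two terms of the same shape with
one factor differentiated.\<close>
lemma Ck_bilinear:
 fixes f :: "'a::euclidean_space => 'b::real_normed_vector" and g :: "'a => 'c::real_normed_vector"
 assumes B: "bounded_bilinear B" and "Ck k f" "Ck k g" shows "Ck k (%x. B (f x) (g x))" using assms(2-)
proof (induction k arbitrary: f g)
 case 0 then show ?case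
  using bounded_bilinear.continuous_on[OF B] by simp
next
 case (Suc k)
 show ?case
 proof (rule Ck_SucI, rule bounded_bilinear.FDERIV[OF B Suc.prems[THEN Ck_has_derivative]])
  fix b :: 'a assume "b \<in> Basis"
  then show "Ck k (%x. B (f x) (frechet_derivative g (at x) b) + B (frechet_derivative f (at x) b) (g x))"
   using Suc.prems Suc.prems[THEN Ck_Suc_imp] by (intro Ck_add Suc.IH) auto
 qed
qed

lemmas Ck_scaleR = Ck_bilinear[OF bounded_bilinear_scaleR]
lemmas Ck_mult = Ck_bilinear[OF bounded_bilinear_mult]
lemmas Ck_inner = Ck_bilinear[OF bounded_bilinear_inner]

lemma bounded_bilinear_cross3: "bounded_bilinear cross3" by (simp add: bilinear_conv_bounded_bilinear[symmetric] bilinear_cross)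

lemmas Ck_cross3 = Ck_bilinear[OF bounded_bilinear_cross3]

lemma Ck_prod:
 fixes f :: "'i => 'a::euclidean_space => real"
 assumes "!!i. i \<in> I ==> Ck k (f i)" shows "Ck k (%x. \<Prod>i\<in>I. f i x)"
 using assms by (induction I rule: infinite_finite_induct) (auto intro!: Ck_const Ck_mult)

lemma Ck_continuous: "Ck k f ==> continuous_on UNIV f" using Ck_mono[of k f 0] by simp

section \<open>Smooth functions of compact support\<close>

text \<open>\<open>exp (-1/s)\<close> times a polynomial in \<open>1/s\<close>, extended by zero. The polynomial makes the family closed under
differentiation.\<close>
definition flat :: "real poly => real => real" where
 "flat p s = (if s > 0 then poly p (1 / s) * exp (- (1 / s)) else 0)"

lemma poly_exp_tendsto_0: "((%y. poly p y * exp (- y)) \<longlongrightarrow> 0) at_top" for p :: "real poly"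
proof -
 have "((%y. \<Sum>i\<le>degree p. coeff p i * (y ^ i / exp y)) \<longlongrightarrow> (\<Sum>i\<le>degree p. coeff p i * 0)) at_top"
  by (intro tendsto_sum tendsto_mult tendsto_const tendsto_power_div_exp_0)
 then show ?thesis by (simp add: poly_altdef sum_distrib_right exp_minus divide_inverse mult.assoc)
qed

text \<open>All derivatives of \<open>exp (-1/s)\<close> are again of the form polynomial in \<open>1/s\<close> times
 \<open>exp (-1/s)\<close>, and such functions vanish at \<open>0\<close> faster than \<open>s\<close>; so the whole family is
 differentiable across \<open>0\<close> and closed under differentiation.\<close>
lemma flat_DERIV:
 "(flat p has_real_derivative flat ([:0, 0, 1:] * (p - pderiv p)) s) (at s)"
proof -
 consider "s > 0" | "s < 0" | "s = 0" by linarith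
 then show ?thesis
 proof cases
  case 1
  have 0: "((%s. 1 / s) has_real_derivative - (1 / s^2)) (at s)" using 1 by (auto intro!: derivative_eq_intros simp: power2_eq_square)
  have "((%s. poly p (1 / s) * exp (- (1 / s))) has_real_derivative
    (poly (pderiv p) (1 / s) * (- (1 / s^2))) * exp (- (1 / s)) +
    (exp (- (1 / s)) * - (- (1 / s^2))) * poly p (1 / s)) (at s)"
   by (intro DERIV_mult DERIV_chain2[OF poly_DERIV 0] DERIV_chain2[OF DERIV_exp] DERIV_minus 0)
  also have "(poly (pderiv p) (1 / s) * (- (1 / s^2))) * exp (- (1 / s)) +
    (exp (- (1 / s)) * - (- (1 / s^2))) * poly p (1 / s) = flat ([:0, 0, 1:] * (p - pderiv p)) s"
   using 1 by (simp add: flat_def power2_eq_square algebra_simps)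
  finally have "((%s. poly p (1 / s) * exp (- (1 / s))) has_real_derivative
    flat ([:0, 0, 1:] * (p - pderiv p)) s) (at s)" .
  then show ?thesis by (rule has_field_derivative_transform_within_open[where S="{0<..}"]) (use 1 in "auto simp: flat_def")
 next
  case 2
  have "((%s. 0) has_real_derivative flat ([:0, 0, 1:] * (p - pderiv p)) s) (at s)" using 2 unfolding flat_def by auto
  then show ?thesis by (rule has_field_derivative_transform_within_open[where S="{..<0}"]) (use 2 in "auto simp: flat_def")
 next
  case 3
  have "((%y. poly (pCons 0 p) y * exp (- y)) \<longlongrightarrow> 0) at_top" by (rule poly_exp_tendsto_0)
  moreover have "filterlim (%h::real. 1 / h) at_top (at_right 0)" using filterlim_inverse_at_top_right by (simp add: inverse_eq_divide)
  ultimately have "((%h. poly (pCons 0 p) (1 / h) * exp (- (1 / h))) \<longlongrightarrow> 0) (at_right 0)" by (rule filterlim_compose)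
  then have r: "((%h. (flat p (0 + h) - flat p 0) / h) \<longlongrightarrow> 0) (at_right 0)"
   by (rule Lim_transform_eventually) (auto simp: flat_def eventually_at_filter)
  have l: "((%h. (flat p (0 + h) - flat p 0) / h) \<longlongrightarrow> 0) (at_left 0)"
   by (rule Lim_transform_eventually[OF tendsto_const]) (auto simp: flat_def eventually_at_filter)
  show ?thesis using filterlim_split_at_real[OF l r] 3 by (simp add: DERIV_def flat_def)
 qed
qed

lemma flat_one_bounds: "0 <= flat 1 s" "flat 1 s <= 1" by (auto simp: flat_def)

lemma flat_continuous: "continuous_on S (flat p)" by (meson DERIV_continuous_on flat_DERIV has_field_derivative_at_within)

lemma flat_bounded: "\<exists>C>0. \<forall>s\<le>1. \<bar>flat p s\<bar> <= C"
proof -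
 have "compact (flat p ` {0..1})" by (rule compact_continuous_image[OF flat_continuous]) simp
 then obtain C where C: "C > 0" "!!y. y \<in> flat p ` {0..1} ==> norm y <= C" using bounded_pos compact_imp_bounded by metis
 have "\<bar>flat p s\<bar> <= C" if "s <= 1" for s
 proof (cases "s >= 0")
  case True then show ?thesis using C(2)[of "flat p s"] that by auto
 next
  case False then show ?thesis using C(1) by (simp add: flat_def)
 qed
 then show ?thesis using C(1) by blast
qed

lemma has_derivative_flat:
 assumes "(f has_derivative f') (at x)"
 shows "((%x. flat p (f x)) has_derivative (%v. f' v * flat ([:0, 0, 1:] * (p - pderiv p)) (f x))) (at x)"
proof -
 have "(flat p has_derivative (%v. v * flat ([:0, 0, 1:] * (p - pderiv p)) (f x))) (at (f x))"
  using flat_DERIV[of p "f x"] by (simp add: has_field_derivative_def mult_commute_abs)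
 from has_derivative_compose[OF assms this] show ?thesis .
qed

text \<open>The derivative of \<open>flat p\<close> is \<open>flat\<close> of another polynomial, so the induction must run over all \<open>p\<close> at
once.\<close>
lemma Ck_flat:
 fixes f :: "'a::euclidean_space => real"
 assumes "Ck k f" shows "Ck k (%x. flat p (f x))" using assms
proof (induction k arbitrary: p)
 case 0
 then show ?case using continuous_on_compose2[OF flat_continuous[of UNIV p], of UNIV f] by simp
next
 case (Suc k)
 show ?case
 proof (rule Ck_SucI, rule has_derivative_flat, rule Ck_has_derivative[OF Suc.prems])
  fix b :: 'a assume "b \<in> Basis"
  then show "Ck k (%x. frechet_derivative f (at x) b * flat ([:0, 0, 1:] * (p - pderiv p)) (f x))"
   using Suc.prems by (intro Ck_mult Suc.IH Ck_Suc_imp[OF Suc.prems]) auto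
 qed
qed

lemma test_funI:
 fixes f :: "'a::euclidean_space => 'b::real_normed_vector"
 assumes "!!k. Ck k f" "!!x. norm x > R ==> f x = 0"
 shows "test_fun f"
proof -
 have "{x. f x \<noteq> 0} \<subseteq> cball 0 R" using assms(2) by (auto simp: not_less[symmetric])
 then have "bounded {x. f x \<noteq> 0}" using bounded_cball bounded_subset by blast
 then show ?thesis using assms(1) by (simp add: test_fun_def compact_closure)
qed

lemma test_fun_vanishes:
 assumes "test_fun f" obtains R where "R > 0" "!!x. norm x >= R ==> f x = 0"
proof -
 have "compact (closure {x. f x \<noteq> 0})" using assms by (simp add: test_fun_def)
 then have "bounded {x. f x \<noteq> 0}" using bounded_subset[OF compact_imp_bounded closure_subset] by metis
 then obtain b where b: "b > 0" "\<forall>x\<in>{x. f x \<noteq> 0}. norm x <= b" unfolding bounded_pos by metis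
 have "f x = 0" if "norm x >= b + 1" for x
 proof (rule ccontr)
  assume "f x \<noteq> 0" then have "norm x <= b" using b(2) by simp
  then show False using that by linarith
 qed
 then show thesis using b(1) by (intro that[of "b + 1"]) auto
qed

lemma test_fun_Ck: "test_fun f ==> Ck k f" by (simp add: test_fun_def)

text \<open>A smooth radial cutoff at radius \<open>R\<close>. Its value at the centre is \<open>exp (-1)\<close> for \<open>p = 1\<close>, so limits of cutoffs
carry this constant.\<close>
definition dbump :: "real poly => real => 'a::euclidean_space => real" where
 "dbump p R x = flat p (1 - (x \<bullet> x) / R^2)"

lemma Ck_dbump: "Ck k (dbump p R :: 'a::euclidean_space => real)"
proof -
 have "Ck k (%x::'a. 1 + (x \<bullet> x) * (- 1 / R^2))" by (intro Ck_add Ck_mult Ck_inner Ck_const Ck_linear bounded_linear_ident)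
 then have "Ck k (%x::'a. flat p (1 + (x \<bullet> x) * (- 1 / R^2)))" by (rule Ck_flat)
 then show ?thesis unfolding dbump_def[abs_def] by simp
qed

lemma dbump_zero:
 assumes "R > 0" "norm x >= R" shows "dbump p R x = 0"
proof -
 have "R^2 <= x \<bullet> x" using assms power_mono[of R "norm x" 2] by (simp add: dot_square_norm)
 then have "(x \<bullet> x) / R^2 >= 1" using assms(1) by (simp add: pos_le_divide_eq)
 then show ?thesis by (simp add: dbump_def flat_def)
qed

lemma has_derivative_dbump:
 "(dbump p R has_derivative
   (%v. (x \<bullet> v) * (- 2 / R^2 * dbump ([:0, 0, 1:] * (p - pderiv p)) R x))) (at x)"
proof -
 have "((%x. 1 - (x \<bullet> x) / R^2) has_derivative (%v. - (2 / R^2) * (x \<bullet> v))) (at x)"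
 proof -
  have "((%x. 1 - (1 / R^2) * (x \<bullet> x)) has_derivative (%v. 0 - (1 / R^2) * (x \<bullet> v + v \<bullet> x))) (at x)"
   by (intro has_derivative_diff has_derivative_const has_derivative_mult_right has_derivative_inner has_derivative_ident)
  then show ?thesis by (simp add: inner_commute)
 qed
 from has_derivative_flat[OF this, of p] show ?thesis unfolding dbump_def[abs_def] by (simp add: algebra_simps)
qed

lemma dbump_tendsto:
 "(%n. dbump p (real n) x) \<longlonglongrightarrow> flat p 1"
proof -
 have "(%n. 1 - (x \<bullet> x) / (real n)^2) \<longlonglongrightarrow> 1 - 0"
  by (intro tendsto_diff tendsto_const real_tendsto_divide_at_top[where c="x \<bullet> x"]
    filterlim_pow_at_top filterlim_real_sequentially) auto
 then show ?thesis unfolding dbump_def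
  using continuous_on_tendsto_compose[OF flat_continuous[of UNIV p], of "%n. 1 - (x \<bullet> x) / (real n)^2" 1 sequentially] by simp
qed

lemma dbump_bounded: "\<exists>C>0. \<forall>R x. \<bar>dbump p R x\<bar> <= C" using flat_bounded[of p] by (auto simp: dbump_def)

section \<open>Lebesgue measure\<close>

lemmas dominated_integrable = Bochner_Integration.integrable_bound

lemma integral_affine:
 fixes f :: "'a::euclidean_space => 'b::{banach, second_countable_topology}"
 assumes "c \<noteq> 0" and [measurable]: "f \<in> borel_measurable borel"
 shows "(LBINT x. f (t + c *\<^sub>R x)) = (1 / \<bar>c\<bar>^DIM('a)) *\<^sub>R (LBINT x. f x)"
proof -
 have "(LBINT x. f x) = (LBINT x. \<bar>c\<bar>^DIM('a) *\<^sub>R f (t + c *\<^sub>R x))"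
  by (subst lborel_affine[OF assms(1), of t]) (simp add: integral_density integral_distr)
 then show ?thesis using assms(1) by simp
qed

lemma integrable_affine:
 fixes f :: "'a::euclidean_space => 'b::{banach, second_countable_topology}"
 assumes "c \<noteq> 0" and f: "integrable lborel f"
 shows "integrable lborel (%x. f (t + c *\<^sub>R x))"
proof -
 have [measurable]: "f \<in> borel_measurable borel" using f by auto
 have "integrable lborel (%x. \<bar>c\<bar>^DIM('a) *\<^sub>R f (t + c *\<^sub>R x))" using f by (subst (asm) lborel_affine[OF assms(1), of t])
   (simp add: integrable_density integrable_distr_eq)
 then have "integrable lborel (%x. (1 / \<bar>c\<bar>^DIM('a)) *\<^sub>R (\<bar>c\<bar>^DIM('a) *\<^sub>R f (t + c *\<^sub>R x)))"
  by (rule integrable_scaleR_right)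
 then show ?thesis using assms(1) by simp
qed

lemma integral_translate:
 fixes f :: "'a::euclidean_space => 'b::{banach, second_countable_topology}"
 assumes "f \<in> borel_measurable borel"
 shows "(LBINT x. f (t + x)) = (LBINT x. f x)" using integral_affine[of 1 f t] assms by simp

lemma integral_reflect:
 fixes f :: "'a::euclidean_space => 'b::{banach, second_countable_topology}"
 assumes "f \<in> borel_measurable borel"
 shows "(LBINT x. f (t - x)) = (LBINT x. f x)" using integral_affine[of "-1" f t] assms by simp

lemma integrable_translate:
 fixes f :: "'a::euclidean_space => 'b::{banach, second_countable_topology}"
 assumes "integrable lborel f"
 shows "integrable lborel (%x. f (t + x))" "integrable lborel (%x. f (t - x))"
 using integrable_affine[of 1 f t] integrable_affine[of "-1" f t] assms by simp_all

lemma integrable_continuous_compact_support: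
 fixes f :: "'a::euclidean_space => 'b::{banach, second_countable_topology}"
 assumes "continuous_on UNIV f" "!!x. norm x >= R ==> f x = 0"
 shows "integrable lborel f"
proof -
 have "integrable lborel (%x. indicator (cball 0 R) x *\<^sub>R f x)"
  by (rule borel_integrable_compact) (auto intro: continuous_on_subset[OF assms(1)])
 also have "(%x. indicator (cball 0 R) x *\<^sub>R f x) = f" using assms(2) by (force simp: indicator_def fun_eq_iff)
 finally show ?thesis .
qed

section \<open>Integration by parts\<close>

text \<open>By translation invariance the integral of every difference quotient vanishes; the
 difference quotients converge boundedly on a fixed compact set.\<close>
lemma integral_directional_derivative_eq_0:
 fixes F :: "'a::euclidean_space => 'b::{banach, second_countable_topology}"
 assumes D: "!!x. (F has_derivative F' x) (at x)"
  and c: "continuous_on UNIV (%x. F' x e)"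
  and R: "!!x. norm x >= R ==> F x = 0"
 shows "(LBINT x. F' x e) = 0"
proof -
 define S where "S = \<bar>R\<bar> + norm e + norm e"
 have cF: "continuous_on UNIV F" using D by (meson continuous_at_imp_continuous_on has_derivative_continuous)
 have [measurable]: "F \<in> borel_measurable borel" "(%x. F' x e) \<in> borel_measurable borel"
  using cF c by (auto intro: borel_measurable_continuous_onI)
 define h where "h n = 1 / real (Suc n)" for n
 have h: "h n > 0" "h n <= 1" for n by (auto simp: h_def)
 have h0: "h \<longlonglongrightarrow> 0" unfolding h_def[abs_def] using LIMSEQ_Suc[OF lim_const_over_n[of 1]] by simp
 define d where "d n x = (1 / h n) *\<^sub>R (F (h n *\<^sub>R e + x) - F x)" for n x
 have iF: "integrable lborel F" by (rule integrable_continuous_compact_support[OF cF R])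
 have "(LBINT x. d n x) = 0" for n unfolding d_def using iF integrable_translate[OF iF] by (simp add: integral_translate)
 have vd: "((%t. F (x + t *\<^sub>R e)) has_vector_derivative F' (x + t *\<^sub>R e) e) (at t within T)" for x t T
 proof -
  have "((%t. F (x + t *\<^sub>R e)) has_derivative (%s. F' (x + t *\<^sub>R e) (s *\<^sub>R e))) (at t)"
   by (rule has_derivative_compose[OF _ D, of "%t. x + t *\<^sub>R e" "%s. s *\<^sub>R e"])
    (auto intro!: derivative_eq_intros)
  then show ?thesis unfolding has_vector_derivative_def
   using linear_simps(5)[OF has_derivative_bounded_linear[OF D]] by (simp add: has_derivative_at_withinI)
 qed
 have lim: "(%n. d n x) \<longlonglongrightarrow> F' x e" for x
 proof -
  have "((%t. F (x + t *\<^sub>R e)) has_vector_derivative F' x e) (at 0)" using vd[of x 0 UNIV] by simp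
  then have "((%t. norm (F (x + t *\<^sub>R e) - F x - t *\<^sub>R F' x e) / norm t) \<longlongrightarrow> 0) (at 0)"
   by (simp add: has_vector_derivative_def has_derivative_iff_norm)
  then have "((%t. norm ((1 / t) *\<^sub>R (F (x + t *\<^sub>R e) - F x) - F' x e)) \<longlongrightarrow> 0) (at 0)"
  proof (rule Lim_transform_eventually)
   have "norm (F (x + t *\<^sub>R e) - F x - t *\<^sub>R F' x e) / norm t =
     norm ((1 / t) *\<^sub>R (F (x + t *\<^sub>R e) - F x) - F' x e)" if "t \<noteq> 0" for t
   proof -
    have "(1 / t) *\<^sub>R (F (x + t *\<^sub>R e) - F x) - F' x e =
      (1 / t) *\<^sub>R (F (x + t *\<^sub>R e) - F x - t *\<^sub>R F' x e)" using that by (simp add: scaleR_diff_right)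
    then show ?thesis by simp
   qed
   then show "\<forall>\<^sub>F t in at 0. norm (F (x + t *\<^sub>R e) - F x - t *\<^sub>R F' x e) / norm t =
     norm ((1 / t) *\<^sub>R (F (x + t *\<^sub>R e) - F x) - F' x e)" by (simp add: eventually_at_filter)
  qed
  then have "((%t. (1 / t) *\<^sub>R (F (x + t *\<^sub>R e) - F x)) \<longlongrightarrow> F' x e) (at 0)"
   by (rule LIM_zero_cancel[OF tendsto_norm_zero_cancel])
  moreover have "filterlim h (at 0) sequentially" using h(1) by (intro filterlim_atI h0 always_eventually) (simp add: less_imp_neq[symmetric])
  ultimately have "(%n. (1 / h n) *\<^sub>R (F (x + h n *\<^sub>R e) - F x)) \<longlonglongrightarrow> F' x e" by (rule filterlim_compose)
  then show ?thesis by (simp add: d_def add.commute)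
 qed
 obtain C where C: "!!x. norm x <= S ==> norm (F' x e) <= C"
 proof -
  have "compact ((%x. F' x e) ` cball 0 S)" by (rule compact_continuous_image) (auto intro: continuous_on_subset[OF c])
  then show thesis using that unfolding bounded_iff[of "_ ` _"] by (force dest!: compact_imp_bounded simp: bounded_iff)
 qed
 have bnd: "norm (d n x) <= indicator (cball 0 S) x *\<^sub>R C" for n x
 proof (cases "norm x <= R + norm e")
  case True
  have "norm (F (x + h n *\<^sub>R e) - F (x + 0 *\<^sub>R e)) <= C * norm (h n - 0)"
  proof (rule differentiable_bound[where S="{0..h n}" and f'="%t s. s *\<^sub>R F' (x + t *\<^sub>R e) e"])
   fix t assume t: "t \<in> {0..h n}"
   show "((%t. F (x + t *\<^sub>R e)) has_derivative (%s. s *\<^sub>R F' (x + t *\<^sub>R e) e)) (at t within {0..h n})"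
    using vd unfolding has_vector_derivative_def .
   have "norm (t *\<^sub>R e) <= norm e" using t h[of n] by (simp add: mult_left_le_one_le)
   then have "norm (x + t *\<^sub>R e) <= S" using True norm_triangle_ineq[of x "t *\<^sub>R e"] by (simp add: S_def)
   then show "onorm (%s. s *\<^sub>R F' (x + t *\<^sub>R e) e) <= C"
    by (intro onorm_le) (metis C mult.commute abs_ge_zero mult_right_mono norm_scaleR real_norm_def)
  qed (use h(1)[of n] in auto)
  then have "norm (d n x) <= C" using h(1)[of n] by (simp add: d_def add.commute[of "h n *\<^sub>R e"] pos_divide_le_eq del: scaleR_diff_right)
  moreover have "norm x <= S" unfolding S_def using True norm_ge_zero[of e] abs_ge_self[of R] by linarith
  ultimately show ?thesis by simp
 next
  case False
  have "norm (h n *\<^sub>R e) <= norm e" using h[of n] by (simp add: mult_left_le_one_le)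
  then have "norm (h n *\<^sub>R e + x) >= R" using False norm_diff_ineq[of x "h n *\<^sub>R e"] by (simp add: add.commute)
  moreover have "norm x >= R" using False norm_ge_zero[of e] by linarith
  ultimately have "d n x = 0" by (simp add: d_def R)
  moreover have "0 <= C" if "norm x <= S" using C[OF that] norm_ge_zero order_trans by blast
  ultimately show ?thesis by (simp add: indicator_def)
 qed
 have "(%n. LBINT x. d n x) \<longlonglongrightarrow> (LBINT x. F' x e)"
 proof (rule integral_dominated_convergence[where w="%x. indicator (cball 0 S) x *\<^sub>R C"])
  show "integrable lborel (%x::'a. indicator (cball 0 S) x *\<^sub>R C)" by (intro borel_integrable_compact) auto
  show "AE x in lborel. norm (d n x) <= indicator (cball 0 S) x *\<^sub>R C" for n using bnd by simp
  show "AE x in lborel. (%n. d n x) \<longlonglongrightarrow> F' x e" using lim by simp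
 qed (auto simp: d_def[abs_def])
 then show ?thesis using \<open>!!n. (LBINT x. d n x) = 0\<close> by (simp add: LIMSEQ_const_iff)
qed

section \<open>Integrals over space\<close>

lemma lborel_integral_prod:
 fixes f :: "'a::euclidean_space => real => 'b::{real_normed_field,banach,second_countable_topology}"
 assumes "!!b. b \<in> Basis ==> integrable lborel (f b)"
 shows "integrable lborel (%x::'a. \<Prod>b\<in>Basis. f b (x \<bullet> b))" (is ?g1)
  and "(LBINT x. (\<Prod>b\<in>Basis. f b (x \<bullet> b))) = (\<Prod>b\<in>Basis. LBINT t. f b t)" (is ?g2)
proof -
 interpret product_sigma_finite "%_::'a. lborel :: real measure" ..
 have [measurable]: "!!b. b \<in> Basis ==> f b \<in> borel_measurable borel" using assms by (auto dest: borel_measurable_integrable)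
 have [measurable]: "(%F. \<Sum>b\<in>Basis. F b *\<^sub>R b :: 'a) \<in> (\<Pi>\<^sub>M b\<in>Basis. lborel) \<rightarrow>\<^sub>M borel" by simp
 have [measurable]: "(%x::'a. \<Prod>b\<in>Basis. f b (x \<bullet> b)) \<in> borel_measurable borel" by simp
 have eq: "(\<Prod>b\<in>Basis. f b ((\<Sum>c\<in>Basis. F c *\<^sub>R c) \<bullet> b)) = (\<Prod>b\<in>Basis. f b (F b))" for F
  by (intro prod.cong refl) simp
 show ?g1 by (subst lborel_eq, subst integrable_distr_eq) (use product_integrable_prod[OF finite_Basis assms] eq in simp_all)
 show ?g2 by (subst lborel_eq, subst integral_distr) (use product_integral_prod[OF finite_Basis assms] eq in simp_all)
qed

lemma integrable_fraction_power: "integrable lborel (%s::real. (1 + s^2) powr (- 2 / 3))"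
proof -
 define h where "h s = indicator {0..} s * (2 * (1 + s) powr (- 4 / 3))" for s :: real
 have hm[measurable]: "h \<in> borel_measurable borel" unfolding h_def by simp
 have 1: "(\<integral>\<^sup>+s. ennreal (2 * (1 + s) powr (- 4 / 3)) * indicator {0..} s \<partial>lborel) = ennreal (0 - (- 6 * (1 + 0) powr (- 1 / 3)))"
 proof (rule nn_integral_FTC_atLeast)
  fix x :: real assume "0 <= x"
  then show "DERIV (%s. - 6 * (1 + s) powr (- 1 / 3)) x :> 2 * (1 + x) powr (- 4 / 3)"
   by (auto intro!: derivative_eq_intros simp: powr_diff[symmetric])
  show "0 <= 2 * (1 + x) powr (- 4 / 3)" by simp
 next
  have "((%s::real. (1 + s) powr (- 1 / 3)) \<longlongrightarrow> 0) at_top"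
   by (intro tendsto_neg_powr filterlim_tendsto_add_at_top[OF tendsto_const] filterlim_ident) auto
  from tendsto_mult_left[OF this, of "- 6"]
  show "((%s::real. - 6 * (1 + s) powr (- 1 / 3)) \<longlongrightarrow> 0) at_top" by simp
 qed auto
 then have 2: "(\<integral>\<^sup>+s. ennreal (h s) \<partial>lborel) < \<infinity>"
  by (simp add: h_def mult.commute[of "ennreal _"] ennreal_mult'' ennreal_indicator[symmetric] ennreal_mult''[symmetric])
 have ih: "integrable lborel h" using 2 by (intro integrableI_bounded) (auto simp: h_def)
 show ?thesis
 proof (rule dominated_integrable)
  show "integrable lborel (%s. h s + h (- s))" using ih integrable_affine[of "-1" h 0] by simp
  show "AE s in lborel. norm ((1 + s^2) powr (- 2 / 3)) <= norm (h s + h (- s))"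
  proof (rule AE_I2)
   fix s :: real
   define a where "a = \<bar>s\<bar>"
   have a: "a >= 0" "s^2 = a^2" by (auto simp: a_def)
   have "(1 + a)^2 / 2 <= 1 + a^2" using sum_squares_bound[of 1 a] by (simp add: power2_sum)
   then have "(1 + a^2) powr (- 2 / 3) <= ((1 + a)^2 / 2) powr (- 2 / 3)" using a by (intro powr_mono2') auto
   also have "... = (1 + a) powr (- 4 / 3) * 2 powr (2 / 3)"
    using a by (simp add: powr_divide powr_minus powr_powr powr_realpow[symmetric] field_simps
      flip: powr_numeral)
   also have "... <= (1 + a) powr (- 4 / 3) * 2" using powr_mono[of "2/3" 1 "2::real"] by (intro mult_left_mono) auto
   also have "... = h a" using a by (simp add: h_def)
   also have "... <= h s + h (- s)" by (auto simp: h_def a_def indicator_def)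
   finally show "norm ((1 + s^2) powr (- 2 / 3)) <= norm (h s + h (- s))" using a by simp
  qed
 qed simp
qed

lemma integrable_inverse_quartic: "integrable lborel (%x::real^3. 1 / (1 + (norm x)^2)^2)"
proof (rule dominated_integrable[OF lborel_integral_prod(1)])
 show "integrable lborel (%s::real. (1 + s^2) powr (- 2 / 3))" by (rule integrable_fraction_power)
 show "AE x in lborel. norm (1 / (1 + (norm (x::real^3))^2)^2) <= norm (\<Prod>b\<in>Basis. (1 + (x \<bullet> b)^2) powr (- 2 / 3))"
 proof (rule AE_I2)
  fix x :: "real^3"
  have p: "1 + (norm x)^2 > 0" by (simp add: add_pos_nonneg)
  have q: "(a powr (- 2 / 3)) ^ 3 = 1 / a^2" if "a > 0" for a :: real
  proof -
   have "(a powr (- 2 / 3)) ^ 3 = a powr (- 2)" using powr_powr[of a "- 2 / 3" 3] that by (simp add: powr_numeral)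
   then show ?thesis using that powr_minus_divide[of a 2] by (simp add: powr_numeral)
  qed
  have "1 / (1 + (norm x)^2)^2 = (\<Prod>b\<in>(Basis::(real^3) set). (1 + (norm x)^2) powr (- 2 / 3))" using q[OF p] by simp
  also have "... <= (\<Prod>b\<in>Basis. (1 + (x \<bullet> b)^2) powr (- 2 / 3))"
  proof (intro prod_mono conjI powr_mono2')
   fix b :: "real^3" assume "b \<in> Basis"
   then have "\<bar>x \<bullet> b\<bar> <= norm x" by (rule Basis_le_norm)
   then show "1 + (x \<bullet> b)^2 <= 1 + (norm x)^2" by (simp add: abs_le_square_iff[symmetric])
  qed (auto simp: add_pos_nonneg)
  finally show "norm (1 / (1 + (norm x)^2)^2) <= norm (\<Prod>b\<in>Basis. (1 + (x \<bullet> b)^2) powr (- 2 / 3))" by (simp add: prod_nonneg)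
 qed
qed simp

lemma integrable_quartic_decay:
 fixes f :: "real^3 => 'b::{banach, second_countable_topology}"
 assumes "f \<in> borel_measurable borel" "!!x. norm (f x) <= C / (1 + (norm x)^2)^2"
 shows "integrable lborel f"
proof (rule dominated_integrable)
 show "integrable lborel (%x::real^3. C * (1 / (1 + (norm x)^2)^2))" by (intro integrable_mult_right integrable_inverse_quartic)
 show "AE x in lborel. norm (f x) <= norm (C * (1 / (1 + (norm x)^2)^2))" by (auto intro!: AE_I2 order_trans[OF assms(2)] divide_right_mono)
qed (use assms in simp)

lemma fubini_product_bound:
 fixes F :: "'a::euclidean_space => 'c::euclidean_space => 'b::{banach, second_countable_topology}"
 assumes m[measurable]: "(%(x, y). F x y) \<in> borel_measurable (borel \<Otimes>\<^sub>M borel)"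
  and p: "integrable lborel p" and q: "integrable lborel q"
  and le: "!!x y. norm (F x y) <= p x * q y"
 shows "(LBINT x. (LBINT y. F x y)) = (LBINT y. (LBINT x. F x y))" (is ?g1)
  and "integrable lborel (%x. LBINT y. F x y)" (is ?g2)
  and "integrable lborel (%y. LBINT x. F x y)" (is ?g3)
  and "integrable lborel (%y. F x y)" (is ?g4)
  and "integrable lborel (%x. F x y)" (is ?g5)
proof -
 have [measurable]: "p \<in> borel_measurable borel" "q \<in> borel_measurable borel" using p q by auto
 have mF: "case_prod F \<in> borel_measurable (lborel \<Otimes>\<^sub>M lborel)" using m by (simp cong: measurable_cong_sets)
 have pq: "integrable (lborel \<Otimes>\<^sub>M lborel) (%(x, y). p x * q y)"
 proof (rule lborel_pair.Fubini_integrable)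
  show "integrable lborel (%x. LBINT y. norm (case (x, y) of (x, y) => p x * q y))" using p q by (simp add: abs_mult)
 qed (use q in "auto simp: measurable_split_conv")
 have I: "integrable (lborel \<Otimes>\<^sub>M lborel) (case_prod F)" by (rule dominated_integrable[OF pq mF])
    (use le in "auto intro!: AE_I2 order_trans[OF _ abs_ge_self]")
 show ?g1 using lborel_pair.Fubini_integral[OF I] by simp
 show ?g2 using lborel_pair.integrable_fst[OF I] by simp
 show ?g3 using lborel_pair.integrable_snd[OF I] by simp
 show ?g4 by (rule dominated_integrable[OF integrable_mult_right[OF q, of "p x"]])
    (use le in "auto intro!: AE_I2 order_trans[OF _ abs_ge_self]")
 show ?g5 by (rule dominated_integrable[OF integrable_mult_left[OF p, of "q y"]])
    (use le in "auto intro!: AE_I2 order_trans[OF _ abs_ge_self]")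
qed

text \<open>Fatou's lemma, used to remove weights and cutoffs.\<close>
lemma integrable_limit_bounded_integrals:
 fixes f :: "nat => 'a::euclidean_space => real"
 assumes i: "!!n. integrable lborel (f n)" and nn: "!!n x. 0 <= f n x"
  and lim: "!!x. (%n. f n x) \<longlonglongrightarrow> g x" and le: "!!n. (LBINT x. f n x) <= C"
 shows "integrable lborel g" (is ?g1) "(LBINT x. g x) <= C" (is ?g2)
proof -
 have [measurable]: "!!n. f n \<in> borel_measurable borel" using i by auto
 have [measurable]: "g \<in> borel_measurable borel" by (rule borel_measurable_LIMSEQ_real[OF lim]) auto
 have g: "g x >= 0" for x by (rule LIMSEQ_le_const[OF lim]) (use nn in auto)
 have "0 <= (LBINT x. f 0 x)" by (rule integral_nonneg_AE) (use nn in auto)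
 then have C: "C >= 0" using le[of 0] by linarith
 have "(\<integral>\<^sup>+x. ennreal (g x) \<partial>lborel) = (\<integral>\<^sup>+x. liminf (%n. ennreal (f n x)) \<partial>lborel)"
  by (intro nn_integral_cong lim_imp_Liminf[symmetric] tendsto_ennrealI lim) auto
 also have "... <= liminf (%n. \<integral>\<^sup>+x. ennreal (f n x) \<partial>lborel)" by (rule nn_integral_liminf) simp
 also have "... <= ennreal C" by (rule Liminf_le) (use i nn le in "auto simp: nn_integral_eq_integral ennreal_leI")
 finally have 1: "(\<integral>\<^sup>+x. ennreal (g x) \<partial>lborel) <= ennreal C" .
 show 2: ?g1 using le_less_trans[OF 1] g by (intro integrableI_bounded) auto
 show ?g2 using 1 nn_integral_eq_integral[OF 2] g C by simp
qed

section \<open>Gaussian integrals\<close>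

lemma gaussian_iexp:
 assumes c: "c > 0"
 shows "integrable lborel (%x. iexp (t * x) * complex_of_real (exp (- c * x^2)))"
  and "(LBINT x. iexp (t * x) * complex_of_real (exp (- c * x^2)))
    = complex_of_real (sqrt (pi / c) * exp (- t\<^sup>2 / (4 * c)))"
proof -
 define s where "s = sqrt (2 * c)"
 have s: "s > 0" "s^2 = 2 * c" using c by (auto simp: s_def)
 define f where "f x = iexp (t * x) * complex_of_real (exp (- c * x^2))" for x :: real
 have [measurable]: "f \<in> borel_measurable borel" unfolding f_def[abs_def]
  by (rule borel_measurable_continuous_onI) (auto intro!: continuous_intros)
 define h where "h x = std_normal_density x *\<^sub>R iexp ((t / s) * x)" for x
 have fh: "f x = (sqrt (2 * pi)) *\<^sub>R h (0 + s * x)" for x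
 proof -
  have "(s * x)^2 / 2 = c * x^2" using s by (simp add: power_mult_distrib)
  then show ?thesis using s by (simp add: f_def h_def std_normal_density_def scaleR_conv_of_real)
 qed
 have ih: "integrable lborel h" unfolding h_def by (rule dominated_integrable[OF integrable_std_normal_moment[of 0]]) auto
 have "char std_normal_distribution (t / s) = (LBINT x. h x)" unfolding char_def h_def by (subst integral_density) auto
 then have h: "(LBINT x. h x) = complex_of_real (exp (- (t / s)\<^sup>2 / 2))" by (simp add: char_std_normal_distribution)
 show "integrable lborel f" unfolding fh[abs_def] using lborel_integrable_real_affine[OF ih, of s 0] s by (intro integrable_scaleR_right) auto
 have "(LBINT x. f x) = sqrt (2 * pi) *\<^sub>R (LBINT x. h (0 + s * x))" unfolding fh[abs_def] by (rule integral_scaleR_right)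
 also have "(LBINT x. h (0 + s * x)) = (1 / s) *\<^sub>R (LBINT x. h x)" using lborel_integral_real_affine[of s h 0] s by simp
 also have "sqrt (2 * pi) *\<^sub>R (1 / s) *\<^sub>R (LBINT x. h x)
   = complex_of_real (sqrt (2 * pi) / s * exp (- (t / s)\<^sup>2 / 2))" by (simp add: h scaleR_conv_of_real)
 also have "sqrt (2 * pi) / s = sqrt (pi / c)" using c by (simp add: s_def real_sqrt_divide[symmetric])
 also have "- (t / s)\<^sup>2 / 2 = - t\<^sup>2 / (4 * c)" using s by (simp add: power_divide)
 finally show "(LBINT x. f x) = complex_of_real (sqrt (pi / c) * exp (- t\<^sup>2 / (4 * c)))" .
qed

lemma norm_sq_Basis: "(norm x)^2 = (\<Sum>b\<in>Basis. (x \<bullet> b)^2)" for x :: "'a::euclidean_space"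
 unfolding power2_norm_eq_inner euclidean_inner[of x x] by (simp add: power2_eq_square)

text \<open>The Fourier transform factors over the coordinates; in each of them it is the characteristic function of a
normal distribution.\<close>
lemma gaussian_fourier:
 fixes k :: "real^3"
 assumes c: "c > 0"
 shows "integrable lborel (%x::real^3. exp (- c * (norm x)^2))" (is ?g1)
  and "(LBINT x. cos (k \<bullet> x) * exp (- c * (norm x)^2)) = sqrt (pi / c) ^ 3 * exp (- (norm k)\<^sup>2 / (4 * c))" (is ?g2)
  and "(LBINT x. sin (k \<bullet> x) * exp (- c * (norm x)^2)) = 0" (is ?g3)
  and "(LBINT x. exp (- c * (norm (x::real^3))^2)) = sqrt (pi / c) ^ 3" (is ?g4)
proof -
 define f where "f k x = (\<Prod>b\<in>Basis. iexp ((k \<bullet> b) * (x \<bullet> b)) * complex_of_real (exp (- c * (x \<bullet> b)^2)))"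
  for k x :: "real^3"
 have f: "f k x = iexp (k \<bullet> x) * complex_of_real (exp (- c * (norm x)^2))" for k x
 proof -
  have "(\<Prod>b\<in>Basis. iexp ((k \<bullet> b) * (x \<bullet> b))) = iexp (k \<bullet> x)"
  proof -
   have "\<i> * complex_of_real (k \<bullet> x) = (\<Sum>b\<in>Basis. \<i> * complex_of_real ((k \<bullet> b) * (x \<bullet> b)))"
    by (simp add: euclidean_inner[of k x] sum_distrib_left)
   then show ?thesis by (simp add: exp_sum)
  qed
  moreover have "(\<Prod>b\<in>Basis. exp (- c * (x \<bullet> b)^2)) = exp (- c * (norm x)^2)"
   unfolding norm_sq_Basis sum_distrib_left by (rule exp_sum[symmetric]) simp
  ultimately show ?thesis unfolding f_def prod.distrib by (simp flip: of_real_prod)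
 qed
 have i: "integrable lborel (f k)" for k unfolding f_def[abs_def] by (rule lborel_integral_prod(1)) (rule gaussian_iexp[OF c])
 have v: "(LBINT x. f k x) = complex_of_real (sqrt (pi / c) ^ 3 * exp (- (norm k)\<^sup>2 / (4 * c)))" for k
 proof -
  have "(LBINT x. f k x) = (\<Prod>b\<in>Basis. complex_of_real (sqrt (pi / c) * exp (- (k \<bullet> b)\<^sup>2 / (4 * c))))"
   unfolding f_def by (subst lborel_integral_prod(2)[OF gaussian_iexp(1)[OF c]]) (simp only: gaussian_iexp(2)[OF c])
  also have "... = complex_of_real (sqrt (pi / c) ^ 3 * exp (- (norm k)\<^sup>2 / (4 * c)))"
   unfolding of_real_prod[symmetric] prod.distrib norm_sq_Basis by (simp add: exp_sum[symmetric] sum_divide_distrib sum_negf)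
  finally show ?thesis .
 qed
 have re: "Re (f k x) = cos (k \<bullet> x) * exp (- c * (norm x)^2)" "Im (f k x) = sin (k \<bullet> x) * exp (- c * (norm x)^2)" for k x
  by (auto simp: f cis_conv_exp[symmetric])
 have 2: "(LBINT x. cos (k \<bullet> x) * exp (- c * (norm x)^2)) = sqrt (pi / c) ^ 3 * exp (- (norm k)\<^sup>2 / (4 * c))" for k :: "real^3"
  using integral_Re[OF i, of k] unfolding v re[symmetric] by simp
 then show ?g2 .
 show ?g3 using integral_Im[OF i, of k] unfolding v re[symmetric] by simp
 show ?g1 using integrable_Re[OF i, of 0] unfolding re by simp
 show ?g4 using 2[of 0] by simp
qed

section \<open>The Hartley transform\<close>

text \<open>Hartley's kernel. Integrating a real density against it represents real fields without complex numbers,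
and its derivative is its reflection.\<close>
definition cas :: "real => real" where
 "cas \<theta> = cos \<theta> + sin \<theta>"

definition hart :: "(real^3 => 'b::euclidean_space) => real^3 => 'b" where
 "hart g x = (LBINT k. cas (k \<bullet> x) *\<^sub>R g k)"

lemma cas_measurable[measurable]: "cas \<in> borel_measurable borel" unfolding cas_def[abs_def] by simp

lemma abs_cas_le: "\<bar>cas \<theta>\<bar> <= 2" unfolding cas_def using abs_cos_le_one[of \<theta>] abs_sin_le_one[of \<theta>] by linarith

lemma cas_minus: "cas (- \<theta>) = cos \<theta> - sin \<theta>" by (simp add: cas_def)

lemma cas_expansion: "\<bar>cas (a + h) - cas a - h * cas (- a)\<bar> <= 2 * h^2"
proof -
 have c: "\<bar>cos h - 1\<bar> <= h^2 / 2"
 proof -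
  have "cos h - 1 = - 2 * (sin (h / 2))^2" using cos_double_sin[of "h / 2"] by simp
  moreover have "(sin (h / 2))^2 <= (h / 2)^2" using abs_sin_x_le_abs_x[of "h / 2"] by (simp only: abs_le_square_iff)
  ultimately show ?thesis by (simp add: power_divide)
 qed
 have s: "\<bar>sin h - h\<bar> <= h^2 / 2" using Maclaurin_sin_bound[of h 2] by (simp add: numeral_2_eq_2 sin_coeff_def)
 have eq: "cas (a + h) - cas a - h * cas (- a) = cas a * (cos h - 1) + cas (- a) * (sin h - h)" by (simp add: cas_def cos_add sin_add algebra_simps)
 have "\<bar>cas a * (cos h - 1)\<bar> <= 2 * (h^2 / 2)" "\<bar>cas (- a) * (sin h - h)\<bar> <= 2 * (h^2 / 2)"
  unfolding abs_mult by (intro mult_mono abs_cas_le c s; simp)+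
 then show ?thesis unfolding eq by linarith
qed

definition rapid :: "(real^3 => 'b::euclidean_space) => bool" where
 "rapid g \<longleftrightarrow> g \<in> borel_measurable borel \<and> (\<forall>m. \<exists>C. \<forall>k. norm (g k) * (1 + norm k) ^ m <= C)"

lemma rapid_measurable[measurable_dest]: "rapid g ==> g \<in> borel_measurable borel" by (simp add: rapid_def)

lemma rapid_bound:
 fixes g :: "real^3 => 'b::euclidean_space" and f :: "real^3 => 'c::euclidean_space"
 assumes "rapid g" "f \<in> borel_measurable borel"
  and le: "!!k. norm (f k) <= C * (1 + norm k) ^ j * norm (g k)"
 shows "rapid f" unfolding rapid_def
proof (intro conjI allI)
 fix m
 from assms(1) obtain D where D: "!!k. norm (g k) * (1 + norm k) ^ (j + m) <= D" unfolding rapid_def by blast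
 have "norm (f k) * (1 + norm k) ^ m <= \<bar>C\<bar> * D" for k
 proof -
  have "norm (f k) * (1 + norm k) ^ m <= C * (1 + norm k) ^ j * norm (g k) * (1 + norm k) ^ m" by (intro mult_right_mono le) simp
  also have "... = C * (norm (g k) * (1 + norm k) ^ (j + m))" by (simp add: power_add)
  also have "... <= \<bar>C\<bar> * D" by (intro mult_mono D) auto
  finally show ?thesis .
 qed
 then show "\<exists>C. \<forall>k. norm (f k) * (1 + norm k) ^ m <= C" by blast
qed (rule assms(2))

lemma rapid_reflect: "rapid g ==> rapid (%k. g (- k))"
 for g :: "real^3 => 'b::euclidean_space" unfolding rapid_def
proof (intro conjI allI; elim conjE)
 fix m assume "\<forall>m. \<exists>C. \<forall>k. norm (g k) * (1 + norm k) ^ m <= C"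
 then obtain C where "\<forall>k. norm (g k) * (1 + norm k) ^ m <= C" by blast
 then have "\<forall>k. norm (g (- k)) * (1 + norm k) ^ m <= C" by (metis norm_minus_cancel)
 then show "\<exists>C. \<forall>k. norm (g (- k)) * (1 + norm k) ^ m <= C" by blast
qed simp

lemma rapid_integrable_mult:
 assumes "rapid g" shows "integrable lborel (%k. norm k ^ m * norm (g k))"
proof -
 have [measurable]: "g \<in> borel_measurable borel" using assms by measurable
 from assms obtain C where C: "!!k. norm (g k) * (1 + norm k) ^ (m + 4) <= C" unfolding rapid_def by blast
 show ?thesis
 proof (rule integrable_quartic_decay)
  fix k :: "real^3"
  have q: "(1 + (norm k)^2)^2 <= (1 + norm k) ^ 4"
  proof -
   have "1 + (norm k)^2 <= (1 + norm k)^2" by (simp add: power2_sum)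
   from power_mono[OF this, of 2] show ?thesis by (simp flip: power_mult)
  qed
  have "norm k ^ m * norm (g k) * (1 + (norm k)^2)^2 <= (1 + norm k) ^ m * norm (g k) * (1 + norm k) ^ 4" by (intro mult_mono q power_mono) auto
  also have "... <= C" using C[of k] by (simp add: power_add mult_ac)
  finally have "norm k ^ m * norm (g k) * (1 + (norm k)^2)^2 <= C" .
  moreover have "(1 + (norm k)^2)^2 > 0" by (intro zero_less_power add_pos_nonneg) auto
  ultimately show "norm (norm k ^ m * norm (g k)) <= C / (1 + (norm k)^2)^2" by (simp only: pos_le_divide_eq) simp
 qed simp
qed

lemma rapid_integrable_norm: "rapid g ==> integrable lborel (%k. norm (g k))" using rapid_integrable_mult[of g 0] by simp

lemma rapid_integrable: "rapid g ==> integrable lborel g"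
 using rapid_integrable_norm integrable_norm_iff[of g lborel] by (auto simp: rapid_measurable)

lemma integrable_cas:
 fixes g :: "real^3 => 'b::euclidean_space"
 assumes "integrable lborel g"
 shows "integrable lborel (%k. cas (k \<bullet> x) *\<^sub>R g k)"
proof -
 have [measurable]: "g \<in> borel_measurable borel" using assms by auto
 show ?thesis by (rule dominated_integrable[OF integrable_mult_right[OF integrable_norm[OF assms], of 2]])
    (use abs_cas_le in "auto intro!: AE_I2 mult_right_mono")
qed

lemma norm_hart_le:
 fixes g :: "real^3 => 'b::euclidean_space"
 assumes "integrable lborel g"
 shows "norm (hart g x) <= 2 * (LBINT k. norm (g k))"
proof -
 have "norm (hart g x) <= (LBINT k. 2 * norm (g k))" unfolding hart_def
  by (rule Bochner_Integration.integral_norm_bound_integral[OF integrable_cas[OF assms] integrable_mult_right[OF integrable_norm[OF assms]]])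
    (use abs_cas_le in "auto intro!: mult_right_mono")
 then show ?thesis by simp
qed

lemma hart_add: "integrable lborel f ==> integrable lborel g ==> hart (%k. f k + g k) x = hart f x + hart g x"
 for f :: "real^3 => 'b::euclidean_space" unfolding hart_def by (simp add: scaleR_add_right integrable_cas)

lemma hart_diff: "integrable lborel f ==> integrable lborel g ==> hart (%k. f k - g k) x = hart f x - hart g x"
 for f :: "real^3 => 'b::euclidean_space" unfolding hart_def by (simp add: scaleR_diff_right integrable_cas)

lemma hart_bounded_linear:
 fixes f :: "real^3 => 'b::euclidean_space" and L :: "'b => 'c::euclidean_space"
 assumes "bounded_linear L" "integrable lborel f"
 shows "hart (%k. L (f k)) x = L (hart f x)" unfolding hart_def
 by (simp add: integral_bounded_linear[OF assms(1) integrable_cas[OF assms(2)], symmetric]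
   linear_simps(5)[OF assms(1)])

lemma hart_scaleR: "integrable lborel f ==> hart (%k. a *\<^sub>R f k) x = a *\<^sub>R hart f x"
 for f :: "real^3 => 'b::euclidean_space" using hart_bounded_linear[OF bounded_linear_scaleR_right] .

lemma hart_zero: "hart (%k. 0) x = 0" by (simp add: hart_def)

text \<open>Directional differentiation of a Hartley integral multiplies the density by \<open>- k \<bullet> v\<close> and
 reflects it, since \<open>cas' \<theta> = cas (- \<theta>)\<close>.\<close>
definition dirmult :: "real^3 => (real^3 => 'b::euclidean_space) => real^3 => 'b" where
 "dirmult v g k = - (k \<bullet> v) *\<^sub>R g (- k)"

lemma rapid_dirmult:
 fixes g :: "real^3 => 'b::euclidean_space"
 assumes "rapid g" shows "rapid (dirmult v g)"
proof (rule rapid_bound[OF rapid_reflect[OF assms], where C="norm v" and j=1])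
 have [measurable]: "g \<in> borel_measurable borel" using assms by measurable
 show "dirmult v g \<in> borel_measurable borel" unfolding dirmult_def[abs_def] by measurable
 fix k
 have "\<bar>k \<bullet> v\<bar> <= norm v * (1 + norm k)"
 proof -
  have "norm v * (1 + norm k) = norm v + norm k * norm v" by (simp add: algebra_simps)
  then show ?thesis using Cauchy_Schwarz_ineq2[of k v] norm_ge_zero[of v] by linarith
 qed
 then show "norm (dirmult v g k) <= norm v * (1 + norm k) ^ 1 * norm (g (- k))" by (simp add: dirmult_def mult_right_mono)
qed

lemma hart_dirmult:
 assumes "rapid g"
 shows "hart (dirmult v g) x = (LBINT k. (cas (- (k \<bullet> x)) * (k \<bullet> v)) *\<^sub>R g k)"
proof -
 have [measurable]: "g \<in> borel_measurable borel" using assms by measurable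
 have "hart (dirmult v g) x = (LBINT k. (cas (- ((0 - k) \<bullet> x)) * ((0 - k) \<bullet> v)) *\<^sub>R g (0 - k))"
  unfolding hart_def dirmult_def by simp
 also have "... = (LBINT k. (cas (- (k \<bullet> x)) * (k \<bullet> v)) *\<^sub>R g k)" by (rule integral_reflect) measurable
 finally show ?thesis .
qed

text \<open>Differentiation under the integral sign: by Taylor's formula for \<open>cas\<close> the remainder is at most
\<open>2 |v|^2\<close> times the second moment of \<open>g\<close>.\<close>
lemma hart_has_derivative:
 fixes g :: "real^3 => 'b::euclidean_space"
 assumes r: "rapid g"
 shows "(hart g has_derivative (%v. hart (dirmult v g) x)) (at x)"
proof -
 have [measurable]: "g \<in> borel_measurable borel" using assms by measurable
 have ig: "integrable lborel g" by (rule rapid_integrable[OF r])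
 have idg: "integrable lborel (dirmult v g)" for v by (rule rapid_integrable[OF rapid_dirmult[OF r]])
 define C where "C = 2 * (LBINT k. norm k ^ 2 * norm (g k))"
 define L where "L v = hart (dirmult v g) x" for v
 have i2: "integrable lborel (%k. (cas (- (k \<bullet> x)) * (k \<bullet> v)) *\<^sub>R g k)" for v
 proof (rule dominated_integrable[OF integrable_mult_right[OF rapid_integrable_mult[OF r, of 1], of "2 * norm v"]])
  show "AE k in lborel. norm ((cas (- (k \<bullet> x)) * (k \<bullet> v)) *\<^sub>R g k) <= norm (2 * norm v * (norm k ^ 1 * norm (g k)))"
  proof (rule AE_I2)
   fix k
   have "\<bar>cas (- (k \<bullet> x))\<bar> * \<bar>k \<bullet> v\<bar> <= 2 * (norm k * norm v)"
    by (intro mult_mono abs_cas_le Cauchy_Schwarz_ineq2) auto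
   from mult_right_mono[OF this norm_ge_zero[of "g k"]]
   show "norm ((cas (- (k \<bullet> x)) * (k \<bullet> v)) *\<^sub>R g k) <= norm (2 * norm v * (norm k ^ 1 * norm (g k)))"
    by (simp add: abs_mult mult_ac)
  qed
 qed simp
 have bl: "bounded_linear L"
 proof (rule bounded_linear_intro)
  show "L (v + w) = L v + L w" for v w unfolding L_def hart_dirmult[OF r] using i2 by (simp add: inner_add_right algebra_simps)
  show "L (s *\<^sub>R v) = s *\<^sub>R L v" for s v
   unfolding L_def hart_dirmult[OF r] by (simp add: mult_ac flip: integral_scaleR_right scaleR_scaleR)
  show "norm (L v) <= norm v * (2 * (LBINT k. norm k ^ 1 * norm (g k)))" for v
  proof -
   have "norm (L v) <= 2 * (LBINT k. norm (dirmult v g k))" unfolding L_def by (rule norm_hart_le[OF idg])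
   also have "(LBINT k. norm (dirmult v g k)) <= (LBINT k. norm v * (norm k ^ 1 * norm (g (0 - k))))"
   proof (rule integral_mono)
    show "integrable lborel (%k. norm v * (norm k ^ 1 * norm (g (0 - k))))" using rapid_integrable_mult[OF rapid_reflect[OF r], of 1] by simp
    fix k show "norm (dirmult v g k) <= norm v * (norm k ^ 1 * norm (g (0 - k)))"
     using mult_right_mono[OF Cauchy_Schwarz_ineq2[of k v] norm_ge_zero[of "g (- k)"]] by (simp add: dirmult_def mult_ac)
   qed (use idg in simp)
   also have "... = norm v * (LBINT k. norm k ^ 1 * norm (g k))" using integral_reflect[of "%k. norm k ^ 1 * norm (g k)" 0] by simp
   finally show ?thesis by simp
  qed
 qed
 have rem: "norm (hart g (x + v) - hart g x - L v) <= C * norm v ^ 2" for v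
 proof -
  have "hart g (x + v) - hart g x - L v =
    (LBINT k. (cas (k \<bullet> x + k \<bullet> v) - cas (k \<bullet> x) - (k \<bullet> v) * cas (- (k \<bullet> x))) *\<^sub>R g k)"
   unfolding L_def hart_dirmult[OF r] unfolding hart_def using integrable_cas[OF ig, of x] integrable_cas[OF ig, of "x + v"] i2[of v]
   by (simp add: inner_add_right scaleR_diff_left mult.commute)
  also have "norm ... <= (LBINT k. (2 * norm v ^ 2) * (norm k ^ 2 * norm (g k)))"
  proof (rule Bochner_Integration.integral_norm_bound_integral)
   show "integrable lborel (%k. (cas (k \<bullet> x + k \<bullet> v) - cas (k \<bullet> x) - (k \<bullet> v) * cas (- (k \<bullet> x))) *\<^sub>R g k)"
    using integrable_cas[OF ig, of x] integrable_cas[OF ig, of "x + v"] i2[of v] by (simp add: inner_add_right scaleR_diff_left mult.commute)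
   show "integrable lborel (%k. (2 * norm v ^ 2) * (norm k ^ 2 * norm (g k)))" by (intro integrable_mult_right rapid_integrable_mult r)
   fix k
   have "(k \<bullet> v)^2 <= (norm k * norm v)^2" using Cauchy_Schwarz_ineq2[of k v] by (metis abs_le_square_iff abs_mult abs_norm_cancel)
   then have "\<bar>cas (k \<bullet> x + k \<bullet> v) - cas (k \<bullet> x) - (k \<bullet> v) * cas (- (k \<bullet> x))\<bar> <= 2 * (norm k * norm v)^2"
    using cas_expansion[of "k \<bullet> x" "k \<bullet> v"] by linarith
   from mult_right_mono[OF this norm_ge_zero[of "g k"]]
   show "norm ((cas (k \<bullet> x + k \<bullet> v) - cas (k \<bullet> x) - (k \<bullet> v) * cas (- (k \<bullet> x))) *\<^sub>R g k)
     <= (2 * norm v ^ 2) * (norm k ^ 2 * norm (g k))" by (simp add: power_mult_distrib mult_ac)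
  qed
  finally show ?thesis unfolding integral_mult_right_zero C_def by (simp only: mult_ac)
 qed
 have "C >= 0" unfolding C_def by simp
 show ?thesis unfolding L_def[symmetric]
 proof (rule has_derivativeI_sandwich[of 1])
  show "bounded_linear L" by (rule bl)
  show "norm (hart g y - hart g x - L (y - x)) / norm (y - x) <= C * norm (y - x)" if "y \<noteq> x" for y
   using rem[of "y - x"] that by (simp add: pos_divide_le_eq power2_eq_square mult_ac)
  have "((%y. C * norm (y - x)) \<longlongrightarrow> C * norm (x - x)) (at x)" by (intro tendsto_intros)
  then show "((%y. C * norm (y - x)) \<longlongrightarrow> 0) (at x)" by simp
 qed simp
qed

lemma rapid_Ck_hart: "rapid g ==> Ck k (hart g)"
proof (induction k arbitrary: g)
 case 0
 then show ?case by (metis Ck.simps(1) continuous_at_imp_continuous_on has_derivative_continuous hart_has_derivative)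
next
 case (Suc k)
 show ?case by (rule Ck_SucI, rule hart_has_derivative[OF Suc.prems]) (rule Suc.IH[OF rapid_dirmult[OF Suc.prems]])
qed

lemma hart_continuous: "rapid g ==> continuous_on S (hart g)" by (metis Ck_continuous continuous_on_subset rapid_Ck_hart top_greatest)

lemma hart_measurable: "rapid g ==> hart g \<in> borel_measurable borel" by (intro borel_measurable_continuous_onI hart_continuous)

section \<open>Square integrability\<close>

lemma rapid_integrable_square:
 assumes r: "rapid g" shows "integrable lborel (%k. (norm (g k))^2)"
proof -
 have [measurable]: "g \<in> borel_measurable borel" using assms by measurable
 from r obtain C where C: "!!k. norm (g k) * (1 + norm k) ^ 0 <= C" unfolding rapid_def by blast
 show ?thesis
 proof (rule dominated_integrable[OF integrable_mult_right[OF rapid_integrable_norm[OF r], of C]])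
  show "AE k in lborel. norm ((norm (g k))^2) <= norm (C * norm (g k))"
   using C by (auto intro!: AE_I2 mult_right_mono order_trans[OF _ abs_ge_self] simp: power2_eq_square abs_mult)
 qed simp
qed

text \<open>A product of two \<open>cas\<close> is a sum of a cosine of the difference and a sine of the sum of the phases; the
sine integrates to zero against an even weight.\<close>
lemma cas_gaussian:
 fixes k l :: "real^3"
 assumes c: "c > 0"
 shows "(LBINT x. exp (- c * (norm x)^2) * (cas (k \<bullet> x) * cas (l \<bullet> x)))
  = sqrt (pi / c) ^ 3 * exp (- (norm (k - l))\<^sup>2 / (4 * c))"
proof -
 have eq: "exp (- c * (norm x)^2) * (cas (k \<bullet> x) * cas (l \<bullet> x)) =
   cos ((k - l) \<bullet> x) * exp (- c * (norm x)^2) + sin ((k + l) \<bullet> x) * exp (- c * (norm x)^2)" for x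
  by (simp add: cas_def inner_diff_left inner_add_left cos_diff sin_add algebra_simps)
 have i: "integrable lborel (%x. cos (m \<bullet> x) * exp (- c * (norm x)^2))"
  "integrable lborel (%x. sin (m \<bullet> x) * exp (- c * (norm x)^2))" for m :: "real^3"
  by (rule dominated_integrable[OF gaussian_fourier(1)[OF c]]; simp add: abs_mult)+
 show ?thesis unfolding eq Bochner_Integration.integral_add[OF i(1) i(2)] gaussian_fourier(2,3)[OF c] by simp
qed

text \<open>One half of Plancherel's theorem. With a Gaussian weight the square integral is a double
 integral of \<open>g k \<bullet> g l\<close> against a nonnegative kernel of total mass \<open>(2 pi)^3\<close>, so Schur's test
 applies; then the weight is removed by Fatou's lemma.\<close>
lemma hart_square_integrable:
 fixes g :: "real^3 => 'b::euclidean_space"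
 assumes r: "rapid g"
 shows "integrable lborel (%x. (norm (hart g x))^2)" (is ?g1)
  and "(LBINT x. (norm (hart g x))^2) <= (2 * pi) ^ 3 * (LBINT k. (norm (g k))^2)" (is ?g2)
proof -
 have [measurable]: "g \<in> borel_measurable borel" "hart g \<in> borel_measurable borel" using r hart_measurable by measurable
 have ig: "integrable lborel g" and ign: "integrable lborel (%k. norm (g k))" using rapid_integrable[OF r] rapid_integrable_norm[OF r] .
 have ig2: "integrable lborel (%k. (norm (g k))^2)" by (rule rapid_integrable_square[OF r])
 define B where "B = 2 * (LBINT k. norm (g k))"
 have B: "norm (hart g x) <= B" for x unfolding B_def by (rule norm_hart_le[OF ig])
 have weighted: "integrable lborel (%x. exp (- c * (norm x)^2) * (norm (hart g x))^2)
   \<and> (LBINT x. exp (- c * (norm x)^2) * (norm (hart g x))^2) <= (2 * pi) ^ 3 * (LBINT k. (norm (g k))^2)"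
  if c: "c > 0" for c
 proof
  define W where "W x = exp (- c * (norm x)^2)" for x :: "real^3"
  define K where "K m = sqrt (pi / c) ^ 3 * exp (- (norm m)\<^sup>2 / (4 * c))" for m :: "real^3"
  have [measurable]: "W \<in> borel_measurable borel" "K \<in> borel_measurable borel" by (auto simp: W_def[abs_def] K_def[abs_def])
  have W0: "W x >= 0" and K0: "K x >= 0" for x using c by (auto simp: W_def K_def)
  have iW: "integrable lborel W" unfolding W_def using gaussian_fourier(1)[OF c] .
  \<comment> \<open>The mass of the transformed Gaussian does not depend on \<open>c\<close>, so the bound survives the limit.\<close>
  have iK: "integrable lborel K" (is ?g1) and vK: "(LBINT m. K m) = (2 * pi) ^ 3" (is ?g2)
  proof -
   have c': "1 / (4 * c) > 0" using c by simp
   have e: "exp (- (norm m)\<^sup>2 / (4 * c)) = exp (- (1 / (4 * c)) * (norm m)^2)" for m :: "real^3" by simp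
   show ?g1 unfolding K_def[abs_def] e by (intro integrable_mult_right gaussian_fourier(1)[OF c'])
   have "sqrt (pi / c) ^ 3 * sqrt (pi / (1 / (4 * c))) ^ 3 = (2 * pi) ^ 3"
   proof -
    have "sqrt (pi / c) * sqrt (pi / (1 / (4 * c))) = sqrt ((2 * pi)^2)"
     using c by (simp add: real_sqrt_mult[symmetric] power2_eq_square field_simps)
    moreover have "sqrt ((2 * pi)^2) = 2 * pi" by (rule real_sqrt_unique) auto
    ultimately have "sqrt (pi / c) * sqrt (pi / (1 / (4 * c))) = 2 * pi" by (rule trans)
    then show ?thesis by (metis power_mult_distrib)
   qed
   then show ?g2 unfolding K_def e using gaussian_fourier(4)[OF c'] by simp
  qed
  have iKt: "integrable lborel (%l. K (k - l))" "(LBINT l. K (k - l)) = (2 * pi) ^ 3" for k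
   using integrable_translate(2)[OF iK, of k] integral_reflect[of K k] vK by auto
  show "integrable lborel (%x. exp (- c * (norm x)^2) * (norm (hart g x))^2)"
  proof (rule dominated_integrable[OF integrable_mult_right[OF iW, of "B^2"]])
   show "AE x in lborel. norm (exp (- c * (norm x)^2) * (norm (hart g x))^2) <= norm (B^2 * W x)"
    using W0 B by (auto intro!: AE_I2 mult_right_mono power_mono simp: abs_mult W_def mult.commute[of "exp _"])
  qed simp
  have inner: "(LBINT x. (W x * cas (k \<bullet> x)) *\<^sub>R hart g x) = (LBINT l. K (k - l) *\<^sub>R g l)" (is ?g1)
   and iinner: "integrable lborel (%x. (W x * cas (k \<bullet> x)) *\<^sub>R hart g x)" (is ?g2) for k
  proof -
   have meas: "(%(x, l). (W x * cas (k \<bullet> x) * cas (l \<bullet> x)) *\<^sub>R g l) \<in> borel_measurable (borel \<Otimes>\<^sub>M borel)"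
    by measurable
   have le: "norm ((W x * cas (k \<bullet> x) * cas (l \<bullet> x)) *\<^sub>R g l) <= (W x * 4) * norm (g l)" for x l
   proof -
    have "\<bar>cas (k \<bullet> x)\<bar> * \<bar>cas (l \<bullet> x)\<bar> <= 2 * 2" by (intro mult_mono abs_cas_le) auto
    from mult_right_mono[OF mult_left_mono[OF this W0[of x]] norm_ge_zero[of "g l"]] show ?thesis using W0[of x] by (simp add: abs_mult mult_ac)
   qed
   note F = fubini_product_bound[OF meas integrable_mult_left[OF iW] ign le]
   have h: "(W x * cas (k \<bullet> x)) *\<^sub>R hart g x = (LBINT l. (W x * cas (k \<bullet> x) * cas (l \<bullet> x)) *\<^sub>R g l)" for x
    unfolding hart_def by (simp flip: integral_scaleR_right scaleR_scaleR)
   have "(LBINT x. (W x * cas (k \<bullet> x)) *\<^sub>R hart g x)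
     = (LBINT l. (LBINT x. (W x * cas (k \<bullet> x) * cas (l \<bullet> x)) *\<^sub>R g l))" unfolding h by (rule F(1))
   also have "... = (LBINT l. K (k - l) *\<^sub>R g l)"
   proof (intro Bochner_Integration.integral_cong refl)
    fix l
    have "(LBINT x. (W x * cas (k \<bullet> x) * cas (l \<bullet> x)) *\<^sub>R g l) = (LBINT x. W x * (cas (k \<bullet> x) * cas (l \<bullet> x))) *\<^sub>R g l"
    proof (cases "g l = 0")
     case False
     have cc: "\<bar>cas (k \<bullet> x)\<bar> * \<bar>cas (l \<bullet> x)\<bar> <= 4" for x
      using mult_mono[OF abs_cas_le[of "k \<bullet> x"] abs_cas_le[of "l \<bullet> x"]] by simp
     have "integrable lborel (%x. W x * (cas (k \<bullet> x) * cas (l \<bullet> x)))"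
      by (rule dominated_integrable[OF integrable_mult_left[OF iW, of 4]])
        (use W0 cc in "auto intro!: AE_I2 mult_left_mono simp: abs_mult")
     then show ?thesis by (simp add: mult.assoc)
    qed simp
    then show "(LBINT x. (W x * cas (k \<bullet> x) * cas (l \<bullet> x)) *\<^sub>R g l) = K (k - l) *\<^sub>R g l"
     unfolding W_def K_def cas_gaussian[OF c] .
   qed
   finally show ?g1 .
   show ?g2 unfolding h by (rule F(2))
  qed
  have meas2: "(%(x, k). W x * cas (k \<bullet> x) * (g k \<bullet> hart g x)) \<in> borel_measurable (borel \<Otimes>\<^sub>M borel)" by measurable
  have le2: "norm (W x * cas (k \<bullet> x) * (g k \<bullet> hart g x)) <= (W x * (2 * B)) * norm (g k)" for x k
  proof -
   have "\<bar>g k \<bullet> hart g x\<bar> <= norm (g k) * B"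
    using Cauchy_Schwarz_ineq2[of "g k" "hart g x"] mult_left_mono[OF B[of x] norm_ge_zero[of "g k"]] by linarith
   then have "\<bar>cas (k \<bullet> x)\<bar> * \<bar>g k \<bullet> hart g x\<bar> <= 2 * (norm (g k) * B)" by (intro mult_mono abs_cas_le) auto
   from mult_left_mono[OF this W0[of x]] show ?thesis using W0[of x] by (simp add: abs_mult mult_ac)
  qed
  note F2 = fubini_product_bound[OF meas2 integrable_mult_left[OF iW] ign le2]
  have "integrable (lborel \<Otimes>\<^sub>M lborel) (%(l, k). K (k - l) * (norm (g l))^2)"
  proof (rule lborel_pair.Fubini_integrable)
   show "(%(l, k). K (k - l) * (norm (g l))^2) \<in> borel_measurable (lborel \<Otimes>\<^sub>M lborel)" by measurable
   have "(LBINT k. norm (K (k - l) * (norm (g l))^2)) = (2 * pi) ^ 3 * (norm (g l))^2" for l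
    using K0 integral_translate[of K "- l"] vK by (simp add: abs_mult)
   then show "integrable lborel (%l. LBINT k. norm (case (l, k) of (l, k) => K (k - l) * (norm (g l))^2))" using ig2 by simp
   show "AE l in lborel. integrable lborel (%k. case (l, k) of (l, k) => K (k - l) * (norm (g l))^2)"
    using integrable_translate(1)[OF iK, of "- l" for l] by (auto intro!: AE_I2)
  qed
  note I3 = this
  have F3: "(LBINT k. (LBINT l. K (k - l) * (norm (g l))^2)) = (2 * pi) ^ 3 * (LBINT k. (norm (g k))^2)" (is ?g1)
   "integrable lborel (%k. LBINT l. K (k - l) * (norm (g l))^2)" (is ?g2)
  proof -
   have "(LBINT k. (LBINT l. K (k - l) * (norm (g l))^2)) = (LBINT l. (LBINT k. K (k - l) * (norm (g l))^2))"
    using lborel_pair.Fubini_integral[OF I3] by simp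
   also have "(%l. LBINT k. K (k - l) * (norm (g l))^2) = (%l. (2 * pi) ^ 3 * (norm (g l))^2)"
    using integral_translate[of K "- l" for l] vK by simp
   finally show ?g1 by simp
   show ?g2 using lborel_pair.integrable_snd[OF I3] by simp
  qed
  from r obtain D where D: "!!k. norm (g k) * (1 + norm k) ^ 0 <= D" unfolding rapid_def by blast
  have iKg: "integrable lborel (%l. K (k - l) *\<^sub>R g l)" (is ?g1) "integrable lborel (%l. K (k - l) * (norm (g l))^2)" (is ?g2) for k
  proof -
   show ?g1 by (rule dominated_integrable[OF integrable_mult_right[OF iKt(1), of D]])
      (use D K0 in "auto intro!: AE_I2 order_trans[OF _ abs_ge_self] mult_left_mono simp: mult.commute[of D]")
   show ?g2 by (rule dominated_integrable[OF integrable_mult_right[OF iKt(1), of "D^2"]])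
      (use D K0 in \<open>auto intro!: AE_I2 order_trans[OF _ abs_ge_self] mult_left_mono power_mono simp: mult.commute[of "D^2"] abs_mult\<close>)
  qed
  have pull: "(LBINT x. W x * cas (k \<bullet> x) * (g k \<bullet> hart g x)) = g k \<bullet> (LBINT l. K (k - l) *\<^sub>R g l)" for k
  proof -
   have "(LBINT x. W x * cas (k \<bullet> x) * (g k \<bullet> hart g x)) = (LBINT x. g k \<bullet> ((W x * cas (k \<bullet> x)) *\<^sub>R hart g x))"
    by simp
   also have "... = g k \<bullet> (LBINT x. (W x * cas (k \<bullet> x)) *\<^sub>R hart g x)" by (rule integral_inner_right) (use iinner in simp)
   finally show ?thesis by (simp add: inner)
  qed
  have "(LBINT x. W x * (norm (hart g x))^2) = (LBINT x. (LBINT k. W x * cas (k \<bullet> x) * (g k \<bullet> hart g x)))"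
  proof (intro Bochner_Integration.integral_cong refl)
   fix x
   have "(norm (hart g x))^2 = hart g x \<bullet> hart g x" by (simp add: power2_norm_eq_inner)
   also have "... = (LBINT k. cas (k \<bullet> x) *\<^sub>R g k) \<bullet> hart g x" by (simp add: hart_def)
   also have "... = (LBINT k. (cas (k \<bullet> x) *\<^sub>R g k) \<bullet> hart g x)"
    by (rule integral_inner_left[symmetric]) (use integrable_cas[OF ig] in simp)
   finally show "W x * (norm (hart g x))^2 = (LBINT k. W x * cas (k \<bullet> x) * (g k \<bullet> hart g x))" by (simp add: mult.assoc)
  qed
  also have "... = (LBINT k. (LBINT x. W x * cas (k \<bullet> x) * (g k \<bullet> hart g x)))" by (rule F2(1))
  also have "... = (LBINT k. g k \<bullet> (LBINT l. K (k - l) *\<^sub>R g l))" unfolding pull ..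
  also have "... <= (LBINT k. ((2 * pi) ^ 3 * (norm (g k))^2 + (LBINT l. K (k - l) * (norm (g l))^2)) / 2)"
  proof (rule integral_mono)
   show "integrable lborel (%k. g k \<bullet> (LBINT l. K (k - l) *\<^sub>R g l))" using F2(3) unfolding pull .
   show "integrable lborel (%k. ((2 * pi) ^ 3 * (norm (g k))^2 + (LBINT l. K (k - l) * (norm (g l))^2)) / 2)" using ig2 F3(2) by simp
   fix k
   have "g k \<bullet> (LBINT l. K (k - l) *\<^sub>R g l) = (LBINT l. g k \<bullet> (K (k - l) *\<^sub>R g l))"
    by (rule integral_inner_right[symmetric]) (use iKg in simp)
   also have "... <= (LBINT l. (K (k - l) * (norm (g k))^2 + K (k - l) * (norm (g l))^2) / 2)"
   proof (rule integral_mono)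
    show "integrable lborel (%l. g k \<bullet> (K (k - l) *\<^sub>R g l))" using iKg(1)[of k] by (intro integrable_inner_right) simp
    show "integrable lborel (%l. (K (k - l) * (norm (g k))^2 + K (k - l) * (norm (g l))^2) / 2)" using iKg(2)[of k] iKt(1)[of k] by simp
    fix l
    have "g k \<bullet> g l <= ((norm (g k))^2 + (norm (g l))^2) / 2"
     using norm_cauchy_schwarz[of "g k" "g l"] sum_squares_bound[of "norm (g k)" "norm (g l)"] by simp
    from mult_left_mono[OF this K0[of "k - l"]]
    show "g k \<bullet> (K (k - l) *\<^sub>R g l) <= (K (k - l) * (norm (g k))^2 + K (k - l) * (norm (g l))^2) / 2" by (simp add: distrib_left)
   qed
   also have "... = ((2 * pi) ^ 3 * (norm (g k))^2 + (LBINT l. K (k - l) * (norm (g l))^2)) / 2" using iKg(2)[of k] iKt[of k] by simp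
   finally show "g k \<bullet> (LBINT l. K (k - l) *\<^sub>R g l) <= ..." .
  qed
  also have "... = (2 * pi) ^ 3 * (LBINT k. (norm (g k))^2)" using ig2 F3 by simp
  finally show "(LBINT x. exp (- c * (norm x)^2) * (norm (hart g x))^2) <= (2 * pi) ^ 3 * (LBINT k. (norm (g k))^2)" by (simp add: W_def)
 qed
 have lim: "(%n. exp (- (1 / real (Suc n)) * (norm x)^2) * (norm (hart g x))^2) \<longlonglongrightarrow> (norm (hart g x))^2" for x
 proof -
  have "(%n. exp (- (1 / real (Suc n)) * (norm x)^2) * (norm (hart g x))^2) \<longlonglongrightarrow> exp (- 0 * (norm x)^2) * (norm (hart g x))^2"
   by (intro tendsto_intros LIMSEQ_Suc[OF lim_const_over_n])
  then show ?thesis by simp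
 qed
 have w: "integrable lborel (%x. exp (- (1 / real (Suc n)) * (norm x)^2) * (norm (hart g x))^2)"
  "(LBINT x. exp (- (1 / real (Suc n)) * (norm x)^2) * (norm (hart g x))^2)
    <= (2 * pi) ^ 3 * (LBINT k. (norm (g k))^2)" for n
  using conjunct1[OF weighted[of "1 / real (Suc n)"]] conjunct2[OF weighted[of "1 / real (Suc n)"]]
  by (simp_all only: of_nat_0_less_iff zero_less_Suc zero_less_divide_1_iff True_implies_equals)
 have nn: "0 <= exp (- (1 / real (Suc n)) * (norm x)^2) * (norm (hart g x))^2" for n x by simp
 show ?g1
  ?g2 by (rule integrable_limit_bounded_integrals[OF w(1) nn lim w(2)])+
qed

section \<open>Products of band-limited fields\<close>

text \<open>Bounded densities vanishing outside the ball of radius \<open>R\<close>.\<close>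
definition band :: "real => (real^3 => 'b::euclidean_space) => bool" where
 "band R g \<longleftrightarrow> g \<in> borel_measurable borel \<and> (\<exists>b. \<forall>k. norm (g k) <= b) \<and> (\<forall>k. norm k > R --> g k = 0)"

lemma band_measurable: "band R g ==> g \<in> borel_measurable borel" by (simp add: band_def)

lemma band_zero: "band R g ==> norm k > R ==> g k = 0" by (simp add: band_def)

lemma band_rapid:
 assumes "band R g" shows "rapid g" unfolding rapid_def
proof (intro conjI allI)
 fix m
 from assms obtain b where b: "!!k. norm (g k) <= b" unfolding band_def by blast
 have b0: "b >= 0" using b[of 0] norm_ge_zero order_trans by blast
 have "norm (g k) * (1 + norm k) ^ m <= b * (1 + \<bar>R\<bar>) ^ m" for k
 proof (cases "norm k > R")
  case True
  then show ?thesis using assms b0 by (simp add: band_def)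
 next
  case False
  then show ?thesis using b b0 by (intro mult_mono power_mono) auto
 qed
 then show "\<exists>C. \<forall>k. norm (g k) * (1 + norm k) ^ m <= C" by blast
qed (use assms band_measurable in blast)

text \<open>The density of \<open>u \<cdot> \<nabla>v\<close> when \<open>g\<close>, \<open>h\<close> are densities of \<open>u\<close>, \<open>v\<close> and \<open>u\<close> is divergence-free.
 The four terms come from writing \<open>cas a * cas (- b)\<close> as a combination of \<open>cas (a + b)\<close>,
 \<open>cas (a - b)\<close>, \<open>cas (- a - b)\<close> and \<open>cas (b - a)\<close>. The outer factor \<open>m\<close> is the divergence form
 of the product.\<close>
definition advm :: "(real^3 => real^3) => (real^3 => real^3) => real^3 => real^3" where
 "advm g h m = (LBINT k. (- (1 / 2) * (m \<bullet> g k)) *\<^sub>R (h (k + m) + h (- k - m) + h (k - m) - h (m - k)))"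

lemma cas_product: "cas a * cas (- b) = (cas (a + b) + cas (a - b) + cas (- a - b) - cas (b - a)) / 2"
proof -
 have "cas (- a - b) = cos (a + b) - sin (a + b)" "cas (b - a) = cos (a - b) - sin (a - b)"
  using cas_minus[of "a + b"] cas_minus[of "a - b"] by simp_all
 moreover have "cas a * cas (- b) = cos (a + b) + sin (a - b)" by (simp add: cas_def cos_add sin_diff algebra_simps)
 ultimately show ?thesis by (simp add: cas_def)
qed

lemma advm_measurable:
 assumes [measurable]: "g \<in> borel_measurable borel" "h \<in> borel_measurable borel"
 shows "advm g h \<in> borel_measurable borel" unfolding advm_def[abs_def] by (rule lborel.borel_measurable_lebesgue_integral) measurable

lemma four_terms_norm:
 fixes h :: "real^3 => real^3"
 shows "norm (h (k + m) + h (- k - m) + h (k - m) - h (m - k))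
  <= norm (h (k + m)) + norm (h (- k - m)) + norm (h (k - m)) + norm (h (m - k))"
 using norm_triangle_ineq4[of "h (k + m) + h (- k - m) + h (k - m)" "h (m - k)"]
  norm_triangle_ineq[of "h (k + m) + h (- k - m)" "h (k - m)"]
  norm_triangle_ineq[of "h (k + m)" "h (- k - m)"] by linarith

lemma norm_integral_le:
 fixes f :: "real^3 => 'b::{banach, second_countable_topology}"
 assumes "integrable lborel g" "!!x. norm (f x) <= g x"
 shows "norm (LBINT x. f x) <= (LBINT x. g x)"
proof (cases "integrable lborel f")
 case True
 then show ?thesis using assms by (intro Bochner_Integration.integral_norm_bound_integral) auto
next
 case False
 have "0 <= g x" for x using assms(2)[of x] norm_ge_zero order_trans by blast
 then show ?thesis using False by (simp add: not_integrable_integral_eq)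
qed

text \<open>The support is the sum of the supports, since each of the four shifted copies of \<open>h\<close> vanishes beyond it.
The factor \<open>m\<close> is then at most \<open>R + S\<close>, which is the whole cost of the derivative.\<close>
lemma advm_bounds:
 assumes g: "band R g" and h: "band S h" and R: "0 <= R" "0 <= S"
 shows "!!m. norm m > R + S ==> advm g h m = 0"
  and "!!m b. (!!k. norm (h k) <= b) ==> norm (advm g h m) <= 2 * norm m * (LBINT k. norm (g k)) * b"
  and "band (R + S) (advm g h)" (is ?g3)
  and "(LBINT m. norm (advm g h m)) <= 2 * (R + S) * (LBINT k. norm (g k)) * (LBINT k. norm (h k))" (is ?g4)
proof -
 have [measurable]: "g \<in> borel_measurable borel" "h \<in> borel_measurable borel" using g h band_measurable by auto
 have ig: "integrable lborel (%k. norm (g k))" and ih: "integrable lborel (%k. norm (h k))" using g h band_rapid rapid_integrable_norm by blast+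
 define H where "H k m = norm (h (k + m)) + norm (h (- k - m)) + norm (h (k - m)) + norm (h (m - k))" for k m
 have H0: "H k m >= 0" for k m by (simp add: H_def)
 have [measurable]: "(%(k, m). H k m) \<in> borel_measurable (borel \<Otimes>\<^sub>M borel)" unfolding H_def[abs_def] by measurable
 have le: "norm ((- (1 / 2) * (m \<bullet> g k)) *\<^sub>R (h (k + m) + h (- k - m) + h (k - m) - h (m - k)))
   <= norm m / 2 * (norm (g k) * H k m)" for k m
 proof -
  have "\<bar>m \<bullet> g k\<bar> * norm (h (k + m) + h (- k - m) + h (k - m) - h (m - k)) <= (norm m * norm (g k)) * H k m"
   unfolding H_def by (intro mult_mono Cauchy_Schwarz_ineq2 four_terms_norm) auto
  then show ?thesis by (simp add: abs_mult)
 qed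
 have zero: "norm (g k) * H k m = 0" if "norm m > R + S" for k m
 proof (cases "norm k > R")
  case True then show ?thesis using band_zero[OF g] by simp
 next
  case False
  have "norm (k + m) > S" "norm (- k - m) > S" "norm (k - m) > S" "norm (m - k) > S"
   using that False norm_triangle_ineq2[of m k] norm_triangle_ineq2[of m "- k"]
    norm_minus_commute[of k m] norm_minus_cancel[of "k + m"] by (auto simp: algebra_simps)
  then show ?thesis using band_zero[OF h] by (simp add: H_def)
 qed
 show 1: "advm g h m = 0" if "norm m > R + S" for m
 proof -
  have "(- (1 / 2) * (m \<bullet> g k)) *\<^sub>R (h (k + m) + h (- k - m) + h (k - m) - h (m - k)) = 0" for k
   by (metis (no_types) le zero[OF that] mult_zero_right norm_le_zero_iff)
  then show ?thesis unfolding advm_def by (simp only: Bochner_Integration.integral_zero)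
 qed
 show 2: "norm (advm g h m) <= 2 * norm m * (LBINT k. norm (g k)) * b" if b: "!!k. norm (h k) <= b" for m b
 proof -
  have "norm (advm g h m) <= (LBINT k. (2 * norm m * b) * norm (g k))" unfolding advm_def
  proof (rule norm_integral_le)
   fix k :: "real^3"
   have "H k m <= 4 * b" using b[of "k + m"] b[of "- k - m"] b[of "k - m"] b[of "m - k"] by (simp add: H_def)
   then have "norm m / 2 * (norm (g k) * H k m) <= norm m / 2 * (norm (g k) * (4 * b))" by (intro mult_left_mono) auto
   then show "norm ((- (1 / 2) * (m \<bullet> g k)) *\<^sub>R (h (k + m) + h (- k - m) + h (k - m) - h (m - k))) <= (2 * norm m * b) * norm (g k)"
    using le[of m k] by (simp add: mult_ac)
  qed (use ig in auto)
  then show ?thesis by (simp add: mult_ac)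
 qed
 from h obtain b where b: "!!k. norm (h k) <= b" unfolding band_def by blast
 have b0: "b >= 0" using b[of 0] norm_ge_zero order_trans by blast
 show 3: ?g3 unfolding band_def
 proof (intro conjI allI impI)
  show "advm g h \<in> borel_measurable borel" by (rule advm_measurable) measurable
  have "norm (advm g h m) <= 2 * (R + S) * (LBINT k. norm (g k)) * b" for m
  proof (cases "norm m > R + S")
   case True then show ?thesis using 1 R b0 by simp
  next
   case False
   then have "2 * norm m * (LBINT k. norm (g k)) * b <= 2 * (R + S) * (LBINT k. norm (g k)) * b" using b0 by (intro mult_right_mono) auto
   then show ?thesis using 2[OF b, of m] by linarith
  qed
  then show "\<exists>b. \<forall>k. norm (advm g h k) <= b" by blast
 qed (rule 1)
 define Q where "Q m = (LBINT k. norm (g k) * H k m)" for m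
 have meas: "(%(m, k). norm (g k) * H k m) \<in> borel_measurable (borel \<Otimes>\<^sub>M borel)"  unfolding H_def by measurable
 have ind: "integrable lborel (%m. 4 * b * indicator (cball 0 (R + S)) (m :: real^3))"
  by (intro integrable_mult_right integrable_real_indicator) (use emeasure_lborel_cball_finite[of "0 :: real^3" "R + S"] in auto)
 have leb: "norm (norm (g k) * H k m) <= (4 * b * indicator (cball 0 (R + S)) m) * norm (g k)" for m k
 proof (cases "norm m > R + S")
  case True then show ?thesis using zero[OF True, of k] b0 by simp
 next
  case False
  have "H k m <= 4 * b" using b[of "k + m"] b[of "- k - m"] b[of "k - m"] b[of "m - k"] by (simp add: H_def)
  then have "H k m * norm (g k) <= 4 * b * norm (g k)" by (rule mult_right_mono) simp
  then show ?thesis using False H0[of k m] by (simp add: mult.commute)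
 qed
 note F = fubini_product_bound[OF meas ind ig leb]
 have QI: "(LBINT m. Q m) = 4 * (LBINT k. norm (g k)) * (LBINT k. norm (h k))"
 proof -
  have "(LBINT m. Q m) = (LBINT k. (LBINT m. norm (g k) * H k m))" unfolding Q_def by (rule F(1))
  also have "... = (LBINT k. norm (g k) * (4 * (LBINT k. norm (h k))))"
  proof (intro Bochner_Integration.integral_cong refl)
   fix k :: "real^3"
   have i: "integrable lborel (%m. norm (h (k + m)))" "integrable lborel (%m. norm (h (- k - m)))"
    "integrable lborel (%m. norm (h (k - m)))" "integrable lborel (%m. norm (h (m - k)))"
    using integrable_translate[OF ih, of k] integrable_translate[OF ih, of "- k"] by simp_all
   have "(LBINT m. H k m) = 4 * (LBINT k. norm (h k))"
    unfolding H_def using i integral_translate[of "%k. norm (h k)" k] integral_translate[of "%k. norm (h k)" "- k"]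
     integral_reflect[of "%k. norm (h k)" k] integral_reflect[of "%k. norm (h k)" "- k"] by simp
   then show "(LBINT m. norm (g k) * H k m) = norm (g k) * (4 * (LBINT k. norm (h k)))" by simp
  qed
  finally show ?thesis by simp
 qed
 have "(LBINT m. norm (advm g h m)) <= (LBINT m. (R + S) / 2 * Q m)"
 proof (rule integral_mono)
  show "integrable lborel (%m. norm (advm g h m))" using 3 band_rapid rapid_integrable_norm by blast
  show "integrable lborel (%m. (R + S) / 2 * Q m)" unfolding Q_def using F(2) by (rule integrable_mult_right)
  fix m
  show "norm (advm g h m) <= (R + S) / 2 * Q m"
  proof (cases "norm m > R + S")
   case True
   have "Q m >= 0" unfolding Q_def using H0 by simp
   then show ?thesis using True 1 R by simp
  next
   case False
   have "norm (advm g h m) <= (LBINT k. norm m / 2 * (norm (g k) * H k m))"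
    unfolding advm_def by (rule norm_integral_le[OF _ le]) (use F(4)[of m] in simp)
   also have "... = norm m / 2 * Q m" unfolding Q_def by (rule integral_mult_right_zero)
   also have "... <= (R + S) / 2 * Q m" using False H0 by (intro mult_right_mono) (auto simp: Q_def)
   finally show ?thesis .
  qed
 qed
 also have "... = (R + S) / 2 * (LBINT m. Q m)" by (rule integral_mult_right_zero)
 finally show ?g4 by (simp add: QI algebra_simps)
qed

text \<open>Interchanging the integrals and translating or reflecting \<open>m\<close> turns the four copies of \<open>h\<close> into one
integral over \<open>l\<close> with the product \<open>cas (k \<bullet> x) cas (- (l \<bullet> x))\<close>. The shifts of the factor \<open>m \<bullet> g k\<close> drop
out because \<open>k \<bullet> g k = 0\<close>.\<close>
lemma hart_advm:
 assumes g: "band R g" and h: "band S h" and R: "0 <= R" "0 <= S" and div: "!!k. k \<bullet> g k = 0"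
 shows "hart (advm g h) x = hart (dirmult (hart g x) h) x"
proof -
 have [measurable]: "g \<in> borel_measurable borel" "h \<in> borel_measurable borel" using g h band_measurable by auto
 have rg: "rapid g" and rh: "rapid h" using g h band_rapid by blast+
 have ig: "integrable lborel (%k. norm (g k))" and ih: "integrable lborel h" using rg rh rapid_integrable_norm rapid_integrable by blast+
 from h obtain b where b: "!!k. norm (h k) <= b" unfolding band_def by blast
 have b0: "b >= 0" using b[of 0] norm_ge_zero order_trans by blast
 define F where "F m k = cas (m \<bullet> x) *\<^sub>R (- (1 / 2) * (m \<bullet> g k)) *\<^sub>R (h (k + m) + h (- k - m) + h (k - m) - h (m - k))" for m k
 have meas: "(%(m, k). F m k) \<in> borel_measurable (borel \<Otimes>\<^sub>M borel)" unfolding F_def[abs_def] by measurable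
 have ind: "integrable lborel (%m. 4 * b * (R + S) * indicator (cball 0 (R + S)) (m :: real^3))"
  by (intro integrable_mult_right integrable_real_indicator) (use emeasure_lborel_cball_finite[of "0 :: real^3" "R + S"] in auto)
 have le: "norm (F m k) <= (4 * b * (R + S) * indicator (cball 0 (R + S)) m) * norm (g k)" for m k
 proof (cases "norm k > R")
  case True then show ?thesis using band_zero[OF g] b0 R by (simp add: F_def)
 next
  case k: False
  show ?thesis
  proof (cases "norm m > R + S")
   case True
   have "norm (k + m) > S" "norm (- k - m) > S" "norm (k - m) > S" "norm (m - k) > S"
    using True k norm_triangle_ineq2[of m k] norm_triangle_ineq2[of m "- k"]
     norm_minus_commute[of k m] norm_minus_cancel[of "k + m"] by (auto simp: algebra_simps)
   then have "F m k = 0" using band_zero[OF h] by (simp add: F_def)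
   then show ?thesis using b0 R by simp
  next
   case False
   have "norm (h (k + m) + h (- k - m) + h (k - m) - h (m - k)) <= 4 * b"
    using four_terms_norm[of h k m] b[of "k + m"] b[of "- k - m"] b[of "k - m"] b[of "m - k"] by linarith
   moreover have "\<bar>m \<bullet> g k\<bar> <= (R + S) * norm (g k)"
    using Cauchy_Schwarz_ineq2[of m "g k"] mult_right_mono[of "norm m" "R + S" "norm (g k)"] False by auto
   ultimately have "\<bar>cas (m \<bullet> x)\<bar> * (\<bar>m \<bullet> g k\<bar> * norm (h (k + m) + h (- k - m) + h (k - m) - h (m - k)))
     <= 2 * (((R + S) * norm (g k)) * (4 * b))" using R by (intro mult_mono abs_cas_le) auto
   moreover have "norm (F m k) = (1 / 2) * (\<bar>cas (m \<bullet> x)\<bar> * (\<bar>m \<bullet> g k\<bar> * norm (h (k + m) + h (- k - m) + h (k - m) - h (m - k))))"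
    by (simp add: F_def abs_mult)
   ultimately show ?thesis using False by (simp add: algebra_simps)
  qed
 qed
 note Fub = fubini_product_bound[OF meas ind ig le]
 define L where "L v = hart (dirmult v h) x" for v
 have L: "L v = (LBINT l. (cas (- (l \<bullet> x)) * (l \<bullet> v)) *\<^sub>R h l)" for v unfolding L_def by (rule hart_dirmult[OF rh])
 have bl: "bounded_linear L" unfolding L_def[abs_def] by (rule has_derivative_bounded_linear[OF hart_has_derivative[OF rh]])
 have inner: "(LBINT m. F m k) = L (cas (k \<bullet> x) *\<^sub>R g k)" for k
 proof -
  define \<gamma> where "\<gamma> = g k"
  have k\<gamma>: "k \<bullet> \<gamma> = 0" using div by (simp add: \<gamma>_def)
  define f1 where "f1 l = (cas (l \<bullet> x - k \<bullet> x) * (l \<bullet> \<gamma>)) *\<^sub>R h l" for l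
  define f2 where "f2 l = (cas (- (k \<bullet> x) - l \<bullet> x) * (l \<bullet> \<gamma>)) *\<^sub>R h l" for l
  define f3 where "f3 l = (cas (k \<bullet> x - l \<bullet> x) * (l \<bullet> \<gamma>)) *\<^sub>R h l" for l
  define f4 where "f4 l = (cas (k \<bullet> x + l \<bullet> x) * (l \<bullet> \<gamma>)) *\<^sub>R h l" for l
  have [measurable]: "f1 \<in> borel_measurable borel" "f2 \<in> borel_measurable borel" "f3 \<in> borel_measurable borel" "f4 \<in> borel_measurable borel"
   unfolding f1_def[abs_def] f2_def[abs_def] f3_def[abs_def] f4_def[abs_def] by measurable
  have nb: "norm ((cas a * (l \<bullet> \<gamma>)) *\<^sub>R h l) <= 2 * norm \<gamma> * (norm l ^ 1 * norm (h l))" for a l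
  proof -
   have "\<bar>cas a\<bar> * \<bar>l \<bullet> \<gamma>\<bar> <= 2 * (norm l * norm \<gamma>)"
    by (intro mult_mono abs_cas_le Cauchy_Schwarz_ineq2) auto
   from mult_right_mono[OF this norm_ge_zero[of "h l"]] show ?thesis by (simp add: abs_mult mult_ac)
  qed
  have i: "integrable lborel f" if [measurable]: "f \<in> borel_measurable borel"
   and f: "!!l. \<exists>a. f l = (cas a * (l \<bullet> \<gamma>)) *\<^sub>R h l" for f :: "real^3 => real^3"
  proof -
   have "norm (f l) <= 2 * norm \<gamma> * (norm l ^ 1 * norm (h l))" for l using f[of l] nb by metis
   then show ?thesis by (intro dominated_integrable[OF integrable_mult_right[OF rapid_integrable_mult[OF rh, of 1], of "2 * norm \<gamma>"]])
      (auto intro!: AE_I2 order_trans[OF _ abs_ge_self])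
  qed
  have if1: "integrable lborel f1" by (rule i, measurable) (unfold f1_def, blast)
  have if2: "integrable lborel f2" by (rule i, measurable) (unfold f2_def, blast)
  have if3: "integrable lborel f3" by (rule i, measurable) (unfold f3_def, blast)
  have if4: "integrable lborel f4" by (rule i, measurable) (unfold f4_def, blast)
  have Fk: "F m k = (1 / 2) *\<^sub>R (f4 (- k + m) - f1 (k + m) + f2 (- k - m) + f3 (k - m))" for m
   unfolding F_def f1_def f2_def f3_def f4_def \<gamma>_def[symmetric]
   by (simp add: inner_add_left inner_diff_left k\<gamma> scaleR_add_right scaleR_diff_right)
  have "(LBINT m. F m k) = (1 / 2) *\<^sub>R ((LBINT l. f4 l) - (LBINT l. f1 l) + (LBINT l. f2 l) + (LBINT l. f3 l))" unfolding Fk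
   using integrable_translate(1)[OF if4, of "- k"] integrable_translate(1)[OF if1, of k]
    integrable_translate(2)[OF if2, of "- k"] integrable_translate(2)[OF if3, of k]
    integral_translate[of f4 "- k"] integral_translate[of f1 k] integral_reflect[of f2 "- k"] integral_reflect[of f3 k] by simp
  also have "... = (LBINT l. (1 / 2) *\<^sub>R (f4 l - f1 l + f2 l + f3 l))" using if1 if2 if3 if4 by simp
  also have "... = L (cas (k \<bullet> x) *\<^sub>R \<gamma>)" unfolding L
  proof (intro Bochner_Integration.integral_cong refl)
   fix l
   have "(cas (- (l \<bullet> x)) * (l \<bullet> cas (k \<bullet> x) *\<^sub>R \<gamma>)) *\<^sub>R h l = (cas (k \<bullet> x) * cas (- (l \<bullet> x)) * (l \<bullet> \<gamma>)) *\<^sub>R h l"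
    by (simp add: mult_ac)
   also have "... = (1 / 2) *\<^sub>R (f4 l - f1 l + f2 l + f3 l)" unfolding cas_product f1_def f2_def f3_def f4_def
    by (simp add: algebra_simps add_divide_distrib diff_divide_distrib)
   finally show "(1 / 2) *\<^sub>R (f4 l - f1 l + f2 l + f3 l) = (cas (- (l \<bullet> x)) * (l \<bullet> cas (k \<bullet> x) *\<^sub>R \<gamma>)) *\<^sub>R h l" by simp
  qed
  finally show ?thesis by (simp add: \<gamma>_def)
 qed
 have "hart (advm g h) x = (LBINT m. (LBINT k. F m k))" unfolding hart_def advm_def F_def by (simp only: integral_scaleR_right)
 also have "... = (LBINT k. L (cas (k \<bullet> x) *\<^sub>R g k))" unfolding Fub(1) inner ..
 also have "... = L (hart g x)" unfolding hart_def by (rule integral_bounded_linear[OF bl integrable_cas[OF rapid_integrable[OF rg]]])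
 finally show ?thesis by (simp add: L_def)
qed

section \<open>The Newtonian kernel as a superposition of Gaussians\<close>

definition newton :: "real^3 => real" where
 "newton z = 1 / (4 * pi * norm z)"

text \<open>\<open>1 / (4 pi |z|)\<close> is the integral of \<open>exp (- r^2 |z|^2) / (2 pi^(3/2))\<close> over all \<open>r > 0\<close>. Restricting
 \<open>r\<close> to a compact interval gives integrable kernels that increase to the Newtonian kernel.\<close>
definition newton_trunc :: "nat => real^3 => real" where
 "newton_trunc n z =
  (LBINT r. 1 / (2 * pi * sqrt pi) * (indicator {1 / real n..real n} r * exp (- r\<^sup>2 * (norm z)^2)))"

definition newton_trunc_hat :: "nat => real^3 => real" where
 "newton_trunc_hat n k = (LBINT z. newton_trunc n z * cos (k \<bullet> z))"

lemma gaussian_half_line: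
 assumes "a > 0"
 shows "integrable lborel (%r. indicator {0..} r * exp (- r\<^sup>2 * a^2) :: real)" (is ?g1)
  and "(LBINT r. indicator {0..} r * exp (- r\<^sup>2 * a^2)) = sqrt pi / (2 * a)" (is ?g2)
proof -
 have h: "has_bochner_integral lborel (%x. indicator {0..} x *\<^sub>R exp (- x\<^sup>2)) (sqrt pi / 2)" using gaussian_moment_0 by simp
 have eq: "indicator {0..} (0 + a * r) *\<^sub>R exp (- (0 + a * r)\<^sup>2) = indicator {0..} r * exp (- r\<^sup>2 * a^2)" for r
  using assms by (auto simp: indicator_def zero_le_mult_iff power_mult_distrib mult_ac)
 have i: "integrable lborel (%x::real. indicator {0..} x *\<^sub>R exp (- x\<^sup>2))" using h by (simp add: has_bochner_integral_iff)
 show ?g1 using lborel_integrable_real_affine[OF i, of a 0] assms unfolding eq by simp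
 have "(LBINT x. indicator {0..} x *\<^sub>R exp (- (x::real)\<^sup>2))
   = \<bar>a\<bar> *\<^sub>R (LBINT x. indicator {0..} (0 + a * x) *\<^sub>R exp (- (0 + a * x)\<^sup>2))"
  by (rule lborel_integral_real_affine) (use assms in simp)
 then show ?g2 unfolding eq using h assms by (simp add: has_bochner_integral_iff field_simps)
qed

lemma trunc_integrand_integrable:
 "n > 0 ==> integrable lborel (%r. 1 / (2 * pi * sqrt pi) * (indicator {1 / real n..real n} r * exp (- r\<^sup>2 * (norm z)^2)))"
proof (intro integrable_mult_right)
 show "integrable lborel (%r. indicator {1 / real n..real n} r * exp (- r\<^sup>2 * (norm z)^2))"
 proof -
  have "continuous_on {1 / real n..real n} (%r. exp (- r\<^sup>2 * (norm z)^2))" by (intro continuous_intros)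
  from borel_integrable_compact[OF compact_Icc this] show ?thesis by simp
 qed
qed

lemma newton_integral:
 assumes "z \<noteq> 0"
 shows "integrable lborel (%r. 1 / (2 * pi * sqrt pi) * (indicator {0..} r * exp (- r\<^sup>2 * (norm z)^2)) :: real)" (is ?g1)
  and "newton z = (LBINT r. 1 / (2 * pi * sqrt pi) * (indicator {0..} r * exp (- r\<^sup>2 * (norm z)^2)))" (is ?g2)
proof -
 have a: "norm z > 0" using assms by simp
 show ?g1 by (intro integrable_mult_right gaussian_half_line a)
 show ?g2 unfolding integral_mult_right_zero gaussian_half_line(2)[OF a] newton_def using a by (simp add: field_simps)
qed

lemma newton_trunc_nonneg: "0 <= newton_trunc n z" unfolding newton_trunc_def by (intro integral_nonneg_AE) auto

text \<open>The difference of the truncated kernels at two points is an integral of a function of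
 constant sign, so truncation can only decrease its absolute value.\<close>
lemma newton_trunc_diff_le:
 assumes n: "n > 0" and "z \<noteq> 0" "w \<noteq> 0"
 shows "\<bar>newton_trunc n z - newton_trunc n w\<bar> <= \<bar>newton z - newton w\<bar>"
proof -
 have *: "0 <= newton_trunc n z - newton_trunc n w \<and> newton_trunc n z - newton_trunc n w <= newton z - newton w"
  if "norm z <= norm w" "z \<noteq> 0" "w \<noteq> 0" for z w
 proof -
  have le: "exp (- r\<^sup>2 * (norm w)^2) <= exp (- r\<^sup>2 * (norm z)^2)" for r :: real
   using that(1) by (simp add: mult_left_mono power_mono)
  define D where "D S r = 1 / (2 * pi * sqrt pi) * (indicator S r * exp (- r\<^sup>2 * (norm z)^2))
    - 1 / (2 * pi * sqrt pi) * (indicator S r * exp (- r\<^sup>2 * (norm w)^2))" for S and r :: real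
  have D: "D S r = 1 / (2 * pi * sqrt pi) * (indicator S r * (exp (- r\<^sup>2 * (norm z)^2) - exp (- r\<^sup>2 * (norm w)^2)))" for S r
   unfolding D_def by (simp add: algebra_simps diff_divide_distrib)
  have 1: "newton_trunc n z - newton_trunc n w = (LBINT r. D {1 / real n..real n} r)"
   unfolding newton_trunc_def D_def by (rule Bochner_Integration.integral_diff[symmetric]; rule trunc_integrand_integrable[OF n])
  have 2: "newton z - newton w = (LBINT r. D {0..} r)" unfolding newton_integral(2)[OF that(2)] newton_integral(2)[OF that(3)] D_def
   by (rule Bochner_Integration.integral_diff[symmetric]; rule newton_integral; rule that)
  have "0 <= (LBINT r. D {1 / real n..real n} r)" unfolding D using le by (intro integral_nonneg_AE) auto
  moreover have "(LBINT r. D {1 / real n..real n} r) <= (LBINT r. D {0..} r)"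
  proof (rule integral_mono)
   show "integrable lborel (D {1 / real n..real n})" unfolding D_def by (intro Bochner_Integration.integrable_diff trunc_integrand_integrable n)
   show "integrable lborel (D {0..})" unfolding D_def by (intro Bochner_Integration.integrable_diff newton_integral that)
   fix r :: real
   have "indicator {1 / real n..real n} r <= (indicator {0..} r :: real)"
    using n by (auto simp: indicator_def divide_le_eq intro: order_trans[of 0 "1 / real n"])
   then show "D {1 / real n..real n} r <= D {0..} r" unfolding D using le[of r] by (intro mult_left_mono mult_right_mono) auto
  qed
  ultimately show ?thesis using 1 2 by simp
 qed
 show ?thesis
 proof (cases "norm z <= norm w")
  case True then show ?thesis using *[OF True assms(2,3)] by simp
 next
  case False then show ?thesis using *[of w z] assms(2,3) by simp
 qed
qed

lemma newton_trunc_le: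
 assumes n: "n > 0" and "z \<noteq> 0" shows "newton_trunc n z <= newton z" unfolding newton_integral(2)[OF assms(2)] newton_trunc_def
proof (rule integral_mono[OF trunc_integrand_integrable[OF n] newton_integral(1)[OF assms(2)]])
 fix r :: real
 have "indicator {1 / real n..real n} r <= (indicator {0..} r :: real)"
  using n by (auto simp: indicator_def divide_le_eq intro: order_trans[of 0 "1 / real n"])
 then show "1 / (2 * pi * sqrt pi) * (indicator {1 / real n..real n} r * exp (- r\<^sup>2 * (norm z)^2))
  <= 1 / (2 * pi * sqrt pi) * (indicator {0..} r * exp (- r\<^sup>2 * (norm z)^2))" by (intro mult_left_mono mult_right_mono) auto
qed

lemma newton_trunc_tendsto:
 assumes z: "z \<noteq> 0" shows "(%n. newton_trunc n z) \<longlonglongrightarrow> newton z" unfolding newton_integral(2)[OF z] newton_trunc_def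
proof (rule integral_dominated_convergence[OF _ _ newton_integral(1)[OF z]])
 let ?f = "%S r. 1 / (2 * pi * sqrt pi) * (indicator S r * exp (- r\<^sup>2 * (norm z)^2)) :: real"
 show "AE r in lborel. (%n. ?f {1 / real n..real n} r) \<longlonglongrightarrow> ?f {0..} r"
 proof (rule AE_mp[OF AE_lborel_singleton[of 0]], rule AE_I2, rule impI)
  fix r :: real assume r: "r \<noteq> 0"
  have "\<forall>\<^sub>F n in sequentially. ?f {1 / real n..real n} r = ?f {0..} r"
  proof (cases "r > 0")
   case True
   have "\<forall>\<^sub>F n in sequentially. 1 / real n < r" using order_tendstoD(2)[OF lim_const_over_n[of 1] True] .
   moreover have "\<forall>\<^sub>F n in sequentially. r <= real n" using filterlim_real_sequentially by (auto simp: filterlim_at_top)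
   ultimately show ?thesis by eventually_elim (use True in "auto simp: indicator_def")
  next
   case False
   have "\<not> 1 / real n <= r" for n using False r by (metis divide_nonneg_nonneg less_eq_real_def of_nat_0_le_iff order_trans zero_le_one)
   then show ?thesis using False r by (simp add: indicator_def)
  qed
  then show "(%n. ?f {1 / real n..real n} r) \<longlonglongrightarrow> ?f {0..} r" by (rule tendsto_eventually)
 qed
 fix n
 have "indicator {1 / real n..real n} r <= (indicator {0..} r :: real)" for r by (auto simp: indicator_def intro: order_trans[of 0 "1 / real n"])
 then show "AE r in lborel. norm (?f {1 / real n..real n} r) <= ?f {0..} r"
  by (intro AE_I2) (auto simp: abs_mult intro!: divide_right_mono mult_right_mono)
qed auto

lemma newton_measurable[measurable]: "newton \<in> borel_measurable borel" unfolding newton_def[abs_def] by simp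

lemma newton_trunc_measurable[measurable]: "newton_trunc n \<in> borel_measurable borel"
 unfolding newton_trunc_def[abs_def] by (rule lborel.borel_measurable_lebesgue_integral) measurable

lemma newton_trunc_even: "newton_trunc n (- z) = newton_trunc n z" by (simp add: newton_trunc_def)

lemma newton_trunc_fubini:
 fixes k :: "real^3"
 assumes n: "n > 0" and [measurable]: "f \<in> borel_measurable borel" and f: "!!z. \<bar>f z\<bar> <= 1"
 shows "integrable lborel (%z. newton_trunc n z * f z)" (is ?g1)
  and "(LBINT z. newton_trunc n z * f z) =
   (LBINT r. 1 / (2 * pi * sqrt pi) * (indicator {1 / real n..real n} r * (LBINT z. f z * exp (- r\<^sup>2 * (norm z)^2))))" (is ?g2)
proof -
 define F where "F z r = 1 / (2 * pi * sqrt pi) * (indicator {1 / real n..real n} r * exp (- r\<^sup>2 * (norm z)^2)) * f z"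
  for z :: "real^3" and r :: real
 have meas: "(%(z, r). F z r) \<in> borel_measurable (borel \<Otimes>\<^sub>M borel)" unfolding F_def[abs_def] by measurable
 have c: "(1 / real n)^2 > 0" using n by simp
 have iq: "integrable lborel (%r::real. 1 / (2 * pi * sqrt pi) * indicator {1 / real n..real n} r)"
  by (intro integrable_mult_right integrable_real_indicator) (auto simp: emeasure_lborel_Icc_eq)
 have le: "norm (F z r) <= exp (- (1 / real n)\<^sup>2 * (norm z)^2) * (1 / (2 * pi * sqrt pi) * indicator {1 / real n..real n} r)" for z r
 proof (cases "r \<in> {1 / real n..real n}")
  case True
  have "(1 / real n)^2 <= r^2" using True by (intro power_mono) auto
  then have "exp (- r\<^sup>2 * (norm z)^2) * \<bar>f z\<bar> <= exp (- (1 / real n)\<^sup>2 * (norm z)^2) * 1"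
   by (intro mult_mono f) (auto intro: mult_right_mono simp del: power_one_over)
  then show ?thesis using True by (simp add: F_def abs_mult field_simps)
 qed (simp add: F_def)
 note Fub = fubini_product_bound[OF meas gaussian_fourier(1)[OF c] iq le]
 have eq: "newton_trunc n z * f z = (LBINT r. F z r)" for z unfolding newton_trunc_def F_def by simp
 show ?g1 unfolding eq by (rule Fub(2))
 have "(LBINT z. F z r) = 1 / (2 * pi * sqrt pi) * (indicator {1 / real n..real n} r * (LBINT z. f z * exp (- r\<^sup>2 * (norm z)^2)))" for r
 proof -
  have "F z r = (1 / (2 * pi * sqrt pi) * indicator {1 / real n..real n} r) * (f z * exp (- r\<^sup>2 * (norm z)^2))" for z by (simp add: F_def)
  then show ?thesis by simp
 qed
 then show ?g2 unfolding eq Fub(1) by simp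
qed

lemma newton_trunc_integrable: "n > 0 ==> integrable lborel (newton_trunc n)" using newton_trunc_fubini(1)[of n "%_. 1"] by simp

text \<open>The transform of \<open>exp (- r^2 |z|^2)\<close>, multiplied by \<open>|k|^2\<close>, is a constant times the derivative in \<open>r\<close> of
\<open>exp (- |k|^2 / (4 r^2))\<close>; so the integral over \<open>r\<close> is elementary and, for \<open>k \<noteq> 0\<close>, tends to \<open>1\<close> with \<open>n\<close>.\<close>
lemma newton_trunc_hat_sq:
 assumes n: "n > 0"
 shows "(norm k)^2 * newton_trunc_hat n k = exp (- (norm k)\<^sup>2 / (4 * (real n)^2)) - exp (- (norm k)\<^sup>2 / (4 * (1 / real n)^2))"
proof -
 have "newton_trunc_hat n k = (LBINT r. 1 / (2 * pi * sqrt pi) * (indicator {1 / real n..real n} r * (LBINT z. cos (k \<bullet> z) * exp (- r\<^sup>2 * (norm z)^2))))"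
  unfolding newton_trunc_hat_def by (rule newton_trunc_fubini(2)[OF n]) auto
 also have "... = (LBINT r. indicator {1 / real n..real n} r *\<^sub>R (1 / (2 * r ^ 3) * exp (- (norm k)\<^sup>2 / (4 * r^2))))"
 proof (intro Bochner_Integration.integral_cong refl)
  fix r :: real
  show "1 / (2 * pi * sqrt pi) * (indicator {1 / real n..real n} r * (LBINT z. cos (k \<bullet> z) * exp (- r\<^sup>2 * (norm z)^2)))
    = indicator {1 / real n..real n} r *\<^sub>R (1 / (2 * r ^ 3) * exp (- (norm k)\<^sup>2 / (4 * r^2)))"
  proof (cases "r \<in> {1 / real n..real n}")
   case True
   have "1 / real n > 0" using n by simp
   then have r: "r > 0" using True by (meson atLeastAtMost_iff less_le_trans)
   have "sqrt (pi / r^2) = sqrt pi / r" using r by (simp add: real_sqrt_divide)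
   moreover have "sqrt pi ^ 3 = pi * sqrt pi" by (simp add: power3_eq_cube)
   moreover have "(LBINT z. cos (k \<bullet> z) * exp (- r\<^sup>2 * (norm z)^2)) = sqrt (pi / r^2) ^ 3 * exp (- (norm k)\<^sup>2 / (4 * r^2))"
    by (rule gaussian_fourier(2)) (use r in simp)
   ultimately have "(LBINT z. cos (k \<bullet> z) * exp (- r\<^sup>2 * (norm z)^2)) = pi * sqrt pi / r ^ 3 * exp (- (norm k)\<^sup>2 / (4 * r^2))"
    by (simp only: power_divide)
   then show ?thesis using True r by simp
  qed simp
 qed
 finally have "(norm k)^2 * newton_trunc_hat n k = (LBINT r. (norm k)^2 * (indicator {1 / real n..real n} r *\<^sub>R (1 / (2 * r ^ 3) * exp (- (norm k)\<^sup>2 / (4 * r^2)))))"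
  by (simp only: integral_mult_right_zero)
 also have "... = (LBINT r. indicator {1 / real n..real n} r *\<^sub>R ((norm k)^2 / (2 * r ^ 3) * exp (- (norm k)\<^sup>2 / (4 * r^2))))"
  by (intro Bochner_Integration.integral_cong refl) simp
 also have "... = exp (- (norm k)\<^sup>2 / (4 * (real n)^2)) - exp (- (norm k)\<^sup>2 / (4 * (1 / real n)^2))"
 proof (rule integral_FTC_Icc)
  have "1 <= real n * real n" using n by (metis One_nat_def Suc_leI mult_le_mono mult_1 of_nat_1 of_nat_le_iff of_nat_mult)
  then show "1 / real n <= real n" using n by (simp add: divide_le_eq)
  fix r assume "1 / real n <= r" "r <= real n"
  moreover have "1 / real n > 0" using n by simp
  ultimately have r: "r > 0" by linarith
  have "((%r. exp (- (norm k)\<^sup>2 / (4 * r^2))) has_real_derivative (norm k)^2 / (2 * r ^ 3) * exp (- (norm k)\<^sup>2 / (4 * r^2))) (at r)"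
   using r by (auto intro!: derivative_eq_intros simp: power2_eq_square power3_eq_cube field_simps)
  then show "((%r. exp (- (norm k)\<^sup>2 / (4 * r^2))) has_vector_derivative (norm k)^2 / (2 * r ^ 3) * exp (- (norm k)\<^sup>2 / (4 * r^2))) (at r within {1 / real n..real n})"
   by (simp add: has_real_derivative_iff_has_vector_derivative has_vector_derivative_at_within)
 next
  have "1 / real n > 0" using n by simp
  then show "continuous_on {1 / real n..real n} (%r. (norm k)^2 / (2 * r ^ 3) * exp (- (norm k)\<^sup>2 / (4 * r^2)))"
   by (intro continuous_intros) auto
 qed
 finally show ?thesis .
qed

lemma newton_trunc_hat_measurable[measurable]: "newton_trunc_hat n \<in> borel_measurable borel"
 unfolding newton_trunc_hat_def[abs_def] by (rule lborel.borel_measurable_lebesgue_integral) measurable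

lemma newton_trunc_hat_bound:
 assumes n: "n > 0" shows "\<bar>newton_trunc_hat n k\<bar> <= (LBINT z. newton_trunc n z)"
proof -
 have "norm (LBINT z. newton_trunc n z * cos (k \<bullet> z)) <= (LBINT z. newton_trunc n z)"
  by (rule norm_integral_le[OF newton_trunc_integrable[OF n]])
    (use newton_trunc_nonneg in "auto simp: abs_mult intro: mult_left_le")
 then show ?thesis by (simp add: newton_trunc_hat_def)
qed

lemma newton_trunc_cas:
 assumes n: "n > 0"
 shows "(LBINT x. newton_trunc n (x - y) * cas (k \<bullet> x)) = newton_trunc_hat n k * cas (k \<bullet> y)"
proof -
 have i: "integrable lborel (%z. newton_trunc n z * cos (k \<bullet> z))" "integrable lborel (%z. newton_trunc n z * sin (k \<bullet> z))"
  by (rule newton_trunc_fubini(1)[OF n]; simp)+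
 have s: "(LBINT z. newton_trunc n z * sin (k \<bullet> z)) = 0"
 proof -
  have "(LBINT z. newton_trunc n z * sin (k \<bullet> z)) = (LBINT z. newton_trunc n (0 - z) * sin (k \<bullet> (0 - z)))"
   by (rule integral_reflect[symmetric]) measurable
  then show ?thesis by (simp add: newton_trunc_even)
 qed
 have "(LBINT x. newton_trunc n (x - y) * cas (k \<bullet> x)) = (LBINT x. newton_trunc n (y + x - y) * cas (k \<bullet> (y + x)))"
  by (rule integral_translate[symmetric]) measurable
 also have "... = (LBINT z. cas (k \<bullet> y) * (newton_trunc n z * cos (k \<bullet> z)) + cas (- (k \<bullet> y)) * (newton_trunc n z * sin (k \<bullet> z)))"
  by (intro Bochner_Integration.integral_cong refl)
    (simp add: cas_def inner_add_right cos_add sin_add algebra_simps)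
 also have "... = newton_trunc_hat n k * cas (k \<bullet> y)" using i s by (simp add: newton_trunc_hat_def)
 finally show ?thesis .
qed

section \<open>Partial derivatives\<close>

lemma axis_Basis: "axis i 1 \<in> (Basis :: (real^3) set)" by (simp add: axis_in_Basis_iff)

lemma pd_eq: "(f has_derivative f') (at x) ==> pd i f x = f' (axis i 1)" unfolding pd_def by (metis frechet_derivative_at)

lemma Ck_pd: "Ck (Suc k) f ==> Ck k (pd i f)" unfolding pd_def[abs_def] using axis_Basis[of i] by simp

lemma pd_continuous: "Ck 1 f ==> continuous_on UNIV (pd i f)" using Ck_pd[of 0 f i] by simp

lemma Ck1_has_derivative: "Ck 1 f ==> (f has_derivative frechet_derivative f (at x)) (at x)" using Ck_has_derivative[of 0 f x] by simp

lemma pd_zero_outside: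
 assumes "Ck 1 f" "!!x. norm x >= R ==> f x = 0" "norm x > R"
 shows "pd i f x = 0"
proof -
 have "((%x. 0) has_derivative (%_. 0)) (at x)" by simp
 then have "(f has_derivative (%_. 0)) (at x)" by (rule has_derivative_transform_within_open[where s="- cball 0 R"]) (use assms in auto)
 then show ?thesis by (simp add: pd_eq)
qed

lemma pd_component: "Ck 1 f ==> pd i (%x. f x $ j) x = pd i f x $ j"
 by (rule trans[OF pd_eq[OF bounded_linear.has_derivative[OF bounded_linear_vec_nth Ck1_has_derivative]]])
   (simp_all add: pd_def)

lemma Ck_component: "Ck k f ==> Ck k (%x. f x $ j)" by (rule Ck_bounded_linear[OF bounded_linear_vec_nth])

lemma Ck_sum: "(!!i. i \<in> I ==> Ck k (f i)) ==> Ck k (%x. \<Sum>i\<in>I. f i x)"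
 by (induction I rule: infinite_finite_induct) (auto intro!: Ck_const Ck_add)

lemma Ck_vec_lambda:
 fixes f :: "3 => real^3 => real"
 assumes "!!i. Ck k (f i)" shows "Ck k (%x. \<chi> i. f i x)"
proof -
 have eq: "(%x. \<chi> i. f i x) = (%x. \<Sum>i\<in>UNIV. f i x *\<^sub>R axis i 1)"
  by (simp add: fun_eq_iff vec_eq_iff axis_def if_distrib cong: if_cong)
 show ?thesis unfolding eq by (intro Ck_sum Ck_scaleR assms Ck_const)
qed

lemma Ck_dvg: "Ck (Suc k) f ==> Ck k (dvg f)" unfolding dvg_def[abs_def] by (intro Ck_sum Ck_component Ck_pd)

lemma Ck_grad: "Ck (Suc k) f ==> Ck k (grad f)" unfolding grad_def[abs_def] by (intro Ck_vec_lambda Ck_pd)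

lemma test_fun_vanishing_Ck:
 fixes f :: "real^3 => 'b::real_normed_vector"
 assumes "test_fun f" obtains R where "R > 0" "!!x. norm x >= R ==> f x = 0" "!!i x. norm x > R ==> pd i f x = 0"
 using test_fun_vanishes[OF assms] pd_zero_outside[OF test_fun_Ck[OF assms]] by metis

lemma test_fun_dvg: assumes "test_fun \<phi>" shows "test_fun (dvg \<phi>)"
proof -
 obtain R where R: "!!i x. norm x > R ==> pd i \<phi> x = 0" using test_fun_vanishing_Ck[OF assms] by metis
 show ?thesis by (rule test_funI[where R=R], rule Ck_dvg, rule test_fun_Ck, rule assms) (simp add: dvg_def R)
qed

lemma test_fun_grad: assumes "test_fun \<phi>" shows "test_fun (grad \<phi>)"
proof -
 obtain R where R: "!!i x. norm x > R ==> pd i \<phi> x = 0" using test_fun_vanishing_Ck[OF assms] by metis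
 show ?thesis by (rule test_funI[where R=R], rule Ck_grad, rule test_fun_Ck, rule assms) (simp add: grad_def vec_eq_iff R)
qed

lemma test_fun_component: assumes "test_fun \<phi>" shows "test_fun (%x. \<phi> x $ i)"
proof -
 obtain R where R: "!!x. norm x >= R ==> \<phi> x = 0" using test_fun_vanishes[OF assms] by metis
 show ?thesis by (rule test_funI[where R=R], rule Ck_component, rule test_fun_Ck, rule assms) (simp add: R)
qed

lemma test_fun_integrable:
 fixes f :: "'a::euclidean_space => 'b::{banach, second_countable_topology}"
 assumes "test_fun f" shows "integrable lborel f"
proof -
 obtain R where "!!x. norm x >= R ==> f x = 0" using test_fun_vanishes[OF assms] by metis
 then show ?thesis by (rule integrable_continuous_compact_support[OF Ck_continuous[OF test_fun_Ck[OF assms, of 0]]])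
qed

lemma integral_pd_eq_0:
 fixes f :: "real^3 => 'b::{banach, second_countable_topology}"
 assumes "Ck 1 f" "!!x. norm x >= R ==> f x = 0"
 shows "(LBINT x. pd i f x) = 0" unfolding pd_def by (rule integral_directional_derivative_eq_0[OF Ck1_has_derivative[OF assms(1)] _ assms(2)])
   (use pd_continuous[OF assms(1), of i] in "simp_all add: pd_def[abs_def]")

lemma integration_by_parts_compact:
 fixes a :: "real^3 => real" and b :: "real^3 => 'b::{banach, second_countable_topology}"
 assumes a: "Ck 1 a" and b: "Ck 1 b" and R: "(\<forall>x. norm x >= R --> a x = 0) \<or> (\<forall>x. norm x >= R --> b x = 0)"
 shows "integrable lborel (%x. a x *\<^sub>R pd i b x)" (is ?g1) "integrable lborel (%x. pd i a x *\<^sub>R b x)" (is ?g2)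
  and "(LBINT x. a x *\<^sub>R pd i b x) = - (LBINT x. pd i a x *\<^sub>R b x)" (is ?g3)
proof -
 have z: "a x = 0 \<and> pd i a x = 0 \<or> b x = 0 \<and> pd i b x = 0" if "norm x >= R + 1" for x
  using R pd_zero_outside[OF a, of R x i] pd_zero_outside[OF b, of R x i] that by auto
 have c: "continuous_on UNIV a" "continuous_on UNIV b" "continuous_on UNIV (pd i a)" "continuous_on UNIV (pd i b)"
  using a b by (auto intro: Ck_continuous pd_continuous simp del: Ck.simps)
 show i1: ?g1 by (rule integrable_continuous_compact_support[where R="R + 1"], intro continuous_intros c) (use z in fastforce)
 show i2: ?g2 by (rule integrable_continuous_compact_support[where R="R + 1"], intro continuous_intros c) (use z in fastforce)
 have "(LBINT x. a x *\<^sub>R pd i b x + pd i a x *\<^sub>R b x) = 0" unfolding pd_def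
 proof (rule integral_directional_derivative_eq_0[where F="%x. a x *\<^sub>R b x" and R=R])
  show "((%x. a x *\<^sub>R b x) has_derivative
   (%v. a x *\<^sub>R frechet_derivative b (at x) v + frechet_derivative a (at x) v *\<^sub>R b x)) (at x)" for x
   by (rule has_derivative_scaleR[OF Ck1_has_derivative[OF a] Ck1_has_derivative[OF b]])
  show "continuous_on UNIV (%x. a x *\<^sub>R frechet_derivative b (at x) (axis i 1) + frechet_derivative a (at x) (axis i 1) *\<^sub>R b x)"
   using c unfolding pd_def[abs_def] by (intro continuous_intros)
 qed (use R in auto)
 then show ?g3 using i1 i2 by (simp add: add_eq_0_iff)
qed

lemma integration_by_parts:
 fixes a :: "real^3 => real" and b :: "real^3 => 'b::{banach, second_countable_topology}"
 assumes "Ck 1 a" "Ck 1 b" "!!x. norm x >= R ==> b x = 0"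
 shows "integrable lborel (%x. a x *\<^sub>R pd i b x)" "integrable lborel (%x. pd i a x *\<^sub>R b x)"
  and "(LBINT x. a x *\<^sub>R pd i b x) = - (LBINT x. pd i a x *\<^sub>R b x)"
 using integration_by_parts_compact[OF assms(1,2), of R] assms(3) by auto

lemma integration_by_parts_left:
 fixes a :: "real^3 => real" and b :: "real^3 => 'b::{banach, second_countable_topology}"
 assumes "Ck 1 a" "!!x. norm x >= R ==> a x = 0" "Ck 1 b"
 shows "(LBINT x. pd i a x *\<^sub>R b x) = - (LBINT x. a x *\<^sub>R pd i b x)"
 using integration_by_parts_compact(3)[OF assms(1,3), of R i] assms(2) by auto

lemma pd_hart: "rapid g ==> pd i (hart g) x = hart (dirmult (axis i 1) g) x" by (rule pd_eq[OF hart_has_derivative])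

lemma rapid_component: "rapid g ==> rapid (%k. g k $ i)" for g :: "real^3 => real^3" by (rule rapid_bound[where C=1 and j=0])
   (auto simp: cart_eq_inner_axis intro!: borel_measurable_inner rapid_measurable
    intro: order_trans[OF Cauchy_Schwarz_ineq2] simp del: inner_axis)

lemma hart_component: "rapid g ==> hart g x $ i = hart (%k. g k $ i) x" for g :: "real^3 => real^3"
 using hart_bounded_linear[OF bounded_linear_vec_nth[of i] rapid_integrable] by metis

lemma inner_vec3: "x \<bullet> y = (\<Sum>i\<in>UNIV. x $ i * y $ i)" for x y :: "real^3" by (simp add: inner_vec_def)

lemma rapid_lowerdim:
 fixes h :: "real^3 => real^3"
 assumes "rapid h" shows "rapid (%k. k \<bullet> h k)" (is ?g1) "rapid (%k. (k \<bullet> h k) *\<^sub>R k)" (is ?g2)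
proof -
 have [measurable]: "h \<in> borel_measurable borel" using assms by measurable
 show 1: ?g1
 proof (rule rapid_bound[OF assms, where C=1 and j=1])
  fix k
  have "norm k * norm (h k) <= 1 * (1 + norm k) ^ 1 * norm (h k)" by (intro mult_right_mono) auto
  then show "norm (k \<bullet> h k) <= 1 * (1 + norm k) ^ 1 * norm (h k)" using Cauchy_Schwarz_ineq2[of k "h k"] by simp
 qed measurable
 show ?g2 by (rule rapid_bound[OF 1, where C=1 and j=1]) (measurable, auto simp: mult.commute[of _ "norm _"] intro: mult_right_mono)
qed

lemma integral_hart_grad_dvg:
 assumes h: "rapid h" and \<phi>: "test_fun \<phi>"
 shows "(LBINT x. hart h x \<bullet> grad (dvg \<phi>) x) = - (LBINT x. hart (%k. (k \<bullet> h k) *\<^sub>R k) x \<bullet> \<phi> x)"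
proof -
 note ck = rapid_Ck_hart[of _ 1]
 define d where "d k = - (k \<bullet> h (- k))" for k
 have rd: "rapid d" using rapid_reflect[OF rapid_lowerdim(1)[OF h]] by (simp add: d_def[abs_def])
 have rh: "rapid (%k. h k $ i)" for i by (rule rapid_component[OF h])
 have rl: "rapid (%k. (k \<bullet> h k) *\<^sub>R k)" by (rule rapid_lowerdim[OF h])
 obtain R where R: "!!x. norm x >= R ==> \<phi> x = 0" using test_fun_vanishes[OF \<phi>] by metis
 obtain S where S: "!!x. norm x >= S ==> dvg \<phi> x = 0" using test_fun_vanishes[OF test_fun_dvg[OF \<phi>]] by metis
 note P1 = integration_by_parts[OF ck[OF rh] test_fun_Ck[OF test_fun_dvg[OF \<phi>]] S]
 note P2 = integration_by_parts[OF ck[OF rd] Ck_component[OF test_fun_Ck[OF \<phi>]], of R]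
 have dd: "(\<Sum>i\<in>UNIV. hart (dirmult (axis i 1) (%k. h k $ i)) x) = hart d x" for x
 proof -
  have "(\<Sum>i\<in>UNIV. hart (dirmult (axis i 1) (%k. h k $ i)) x) = hart (%k. \<Sum>i\<in>UNIV. dirmult (axis i 1) (%k. h k $ i) k) x"
   unfolding hart_def scaleR_sum_right
   by (rule Bochner_Integration.integral_sum[symmetric]) (rule integrable_cas[OF rapid_integrable[OF rapid_dirmult[OF rh]]])
  also have "(%k. \<Sum>i\<in>UNIV. dirmult (axis i 1) (%k. h k $ i) k) = d"
   by (simp add: fun_eq_iff d_def dirmult_def inner_vec3[of _ "h _"] inner_axis sum_negf)
  finally show ?thesis .
 qed
 have dj: "pd j (hart d) x = - (hart (%k. (k \<bullet> h k) *\<^sub>R k) x $ j)" for j x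
 proof -
  have "pd j (hart d) x = hart (dirmult (axis j 1) d) x" by (rule pd_hart[OF rd])
  also have "dirmult (axis j 1) d = (%k. - 1 *\<^sub>R ((k \<bullet> h k) *\<^sub>R k) $ j)" by (simp add: fun_eq_iff d_def dirmult_def inner_axis)
  also have "hart ... x = - hart (%k. ((k \<bullet> h k) *\<^sub>R k) $ j) x"
   using hart_scaleR[OF rapid_integrable[OF rapid_component[OF rl, of j]], of "- 1" x] by simp
  finally show ?thesis using hart_component[OF rl] by simp
 qed
 have "(LBINT x. hart h x \<bullet> grad (dvg \<phi>) x) = (LBINT x. (\<Sum>i\<in>UNIV. hart (%k. h k $ i) x *\<^sub>R pd i (dvg \<phi>) x))"
  by (simp add: inner_vec3 grad_def hart_component[OF h])
 also have "... = (\<Sum>i\<in>UNIV. - (LBINT x. pd i (hart (%k. h k $ i)) x *\<^sub>R dvg \<phi> x))" using P1 by simp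
 also have "... = - (LBINT x. (\<Sum>i\<in>UNIV. pd i (hart (%k. h k $ i)) x *\<^sub>R dvg \<phi> x))" using P1(2) by (simp add: sum_negf)
 also have "... = - (LBINT x. hart d x * dvg \<phi> x)" unfolding pd_hart[OF rh] dd[symmetric] by (simp add: sum_distrib_right)
 also have "... = - (LBINT x. (\<Sum>j\<in>UNIV. hart d x *\<^sub>R pd j (%x. \<phi> x $ j) x))"
  by (simp add: dvg_def pd_component[OF test_fun_Ck[OF \<phi>]] sum_distrib_left)
 also have "... = (\<Sum>j\<in>UNIV. LBINT x. pd j (hart d) x *\<^sub>R \<phi> x $ j)" using P2 R by (simp add: sum_negf)
 also have "... = (LBINT x. (\<Sum>j\<in>UNIV. pd j (hart d) x *\<^sub>R \<phi> x $ j))" using P2(2) R by simp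
 also have "... = - (LBINT x. hart (%k. (k \<bullet> h k) *\<^sub>R k) x \<bullet> \<phi> x)" by (simp add: dj inner_vec3[of "hart _ _"] sum_negf)
 finally show ?thesis .
qed

section \<open>Newtonian potentials\<close>

text \<open>The singularity at the origin is avoided by writing the kernel as a mixture of Gaussians in \<open>r\<close> and
integrating in space first: this leaves a multiple of \<open>(1 + r^2)\<close> to the power \<open>- 3/2\<close>.\<close>
lemma newton_gaussian_integrable: "integrable lborel (%z. newton z * exp (- (norm z)\<^sup>2))"
proof -
 define f where "f n z = (if z = 0 then 0 else newton_trunc (Suc n) z * exp (- (norm z)\<^sup>2))" for n and z :: "real^3"
 define C where "C = (LBINT r. 1 / (2 * pi * sqrt pi) * (sqrt pi ^ 3 * (1 + r^2) powr (- 2 / 3)))"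
 have iC: "integrable lborel (%r. 1 / (2 * pi * sqrt pi) * (sqrt pi ^ 3 * (1 + r^2) powr (- 2 / 3)))"
  by (intro integrable_mult_right integrable_fraction_power)
 have [measurable]: "f n \<in> borel_measurable borel" for n unfolding f_def[abs_def] by measurable
 have ae: "AE z in lborel. f n z = newton_trunc (Suc n) z * exp (- (norm z)\<^sup>2)" for n
  using AE_lborel_singleton[of 0] by eventually_elim (simp add: f_def)
 have fub: "integrable lborel (%z::real^3. newton_trunc (Suc n) z * exp (- (norm z)\<^sup>2))"
  "(LBINT z. newton_trunc (Suc n) z * exp (- (norm (z::real^3))\<^sup>2)) =
   (LBINT r. 1 / (2 * pi * sqrt pi) * (indicator {1 / real (Suc n)..real (Suc n)} r * (LBINT z. exp (- (norm (z::real^3))\<^sup>2) * exp (- r\<^sup>2 * (norm z)^2))))" for n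
  by (rule newton_trunc_fubini; simp)+
 have g: "(LBINT z. exp (- (norm (z::real^3))\<^sup>2) * exp (- r\<^sup>2 * (norm z)^2)) <= sqrt pi ^ 3 * (1 + r^2) powr (- 2 / 3)" (is ?g1)
  "0 <= (LBINT z. exp (- (norm (z::real^3))\<^sup>2) * exp (- r\<^sup>2 * (norm z)^2))" (is ?g2) for r :: real
 proof -
  have p: "1 + r^2 > 0" by (simp add: add_pos_nonneg)
  have "exp (- (norm (z::real^3))\<^sup>2) * exp (- r\<^sup>2 * (norm z)^2) = exp (- (1 + r^2) * (norm z)^2)" for z :: "real^3"
   by (simp add: exp_add[symmetric] algebra_simps)
  then have "(LBINT z. exp (- (norm (z::real^3))\<^sup>2) * exp (- r\<^sup>2 * (norm z)^2)) = sqrt (pi / (1 + r^2)) ^ 3"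
   using gaussian_fourier(4)[OF p] by simp
  also have "... = sqrt pi ^ 3 * (1 / sqrt (1 + r^2)) ^ 3" by (simp add: real_sqrt_divide power_divide)
  also have "1 / sqrt (1 + r^2) = (1 + r^2) powr (- 1 / 2)" using p by (simp add: powr_half_sqrt powr_minus_divide)
  also have "((1 + r^2) powr (- 1 / 2)) ^ 3 = (1 + r^2) powr (- 3 / 2)" using p powr_powr[of "1 + r^2" "- 1 / 2" 3] by (simp add: powr_numeral)
  also have "sqrt pi ^ 3 * (1 + r^2) powr (- 3 / 2) <= sqrt pi ^ 3 * (1 + r^2) powr (- 2 / 3)" by (intro mult_left_mono powr_mono) auto
  finally show ?g1 .
  show ?g2 by simp
 qed
 show ?thesis
 proof (rule integrable_limit_bounded_integrals(1)[where f=f and C=C])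
  fix n
  show "integrable lborel (f n)" by (rule integrable_cong_AE_imp[OF fub(1)]) (use ae[of n] in auto)
  show "0 <= f n x" for x using newton_trunc_nonneg by (simp add: f_def)
  have "(LBINT z. f n z) = (LBINT z. newton_trunc (Suc n) z * exp (- (norm (z::real^3))\<^sup>2))" by (rule integral_cong_AE) (use ae[of n] in auto)
  also have "... <= C" unfolding fub(2) C_def
  proof (cases "integrable lborel (%r. 1 / (2 * pi * sqrt pi) * (indicator {1 / real (Suc n)..real (Suc n)} r * (LBINT z. exp (- (norm (z::real^3))\<^sup>2) * exp (- r\<^sup>2 * (norm z)^2))))")
   case True
   show "(LBINT r. 1 / (2 * pi * sqrt pi) * (indicator {1 / real (Suc n)..real (Suc n)} r * (LBINT z. exp (- (norm (z::real^3))\<^sup>2) * exp (- r\<^sup>2 * (norm z)^2))))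
    <= (LBINT r. 1 / (2 * pi * sqrt pi) * (sqrt pi ^ 3 * (1 + r^2) powr (- 2 / 3)))"
   proof (rule integral_mono[OF True iC])
    fix r :: real
    have "indicator {1 / real (Suc n)..real (Suc n)} r * (LBINT z. exp (- (norm (z::real^3))\<^sup>2) * exp (- r\<^sup>2 * (norm z)^2))
     <= 1 * (sqrt pi ^ 3 * (1 + r^2) powr (- 2 / 3))" by (intro mult_mono g) (auto simp: indicator_def)
    then show "1 / (2 * pi * sqrt pi) * (indicator {1 / real (Suc n)..real (Suc n)} r * (LBINT z. exp (- (norm (z::real^3))\<^sup>2) * exp (- r\<^sup>2 * (norm z)^2)))
     <= 1 / (2 * pi * sqrt pi) * (sqrt pi ^ 3 * (1 + r^2) powr (- 2 / 3))" by (intro mult_left_mono) auto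
   qed
  next
   case False
   have "0 <= (LBINT r. 1 / (2 * pi * sqrt pi) * (sqrt pi ^ 3 * (1 + r^2) powr (- 2 / 3)))" by (intro integral_nonneg_AE AE_I2) auto
   then show "(LBINT r. 1 / (2 * pi * sqrt pi) * (indicator {1 / real (Suc n)..real (Suc n)} r * (LBINT z. exp (- (norm (z::real^3))\<^sup>2) * exp (- r\<^sup>2 * (norm z)^2))))
    <= (LBINT r. 1 / (2 * pi * sqrt pi) * (sqrt pi ^ 3 * (1 + r^2) powr (- 2 / 3)))" using not_integrable_integral_eq[OF False] by linarith
  qed
  finally show "(LBINT z. f n z) <= C" .
 next
  fix z :: "real^3"
  show "(%n. f n z) \<longlonglongrightarrow> newton z * exp (- (norm z)\<^sup>2)"
  proof (cases "z = 0")
   case False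
   then show ?thesis unfolding f_def by (auto intro!: tendsto_mult LIMSEQ_Suc[OF newton_trunc_tendsto])
  qed (simp add: f_def newton_def)
 qed
qed

lemma newton_nonneg: "0 <= newton z" by (simp add: newton_def)

lemma newton_local_measurable[measurable]: "(%z. indicator (cball 0 \<rho>) z * newton z) \<in> borel_measurable borel"
 by (intro borel_measurable_times borel_measurable_indicator) auto

lemma newton_local_integrable: "integrable lborel (%z. indicator (cball 0 \<rho>) z * newton z)"
proof (rule dominated_integrable[OF integrable_mult_right[OF newton_gaussian_integrable, of "exp (\<rho>^2)"]])
 show "AE z in lborel. norm (indicator (cball 0 \<rho>) z * newton z) <= norm (exp (\<rho>^2) * (newton z * exp (- (norm z)\<^sup>2)))"
 proof (rule AE_I2)
  fix z :: "real^3"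
  show "norm (indicator (cball 0 \<rho>) z * newton z) <= norm (exp (\<rho>^2) * (newton z * exp (- (norm z)\<^sup>2)))"
  proof (cases "norm z <= \<rho>")
   case True
   then have "(norm z)^2 <= \<rho>^2" by (intro power_mono) auto
   then have "1 <= exp (\<rho>^2) * exp (- (norm z)\<^sup>2)" by (simp add: exp_add[symmetric])
   from mult_left_mono[OF this newton_nonneg[of z]] show ?thesis using True newton_nonneg[of z] by (simp add: abs_mult mult_ac)
  qed (use newton_nonneg[of z] in simp)
 qed
qed simp

lemma newton_diff_far:
 assumes "norm y <= \<rho>" "norm x >= 2 * \<rho>" "\<rho> > 0"
 shows "\<bar>newton (x - y) - newton x\<bar> <= \<rho> / (norm x)^2"
proof -
 have xp: "norm x > 0" using assms by linarith
 have xy: "norm (x - y) >= norm x / 2" using norm_triangle_ineq2[of x y] assms by linarith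
 have xy0: "norm (x - y) > 0" using xy xp by linarith
 have "newton (x - y) - newton x = (norm x - norm (x - y)) / (4 * pi * norm x * norm (x - y))" using xp xy0 by (simp add: newton_def field_simps)
 then have "\<bar>newton (x - y) - newton x\<bar> = \<bar>norm x - norm (x - y)\<bar> / (4 * pi * norm x * norm (x - y))"
  using xp xy0 by (simp add: abs_mult)
 also have "... <= \<rho> / (norm x)^2"
 proof (rule frac_le)
  show "\<bar>norm x - norm (x - y)\<bar> <= \<rho>" using norm_triangle_ineq3[of x "x - y"] assms by simp
  have "(norm x)^2 = 2 * (norm x * (norm x / 2))" by (simp add: power2_eq_square)
  also have "... <= (4 * pi) * (norm x * norm (x - y))" using xp xy pi_gt3 by (intro mult_mono) auto
  finally show "(norm x)^2 <= 4 * pi * norm x * norm (x - y)" by (simp add: mult_ac)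
 qed (use assms xp in auto)
 finally show ?thesis .
qed

text \<open>A potential whose density has mean zero decays like \<open>1 / |x|^2\<close>, uniformly over all kernels that
 are dominated by the Newtonian kernel together with their differences.\<close>
lemma potential_decay:
 fixes w :: "real^3 => real^3"
 assumes w: "continuous_on UNIV w" "!!x. norm x >= \<rho> ==> w x = 0" and \<rho>: "\<rho> > 0" and mean: "(LBINT x. w x) = 0"
 shows "\<exists>C\<ge>0. \<forall>K. K \<in> borel_measurable borel --> (\<forall>z. z \<noteq> 0 --> 0 <= K z \<and> K z <= newton z) -->
   (\<forall>y z. y \<noteq> 0 --> z \<noteq> 0 --> \<bar>K y - K z\<bar> <= \<bar>newton y - newton z\<bar>) -->
   (\<forall>x. integrable lborel (%y. K (x - y) *\<^sub>R w y) \<and> norm (LBINT y. K (x - y) *\<^sub>R w y) <= C / (1 + (norm x)^2))"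
proof -
 have [measurable]: "w \<in> borel_measurable borel" using w(1) by (rule borel_measurable_continuous_onI)
 have iw: "integrable lborel w" by (rule integrable_continuous_compact_support[OF w])
 obtain M where M: "M >= 0" "!!x. norm (w x) <= M"
 proof -
  have "compact (w ` cball 0 \<rho>)" by (rule compact_continuous_image) (auto intro: continuous_on_subset[OF w(1)])
  then obtain b where b: "b > 0" "!!y. y \<in> w ` cball 0 \<rho> ==> norm y <= b" using bounded_pos compact_imp_bounded by metis
  have "norm (w x) <= b" for x using b(1) b(2)[of "w x"] w(2)[of x] by (cases "norm x >= \<rho>") auto
  then show thesis using b(1) that[of b] by simp
 qed
 define I where "I = (LBINT z. indicator (cball 0 (3 * \<rho>)) z * newton z)"
 have I0: "I >= 0" unfolding I_def using newton_nonneg by simp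
 define W where "W = (LBINT y. norm (w y))"
 have W0: "W >= 0" unfolding W_def by simp
 define C where "C = M * I * (1 + 4 * \<rho>^2) + \<rho> * W * (1 + 1 / \<rho>^2)"
 show ?thesis
 proof (intro exI[of _ C] conjI allI impI)
  show "C >= 0" unfolding C_def using M I0 W0 \<rho> by simp
  fix K :: "real^3 => real" and x :: "real^3"
  assume [measurable]: "K \<in> borel_measurable borel"
   and K: "\<forall>z. z \<noteq> 0 --> 0 <= K z \<and> K z <= newton z"
   and Kd: "\<forall>y z. y \<noteq> 0 --> z \<noteq> 0 --> \<bar>K y - K z\<bar> <= \<bar>newton y - newton z\<bar>"
  have nx: "AE y in lborel. x - y \<noteq> 0" using AE_lborel_singleton[of x] by eventually_elim auto
  have b: "integrable lborel (%y. M * (indicator (cball 0 r) (x - y) * newton (x - y)))" for r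
   by (intro integrable_mult_right integrable_translate(2)[OF newton_local_integrable])
  have le: "AE y in lborel. norm (K (x - y) *\<^sub>R w y) <= M * (indicator (cball 0 r) (x - y) * newton (x - y))"
   if r: "r >= norm x + \<rho>" for r using nx
  proof eventually_elim
   case (elim y)
   show ?case
   proof (cases "norm y >= \<rho>")
    case True then show ?thesis using w(2) M newton_nonneg by simp
   next
    case False
    then have "norm (x - y) <= r" using norm_triangle_ineq4[of x y] r by linarith
    moreover have "K (x - y) * norm (w y) <= newton (x - y) * M" using K elim M newton_nonneg by (intro mult_mono) auto
    ultimately show ?thesis using K elim by (simp add: mult_ac)
   qed
  qed
  show i: "integrable lborel (%y. K (x - y) *\<^sub>R w y)" by (rule dominated_integrable[OF b[of "norm x + \<rho>"]])
     (simp, use le[OF order_refl] in eventually_elim, auto intro: order_trans[OF _ abs_ge_self])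
  show "norm (LBINT y. K (x - y) *\<^sub>R w y) <= C / (1 + (norm x)^2)"
  proof (cases "norm x >= 2 * \<rho>")
   case False
   have "norm (LBINT y. K (x - y) *\<^sub>R w y) <= (LBINT y. norm (K (x - y) *\<^sub>R w y))" by (rule integral_norm_bound)
   also have "... <= (LBINT y. M * (indicator (cball 0 (3 * \<rho>)) (x - y) * newton (x - y)))"
    by (rule integral_mono_AE[OF integrable_norm[OF i] b le]) (use False in simp)
   also have "... = M * I" using integral_reflect[of "%z. indicator (cball 0 (3 * \<rho>)) z * newton z" x] by (simp add: I_def)
   also have "M * I <= M * I * (1 + 4 * \<rho>^2) / (1 + (norm x)^2)"
   proof -
    have "(norm x)^2 <= (2 * \<rho>)^2" using False by (intro power_mono) auto
    then have "M * I * (1 + (norm x)^2) <= M * I * (1 + 4 * \<rho>^2)" using M I0 by (intro mult_left_mono) (auto simp: power_mult_distrib)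
    then show ?thesis by (subst pos_le_divide_eq) (auto simp: add_pos_nonneg)
   qed
   also have "... <= C / (1 + (norm x)^2)" unfolding C_def using W0 \<rho> by (intro divide_right_mono) auto
   finally show ?thesis .
  next
   case True
   have xp: "norm x > 0" using True \<rho> by linarith
   have "(LBINT y. K (x - y) *\<^sub>R w y) = (LBINT y. (K (x - y) - K x) *\<^sub>R w y)" using i iw mean by (simp add: scaleR_diff_left)
   also have "norm ... <= (LBINT y. \<rho> / (norm x)^2 * norm (w y))"
   proof (rule norm_integral_le)
    fix y
    show "norm ((K (x - y) - K x) *\<^sub>R w y) <= \<rho> / (norm x)^2 * norm (w y)"
    proof (cases "norm y >= \<rho>")
     case True then show ?thesis using w(2) by simp
    next
     case False
     have "norm (x - y) > 0" using norm_triangle_ineq2[of x y] False True \<rho> by linarith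
     then have "\<bar>K (x - y) - K x\<bar> <= \<bar>newton (x - y) - newton x\<bar>" using Kd xp by auto
     also have "... <= \<rho> / (norm x)^2" by (rule newton_diff_far) (use False True \<rho> in auto)
     finally have "\<bar>K (x - y) - K x\<bar> <= \<rho> / (norm x)^2" .
     from mult_right_mono[OF this norm_ge_zero[of "w y"]] show ?thesis by simp
    qed
   qed (use iw in auto)
   also have "... = \<rho> * W * (1 / (norm x)^2)" by (simp add: W_def)
   also have "... <= \<rho> * W * ((1 + 1 / \<rho>^2) / (1 + (norm x)^2))"
   proof (rule mult_left_mono)
    have "\<rho>^2 <= (norm x)^2" using True \<rho> by (intro power_mono) auto
    then have "1 / (norm x)^2 <= 1 / \<rho>^2" using \<rho> by (intro frac_le) auto
    then have "1 / (norm x)^2 * (1 + (norm x)^2) <= 1 + 1 / \<rho>^2" using xp by (simp add: distrib_left)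
    moreover have "1 + (norm x)^2 > 0" by (simp add: add_pos_nonneg)
    ultimately show "1 / (norm x)^2 <= (1 + 1 / \<rho>^2) / (1 + (norm x)^2)" by (simp only: pos_le_divide_eq)
   qed (use \<rho> W0 in auto)
   also have "... <= C / (1 + (norm x)^2)" unfolding C_def using M I0 by (simp add: divide_right_mono)
   finally show ?thesis .
  qed
 qed
qed

section \<open>The Leray projection\<close>

lemma integral_lebesgue_lborel:
 fixes f :: "'a::euclidean_space => 'b::{banach, second_countable_topology}"
 shows "f \<in> borel_measurable borel ==> (LINT x|lebesgue. f x) = (LBINT x. f x)" by (rule integral_completion) simp

lemma integrable_lebesgue_lborel:
 fixes f :: "'a::euclidean_space => 'b::{banach, second_countable_topology}"
 shows "f \<in> borel_measurable borel ==> integrable lebesgue f \<longleftrightarrow> integrable lborel f" by (rule integrable_completion) simp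

text \<open>The multiplier of \<open>\<nabla> (1/\<Delta>) div\<close>: the component of \<open>v\<close> along \<open>k\<close>. At \<open>k = 0\<close> its value is zero by the
convention for division.\<close>
definition gradm :: "real^3 => real^3 => real^3" where
 "gradm k v = ((k \<bullet> v) / (k \<bullet> k)) *\<^sub>R k"

lemma norm_gradm: "norm (gradm k v) <= norm v"
proof (cases "k = 0")
 case False
 then have k: "norm k > 0" by simp
 have "\<bar>k \<bullet> v\<bar> * norm k <= (norm k * norm v) * norm k" by (intro mult_right_mono Cauchy_Schwarz_ineq2) simp
 then show ?thesis using k by (simp add: gradm_def dot_square_norm abs_mult divide_le_eq power2_eq_square mult_ac)
qed (simp add: gradm_def)

lemma gradm_measurable[measurable]:
 assumes [measurable]: "f \<in> borel_measurable borel"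
 shows "(%k. gradm k (f k)) \<in> borel_measurable borel" unfolding gradm_def by measurable

lemma rapid_gradm: "rapid f ==> rapid (%k. gradm k (f k))"
 by (rule rapid_bound[where C=1 and j=0]) (auto simp: norm_gradm rapid_measurable gradm_measurable)

lemma square_integrable_product:
 fixes f g :: "real^3 => real^3"
 assumes [measurable]: "f \<in> borel_measurable borel" "g \<in> borel_measurable borel"
  and i: "integrable lborel (%x. (norm (f x))^2)" "integrable lborel (%x. (norm (g x))^2)"
 shows "integrable lborel (%x. f x \<bullet> g x)"
proof -
 have le: "norm (f x) * norm (g x) <= (norm (f x))^2 + (norm (g x))^2" for x
  using sum_squares_bound[of "norm (f x)" "norm (g x)"] mult_nonneg_nonneg[OF norm_ge_zero[of "f x"] norm_ge_zero[of "g x"]]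
  by linarith
 show ?thesis by (rule dominated_integrable[OF Bochner_Integration.integrable_add[OF i]])
   (use le in "auto intro!: AE_I2 order_trans[OF Cauchy_Schwarz_ineq2]")
qed

lemma rapid_newton_trunc_hat:
 assumes f: "rapid f" and n: "n > 0"
 shows "rapid (%k. newton_trunc_hat n k *\<^sub>R f k)"
proof (rule rapid_bound[OF f, where C="LBINT z. newton_trunc n z" and j=0])
 have [measurable]: "f \<in> borel_measurable borel" using f by measurable
 show "(%k. newton_trunc_hat n k *\<^sub>R f k) \<in> borel_measurable borel" by measurable
 show "norm (newton_trunc_hat n k *\<^sub>R f k) <= (LBINT z. newton_trunc n z) * (1 + norm k) ^ 0 * norm (f k)" for k
  using newton_trunc_hat_bound[OF n, of k] by (simp add: mult_right_mono)
qed

lemma newton_trunc_hart: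
 fixes f :: "real^3 => real^3"
 assumes f: "rapid f" and n: "n > 0"
 shows "(LBINT x. newton_trunc n (x - y) *\<^sub>R hart f x) = hart (%k. newton_trunc_hat n k *\<^sub>R f k) y"
proof -
 have [measurable]: "f \<in> borel_measurable borel" using f by measurable
 have it: "integrable lborel (%x. 2 * newton_trunc n (x - y))" using integrable_translate(1)[OF newton_trunc_integrable[OF n], of "- y"] by simp
 have meas: "(%(x, k). (newton_trunc n (x - y) * cas (k \<bullet> x)) *\<^sub>R f k) \<in> borel_measurable (borel \<Otimes>\<^sub>M borel)"
  by measurable
 have le: "norm ((newton_trunc n (x - y) * cas (k \<bullet> x)) *\<^sub>R f k) <= (2 * newton_trunc n (x - y)) * norm (f k)" for x k
  using mult_right_mono[OF mult_left_mono[OF abs_cas_le[of "k \<bullet> x"] newton_trunc_nonneg[of n "x - y"]] norm_ge_zero[of "f k"]]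
   newton_trunc_nonneg[of n "x - y"] by (simp add: abs_mult mult_ac)
 note F = fubini_product_bound[OF meas it rapid_integrable_norm[OF f] le]
 have "(LBINT x. newton_trunc n (x - y) *\<^sub>R hart f x)
   = (LBINT x. (LBINT k. (newton_trunc n (x - y) * cas (k \<bullet> x)) *\<^sub>R f k))"
  unfolding hart_def scaleR_scaleR[symmetric] integral_scaleR_right ..
 also have "... = (LBINT k. (LBINT x. (newton_trunc n (x - y) * cas (k \<bullet> x)) *\<^sub>R f k))" by (rule F(1))
 also have "... = (LBINT k. cas (k \<bullet> y) *\<^sub>R newton_trunc_hat n k *\<^sub>R f k)"
 proof (intro Bochner_Integration.integral_cong refl)
  fix k
  have "integrable lborel (%x. newton_trunc n (x - y) * cas (k \<bullet> x))" by (rule dominated_integrable[OF it])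
     (use abs_cas_le newton_trunc_nonneg in "auto intro!: AE_I2 mult_mono simp: abs_mult mult.commute[of 2]")
  then have "(LBINT x. (newton_trunc n (x - y) * cas (k \<bullet> x)) *\<^sub>R f k) = (newton_trunc_hat n k * cas (k \<bullet> y)) *\<^sub>R f k"
   by (simp add: newton_trunc_cas[OF n])
  then show "(LBINT x. (newton_trunc n (x - y) * cas (k \<bullet> x)) *\<^sub>R f k) = cas (k \<bullet> y) *\<^sub>R newton_trunc_hat n k *\<^sub>R f k"
   by (simp add: mult.commute)
 qed
 finally show ?thesis by (simp add: hart_def)
qed

text \<open>The truncated kernels are integrable, so Fubini's theorem applies and convolution becomes
multiplication of the density; evenness of the kernel moves it to the other factor.\<close>
lemma newton_trunc_adjoint:
 fixes f w :: "real^3 => real^3"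
 assumes f: "rapid f" and n: "n > 0" and w: "continuous_on UNIV w" "integrable lborel w"
 shows "(LBINT x. hart f x \<bullet> (LBINT y. newton_trunc n (x - y) *\<^sub>R w y))
  = (LBINT y. hart (%k. newton_trunc_hat n k *\<^sub>R f k) y \<bullet> w y)"
proof -
 have [measurable]: "w \<in> borel_measurable borel" "hart f \<in> borel_measurable borel" using hart_measurable[OF f] w(2) by auto
 define B where "B = 2 * (LBINT k. norm (f k))"
 have B: "norm (hart f x) <= B" for x unfolding B_def by (rule norm_hart_le[OF rapid_integrable[OF f]])
 have iN: "integrable lborel (newton_trunc n)" by (rule newton_trunc_integrable[OF n])
 have iNs: "integrable lborel (%x. newton_trunc n (x - y))" for y using integrable_translate(1)[OF iN, of "- y"] by simp
 have iNf: "integrable lborel (%x. newton_trunc n (x - y) *\<^sub>R hart f x)" for y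
  by (rule dominated_integrable[OF integrable_mult_left[OF iNs[of y], of B]])
    (use B newton_trunc_nonneg in "auto intro!: AE_I2 mult_left_mono order_trans[OF _ abs_ge_self]")
 have "integrable (lborel \<Otimes>\<^sub>M lborel) (%(y, x). newton_trunc n (x - y) * (hart f x \<bullet> w y))"
 proof (rule lborel_pair.Fubini_integrable)
  show m: "(%(y, x). newton_trunc n (x - y) * (hart f x \<bullet> w y)) \<in> borel_measurable (lborel \<Otimes>\<^sub>M lborel)" by measurable
  show "AE y in lborel. integrable lborel (%x. case (y, x) of (y, x) => newton_trunc n (x - y) * (hart f x \<bullet> w y))"
  proof (rule AE_I2)
   fix y
   have "integrable lborel (%x. (newton_trunc n (x - y) *\<^sub>R hart f x) \<bullet> w y)" by (rule integrable_inner_left) (use iNf in simp)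
   then show "integrable lborel (%x. case (y, x) of (y, x) => newton_trunc n (x - y) * (hart f x \<bullet> w y))" by simp
  qed
  show "integrable lborel (%y. LBINT x. norm (case (y, x) of (y, x) => newton_trunc n (x - y) * (hart f x \<bullet> w y)))"
  proof (rule dominated_integrable[OF integrable_mult_right[OF integrable_norm[OF w(2)], of "B * (LBINT x. newton_trunc n x)"]])
   have mn: "(%(y, x). norm (newton_trunc n (x - y) * (hart f x \<bullet> w y))) \<in> borel_measurable (borel \<Otimes>\<^sub>M lborel)" by measurable
   show "(%y. LBINT x. norm (case (y, x) of (y, x) => newton_trunc n (x - y) * (hart f x \<bullet> w y))) \<in> borel_measurable lborel"
    using lborel.borel_measurable_lebesgue_integral[OF mn] by simp
   show "AE y in lborel. norm (LBINT x. norm (case (y, x) of (y, x) => newton_trunc n (x - y) * (hart f x \<bullet> w y)))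
    <= norm (B * (LBINT x. newton_trunc n x) * norm (w y))"
   proof (rule AE_I2)
    fix y
    have "norm (LBINT x. norm (newton_trunc n (x - y) * (hart f x \<bullet> w y))) <= (LBINT x. newton_trunc n (x - y) * (B * norm (w y)))"
    proof (rule norm_integral_le)
     fix x
     have "\<bar>hart f x \<bullet> w y\<bar> <= B * norm (w y)"
      using Cauchy_Schwarz_ineq2[of "hart f x" "w y"] mult_right_mono[OF B[of x] norm_ge_zero[of "w y"]] by linarith
     then show "norm (norm (newton_trunc n (x - y) * (hart f x \<bullet> w y))) <= newton_trunc n (x - y) * (B * norm (w y))"
      using newton_trunc_nonneg[of n "x - y"] by (simp add: abs_mult mult_left_mono)
    qed (use iNs in simp)
    also have "... = (LBINT x. newton_trunc n x) * (B * norm (w y))" using integral_translate[of "newton_trunc n" "- y"] by simp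
    finally show "norm (LBINT x. norm (case (y, x) of (y, x) => newton_trunc n (x - y) * (hart f x \<bullet> w y)))
     <= norm (B * (LBINT x. newton_trunc n x) * norm (w y))" by (simp add: mult_ac)
   qed
  qed
 qed
 note Fub = lborel_pair.Fubini_integral[OF this]
 have iNw: "integrable lborel (%y. newton_trunc n (x - y) *\<^sub>R w y)" for x
 proof -
  obtain M where "!!z. newton_trunc n z <= M"
  proof
   fix z :: "real^3"
   show "newton_trunc n z <= newton_trunc n 0" unfolding newton_trunc_def
    by (rule integral_mono[OF trunc_integrand_integrable[OF n] trunc_integrand_integrable[OF n]])
      (auto intro!: divide_right_mono simp: indicator_def)
  qed
  then show ?thesis by (intro dominated_integrable[OF integrable_mult_right[OF integrable_norm[OF w(2)], of M]])
     (use newton_trunc_nonneg in "auto intro!: AE_I2 mult_right_mono order_trans[OF _ abs_ge_self]")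
 qed
 have "(LBINT x. hart f x \<bullet> (LBINT y. newton_trunc n (x - y) *\<^sub>R w y))
   = (LBINT x. (LBINT y. newton_trunc n (x - y) * (hart f x \<bullet> w y)))"
 proof (intro Bochner_Integration.integral_cong refl)
  fix x
  have "hart f x \<bullet> (LBINT y. newton_trunc n (x - y) *\<^sub>R w y) = (LBINT y. hart f x \<bullet> (newton_trunc n (x - y) *\<^sub>R w y))"
   by (rule integral_inner_right[symmetric]) (use iNw in simp)
  then show "hart f x \<bullet> (LBINT y. newton_trunc n (x - y) *\<^sub>R w y) = (LBINT y. newton_trunc n (x - y) * (hart f x \<bullet> w y))" by simp
 qed
 also have "... = (LBINT y. (LBINT x. newton_trunc n (x - y) * (hart f x \<bullet> w y)))" using Fub by simp
 also have "... = (LBINT y. (LBINT x. newton_trunc n (x - y) *\<^sub>R hart f x) \<bullet> w y)"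
 proof (intro Bochner_Integration.integral_cong refl)
  fix y
  have "(LBINT x. newton_trunc n (x - y) *\<^sub>R hart f x) \<bullet> w y = (LBINT x. (newton_trunc n (x - y) *\<^sub>R hart f x) \<bullet> w y)"
   by (rule integral_inner_left[symmetric]) (use iNf in simp)
  then show "(LBINT x. newton_trunc n (x - y) * (hart f x \<bullet> w y)) = (LBINT x. newton_trunc n (x - y) *\<^sub>R hart f x) \<bullet> w y" by simp
 qed
 finally show ?thesis by (simp add: newton_trunc_hart[OF f n])
qed

lemma inv_neg_laplacian_eq:
 assumes "g \<in> borel_measurable borel"
 shows "inv_neg_laplacian g x = (LBINT y. newton (x - y) *\<^sub>R g y)"
 unfolding inv_neg_laplacian_def newton_def using assms by (intro integral_lebesgue_lborel) measurable

text \<open>On fields given by a Hartley density the projection \<open>leray_P\<close>, transposed, is the Fourier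
 multiplier that removes the component along \<open>k\<close>. Both sides are computed for the truncated
 Newtonian kernels, for which all integrals may be interchanged.\<close>
lemma leray_P_adjoint:
 assumes f: "rapid f" and \<phi>: "test_fun \<phi>"
 shows "integrable lborel (%x. hart f x \<bullet> leray_P \<phi> x)" (is ?g1)
  and "(LBINT x. hart f x \<bullet> leray_P \<phi> x) = (LBINT x. hart (%k. f k - gradm k (f k)) x \<bullet> \<phi> x)" (is ?g2)
  and "leray_P \<phi> \<in> borel_measurable borel" (is ?g3)
proof -
 define w where "w = grad (dvg \<phi>)"
 have tw: "test_fun w" unfolding w_def by (intro test_fun_grad test_fun_dvg \<phi>)
 have cw: "continuous_on UNIV w" by (rule Ck_continuous[OF test_fun_Ck[OF tw, of 0]])
 have iw: "integrable lborel w" by (rule test_fun_integrable[OF tw])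
 have c\<phi>: "continuous_on UNIV \<phi>" by (rule Ck_continuous[OF test_fun_Ck[OF \<phi>, of 0]])
 have i\<phi>: "integrable lborel \<phi>" by (rule test_fun_integrable[OF \<phi>])
 have [measurable]: "w \<in> borel_measurable borel" "\<phi> \<in> borel_measurable borel" "hart f \<in> borel_measurable borel"
  "f \<in> borel_measurable borel" using hart_measurable[OF f] iw i\<phi> f rapid_measurable by auto
 obtain \<rho> where \<rho>: "\<rho> > 0" "!!x. norm x >= \<rho> ==> w x = 0" using test_fun_vanishes[OF tw] by metis
 obtain S where S: "!!x. norm x >= S ==> dvg \<phi> x = 0" using test_fun_vanishes[OF test_fun_dvg[OF \<phi>]] by metis
 \<comment> \<open>The vanishing mean makes the potential decay like \<open>1 / |x|^2\<close>, hence square integrable, as \<open>hart f\<close> is.\<close>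
 have mean: "(LBINT x. w x) = 0"
 proof -
  have "(LBINT x. w x) $ i = 0" for i
  proof -
   have "(LBINT x. w x) $ i = (LBINT x. w x $ i)" using integral_bounded_linear[OF bounded_linear_vec_nth iw] by simp
   also have "... = (LBINT x. pd i (dvg \<phi>) x)" by (simp add: w_def grad_def)
   also have "... = 0" by (rule integral_pd_eq_0[OF test_fun_Ck[OF test_fun_dvg[OF \<phi>]] S])
   finally show ?thesis .
  qed
  then show ?thesis by (simp add: vec_eq_iff)
 qed
 define V where "V x = (LBINT y. newton (x - y) *\<^sub>R w y)" for x
 define Vn where "Vn n x = (LBINT y. newton_trunc (Suc n) (x - y) *\<^sub>R w y)" for n x
 have [measurable]: "V \<in> borel_measurable borel" "Vn n \<in> borel_measurable borel" for n
  unfolding V_def[abs_def] Vn_def[abs_def] by (rule lborel.borel_measurable_lebesgue_integral; measurable)+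
 have P: "leray_P \<phi> x = \<phi> x + V x" for x unfolding leray_P_def V_def w_def[symmetric] by (subst inv_neg_laplacian_eq) auto
 show ?g3 unfolding P[abs_def] by measurable
 obtain C where C: "C >= 0" and decay: "!!K x. K \<in> borel_measurable borel ==> (!!z. z \<noteq> 0 ==> 0 <= K z \<and> K z <= newton z) ==>
   (!!y z. y \<noteq> 0 ==> z \<noteq> 0 ==> \<bar>K y - K z\<bar> <= \<bar>newton y - newton z\<bar>) ==>
   integrable lborel (%y. K (x - y) *\<^sub>R w y) \<and> norm (LBINT y. K (x - y) *\<^sub>R w y) <= C / (1 + (norm x)^2)"
  using potential_decay[OF cw \<rho>(2,1) mean] by blast
 have dV: "integrable lborel (%y. newton (x - y) *\<^sub>R w y) \<and> norm (V x) <= C / (1 + (norm x)^2)" for x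
  unfolding V_def by (rule decay) (auto simp: newton_nonneg)
 have dVn: "norm (Vn n x) <= C / (1 + (norm x)^2)" for n x unfolding Vn_def
  by (rule conjunct2[OF decay]) (auto simp: newton_trunc_nonneg newton_trunc_le newton_trunc_diff_le)
 have limV: "(%n. Vn n x) \<longlonglongrightarrow> V x" for x unfolding V_def Vn_def
 proof (rule integral_dominated_convergence[where w="%y. norm (newton (x - y) *\<^sub>R w y)"])
  have nx: "AE y in lborel. x - y \<noteq> 0" using AE_lborel_singleton[of x] by eventually_elim auto
  show "AE y in lborel. (%n. newton_trunc (Suc n) (x - y) *\<^sub>R w y) \<longlonglongrightarrow> newton (x - y) *\<^sub>R w y"
   using nx by eventually_elim (intro tendsto_intros LIMSEQ_Suc[OF newton_trunc_tendsto])
  show "AE y in lborel. norm (newton_trunc (Suc n) (x - y) *\<^sub>R w y) <= norm (newton (x - y) *\<^sub>R w y)" for n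
   using nx by eventually_elim
    (auto intro!: mult_right_mono newton_trunc_le simp: newton_trunc_nonneg newton_nonneg)
  show "integrable lborel (%y. norm (newton (x - y) *\<^sub>R w y))" using dV by (intro integrable_norm) auto
 qed auto
 define D where "D x = C / (1 + (norm x)^2)" for x :: "real^3"
 have D0: "D x >= 0" for x using C by (simp add: D_def add_nonneg_nonneg)
 have [measurable]: "D \<in> borel_measurable borel" unfolding D_def[abs_def] by measurable
 have ifD: "integrable lborel (%x. norm (hart f x) * D x)"
 proof (rule dominated_integrable[OF Bochner_Integration.integrable_add[OF hart_square_integrable(1)[OF f] integrable_mult_right[OF integrable_inverse_quartic, of "C^2"]]])
  show "AE x in lborel. norm (norm (hart f x) * D x) <= norm ((norm (hart f x))^2 + C^2 * (1 / (1 + (norm x)^2)^2))"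
  proof (rule AE_I2)
   fix x
   have "norm (hart f x) * D x <= (norm (hart f x))^2 + (D x)^2"
    using sum_squares_bound[of "norm (hart f x)" "D x"] mult_nonneg_nonneg[OF norm_ge_zero[of "hart f x"] D0[of x]] by linarith
   then show "norm (norm (hart f x) * D x) <= norm ((norm (hart f x))^2 + C^2 * (1 / (1 + (norm x)^2)^2))"
    using D0[of x] C by (simp add: D_def power_divide abs_mult)
  qed
 qed simp
 have iV: "integrable lborel (%x. hart f x \<bullet> V x)"
 proof (rule dominated_integrable[OF ifD])
  show "AE x in lborel. norm (hart f x \<bullet> V x) <= norm (norm (hart f x) * D x)"
   using dV[folded D_def] D0 by (auto intro!: AE_I2 order_trans[OF Cauchy_Schwarz_ineq2] mult_left_mono simp: abs_mult)
 qed simp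
 have i\<phi>f: "integrable lborel (%x. hart g x \<bullet> \<phi> x)" if "rapid g" for g :: "real^3 => real^3"
 proof -
  obtain r where "!!x. norm x >= r ==> \<phi> x = 0" using test_fun_vanishes[OF \<phi>] by metis
  then show ?thesis by (intro integrable_continuous_compact_support[where R=r] continuous_intros hart_continuous that c\<phi>) auto
 qed
 show ?g1 unfolding P inner_add_right using iV i\<phi>f[OF f] by simp
 have lim1: "(%n. LBINT x. hart f x \<bullet> Vn n x) \<longlonglongrightarrow> (LBINT x. hart f x \<bullet> V x)"
 proof (rule integral_dominated_convergence[OF _ _ ifD])
  show "AE x in lborel. (%n. hart f x \<bullet> Vn n x) \<longlonglongrightarrow> hart f x \<bullet> V x" using limV by (intro AE_I2 tendsto_intros)
  show "AE x in lborel. norm (hart f x \<bullet> Vn n x) <= norm (hart f x) * D x" for n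
   using dVn[folded D_def] by (auto intro!: AE_I2 order_trans[OF Cauchy_Schwarz_ineq2] mult_left_mono)
 qed auto
 define \<theta> where "\<theta> n k = exp (- (norm k)\<^sup>2 / (4 * (real (Suc n))^2)) - exp (- (norm k)\<^sup>2 / (4 * (1 / real (Suc n))^2))" for n and k :: "real^3"
 have [measurable]: "\<theta> n \<in> borel_measurable borel" for n unfolding \<theta>_def[abs_def] by measurable
 have \<theta>b: "\<bar>\<theta> n k\<bar> <= 1" for n k
 proof -
  have "exp (- (norm k)\<^sup>2 / (4 * (real (Suc n))^2)) <= 1" "exp (- (norm k)\<^sup>2 / (4 * (1 / real (Suc n))^2)) <= 1"
   by (simp_all add: divide_nonpos_nonneg)
  then show ?thesis unfolding \<theta>_def by (smt (verit) exp_gt_zero)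
 qed
 define q where "q k = gradm k (f k)" for k
 have rq: "rapid q" unfolding q_def[abs_def] by (rule rapid_gradm[OF f])
 have [measurable]: "q \<in> borel_measurable borel" using rq rapid_measurable by auto
 have r\<theta>: "rapid (%k. \<theta> n k *\<^sub>R q k)" for n
  by (rule rapid_bound[OF rq, where C=1 and j=0]) (measurable, use \<theta>b in "auto intro: mult_left_le_one_le")
 \<comment> \<open>For the truncated kernel the multiplier is \<open>\<theta> n\<close> times the desired one, and \<open>\<theta> n\<close> tends to \<open>1\<close>.\<close>
 have trunc_term: "(LBINT x. hart f x \<bullet> Vn n x) = - (LBINT x. hart (%k. \<theta> n k *\<^sub>R q k) x \<bullet> \<phi> x)" for n
 proof -
  have "(LBINT x. hart f x \<bullet> Vn n x) = (LBINT y. hart (%k. newton_trunc_hat (Suc n) k *\<^sub>R f k) y \<bullet> grad (dvg \<phi>) y)"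
   unfolding Vn_def using newton_trunc_adjoint[OF f _ cw iw, of "Suc n"] by (simp add: w_def)
  also have "... = - (LBINT x. hart (%k. (k \<bullet> (newton_trunc_hat (Suc n) k *\<^sub>R f k)) *\<^sub>R k) x \<bullet> \<phi> x)"
   by (rule integral_hart_grad_dvg[OF rapid_newton_trunc_hat[OF f] \<phi>]) simp
  also have "(%k. (k \<bullet> (newton_trunc_hat (Suc n) k *\<^sub>R f k)) *\<^sub>R k) = (%k. \<theta> n k *\<^sub>R q k)"
  proof
   fix k
   show "(k \<bullet> (newton_trunc_hat (Suc n) k *\<^sub>R f k)) *\<^sub>R k = \<theta> n k *\<^sub>R q k"
   proof -
    have "\<theta> n k = (k \<bullet> k) * newton_trunc_hat (Suc n) k"
     using newton_trunc_hat_sq[of "Suc n" k] by (simp only: \<theta>_def dot_square_norm zero_less_Suc True_implies_equals)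
    then show ?thesis by (cases "k = 0") (simp_all add: q_def gradm_def)
   qed
  qed
  finally show ?thesis .
 qed
 have lim2: "(%n. LBINT x. hart (%k. \<theta> n k *\<^sub>R q k) x \<bullet> \<phi> x) \<longlonglongrightarrow> (LBINT x. hart q x \<bullet> \<phi> x)"
 proof (rule integral_dominated_convergence[where w="%x. 2 * (LBINT k. norm (q k)) * norm (\<phi> x)"])
  show "integrable lborel (%x. 2 * (LBINT k. norm (q k)) * norm (\<phi> x))" using i\<phi> by simp
  show "AE x in lborel. norm (hart (%k. \<theta> n k *\<^sub>R q k) x \<bullet> \<phi> x) <= 2 * (LBINT k. norm (q k)) * norm (\<phi> x)" for n
  proof (rule AE_I2)
   fix x
   have "(LBINT k. norm (\<theta> n k *\<^sub>R q k)) <= (LBINT k. norm (q k))"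
    using rapid_integrable_norm[OF rq] rapid_integrable_norm[OF r\<theta>] \<theta>b by (intro integral_mono) (auto intro: mult_left_le_one_le)
   then have hb: "norm (hart (%k. \<theta> n k *\<^sub>R q k) x) <= 2 * (LBINT k. norm (q k))"
    using norm_hart_le[OF rapid_integrable[OF r\<theta>], of n x] by linarith
   show "norm (hart (%k. \<theta> n k *\<^sub>R q k) x \<bullet> \<phi> x) <= 2 * (LBINT k. norm (q k)) * norm (\<phi> x)"
    using Cauchy_Schwarz_ineq2[of "hart (%k. \<theta> n k *\<^sub>R q k) x" "\<phi> x"] mult_right_mono[OF hb norm_ge_zero[of "\<phi> x"]] by simp
  qed
  have "(%n. hart (%k. \<theta> n k *\<^sub>R q k) x) \<longlonglongrightarrow> hart q x" for x unfolding hart_def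
  proof (rule integral_dominated_convergence[where w="%k. 2 * norm (q k)"])
   show "integrable lborel (%k. 2 * norm (q k))" using rapid_integrable_norm[OF rq] by simp
   show "AE k in lborel. norm (cas (k \<bullet> x) *\<^sub>R \<theta> n k *\<^sub>R q k) <= 2 * norm (q k)" for n
    using mult_mono[OF abs_cas_le \<theta>b] by (auto intro!: AE_I2 mult_right_mono simp: mult.assoc[symmetric] abs_mult)
   show "AE k in lborel. (%n. cas (k \<bullet> x) *\<^sub>R \<theta> n k *\<^sub>R q k) \<longlonglongrightarrow> cas (k \<bullet> x) *\<^sub>R q k"
   proof (rule AE_mp[OF AE_lborel_singleton[of 0]], rule AE_I2, rule impI)
    fix k :: "real^3" assume "k \<noteq> 0"
    then have k: "norm k > 0" by simp
    have "(%n. \<theta> n k) \<longlonglongrightarrow> 1" unfolding \<theta>_def using k by real_asymp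
    then have "(%n. cas (k \<bullet> x) *\<^sub>R \<theta> n k *\<^sub>R q k) \<longlonglongrightarrow> cas (k \<bullet> x) *\<^sub>R 1 *\<^sub>R q k" by (intro tendsto_intros)
    then show "(%n. cas (k \<bullet> x) *\<^sub>R \<theta> n k *\<^sub>R q k) \<longlonglongrightarrow> cas (k \<bullet> x) *\<^sub>R q k" by simp
   qed
  qed measurable
  then show "AE x in lborel. (%n. hart (%k. \<theta> n k *\<^sub>R q k) x \<bullet> \<phi> x) \<longlonglongrightarrow> hart q x \<bullet> \<phi> x"
   by (intro AE_I2 tendsto_intros)
 qed (use hart_measurable[OF rq] hart_measurable[OF r\<theta>] in auto)
 have "(LBINT x. hart f x \<bullet> V x) = - (LBINT x. hart q x \<bullet> \<phi> x)"
  using LIMSEQ_unique[OF lim1[unfolded trunc_term] tendsto_minus[OF lim2]] .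
 then show ?g2 unfolding P inner_add_right hart_diff[OF rapid_integrable[OF f] rapid_integrable[OF rq[unfolded q_def[abs_def]]]]
   inner_diff_left using iV i\<phi>f[OF f] i\<phi>f[OF rq] by (simp add: q_def[abs_def])
qed

section \<open>Locally integrable functions are determined by test functions\<close>

lemma loc_integrable_measurable:
 fixes f :: "real^3 => 'b::{banach, second_countable_topology}"
 assumes "loc_integrable f" shows "f \<in> borel_measurable lebesgue"
proof (rule borel_measurable_LIMSEQ_metric)
 show "(%x. indicator (cball 0 (real n)) x *\<^sub>R f x) \<in> borel_measurable lebesgue" for n
  using assms unfolding loc_integrable_def set_integrable_def by (metis borel_measurable_integrable compact_cball)
 fix x :: "real^3"
 show "(%n. indicator (cball 0 (real n)) x *\<^sub>R f x) \<longlonglongrightarrow> f x"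
 proof (rule tendsto_eventually)
  have "\<forall>\<^sub>F n in sequentially. norm x <= real n" using filterlim_real_sequentially by (auto simp: filterlim_at_top)
  then show "\<forall>\<^sub>F n in sequentially. indicator (cball 0 (real n)) x *\<^sub>R f x = f x" by eventually_elim simp
 qed
qed

lemma loc_integrable_mult_compact_support:
 fixes f :: "real^3 => 'b::{banach, second_countable_topology}" and \<phi> :: "real^3 => 'c::{banach, second_countable_topology}"
  and h :: "'c => 'b => 'd::{banach, second_countable_topology}"
 assumes f: "loc_integrable f" and \<phi>: "continuous_on UNIV \<phi>" "!!x. norm x >= R ==> \<phi> x = 0"
  and h: "!!a b. norm (h a b) <= norm a * norm b" "(%x. h (\<phi> x) (f x)) \<in> borel_measurable lebesgue"
 shows "integrable lebesgue (%x. h (\<phi> x) (f x))"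
proof -
 have "compact (\<phi> ` cball 0 R)" by (rule compact_continuous_image) (auto intro: continuous_on_subset[OF \<phi>(1)])
 then obtain b where b: "b > 0" "!!y. y \<in> \<phi> ` cball 0 R ==> norm y <= b" using bounded_pos compact_imp_bounded by metis
 have i: "integrable lebesgue (%x. indicator (cball 0 R) x *\<^sub>R f x)" using f unfolding loc_integrable_def set_integrable_def by simp
 show ?thesis
 proof (rule dominated_integrable[OF integrable_scaleR_right[OF i, of b] h(2)], rule AE_I2)
  fix x
  show "norm (h (\<phi> x) (f x)) <= norm (b *\<^sub>R indicator (cball 0 R) x *\<^sub>R f x)"
  proof (cases "norm x <= R")
   case True
   then have "norm (\<phi> x) * norm (f x) <= b * norm (f x)" using b(2) by (intro mult_right_mono) auto
   then show ?thesis using True b(1) h(1)[of "\<phi> x" "f x"] by simp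
  next
   case False
   then have "norm (h (\<phi> x) (f x)) <= 0" using h(1)[of "\<phi> x" "f x"] \<phi>(2)[of x] by simp
   then show ?thesis using False by simp
  qed
 qed
qed

lemma continuous_lebesgue_measurable:
 fixes f :: "real^3 => 'b::{banach, second_countable_topology}"
 shows "continuous_on UNIV f ==> f \<in> borel_measurable lebesgue" by (intro measurable_completion) (simp add: borel_measurable_continuous_onI)

lemma loc_integrable_continuous:
 fixes f :: "real^3 => 'b::{banach, second_countable_topology}"
 assumes "continuous_on UNIV f" shows "loc_integrable f" unfolding loc_integrable_def set_integrable_def
proof (intro allI impI)
 fix K :: "(real^3) set" assume K: "compact K"
 have "integrable lborel (%x. indicator K x *\<^sub>R f x)" by (rule borel_integrable_compact[OF K continuous_on_subset[OF assms]]) simp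
 then show "integrable lebesgue (%x. indicator K x *\<^sub>R f x)" by (subst integrable_lebesgue_lborel) auto
qed

lemma loc_integrable_test_scaleR:
 fixes f :: "real^3 => 'b::{banach, second_countable_topology}" and \<phi> :: "real^3 => real"
 assumes "loc_integrable f" "test_fun \<phi>" shows "integrable lebesgue (%x. \<phi> x *\<^sub>R f x)"
proof -
 have c: "continuous_on UNIV \<phi>" by (rule Ck_continuous[OF test_fun_Ck[OF assms(2), of 0]])
 obtain R where "!!x. norm x >= R ==> \<phi> x = 0" using test_fun_vanishes[OF assms(2)] by metis
 then show ?thesis using loc_integrable_measurable[OF assms(1)] continuous_lebesgue_measurable[OF c]
  by (intro loc_integrable_mult_compact_support[OF assms(1) c, where h="%a b. a *\<^sub>R b"]) auto
qed

lemma loc_integrable_test_inner: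
 fixes f \<phi> :: vfield
 assumes "loc_integrable f" "test_fun \<phi>" shows "integrable lebesgue (%x. f x \<bullet> \<phi> x)"
proof -
 have c: "continuous_on UNIV \<phi>" by (rule Ck_continuous[OF test_fun_Ck[OF assms(2), of 0]])
 obtain R where "!!x. norm x >= R ==> \<phi> x = 0" using test_fun_vanishes[OF assms(2)] by metis
 then show ?thesis using loc_integrable_measurable[OF assms(1)] continuous_lebesgue_measurable[OF c]
  by (intro loc_integrable_mult_compact_support[OF assms(1) c, where h="%a b. b \<bullet> a"])
    (auto simp: inner_commute intro: order_trans[OF Cauchy_Schwarz_ineq2])
qed

lemma loc_integrable_component:
 fixes f :: vfield
 assumes "loc_integrable f" shows "loc_integrable (%x. f x $ i)" unfolding loc_integrable_def set_integrable_def
proof (intro allI impI)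
 fix K :: "(real^3) set" assume "compact K"
 then have "integrable lebesgue (%x. indicator K x *\<^sub>R f x)" using assms unfolding loc_integrable_def set_integrable_def by simp
 from integrable_bounded_linear[OF bounded_linear_vec_nth[of i] this]
 show "integrable lebesgue (%x. indicator K x *\<^sub>R f x $ i)" by simp
qed

lemma loc_integrable_diff: "loc_integrable f ==> loc_integrable g ==> loc_integrable (%x. f x - g x)"
 for f :: "real^3 => 'b::{banach, second_countable_topology}" unfolding loc_integrable_def set_integrable_def by (simp add: scaleR_diff_right)

text \<open>Products of the flat functions exhaust the indicator function of a box.\<close>
definition box_bump :: "nat => real^3 => real^3 => real^3 => real" where
 "box_bump n a b x = (\<Prod>i\<in>Basis. flat 1 (real n * (x \<bullet> i - a \<bullet> i)) * flat 1 (real n * (b \<bullet> i - x \<bullet> i)))"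

lemma box_bump_bounds: "0 <= box_bump n a b x" (is ?g1) "box_bump n a b x <= indicator (box a b) x" (is ?g2)
proof -
 have f: "0 <= flat 1 s * flat 1 t" "flat 1 s * flat 1 t <= 1" for s t
  using flat_one_bounds[of s] flat_one_bounds[of t] mult_mono[of "flat 1 s" 1 "flat 1 t" 1] by auto
 show ?g1 unfolding box_bump_def by (intro prod_nonneg f)
 show ?g2
 proof (cases "x \<in> box a b")
  case True
  then show ?thesis unfolding box_bump_def using f prod_le_1[of Basis "%i. flat 1 (real n * (x \<bullet> i - a \<bullet> i)) * flat 1 (real n * (b \<bullet> i - x \<bullet> i))"] by simp
 next
  case False
  then obtain i where i: "i \<in> Basis" "x \<bullet> i <= a \<bullet> i \<or> b \<bullet> i <= x \<bullet> i" by (auto simp: mem_box not_less)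
  then have "flat 1 (real n * (x \<bullet> i - a \<bullet> i)) * flat 1 (real n * (b \<bullet> i - x \<bullet> i)) = 0"
   by (auto simp: flat_def zero_less_mult_iff)
  then have "box_bump n a b x = 0" unfolding box_bump_def using i(1) by (intro prod_zero bexI[of _ i]) auto
  then show ?thesis by simp
 qed
qed

lemma test_fun_box_bump: "test_fun (box_bump n a b)"
proof -
 have "bounded (box a b)" by simp
 then obtain R where R: "!!x. x \<in> box a b ==> norm x <= R" unfolding bounded_iff by blast
 show ?thesis
 proof (rule test_funI[where R=R])
  have 1: "bounded_linear (%x::real^3. real n * (x \<bullet> i))" "bounded_linear (%x::real^3. - (real n * (x \<bullet> i)))" for i
   by (intro bounded_linear_const_mult bounded_linear_inner_left bounded_linear_minus)+
  have "Ck k (%x::real^3. real n * (x \<bullet> i) + - (real n * (a \<bullet> i)))" "Ck k (%x::real^3. - (real n * (x \<bullet> i)) + real n * (b \<bullet> i))" for i k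
   by (intro Ck_add Ck_const Ck_linear 1)+
  then have c: "Ck k (%x::real^3. real n * (x \<bullet> i - a \<bullet> i))" "Ck k (%x::real^3. real n * (b \<bullet> i - x \<bullet> i))" for i k
   by (simp_all add: algebra_simps)
  show "Ck k (box_bump n a b)" for k unfolding box_bump_def[abs_def] by (rule Ck_prod, rule Ck_mult, rule Ck_flat, rule c, rule Ck_flat, rule c)
  fix x :: "real^3" assume "norm x > R"
  then have "x \<notin> box a b" using R by force
  then show "box_bump n a b x = 0" using box_bump_bounds[of n a b x] by simp
 qed
qed

lemma box_bump_tendsto: "(%n. box_bump n a b x) \<longlonglongrightarrow> indicator (box a b) x"
proof (cases "x \<in> box a b")
 case False
 then have "box_bump n a b x = 0" for n using box_bump_bounds[of n a b x] by (intro antisym) auto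
 then show ?thesis using False by simp
next
 case True
 have f: "(%n. flat 1 (real n * s)) \<longlonglongrightarrow> 1" if "s > 0" for s
 proof -
  have "(%n. exp (- (1 / s * (1 / real n)))) \<longlonglongrightarrow> exp (- (1 / s * 0))" by (intro tendsto_intros lim_const_over_n)
  then have "(%n. exp (- (1 / s * (1 / real n)))) \<longlonglongrightarrow> 1" by simp
  moreover have "\<forall>\<^sub>F n in sequentially. exp (- (1 / s * (1 / real n))) = flat 1 (real n * s)"
   using eventually_gt_at_top[of 0] by eventually_elim (use that in "simp add: flat_def mult.commute")
  ultimately show ?thesis by (rule Lim_transform_eventually)
 qed
 have "(%n. box_bump n a b x) \<longlonglongrightarrow> (\<Prod>i\<in>(Basis::(real^3) set). 1 * 1)"
  unfolding box_bump_def by (intro tendsto_prod tendsto_mult f) (use True in "auto simp: mem_box")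
 then show ?thesis using True by simp
qed

text \<open>The box bumps increase to indicator functions, so the integral over every box vanishes. A signed
density with this property is zero because boxes generate the Borel sets.\<close>
lemma loc_integrable_eq_0:
 fixes f :: "real^3 => real"
 assumes f: "loc_integrable f" and z: "!!\<phi> :: real^3 => real. test_fun \<phi> ==> (LINT x|lebesgue. \<phi> x *\<^sub>R f x) = 0"
 shows "AE x in lebesgue. f x = 0"
proof -
 obtain g where g[measurable]: "g \<in> borel_measurable lborel" and fg: "AE x in lborel. f x = g x"
  using completion_ex_borel_measurable_real[OF loc_integrable_measurable[OF f]] by blast
 have fgl: "AE x in lebesgue. f x = g x" using fg by (rule AE_completion)
 have gm[measurable]: "g \<in> borel_measurable borel" using g by simp
 have iK: "integrable lborel (%x. indicator (cbox a b) x * g x)" for a b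
 proof -
  have "integrable lebesgue (%x. indicator (cbox a b) x *\<^sub>R f x)" using f unfolding loc_integrable_def set_integrable_def by simp
  then have "integrable lebesgue (%x. indicator (cbox a b) x * g x)"
  proof (rule integrable_cong_AE_imp)
   show "(%x. indicator (cbox a b) x * g x) \<in> borel_measurable lebesgue" by (intro measurable_completion) auto
  qed (use fgl in auto)
  then show ?thesis by (subst (asm) integrable_lebesgue_lborel) auto
 qed
 have i: "integrable lborel (%x. indicator (box a b) x * g x)" for a b by (rule dominated_integrable[OF iK[of a b]])
    (auto simp: abs_mult indicator_def box_subset_cbox[THEN subsetD] intro!: AE_I2)
 have zero: "(LBINT x. indicator (box a b) x * g x) = 0" for a b
 proof -
  have "(%n. LBINT x. box_bump n a b x * g x) \<longlonglongrightarrow> (LBINT x. indicator (box a b) x * g x)"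
  proof (rule integral_dominated_convergence[where w="%x. \<bar>indicator (box a b) x * g x\<bar>"])
   show "integrable lborel (%x. \<bar>indicator (box a b) x * g x\<bar>)" using i by simp
   show "AE x in lborel. (%n. box_bump n a b x * g x) \<longlonglongrightarrow> indicator (box a b) x * g x"
    by (intro AE_I2 tendsto_intros box_bump_tendsto)
   show "AE x in lborel. norm (box_bump n a b x * g x) <= \<bar>indicator (box a b) x * g x\<bar>" for n
    using box_bump_bounds[of n a b] by (auto intro!: AE_I2 mult_right_mono simp: abs_mult)
   have "continuous_on UNIV (box_bump n a b)" for n by (rule Ck_continuous[OF test_fun_Ck[OF test_fun_box_bump, of 0]])
   then show "(%x. box_bump n a b x * g x) \<in> borel_measurable lborel" for n
    using gm by (simp add: borel_measurable_continuous_onI borel_measurable_times)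
  qed auto
  moreover have "(LBINT x. box_bump n a b x * g x) = 0" for n
  proof -
   have "continuous_on UNIV (box_bump n a b)" by (rule Ck_continuous[OF test_fun_Ck[OF test_fun_box_bump, of 0]])
   then have m: "box_bump n a b \<in> borel_measurable borel" by (rule borel_measurable_continuous_onI)
   have "(LBINT x. box_bump n a b x * g x) = (LINT x|lebesgue. box_bump n a b x * g x)" using m by (intro integral_lebesgue_lborel[symmetric]) auto
   also have "... = (LINT x|lebesgue. box_bump n a b x *\<^sub>R f x)"
   proof (rule integral_cong_AE)
    show "(%x. box_bump n a b x * g x) \<in> borel_measurable lebesgue" using m by (intro measurable_completion) auto
    show "(%x. box_bump n a b x *\<^sub>R f x) \<in> borel_measurable lebesgue"
     by (rule borel_measurable_scaleR[OF continuous_lebesgue_measurable loc_integrable_measurable[OF f]]) fact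
   qed (use fgl in auto)
   finally show ?thesis using z[OF test_fun_box_bump] by simp
  qed
  ultimately show ?thesis by (simp add: LIMSEQ_const_iff)
 qed
 define p where "p x = max 0 (g x)" for x
 define q where "q x = max 0 (- g x)" for x
 have [measurable]: "p \<in> borel_measurable borel" "q \<in> borel_measurable borel" by (simp_all add: p_def[abs_def] q_def[abs_def])
 have ip: "integrable lborel (%x. indicator (box a b) x * p x)" "integrable lborel (%x. indicator (box a b) x * q x)" for a b
  by (rule dominated_integrable[OF i[of a b]]; auto simp: p_def q_def indicator_def intro!: AE_I2)+
 have pq: "(LBINT x. indicator (box a b) x * p x) = (LBINT x. indicator (box a b) x * q x)" for a b
 proof -
  have "(LBINT x. indicator (box a b) x * p x) - (LBINT x. indicator (box a b) x * q x)
   = (LBINT x. indicator (box a b) x * p x - indicator (box a b) x * q x)" by (rule Bochner_Integration.integral_diff[symmetric, OF ip])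
  also have "... = (LBINT x. indicator (box a b) x * g x)" by (intro Bochner_Integration.integral_cong refl) (auto simp: p_def q_def indicator_def)
  finally show ?thesis using zero by simp
 qed
 have em: "emeasure (density lborel (%x. ennreal (h x))) (box a b) = ennreal (LBINT x. indicator (box a b) x * h x)"
  if "h \<in> borel_measurable borel" "!!x. h x >= 0" "integrable lborel (%x. indicator (box a b) x * h x)" for h a b
 proof -
  have "emeasure (density lborel (%x. ennreal (h x))) (box a b) = (\<integral>\<^sup>+x. ennreal (indicator (box a b) x * h x) \<partial>lborel)"
   using that by (subst emeasure_density) (auto intro!: nn_integral_cong simp: indicator_def)
  also have "... = ennreal (LBINT x. indicator (box a b) x * h x)" by (rule nn_integral_eq_integral) (use that in auto)
  finally show ?thesis .
 qed
 have "density lborel (%x. ennreal (p x)) = density lborel (%x. ennreal (q x))"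
 proof (rule measure_eqI_generator_eq)
  let ?E = "range (%(a, b). box a b::(real^3) set)"
  show "Int_stable ?E" by (auto simp: Int_stable_def box_Int_box)
  show "?E \<subseteq> Pow UNIV" "sets (density lborel (%x. ennreal (p x))) = sigma_sets UNIV ?E"
   "sets (density lborel (%x. ennreal (q x))) = sigma_sets UNIV ?E" by (simp_all add: borel_eq_box)
  let ?A = "%n::nat. box (- (real n *\<^sub>R One)) (real n *\<^sub>R One) :: (real^3) set"
  show "range ?A \<subseteq> ?E" "(\<Union>i. ?A i) = UNIV" unfolding UN_box_eq_UNIV by auto
  show "emeasure (density lborel (%x. ennreal (p x))) (?A i) \<noteq> \<infinity>" for i by (subst em) (use ip in "auto simp: p_def")
  fix X assume "X \<in> ?E"
  then obtain a b where X: "X = box a b" by auto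
  show "emeasure (density lborel (%x. ennreal (p x))) X = emeasure (density lborel (%x. ennreal (q x))) X"
   unfolding X by (subst (1 2) em) (use ip pq in "auto simp: p_def q_def")
 qed
 then have "AE x in lborel. ennreal (p x) = ennreal (q x)" by (rule sigma_finite_measure.density_unique[OF sigma_finite_lborel, rotated 2]) auto
 then have "AE x in lborel. f x = 0" using fg by eventually_elim (auto simp: p_def q_def max_def split: if_splits)
 then show ?thesis by (rule AE_completion)
qed

lemma Ck_scaleR_const: "Ck k \<phi> ==> Ck k (%x. \<phi> x *\<^sub>R v)" for \<phi> :: "'a::euclidean_space => real" by (intro Ck_scaleR Ck_const)

lemma test_fun_scaleR_const:
 fixes \<phi> :: "real^3 => real" and v :: "real^3"
 assumes "test_fun \<phi>" shows "test_fun (%x. \<phi> x *\<^sub>R v)"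
proof -
 obtain R where R: "!!x. norm x >= R ==> \<phi> x = 0" using test_fun_vanishes[OF assms] by metis
 show ?thesis by (rule test_funI[where R=R], rule Ck_scaleR_const, rule test_fun_Ck, rule assms) (simp add: R)
qed

lemma pairing_determines:
 fixes f g :: vfield
 assumes f: "loc_integrable f" and g: "loc_integrable g"
  and eq: "!!\<phi>. test_fun \<phi> ==> pairing f \<phi> = pairing g \<phi>"
 shows "AE x in lebesgue. f x = g x"
proof -
 have "AE x in lebesgue. (f x - g x) $ i = 0" for i
 proof (rule loc_integrable_eq_0)
  show "loc_integrable (%x. (f x - g x) $ i)" by (intro loc_integrable_component loc_integrable_diff f g)
  fix \<phi> :: "real^3 => real" assume t: "test_fun \<phi>"
  have tv: "test_fun (%x. \<phi> x *\<^sub>R (axis i 1 :: real^3))" by (rule test_fun_scaleR_const[OF t])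
  have "(LINT x|lebesgue. \<phi> x *\<^sub>R (f x - g x) $ i) = (LINT x|lebesgue. f x \<bullet> (\<phi> x *\<^sub>R axis i 1) - g x \<bullet> (\<phi> x *\<^sub>R axis i 1))"
   by (intro Bochner_Integration.integral_cong refl) (simp add: inner_axis algebra_simps)
  also have "... = pairing f (%x. \<phi> x *\<^sub>R axis i 1) - pairing g (%x. \<phi> x *\<^sub>R axis i 1)" unfolding pairing_def
   by (rule Bochner_Integration.integral_diff[OF loc_integrable_test_inner[OF f tv] loc_integrable_test_inner[OF g tv]])
  finally show "(LINT x|lebesgue. \<phi> x *\<^sub>R (f x - g x) $ i) = 0" using eq[OF tv] by simp
 qed
 then have "AE x in lebesgue. \<forall>i. (f x - g x) $ i = 0" by (simp add: AE_all_countable)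
 then show ?thesis by eventually_elim (simp add: vec_eq_iff)
qed

section \<open>Weak and classical derivatives\<close>

definition jac :: "vfield => real^3 => real^3^3" where
 "jac f x = jacobian f (at x)"

lemma column_jac: "column i (jac f x) = pd i f x" by (simp add: jac_def jacobian_def column_def matrix_def pd_def)

lemma jac_mult:
 assumes "Ck 1 f" shows "jac f x *v v = frechet_derivative f (at x) v"
proof -
 have "linear (frechet_derivative f (at x))" using Ck1_has_derivative[OF assms] has_derivative_linear by blast
 then show ?thesis unfolding jac_def jacobian_def by (simp add: fun_eq_iff[symmetric] matrix_works)
qed

lemma norm_matrix_le:
 fixes A :: "real^3^3"
 assumes "!!i. norm (column i A) <= C" shows "norm A <= 9 * C"
proof -
 have e: "\<bar>A $ j $ i\<bar> <= C" for i j using component_le_norm_cart[of "column i A" j] assms[of i] by (simp add: column_def)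
 have "norm A <= (\<Sum>j\<in>UNIV. norm (A $ j))" unfolding norm_vec_def[of A] by (rule L2_set_le_sum) simp
 also have "... <= (\<Sum>j\<in>(UNIV::3 set). 3 * C)"
 proof (rule sum_mono)
  fix j
  have "norm (A $ j) <= (\<Sum>i\<in>UNIV. \<bar>A $ j $ i\<bar>)" by (rule norm_le_l1_cart)
  also have "... <= (\<Sum>i\<in>(UNIV::3 set). C)" by (intro sum_mono e)
  finally show "norm (A $ j) <= 3 * C" by simp
 qed
 finally show ?thesis by simp
qed

lemma jac_continuous: "Ck 1 f ==> continuous_on UNIV (jac f)"
proof -
 assume "Ck 1 f"
 have eq: "jac f = (%x. \<chi> j i. pd i f x $ j)" by (simp add: fun_eq_iff vec_eq_iff column_jac[symmetric]) (simp add: column_def)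
 show ?thesis unfolding eq using pd_continuous[OF \<open>Ck 1 f\<close>] by (intro continuous_on_vec_lambda continuous_on_component)
qed

lemma has_weak_jac_classical:
 assumes f: "Ck 1 f" shows "has_weak_jac f (jac f)" unfolding has_weak_jac_def weak_pd_def column_jac
proof (intro allI conjI impI)
 show "loc_integrable f" by (rule loc_integrable_continuous[OF Ck_continuous[OF f]])
 show "loc_integrable (pd i f)" for i by (rule loc_integrable_continuous[OF pd_continuous[OF f]])
 fix i :: 3 and \<phi> :: "real^3 => real" assume t: "test_fun \<phi>"
 obtain R where R: "!!x. norm x >= R ==> \<phi> x = 0" using test_fun_vanishes[OF t] by metis
 note t1 = test_fun_Ck[OF t, of 1]
 have m: "f \<in> borel_measurable borel" "pd i f \<in> borel_measurable borel" "\<phi> \<in> borel_measurable borel" "pd i \<phi> \<in> borel_measurable borel"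
  by (rule borel_measurable_continuous_onI[OF Ck_continuous[OF f]], rule borel_measurable_continuous_onI[OF pd_continuous[OF f]],
    rule borel_measurable_continuous_onI[OF Ck_continuous[OF t1]], rule borel_measurable_continuous_onI[OF pd_continuous[OF t1]])
 show "(LINT x|lebesgue. pd i \<phi> x *\<^sub>R f x) = - (LINT x|lebesgue. \<phi> x *\<^sub>R pd i f x)"
  using integration_by_parts_left[OF t1 R f, where i=i] m by (simp add: integral_lebesgue_lborel)
qed

lemma has_weak_jac_unique:
 assumes J: "has_weak_jac f J" "has_weak_jac f J'"
 shows "AE x in lebesgue. J x = J' x"
proof -
 have "AE x in lebesgue. column i (J x) = column i (J' x)" for i
 proof (rule pairing_determines)
  have w: "weak_pd i f (%x. column i (J x))" "weak_pd i f (%x. column i (J' x))" using J by (auto simp: has_weak_jac_def)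
  then show l: "loc_integrable (%x. column i (J x))" "loc_integrable (%x. column i (J' x))" by (auto simp: weak_pd_def)
  fix \<phi> :: vfield assume t: "test_fun \<phi>"
  have eq: "(LINT x|lebesgue. (\<phi> x $ j) *\<^sub>R column i (J x)) = (LINT x|lebesgue. (\<phi> x $ j) *\<^sub>R column i (J' x))" for j
  proof -
   have "- (LINT x|lebesgue. (\<phi> x $ j) *\<^sub>R column i (J x)) = - (LINT x|lebesgue. (\<phi> x $ j) *\<^sub>R column i (J' x))"
    using w[unfolded weak_pd_def] test_fun_component[OF t, of j] by simp
   then show ?thesis by simp
  qed
  have *: "pairing h \<phi> = (\<Sum>j\<in>UNIV. (LINT x|lebesgue. (\<phi> x $ j) *\<^sub>R h x) $ j)" if h: "loc_integrable h" for h :: vfield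
  proof -
   note ij = loc_integrable_test_scaleR[OF h test_fun_component[OF t]]
   have "pairing h \<phi> = (LINT x|lebesgue. (\<Sum>j\<in>UNIV. ((\<phi> x $ j) *\<^sub>R h x) $ j))"
    unfolding pairing_def by (simp add: inner_vec3 mult.commute)
   also have "... = (\<Sum>j\<in>UNIV. (LINT x|lebesgue. ((\<phi> x $ j) *\<^sub>R h x) $ j))"
    by (rule Bochner_Integration.integral_sum) (rule integrable_bounded_linear[OF bounded_linear_vec_nth ij])
   also have "... = (\<Sum>j\<in>UNIV. (LINT x|lebesgue. (\<phi> x $ j) *\<^sub>R h x) $ j)"
    by (intro sum.cong refl integral_bounded_linear[OF bounded_linear_vec_nth ij])
   finally show ?thesis .
  qed
  show "pairing (%x. column i (J x)) \<phi> = pairing (%x. column i (J' x)) \<phi>" unfolding *[OF l(1)] *[OF l(2)] eq ..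
 qed
 then have "AE x in lebesgue. \<forall>i. column i (J x) = column i (J' x)" by (simp add: AE_all_countable)
 then show ?thesis by eventually_elim (simp add: column_def vec_eq_iff)
qed

text \<open>The weak Jacobian is chosen by a choice operator, so it is identified with the classical one only
through uniqueness almost everywhere.\<close>
lemma weak_jac_classical:
 assumes "Ck 1 f" shows "AE x in lebesgue. weak_jac f x = jac f x"
proof -
 have "has_weak_jac f (weak_jac f)" unfolding weak_jac_def by (rule someI[of "has_weak_jac f", OF has_weak_jac_classical[OF assms]])
 then show ?thesis by (rule has_weak_jac_unique[OF _ has_weak_jac_classical[OF assms]])
qed

lemma weak_jac_measurable:
 assumes "Ck 1 f" shows "weak_jac f \<in> borel_measurable lebesgue"
proof -
 have "has_weak_jac f (weak_jac f)" unfolding weak_jac_def by (rule someI[of "has_weak_jac f", OF has_weak_jac_classical[OF assms]])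
 then have m: "(%x. column i (weak_jac f x)) \<in> borel_measurable lebesgue" for i
  by (intro loc_integrable_measurable) (auto simp: has_weak_jac_def weak_pd_def)
 have "(%x. weak_jac f x $ j $ i) \<in> borel_measurable lebesgue" for i j
 proof -
  have "(%x. column i (weak_jac f x) \<bullet> axis j 1) \<in> borel_measurable lebesgue" using m by (intro borel_measurable_inner) auto
  then show ?thesis by (simp add: inner_axis column_def)
 qed
 then show ?thesis by (subst borel_measurable_euclidean_space) (auto simp: Basis_vec_def inner_axis)
qed

lemma advect_classical:
 assumes "Ck 1 f" shows "AE x in lebesgue. advect f x = frechet_derivative f (at x) (f x)" using weak_jac_classical[OF assms] unfolding advect_def
 by eventually_elim (simp add: jac_mult[OF assms])

section \<open>Norms\<close>

lemma Linf_norm_le: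
 fixes f :: "real^3 => 'b::real_normed_vector"
 assumes m: "f \<in> borel_measurable lebesgue" and C: "C >= 0" and le: "AE x in lebesgue. norm (f x) <= C"
 shows "Linf_norm f <= C" (is ?g1) "ess_bounded f"
proof -
 have e: "esssup lebesgue (%x. ereal (norm (f x))) <= ereal C" using m le by (intro esssup_I) auto
 then show ?g1 unfolding Linf_norm_def using C by (cases "esssup lebesgue (%x. ereal (norm (f x)))") auto
 show "ess_bounded f" unfolding ess_bounded_def using m e by (auto intro: le_less_trans)
qed

lemma Linf_norm_nonneg: "0 <= Linf_norm (f :: real^3 => 'b::real_normed_vector)"
proof (rule ccontr)
 assume "\<not> 0 <= Linf_norm f"
 then have n: "esssup lebesgue (%x. ereal (norm (f x))) < 0" unfolding Linf_norm_def by (cases "esssup lebesgue (%x. ereal (norm (f x)))") auto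
 have "AE x in (lebesgue :: (real^3) measure). False"
 proof (rule AE_mp[OF esssup_AE[of "%x. ereal (norm (f x))" lebesgue]], rule AE_I2, rule impI)
  fix x assume "ereal (norm (f x)) <= esssup lebesgue (%x. ereal (norm (f x)))"
  then have "ereal (norm (f x)) < 0" using n by (rule le_less_trans)
  then show False by simp
 qed
 then have "(UNIV :: (real^3) set) \<in> null_sets lebesgue" by (subst AE_iff_null_sets) auto
 then have "negligible (UNIV :: (real^3) set)" by (simp add: negligible_iff_null_sets)
 then show False by simp
qed

text \<open>For a continuous function the essential supremum bounds every value: a larger value would persist on
an open set.\<close>
lemma norm_le_Linf_norm:
 fixes f :: "real^3 => 'b::real_normed_vector"
 assumes c: "continuous_on UNIV f" and b: "ess_bounded f"
 shows "norm (f x0) <= Linf_norm f"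
proof (rule ccontr)
 assume n: "\<not> norm (f x0) <= Linf_norm f"
 let ?U = "{x. Linf_norm f < norm (f x)}"
 have U: "open ?U" by (rule open_Collect_less) (auto intro!: continuous_intros c)
 have "x0 \<in> ?U" using n by simp
 then have "\<not> negligible ?U" using open_not_negligible[OF U] by blast
 moreover have "AE x in lebesgue. x \<notin> ?U"
 proof -
  have "esssup lebesgue (%x. ereal (norm (f x))) < \<infinity>" using b by (simp add: ess_bounded_def)
  then have "\<not> ereal (norm (f x)) <= esssup lebesgue (%x. ereal (norm (f x)))" if "x \<in> ?U" for x using that unfolding Linf_norm_def
   by (cases "esssup lebesgue (%x. ereal (norm (f x)))") auto
  note imp = this
  show ?thesis
  proof (rule AE_mp[OF esssup_AE[of "%x. ereal (norm (f x))" lebesgue]], rule AE_I2, rule impI)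
   fix x assume "ereal (norm (f x)) <= esssup lebesgue (%x. ereal (norm (f x)))"
   then show "x \<notin> ?U" using imp by blast
  qed
 qed
 then have "?U \<in> null_sets lebesgue" using U by (subst AE_iff_null_sets) (auto intro: borel_open)
 ultimately show False by (simp add: negligible_iff_null_sets)
qed

lemma C1_norms:
 fixes f :: vfield
 assumes f: "Ck 1 f" and A: "!!x. norm (f x) <= A" and B: "!!i x. norm (pd i f x) <= B"
 shows "f \<in> C1b" "f \<in> W1inf" "W1inf_norm f <= A + 9 * B" (is ?g3) "!!x. norm (f x) <= W1inf_norm f"
proof -
 have A0: "A >= 0" using A[of 0] norm_ge_zero order_trans by blast
 have B0: "B >= 0" using B[of undefined 0] norm_ge_zero order_trans by blast
 have j: "norm (jac f x) <= 9 * B" for x by (rule norm_matrix_le) (simp add: column_jac B)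
 show "f \<in> C1b" unfolding C1b_def using f A j by (auto simp: bounded_iff jac_def simp del: Ck.simps)
 have fm: "f \<in> borel_measurable lebesgue" by (rule continuous_lebesgue_measurable[OF Ck_continuous[OF f]])
 have jm: "jac f \<in> borel_measurable lebesgue" by (rule continuous_lebesgue_measurable[OF jac_continuous[OF f]])
 have fb: "Linf_norm f <= A" "ess_bounded f" by (rule Linf_norm_le[OF fm A0]; use A in simp)+
 have jb: "ess_bounded (jac f)" by (rule Linf_norm_le(2)[OF jm, of "9 * B"]) (use B0 j in simp_all)
 have wb: "AE x in lebesgue. norm (weak_jac f x) <= 9 * B" using weak_jac_classical[OF f] by eventually_elim (simp add: j)
 have wn: "Linf_norm (weak_jac f) <= 9 * B" by (rule Linf_norm_le(1)[OF weak_jac_measurable[OF f] _ wb]) (use B0 in simp)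
 show "f \<in> W1inf" unfolding W1inf_def using fb(2) jb has_weak_jac_classical[OF f] by blast
 show ?g3 unfolding W1inf_norm_def using fb(1) wn by linarith
 show "norm (f x) <= W1inf_norm f" for x using norm_le_Linf_norm[OF Ck_continuous[OF f] fb(2), of x] Linf_norm_nonneg[of "weak_jac f"]
  unfolding W1inf_norm_def by linarith
qed

section \<open>Exponentially decaying densities\<close>

text \<open>The factor \<open>norm k\<close> keeps the multiplier \<open>gradm\<close>, discontinuous at the origin, harmless, and the
exponential absorbs every polynomial weight.\<close>
definition edens :: "real => (real^3 => 'b::euclidean_space) => bool" where
 "edens C g \<longleftrightarrow> 0 <= C \<and> g \<in> borel_measurable borel \<and> (\<forall>k. norm (g k) <= C * (norm k * exp (- norm k)))"

lemma edens_measurable: "edens C g ==> g \<in> borel_measurable borel" by (simp add: edens_def)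

lemma edens_bound: "edens C g ==> norm (g k) <= C * (norm k * exp (- norm k))" by (simp add: edens_def)

lemma edens_mono: "edens C g ==> C <= D ==> edens D g"
 unfolding edens_def by (meson mult_nonneg_nonneg exp_ge_zero mult_right_mono norm_ge_zero order_trans)

lemma power_le_fact_exp: "x >= 0 ==> x ^ n <= fact n * exp x" for x :: real
proof -
 assume x: "x >= 0"
 have s: "(%n. x ^ n /\<^sub>R fact n) sums exp x" by (rule exp_converges)
 have "(\<Sum>i\<in>{n}. x ^ i /\<^sub>R fact i) <= (\<Sum>i. x ^ i /\<^sub>R fact i)" using s x by (intro sum_le_suminf) (auto simp: sums_iff)
 then have "x ^ n / fact n <= exp x" using s by (simp add: sums_iff divide_inverse mult.commute)
 then show ?thesis by (simp add: divide_le_eq mult.commute)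
qed

lemma edens_rapid:
 fixes g :: "real^3 => 'b::euclidean_space"
 assumes "edens C g" shows "rapid g" unfolding rapid_def
proof (intro conjI allI)
 show "g \<in> borel_measurable borel" using assms by (rule edens_measurable)
 fix m
 have C: "C >= 0" using assms by (simp add: edens_def)
 have "norm (g k) * (1 + norm k) ^ m <= C * (fact (m + 1) * exp 1)" for k
 proof -
  have "norm (g k) * (1 + norm k) ^ m <= C * (norm k * exp (- norm k)) * (1 + norm k) ^ m" by (intro mult_right_mono edens_bound[OF assms]) simp
  also have "... <= C * ((1 + norm k) * exp (- norm k)) * (1 + norm k) ^ m" using C by (intro mult_right_mono mult_left_mono) auto
  also have "... = C * (exp (- norm k) * (1 + norm k) ^ (m + 1))" by simp
  also have "... <= C * (exp (- norm k) * (fact (m + 1) * exp (1 + norm k)))" using C by (intro mult_left_mono power_le_fact_exp) auto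
  also have "... = C * (fact (m + 1) * exp 1)" by (simp add: exp_add exp_minus)
  finally show ?thesis .
 qed
 then show "\<exists>C. \<forall>k. norm (g k) * (1 + norm k) ^ m <= C" by blast
qed

definition eweight :: "real^3 => real" where "eweight k = norm k * exp (- norm k)"

lemma eweight_nonneg: "0 <= eweight k" by (simp add: eweight_def)

lemma eweight_rapid: "rapid eweight" by (rule edens_rapid[of 1]) (simp add: edens_def eweight_def[abs_def])

definition "W0 = (LBINT k. eweight k)"
definition "W1 = (LBINT k. norm k * eweight k)"
definition "W2 = (LBINT k. (eweight k)^2)"
definition "W3 = (LBINT k. (norm k * eweight k)^2)"

lemma W_nonneg: "0 <= W0" "0 <= W1" "0 <= W2" "0 <= W3" by (auto simp: W0_def W1_def W2_def W3_def eweight_nonneg)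

lemma eweight_integrable: "integrable lborel eweight" by (rule rapid_integrable[OF eweight_rapid])

lemma norm_eweight_rapid: "rapid (%k. norm k * eweight k)" by (rule rapid_bound[OF eweight_rapid, where C=1 and j=1])
   (use rapid_measurable[OF eweight_rapid] in "auto simp: abs_mult eweight_nonneg intro: mult_right_mono")

lemma norm_eweight_integrable: "integrable lborel (%k. norm k * eweight k)" by (rule rapid_integrable[OF norm_eweight_rapid])

lemma norm_dirmult_le:
 assumes "edens C g" shows "norm (dirmult v g k) <= C * norm v * (norm k * eweight k)"
proof -
 have "\<bar>k \<bullet> v\<bar> * norm (g (- k)) <= (norm k * norm v) * (C * eweight (- k))"
  unfolding eweight_def by (intro mult_mono Cauchy_Schwarz_ineq2 edens_bound[OF assms]) auto
 then show ?thesis by (simp add: dirmult_def eweight_def mult_ac)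
qed

lemma edens_hart_bounds:
 fixes g :: "real^3 => 'b::euclidean_space"
 assumes e: "edens C g"
 shows "norm (hart g x) <= 2 * W0 * C" (is ?g1)
  and "norm (hart (dirmult v g) x) <= 2 * W1 * norm v * C" (is ?g2)
  and "(LBINT x. (norm (hart g x))^2) <= (2 * pi) ^ 3 * W2 * C^2" (is ?g3)
  and "(LBINT x. (norm (hart (dirmult v g) x))^2) <= (2 * pi) ^ 3 * W3 * (norm v * C)^2" (is ?g4)
proof -
 have C: "C >= 0" using e by (simp add: edens_def)
 have r: "rapid g" and rd: "rapid (dirmult v g)" using edens_rapid[OF e] rapid_dirmult by blast+
 have b: "norm (g k) <= C * eweight k" for k using edens_bound[OF e] by (simp add: eweight_def)
 have "(LBINT k. norm (g k)) <= (LBINT k. C * eweight k)"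
  by (rule integral_mono[OF rapid_integrable_norm[OF r] integrable_mult_right[OF eweight_integrable] b])
 then show ?g1 using norm_hart_le[OF rapid_integrable[OF r], of x] by (simp add: W0_def mult_ac)
 have "(LBINT k. norm (dirmult v g k)) <= (LBINT k. C * norm v * (norm k * eweight k))"
  by (rule integral_mono[OF rapid_integrable_norm[OF rd] integrable_mult_right[OF norm_eweight_integrable] norm_dirmult_le[OF e]])
 also have "... = C * norm v * W1" unfolding W1_def by (rule integral_mult_right_zero)
 finally show ?g2 using norm_hart_le[OF rapid_integrable[OF rd], of x] by (simp add: mult_ac)
 have "(LBINT k. (norm (g k))^2) <= (LBINT k. C^2 * (eweight k)^2)"
 proof (rule integral_mono[OF rapid_integrable_square[OF r] integrable_mult_right])
  show "integrable lborel (%k. (eweight k)^2)" using rapid_integrable_square[OF eweight_rapid] by simp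
  show "(norm (g k))^2 <= C^2 * (eweight k)^2" for k using power_mono[OF b norm_ge_zero, of k 2] by (simp add: power_mult_distrib)
 qed
 then have "(2 * pi) ^ 3 * (LBINT k. (norm (g k))^2) <= (2 * pi) ^ 3 * (C^2 * W2)" by (intro mult_left_mono) (auto simp: W2_def)
 then show ?g3 using order_trans[OF hart_square_integrable(2)[OF r]] by (simp only: mult_ac)
 have "(LBINT k. (norm (dirmult v g k))^2) <= (LBINT k. (norm v * C)^2 * (norm k * eweight k)^2)"
 proof (rule integral_mono[OF rapid_integrable_square[OF rd] integrable_mult_right])
  show "integrable lborel (%k. (norm k * eweight k)^2)" using rapid_integrable_square[OF norm_eweight_rapid] by simp
  show "(norm (dirmult v g k))^2 <= (norm v * C)^2 * (norm k * eweight k)^2" for k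
   using power_mono[OF norm_dirmult_le[OF e] norm_ge_zero, of v k 2] by (simp add: power_mult_distrib mult_ac)
 qed
 then have "(2 * pi) ^ 3 * (LBINT k. (norm (dirmult v g k))^2) <= (2 * pi) ^ 3 * ((norm v * C)^2 * W3)"
  by (intro mult_left_mono) (auto simp: W3_def)
 then show ?g4 using order_trans[OF hart_square_integrable(2)[OF rd]] by (simp only: mult_ac)
qed

lemma edens_add: "edens C f ==> edens D g ==> edens (C + D) (%k. f k + g k)"
 unfolding edens_def by (auto simp: distrib_right intro!: order_trans[OF norm_triangle_ineq] add_mono)

lemma edens_scaleR: "edens C f ==> edens (\<bar>a\<bar> * C) (%k. a *\<^sub>R f k)"
 unfolding edens_def by (auto simp: mult.assoc intro!: mult_left_mono)

lemma edens_diff: "edens C f ==> edens D g ==> edens (C + D) (%k. f k - g k)"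
 unfolding edens_def by (auto simp: distrib_right intro!: order_trans[OF norm_triangle_ineq4] add_mono)

lemma hart_sums:
 fixes G :: "nat => real^3 => 'b::euclidean_space"
 assumes m[measurable]: "!!n. G n \<in> borel_measurable borel" and le: "!!n k. norm (G n k) <= c n * V k"
  and V: "integrable lborel V" "!!k. 0 <= V k" and c: "summable c" "!!n. 0 <= c n"
 shows "!!k. summable (%n. norm (G n k))"
  and "(%n. hart (G n) x) sums hart (%k. \<Sum>n. G n k) x" (is ?g2)
proof -
 have sn: "summable (%n. norm (G n k))" for k by (rule summable_comparison_test'[OF summable_mult2[OF c(1), of "V k"]]) (use le in simp)
 then show "!!k. summable (%n. norm (G n k))" .
 have iG: "integrable lborel (G n)" for n by (rule dominated_integrable[OF integrable_mult_right[OF V(1), of "c n"]])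
    (use le in "auto intro!: AE_I2 order_trans[OF _ abs_ge_self]")
 define f where "f n k = cas (k \<bullet> x) *\<^sub>R G n k" for n k
 have if': "integrable lborel (f n)" for n unfolding f_def by (rule integrable_cas[OF iG])
 have nf: "norm (f n k) <= 2 * c n * V k" for n k using mult_mono[OF abs_cas_le[of "k \<bullet> x"] le[of n k]] by (simp add: f_def mult_ac)
 have s1: "summable (%n. norm (f n k))" for k by (rule summable_comparison_test'[OF summable_mult[OF sn[of k], of 2]])
    (auto simp: f_def intro!: mult_right_mono abs_cas_le)
 have s2: "summable (%n. LBINT k. norm (f n k))"
 proof (rule summable_comparison_test'[OF summable_mult2[OF summable_mult[OF c(1), of 2], of "LBINT k. V k"]])
  fix n :: nat assume "n >= 0"
  have "(LBINT k. norm (f n k)) <= (LBINT k. 2 * c n * V k)"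
   by (rule integral_mono[OF integrable_norm[OF if'] integrable_mult_right[OF V(1)] nf])
  then show "norm (LBINT k. norm (f n k)) <= 2 * c n * (LBINT k. V k)" by simp
 qed
 have "(%n. LBINT k. f n k) sums (LBINT k. (\<Sum>n. f n k))" by (rule sums_integral[OF if' _ s2]) (use s1 in simp)
 moreover have "(\<Sum>n. f n k) = cas (k \<bullet> x) *\<^sub>R (\<Sum>n. G n k)" for k
  unfolding f_def using summable_norm_cancel[OF sn[of k]] by (simp add: suminf_scaleR_right)
 ultimately show ?g2 by (simp add: hart_def f_def)
qed

text \<open>Pointwise absolutely convergent sums of densities commute with the Hartley integral and its derivatives,
by dominated convergence with the common weight.\<close>
lemma edens_series:
 fixes G :: "nat => real^3 => 'b::euclidean_space"
 assumes e: "!!n. edens (c n) (G n)" and c: "summable c"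
 shows "edens (suminf c) (%k. \<Sum>n. G n k)" (is ?g1)
  and "!!k. summable (%n. norm (G n k))"
  and "(%n. hart (G n) x) sums hart (%k. \<Sum>n. G n k) x" (is ?g3)
  and "(%n. hart (dirmult v (G n)) x) sums hart (dirmult v (%k. \<Sum>n. G n k)) x" (is ?g4)
proof -
 have c0: "0 <= c n" for n using e[of n] by (simp add: edens_def)
 have m[measurable]: "!!n. G n \<in> borel_measurable borel" using e edens_measurable by blast
 have le: "norm (G n k) <= c n * eweight k" for n k using edens_bound[OF e] by (simp add: eweight_def)
 note H = hart_sums[OF m le eweight_integrable eweight_nonneg c c0]
 show s: "!!k. summable (%n. norm (G n k))" by (rule H(1))
 show ?g3 by (rule H(2))
 have sG: "(%n. G n k) sums (\<Sum>n. G n k)" for k using summable_norm_cancel[OF s[of k]] by (rule summable_sums)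
 have ms: "(%k. \<Sum>n. G n k) \<in> borel_measurable borel"
 proof (rule borel_measurable_LIMSEQ_metric)
  show "(%k. \<Sum>i<n. G i k) \<in> borel_measurable borel" for n by measurable
  show "(%n. \<Sum>i<n. G i k) \<longlonglongrightarrow> (\<Sum>n. G n k)" for k using sG[of k] by (simp add: sums_def)
 qed
 show ?g1 unfolding edens_def
 proof (intro conjI allI ms)
  show "0 <= suminf c" by (rule suminf_nonneg[OF c c0])
  fix k
  have "norm (\<Sum>n. G n k) <= (\<Sum>n. norm (G n k))" by (rule summable_norm[OF s])
  also have "... <= (\<Sum>n. c n * eweight k)" by (rule suminf_le[OF le s summable_mult2[OF c]])
  also have "... = suminf c * eweight k" by (rule suminf_mult2[OF c, symmetric])
  finally show "norm (\<Sum>n. G n k) <= suminf c * (norm k * exp (- norm k))" by (simp add: eweight_def)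
 qed
 have md: "dirmult v (G n) \<in> borel_measurable borel" for n using rapid_dirmult[OF edens_rapid[OF e]] rapid_measurable by blast
 have "(%n. hart (dirmult v (G n)) x) sums hart (%k. \<Sum>n. dirmult v (G n) k) x"
  using norm_dirmult_le[OF e, of v] c0 norm_eweight_integrable eweight_nonneg
  by (intro hart_sums(2)[OF md, where c="%n. c n * norm v" and V="%k. norm k * eweight k"] summable_mult2 c) auto
 moreover have "(%k. \<Sum>n. dirmult v (G n) k) = dirmult v (%k. \<Sum>n. G n k)"
  unfolding dirmult_def using sums_summable[OF sG] by (simp add: suminf_scaleR_right fun_eq_iff suminf_minus summable_scaleR_right)
 ultimately show ?g4 by simp
qed

section \<open>The time power series of the solution\<close>

text \<open>The coefficients of the time series, found by equating powers of \<open>t\<close> in the projected equation.\<close>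
fun gs :: "real => (real^3 => real^3) => nat => real^3 => real^3" where
 "gs \<Omega> g0 0 = g0"
| "gs \<Omega> g0 (Suc n) = (%k. let f = \<Omega> *\<^sub>R cross3 e3 (gs \<Omega> g0 n k) + (\<Sum>j\<le>n. advm (gs \<Omega> g0 j) (gs \<Omega> g0 (n - j)) k)
   in - (1 / real (Suc n)) *\<^sub>R (f - gradm k f))"

definition fs :: "real => (real^3 => real^3) => nat => real^3 => real^3" where
 "fs \<Omega> g0 n k = \<Omega> *\<^sub>R cross3 e3 (gs \<Omega> g0 n k) + (\<Sum>j\<le>n. advm (gs \<Omega> g0 j) (gs \<Omega> g0 (n - j)) k)"

lemma gs_Suc: "gs \<Omega> g0 (Suc n) k = - (1 / real (Suc n)) *\<^sub>R (fs \<Omega> g0 n k - gradm k (fs \<Omega> g0 n k))"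
 by (simp add: fs_def Let_def)

declare gs.simps(2) [simp del]

lemma norm_cross_e3: "norm (cross3 e3 v) <= norm v"
proof -
 have "(norm (cross3 e3 v))^2 <= (norm v)^2" by (simp add: norm_cross e3_def power_mult_distrib)
 then show ?thesis by (rule power2_le_imp_le) simp
qed

lemma cross3_measurable[measurable]:
 fixes f :: "'a => real^3"
 assumes [measurable]: "f \<in> borel_measurable M" shows "(%x. cross3 v (f x)) \<in> borel_measurable M"
proof -
 have "continuous_on UNIV (cross3 v)" by (intro linear_continuous_on bounded_bilinear.bounded_linear_right[OF bounded_bilinear_cross3])
 then have "cross3 v \<in> borel_measurable borel" by (rule borel_measurable_continuous_onI)
 from measurable_compose[OF assms this] show ?thesis .
qed

lemma gradm_orthogonal: "k \<bullet> (v - gradm k v) = 0" by (cases "k = 0") (auto simp: gradm_def inner_diff_right)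

lemma inverse_square_sum: "(\<Sum>j\<le>n. 1 / (real j + 1)^2) <= 2 - 1 / (real n + 1)"
proof (induction n)
 case (Suc n)
 have "1 / (real (Suc n) + 1)^2 <= 1 / (real n + 1) - 1 / (real (Suc n) + 1)"
 proof -
  have "1 / (real n + 1) - 1 / (real (Suc n) + 1) = 1 / ((real n + 1) * (real n + 2))" by (simp add: field_simps)
  moreover have "1 / (real (Suc n) + 1)^2 <= 1 / ((real n + 1) * (real n + 2))"
   by (rule frac_le) (auto simp: power2_eq_square algebra_simps intro!: add_pos_nonneg)
  ultimately show ?thesis by linarith
 qed
 then show ?case using Suc by simp
qed simp

lemma inverse_square_convolution:
 "(\<Sum>j\<le>n. 1 / (real j + 1)^2 * (1 / (real (n - j) + 1)^2)) <= 16 / (real n + 2)^2"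
proof -
 have le: "1 / (real j + 1)^2 * (1 / (real (n - j) + 1)^2) <= 4 / (real n + 2)^2 * (1 / (real j + 1)^2 + 1 / (real (n - j) + 1)^2)"
  if "j <= n" for j
 proof -
  define p where "p = real j + 1"
  define q where "q = real (n - j) + 1"
  have p: "p > 0" "q > 0" and s: "real n + 2 = p + q" using that by (auto simp: p_def q_def of_nat_diff)
  have "(p + q)^2 <= 2 * (p^2 + q^2)"
  proof -
   have "0 <= (p - q)^2" by simp
   then show ?thesis by (simp add: power2_eq_square algebra_simps)
  qed
  also have "... <= 4 * (p^2 + q^2)" by (rule mult_right_mono) auto
  finally have "(p + q)^2 <= 4 * (p^2 + q^2)" .
  then have "(p + q)^2 / (p^2 * q^2 * (p + q)^2) <= 4 * (p^2 + q^2) / (p^2 * q^2 * (p + q)^2)" by (rule divide_right_mono) simp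
  then show ?thesis unfolding s p_def[symmetric] q_def[symmetric] using p by (simp add: field_simps)
 qed
 have r: "(\<Sum>j\<le>n. 1 / (real (n - j) + 1)^2) = (\<Sum>j\<le>n. 1 / (real j + 1)^2)"
  by (rule sum.reindex_bij_witness[of _ "%j. n - j" "%j. n - j"]) auto
 have "(\<Sum>j\<le>n. 1 / (real j + 1)^2 * (1 / (real (n - j) + 1)^2)) <= (\<Sum>j\<le>n. 4 / (real n + 2)^2 * (1 / (real j + 1)^2 + 1 / (real (n - j) + 1)^2))"
  by (rule sum_mono) (use le in auto)
 also have "... = 4 / (real n + 2)^2 * (2 * (\<Sum>j\<le>n. 1 / (real j + 1)^2))" unfolding sum_distrib_left[symmetric] sum.distrib r by simp
 also have "... <= 4 / (real n + 2)^2 * (2 * 2)" using inverse_square_sum[of n] by (intro mult_left_mono) (auto intro: order_trans)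
 finally show ?thesis by simp
qed

lemma bounded_linear_cross_e3: "bounded_linear (%v. c *\<^sub>R cross3 e3 v)" by (intro bounded_linear_compose[OF bounded_linear_scaleR_right]
   bounded_bilinear.bounded_linear_right[OF bounded_bilinear_cross3])

lemma band_integrable_norm: "band R g ==> integrable lborel (%k. norm (g k))" by (rule rapid_integrable_norm[OF band_rapid])

lemma band_mono: "band R g ==> R <= S ==> band S g" unfolding band_def by force

lemma band_mult_bounded:
 fixes g :: "real^3 => real^3" and f :: "real^3 => real^3"
 assumes g: "band R g" and m: "f \<in> borel_measurable borel" and le: "!!k. norm (f k) <= C * norm (g k)" and C: "0 <= C"
 shows "band R f" "(LBINT k. norm (f k)) <= C * (LBINT k. norm (g k))" (is ?g2)
proof -
 from g obtain b where b: "!!k. norm (g k) <= b" unfolding band_def by blast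
 have "norm (f k) <= C * b" for k using le[of k] mult_left_mono[OF b[of k] C] by linarith
 moreover have "f k = 0" if "norm k > R" for k using le[of k] band_zero[OF g that] by simp
 ultimately show bf: "band R f" unfolding band_def using m by blast
 have "(LBINT k. norm (f k)) <= (LBINT k. C * norm (g k))"
  by (rule integral_mono[OF band_integrable_norm[OF bf] integrable_mult_right[OF band_integrable_norm[OF g]] le])
 then show ?g2 by simp
qed

lemma band_add:
 fixes f g :: "real^3 => real^3"
 assumes f: "band R f" and g: "band R g"
 shows "band R (%k. f k + g k)" (is ?g1)
  "(LBINT k. norm (f k + g k)) <= (LBINT k. norm (f k)) + (LBINT k. norm (g k))" (is ?g2)
proof -
 from f obtain b where b: "!!k. norm (f k) <= b" unfolding band_def by blast
 from g obtain c where c: "!!k. norm (g k) <= c" unfolding band_def by blast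
 have "norm (f k + g k) <= b + c" for k by (rule norm_triangle_mono[OF b c])
 moreover have "(%k. f k + g k) \<in> borel_measurable borel" using f g by (simp add: band_measurable borel_measurable_add)
 ultimately show bf: ?g1 unfolding band_def using f g by (auto simp: band_zero)
 have "(LBINT k. norm (f k + g k)) <= (LBINT k. norm (f k) + norm (g k))"
  using band_integrable_norm[OF bf] band_integrable_norm[OF f] band_integrable_norm[OF g]
  by (intro integral_mono norm_triangle_ineq Bochner_Integration.integrable_add)
 then show ?g2 using band_integrable_norm[OF f] band_integrable_norm[OF g] by simp
qed

lemma band_sum:
 fixes F :: "'i => real^3 => real^3"
 assumes "finite I" "!!i. i \<in> I ==> band R (F i)"
 shows "band R (%k. \<Sum>i\<in>I. F i k) \<and>
  (LBINT k. norm (\<Sum>i\<in>I. F i k)) <= (\<Sum>i\<in>I. LBINT k. norm (F i k))" using assms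
proof (induction I rule: finite_induct)
 case empty
 then show ?case by (auto simp: band_def)
next
 case (insert i I)
 then have "band R (F i)" "band R (%k. \<Sum>i\<in>I. F i k)" by auto
 from band_add[OF this] insert show ?case by auto
qed

text \<open>The sizes in the estimates are governed by \<open>a\<close>; the bound by \<open>b\<close>, however large, places the solution in
the space \<open>Y\<close>.\<close>
locale euler_series =
 fixes \<Omega> \<eta> a b :: real and g0 :: "real^3 => real^3"
 assumes eta: "0 < \<eta>" "\<eta> <= 1" and ab: "0 <= a" "0 <= b" and eta_a: "\<eta> * a <= 1"
  and g0_band: "band \<eta> g0" and g0_div: "!!k. k \<bullet> g0 k = 0"
  and g0_L1: "(LBINT k. norm (g0 k)) <= a" and g0_bound: "!!k. norm (g0 k) <= b * norm k"
begin

abbreviation "g \<equiv> gs \<Omega> g0"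
abbreviation "f \<equiv> fs \<Omega> g0"

definition "B = 8 * \<bar>\<Omega>\<bar> + 128"
definition "q n = B ^ n / (real n + 1)^2"

lemma B_ge: "B >= 128" "B > 0" by (auto simp: B_def)

lemma q_nonneg: "0 <= q n" using B_ge by (simp add: q_def)

text \<open>The denominators \<open>(n + 1)^2\<close> in \<open>q\<close> are there for this: the inverse squares are stable under discrete
convolution up to a constant.\<close>
lemma q_convolution: "(\<Sum>j\<le>n. q j * q (n - j)) <= 16 * B ^ n / (real n + 2)^2"
proof -
 have "(\<Sum>j\<le>n. q j * q (n - j)) = (\<Sum>j\<le>n. B ^ n * (1 / (real j + 1)^2 * (1 / (real (n - j) + 1)^2)))"
  by (intro sum.cong refl) (simp add: q_def power_add[symmetric])
 also have "... = B ^ n * (\<Sum>j\<le>n. 1 / (real j + 1)^2 * (1 / (real (n - j) + 1)^2))" by (rule sum_distrib_left[symmetric])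
 also have "... <= B ^ n * (16 / (real n + 2)^2)" using B_ge by (intro mult_left_mono inverse_square_convolution) auto
 finally show ?thesis by (simp add: mult.commute)
qed

lemma q_le: "q n <= 4 * B ^ n / (real n + 2)^2"
proof -
 have "(real n + 2)^2 <= (2 * (real n + 1))^2" by (intro power_mono) auto
 also have "... = 4 * (real n + 1)^2" unfolding power_mult_distrib by simp
 finally have "B ^ n * (real n + 2)^2 <= B ^ n * (4 * (real n + 1)^2)" using B_ge by (intro mult_left_mono) auto
 then show ?thesis by (simp add: q_def divide_le_eq le_divide_eq mult_ac)
qed

definition good :: "nat => bool" where
 "good n \<longleftrightarrow> band (\<eta> * (real n + 1)) (g n) \<and> (\<forall>k. k \<bullet> g n k = 0) \<and>
   (LBINT k. norm (g n k)) <= a * q n \<and> (\<forall>k. norm (g n k) <= b * q n * norm k)"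

lemma f_bounds:
 assumes "!!j. j <= n ==> good j"
 shows "band (\<eta> * (real n + 2)) (f n)" (is ?g1)
  and "(LBINT k. norm (f n k)) <= (real n + 1) * (a * B ^ Suc n / (2 * (real n + 2)^2))" (is ?g2)
  and "!!k. norm (f n k) <= (real n + 1) * (b * B ^ Suc n / (2 * (real n + 2)^2)) * norm k"
proof -
 have bg: "band (\<eta> * (real j + 1)) (g j)" and L1: "(LBINT k. norm (g j k)) <= a * q j"
  and bd: "!!k. norm (g j k) <= b * q j * norm k" if "j <= n" for j using assms[OF that] by (auto simp: good_def)
 define N where "N j = advm (g j) (g (n - j))" for j
 have e1: "\<eta> * (real j + 1) + \<eta> * (real (n - j) + 1) = \<eta> * (real n + 2)" if "j <= n" for j
  using that by (simp add: of_nat_diff algebra_simps)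
 have N_band: "band (\<eta> * (real n + 2)) (N j)" if "j <= n" for j
  using advm_bounds(3)[OF bg[OF that] bg[of "n - j"]] eta e1[OF that] by (simp add: N_def)
 have N_L1: "(LBINT k. norm (N j k)) <= 2 * (real n + 2) * a * (q j * q (n - j))" if j: "j <= n" for j
 proof -
  have "(LBINT k. norm (N j k)) <= 2 * (\<eta> * (real n + 2)) * (LBINT k. norm (g j k)) * (LBINT k. norm (g (n - j) k))"
   using advm_bounds(4)[OF bg[OF j] bg[of "n - j"]] eta e1[OF j] by (simp add: N_def)
  also have "... <= 2 * (\<eta> * (real n + 2)) * (a * q j) * (a * q (n - j))" using eta ab q_nonneg by (intro mult_mono L1 j) auto
  also have "... = (\<eta> * a) * (2 * (real n + 2) * a * (q j * q (n - j)))" by simp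
  also have "... <= 1 * (2 * (real n + 2) * a * (q j * q (n - j)))" using eta_a ab q_nonneg by (intro mult_right_mono) auto
  finally show ?thesis by simp
 qed
 have N_bd: "norm (N j k) <= 2 * (real n + 1) * b * (q j * q (n - j)) * norm k" if j: "j <= n" for j k
 proof -
  have h: "norm (g (n - j) l) <= b * q (n - j) * (\<eta> * (real n + 1))" for l
  proof (cases "norm l > \<eta> * (real (n - j) + 1)")
   case True
   then show ?thesis using band_zero[OF bg[of "n - j"]] eta ab q_nonneg by simp
  next
   case False
   have "\<eta> * (real (n - j) + 1) <= \<eta> * (real n + 1)" using eta by (intro mult_left_mono) auto
   then have "norm l <= \<eta> * (real n + 1)" using False by linarith
   then have "b * q (n - j) * norm l <= b * q (n - j) * (\<eta> * (real n + 1))" using ab q_nonneg by (intro mult_left_mono) auto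
   then show ?thesis using bd[of "n - j" l] by simp
  qed
  have "norm (N j k) <= 2 * norm k * (LBINT k. norm (g j k)) * (b * q (n - j) * (\<eta> * (real n + 1)))"
   unfolding N_def by (rule advm_bounds(2)[OF bg[OF j] bg[of "n - j"] _ _ h]) (use eta in auto)
  also have "... <= 2 * norm k * (a * q j) * (b * q (n - j) * (\<eta> * (real n + 1)))" using eta ab q_nonneg by (intro mult_mono L1 j) auto
  also have "... = (\<eta> * a) * (2 * (real n + 1) * b * (q j * q (n - j)) * norm k)" by simp
  also have "... <= 1 * (2 * (real n + 1) * b * (q j * q (n - j)) * norm k)" using eta_a ab q_nonneg by (intro mult_right_mono) auto
  finally show ?thesis by simp
 qed
 have sN: "band (\<eta> * (real n + 2)) (%k. \<Sum>j\<le>n. N j k)"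
  "(LBINT k. norm (\<Sum>j\<le>n. N j k)) <= (\<Sum>j\<le>n. LBINT k. norm (N j k))"
  using band_sum[of "{..n}" "\<eta> * (real n + 2)" N] N_band by auto
 have mg: "g n \<in> borel_measurable borel" using bg[of n] band_measurable by blast
 have cb: "norm (\<Omega> *\<^sub>R cross3 e3 v) <= \<bar>\<Omega>\<bar> * norm v" for v by (auto intro: mult_left_mono norm_cross_e3)
 have bg2: "band (\<eta> * (real n + 2)) (g n)" by (rule band_mono[OF bg]) (use eta in auto)
 have mc: "(%k. \<Omega> *\<^sub>R cross3 e3 (g n k)) \<in> borel_measurable borel" using mg by measurable
 note C = band_mult_bounded[OF bg2 mc cb abs_ge_zero]
 have f: "f n = (%k. \<Omega> *\<^sub>R cross3 e3 (g n k) + (\<Sum>j\<le>n. N j k))" by (simp add: fs_def N_def fun_eq_iff)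
 show ?g1 unfolding f by (rule band_add(1)[OF C(1) sN(1)])
 have fin: "\<bar>\<Omega>\<bar> * (4 * B ^ n / (real n + 2)^2) + 4 * (real n + 1) * (16 * B ^ n / (real n + 2)^2)
   <= (real n + 1) * (B ^ Suc n / (2 * (real n + 2)^2))"
 proof -
  have "1 * (4 * \<bar>\<Omega>\<bar>) <= (real n + 1) * (4 * \<bar>\<Omega>\<bar>)" by (rule mult_right_mono) auto
  moreover have "(real n + 1) * (B / 2) = (real n + 1) * (4 * \<bar>\<Omega>\<bar>) + 4 * (real n + 1) * 16" by (simp add: B_def algebra_simps)
  ultimately have "\<bar>\<Omega>\<bar> * 4 + 4 * (real n + 1) * 16 <= (real n + 1) * (B / 2)" by linarith
  then have "(\<bar>\<Omega>\<bar> * 4 + 4 * (real n + 1) * 16) * (B ^ n / (real n + 2)^2) <= (real n + 1) * (B / 2) * (B ^ n / (real n + 2)^2)"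
   using B_ge by (intro mult_right_mono) auto
  then show ?thesis by (simp add: algebra_simps add_divide_distrib)
 qed
 have "(LBINT k. norm (f n k)) <= (LBINT k. norm (\<Omega> *\<^sub>R cross3 e3 (g n k))) + (LBINT k. norm (\<Sum>j\<le>n. N j k))"
  unfolding f by (rule band_add(2)[OF C(1) sN(1)])
 also have "... <= \<bar>\<Omega>\<bar> * (a * q n) + (\<Sum>j\<le>n. 2 * (real n + 2) * a * (q j * q (n - j)))"
  using sum_mono[of "{..n}" "%j. LBINT k. norm (N j k)", OF N_L1] sN(2) C(2) mult_left_mono[OF L1[of n] abs_ge_zero[of \<Omega>]] by auto
 also have "... = \<bar>\<Omega>\<bar> * (a * q n) + 2 * (real n + 2) * a * (\<Sum>j\<le>n. q j * q (n - j))" by (simp add: sum_distrib_left)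
 also have "... <= \<bar>\<Omega>\<bar> * (a * (4 * B ^ n / (real n + 2)^2)) + 4 * (real n + 1) * a * (16 * B ^ n / (real n + 2)^2)"
 proof (rule add_mono)
  show "\<bar>\<Omega>\<bar> * (a * q n) <= \<bar>\<Omega>\<bar> * (a * (4 * B ^ n / (real n + 2)^2))" using ab q_le by (intro mult_left_mono) auto
  have "2 * (real n + 2) <= 4 * (real n + 1)" by simp
  from mult_mono[OF mult_right_mono[OF this ab(1)] q_convolution[of n]]
  show "2 * (real n + 2) * a * (\<Sum>j\<le>n. q j * q (n - j)) <= 4 * (real n + 1) * a * (16 * B ^ n / (real n + 2)^2)"
   using ab q_nonneg by (simp add: sum_nonneg)
 qed
 also have "... = a * (\<bar>\<Omega>\<bar> * (4 * B ^ n / (real n + 2)^2) + 4 * (real n + 1) * (16 * B ^ n / (real n + 2)^2))"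
  by (simp add: algebra_simps)
 also have "... <= a * ((real n + 1) * (B ^ Suc n / (2 * (real n + 2)^2)))" using ab by (intro mult_left_mono fin)
 finally show ?g2 by (simp add: mult_ac)
 fix k
 have "norm (f n k) <= norm (\<Omega> *\<^sub>R cross3 e3 (g n k)) + (\<Sum>j\<le>n. norm (N j k))"
  unfolding f by (intro order_trans[OF norm_triangle_ineq] add_left_mono norm_sum)
 also have "... <= \<bar>\<Omega>\<bar> * (b * q n * norm k) + (\<Sum>j\<le>n. 2 * (real n + 1) * b * (q j * q (n - j)) * norm k)"
  using order_trans[OF cb mult_left_mono[OF bd[of n k] abs_ge_zero[of \<Omega>]]] N_bd by (intro add_mono sum_mono) auto
 also have "... = (\<bar>\<Omega>\<bar> * (b * q n) + 2 * (real n + 1) * b * (\<Sum>j\<le>n. q j * q (n - j))) * norm k"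
  by (simp add: sum_distrib_left sum_distrib_right distrib_right)
 also have "... <= (\<bar>\<Omega>\<bar> * (b * (4 * B ^ n / (real n + 2)^2)) + 4 * (real n + 1) * b * (16 * B ^ n / (real n + 2)^2)) * norm k"
 proof (intro mult_right_mono add_mono)
  show "\<bar>\<Omega>\<bar> * (b * q n) <= \<bar>\<Omega>\<bar> * (b * (4 * B ^ n / (real n + 2)^2))" using ab q_le by (intro mult_left_mono) auto
  have "2 * (real n + 1) <= 4 * (real n + 1)" by simp
  from mult_mono[OF mult_right_mono[OF this ab(2)] q_convolution[of n]]
  show "2 * (real n + 1) * b * (\<Sum>j\<le>n. q j * q (n - j)) <= 4 * (real n + 1) * b * (16 * B ^ n / (real n + 2)^2)"
   using ab q_nonneg by (simp add: sum_nonneg)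
 qed simp
 also have "... = b * (\<bar>\<Omega>\<bar> * (4 * B ^ n / (real n + 2)^2) + 4 * (real n + 1) * (16 * B ^ n / (real n + 2)^2)) * norm k"
  by (simp add: algebra_simps)
 also have "... <= b * ((real n + 1) * (B ^ Suc n / (2 * (real n + 2)^2))) * norm k" using ab by (intro mult_right_mono mult_left_mono fin) auto
 finally show "norm (f n k) <= (real n + 1) * (b * B ^ Suc n / (2 * (real n + 2)^2)) * norm k" by (simp add: mult_ac)
qed

text \<open>The divergence-form bound of the product costs the width of its support, \<open>\<eta> (n + 2)\<close>, and \<open>\<eta> a \<le> 1\<close>
turns this into \<open>n + 2\<close>; the factor \<open>1 / (n + 1)\<close> of the recursion compensates it. The constant \<open>B\<close> leaves
room for the convolution constant and for \<open>\<Omega>\<close>.\<close>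
lemma good: "good n"
proof (induction n rule: less_induct)
 case (less n)
 show ?case
 proof (cases n)
  case 0
  then show ?thesis using g0_band g0_div g0_L1 g0_bound by (simp add: good_def q_def)
 next
  case (Suc m)
  have h: "!!j. j <= m ==> good j" using less Suc by simp
  note F = f_bounds[OF h, of m, simplified]
  have mf: "f m \<in> borel_measurable borel" using F(1) band_measurable by blast
  have gn: "g n = (%k. - (1 / real (Suc m)) *\<^sub>R (f m k - gradm k (f m k)))" by (simp add: Suc gs_Suc fun_eq_iff)
  have mg: "g n \<in> borel_measurable borel" unfolding gn using mf by measurable
  have le: "norm (g n k) <= 2 / (real m + 1) * norm (f m k)" for k
  proof -
   have "norm (f m k - gradm k (f m k)) <= 2 * norm (f m k)"
    using norm_triangle_ineq4[of "f m k" "gradm k (f m k)"] norm_gradm[of k "f m k"] by simp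
   then show ?thesis by (simp add: gn divide_right_mono add.commute)
  qed
  note M = band_mult_bounded[OF F(1) mg le, simplified]
  have e: "2 / (real m + 1) * ((real m + 1) * (c * B ^ Suc m / (2 * (real m + 2)^2))) = c * q n" for c
  proof -
   have gen: "2 / X * (X * (c * P / (2 * Y))) = c * (P / Y)" if "X \<noteq> 0" for X P Y :: real using that by simp
   have qn: "q n = B ^ Suc m / (real m + 2)^2" by (simp add: q_def Suc add.commute)
   show ?thesis unfolding qn by (rule gen) simp
  qed
  show ?thesis unfolding good_def
  proof (intro conjI allI)
   show "band (\<eta> * (real n + 1)) (g n)" using M(1) by (simp add: Suc add.commute)
   show "k \<bullet> g n k = 0" for k by (simp only: gn inner_scaleR_right gradm_orthogonal mult_zero_right)
   show "(LBINT k. norm (g n k)) <= a * q n" using M(2) mult_left_mono[OF F(2), of "2 / (real m + 1)"] e[of a] by simp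
   show "norm (g n k) <= b * q n * norm k" for k
   proof -
    have "2 / (real m + 1) * norm (f m k) <= 2 / (real m + 1) * ((real m + 1) * (b * B ^ Suc m / (2 * (real m + 2)^2)) * norm k)"
     by (intro mult_left_mono f_bounds(3) h) auto
    also have "... = b * q n * norm k" using e[of b] by (simp only: mult.assoc[symmetric])
    finally show ?thesis using le[of k] by simp
   qed
  qed
 qed
qed

end

lemma hart_test_integrable:
 fixes g :: "real^3 => real^3"
 assumes "rapid g" "test_fun \<phi>" shows "integrable lborel (%x. hart g x \<bullet> \<phi> x)"
proof -
 obtain R where "!!x. norm x >= R ==> \<phi> x = 0" using test_fun_vanishes[OF assms(2)] by metis
 then show ?thesis by (intro integrable_continuous_compact_support[where R=R] continuous_intros hart_continuous assms(1)
    Ck_continuous[OF test_fun_Ck[OF assms(2), of 0]]) auto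
qed

lemma hart_test_sums:
 fixes G :: "nat => real^3 => real^3"
 assumes e: "!!n. edens (c n) (G n)" and c: "summable c" and \<phi>: "test_fun \<phi>"
 shows "(%n. LBINT x. hart (G n) x \<bullet> \<phi> x) sums (LBINT x. hart (%k. \<Sum>n. G n k) x \<bullet> \<phi> x)"
proof -
 have r: "rapid (G n)" for n using e edens_rapid by blast
 have i: "integrable lborel (%x. hart (G n) x \<bullet> \<phi> x)" for n by (rule hart_test_integrable[OF r \<phi>])
 have i\<phi>: "integrable lborel (%x. norm (\<phi> x))" using test_fun_integrable[OF \<phi>] by simp
 have b: "norm (hart (G n) x \<bullet> \<phi> x) <= c n * (2 * W0 * norm (\<phi> x))" for n x
  using Cauchy_Schwarz_ineq2[of "hart (G n) x" "\<phi> x"] mult_right_mono[OF edens_hart_bounds(1)[OF e, of n x] norm_ge_zero[of "\<phi> x"]]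
  by (simp add: mult_ac)
 have s: "(%n. hart (G n) x \<bullet> \<phi> x) sums (hart (%k. \<Sum>n. G n k) x \<bullet> \<phi> x)" for x
  by (rule bounded_linear.sums[OF bounded_linear_inner_left edens_series(3)[OF e c]])
 have sn: "summable (%n. norm (hart (G n) x \<bullet> \<phi> x))" for x
  by (rule summable_comparison_test'[OF summable_mult2[OF c, of "2 * W0 * norm (\<phi> x)"]]) (use b in simp)
 have si: "summable (%n. LBINT x. norm (hart (G n) x \<bullet> \<phi> x))"
 proof (rule summable_comparison_test'[OF summable_mult2[OF c, of "LBINT x. 2 * W0 * norm (\<phi> x)"]])
  fix n :: nat assume "n >= 0"
  have "(LBINT x. norm (hart (G n) x \<bullet> \<phi> x)) <= (LBINT x. c n * (2 * W0 * norm (\<phi> x)))"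
   by (rule integral_mono[OF integrable_norm[OF i] _ b]) (use i\<phi> in simp)
  then show "norm (LBINT x. norm (hart (G n) x \<bullet> \<phi> x)) <= c n * (LBINT x. 2 * W0 * norm (\<phi> x))" by simp
 qed
 have "(%n. LBINT x. hart (G n) x \<bullet> \<phi> x) sums (LBINT x. (\<Sum>n. hart (G n) x \<bullet> \<phi> x))"
  by (rule sums_integral[OF i _ si]) (use sn in simp)
 then show ?thesis using s by (simp add: sums_iff)
qed

lemma gradm_linear: "bounded_linear (gradm k)" unfolding gradm_def[abs_def]
 by (intro bounded_linear_scaleR_const bounded_linear_divide[THEN bounded_linear_compose] bounded_linear_inner_right)

lemma hart_dirmult_linear:
 assumes "rapid h"
 shows "hart (dirmult v h) x = (\<Sum>i\<in>UNIV. v $ i *\<^sub>R hart (dirmult (axis i 1) h) x)"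
proof -
 have bl: "bounded_linear (%v. hart (dirmult v h) x)" by (rule has_derivative_bounded_linear[OF hart_has_derivative[OF assms]])
 have "v = (\<Sum>i\<in>UNIV. v $ i *\<^sub>R axis i 1)" by (simp add: vec_eq_iff axis_def if_distrib cong: if_cong)
 then have "hart (dirmult v h) x = hart (dirmult (\<Sum>i\<in>UNIV. v $ i *\<^sub>R axis i 1) h) x" by simp
 also have "... = (\<Sum>i\<in>UNIV. hart (dirmult (v $ i *\<^sub>R axis i 1) h) x)"
  using linear_sum[OF bounded_linear.linear[OF bl], of "%i. v $ i *\<^sub>R axis i 1" UNIV] by simp
 also have "... = (\<Sum>i\<in>UNIV. v $ i *\<^sub>R hart (dirmult (axis i 1) h) x)" using linear_simps(5)[OF bl] by simp
 finally show ?thesis .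
qed

lemma edens_leray:
 fixes f :: "real^3 => real^3"
 assumes "edens C f" shows "edens (2 * C) (%k. f k - gradm k (f k))"
proof -
 have "edens C (%k. gradm k (f k))" using assms unfolding edens_def by (auto intro: order_trans[OF norm_gradm])
 from edens_diff[OF assms this] show ?thesis by simp
qed

context euler_series
begin

definition "K = 1 / (8 * B)"
definition "T = 1 / (16 * B)"
definition "cc = 9 * b * B + 3 * b"
definition "CC = (\<Sum>n. cc * (3 / 8) ^ n)"
definition "gt t k = (\<Sum>n. t ^ n *\<^sub>R g n k)"
definition "ft t k = (\<Sum>n. t ^ n *\<^sub>R f n k)"
definition "u t = hart (gt t)"

lemma KT: "K > 0" "T > 0" "T = K / 2" "T < K" using B_ge by (auto simp: K_def T_def field_simps)

lemma cc_nonneg: "0 <= cc" using ab B_ge by (simp add: cc_def)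

lemma cc_summable: "summable (%n. cc * (3 / 8) ^ n)" by (intro summable_mult summable_geometric) simp

lemma g_band: "band (\<eta> * (real n + 1)) (g n)"
 and g_div: "k \<bullet> g n k = 0"
 and g_L1: "(LBINT k. norm (g n k)) <= a * q n"
 and g_bound: "norm (g n k) <= b * q n * norm k" using good[of n] by (auto simp: good_def)

lemmas f_bnds = f_bounds[OF good]

lemma q_le_power: "q n <= B ^ n" using B_ge by (simp add: q_def divide_le_eq mult_le_cancel_left1 one_le_power)

lemma exp_support: "norm (k::real^3) <= real m ==> 1 <= 3 ^ m * exp (- norm k)"
proof -
 assume "norm k <= real m"
 then have "exp (norm k) <= exp (real m * 1)" by simp
 also have "... = exp 1 ^ m" by (rule exp_of_nat_mult)
 also have "... <= 3 ^ m" using exp_le by (intro power_mono) auto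
 finally show ?thesis by (simp add: exp_minus field_simps)
qed

text \<open>As \<open>\<eta> \<le> 1\<close>, the support lies in \<open>|k| \<le> m\<close>, where \<open>exp (- |k|)\<close> is at least \<open>3^(- m)\<close>, since \<open>exp 1 < 3\<close>.\<close>
lemma edens_support:
 fixes h :: "real^3 => real^3"
 assumes "band (\<eta> * real m) h" "!!k. norm (h k) <= D * norm k" "0 <= D"
 shows "edens (D * 3 ^ m) h" unfolding edens_def
proof (intro conjI allI)
 fix k
 show "norm (h k) <= D * 3 ^ m * (norm k * exp (- norm k))"
 proof (cases "norm k > \<eta> * real m")
  case True
  then show ?thesis using band_zero[OF assms(1)] assms(3) by simp
 next
  case False
  have "\<eta> * real m <= 1 * real m" using eta by (intro mult_right_mono) auto
  then have "1 <= 3 ^ m * exp (- norm k)" using False by (intro exp_support) auto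
  then have "D * norm k * 1 <= D * norm k * (3 ^ m * exp (- norm k))" using assms(3) by (intro mult_left_mono) auto
  then show ?thesis using assms(2)[of k] by (simp add: mult_ac)
 qed
qed (use assms band_measurable in auto)

lemma edens_g: "edens (cc * (3 * B) ^ n) (g n)"
proof -
 have "edens (b * q n * 3 ^ (n + 1)) (g n)"
  using edens_support[of "n + 1" "g n" "b * q n"] g_band[of n] g_bound ab q_nonneg by (simp add: add.commute)
 moreover have "b * q n * 3 ^ (n + 1) <= cc * (3 * B) ^ n"
 proof -
  have "b * q n * 3 ^ (n + 1) <= b * B ^ n * 3 ^ (n + 1)" using ab q_le_power by (intro mult_right_mono mult_left_mono) auto
  also have "... = 3 * b * (3 * B) ^ n" by (simp add: power_mult_distrib)
  also have "... <= cc * (3 * B) ^ n" using ab B_ge by (intro mult_right_mono) (auto simp: cc_def)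
  finally show ?thesis .
 qed
 ultimately show ?thesis by (rule edens_mono)
qed

lemma edens_f: "edens (cc * (3 * B) ^ n) (f n)"
proof -
 have p: "0 <= b * B ^ Suc n" using ab B_ge by simp
 have "norm (f n k) <= b * B ^ Suc n * norm k" for k
 proof -
  have "(real n + 1) / (2 * (real n + 2)^2) <= 1" by (simp add: divide_le_eq power2_eq_square algebra_simps add_nonneg_nonneg)
  from mult_left_mono[OF this p] have "(real n + 1) * (b * B ^ Suc n / (2 * (real n + 2)^2)) <= b * B ^ Suc n" by (simp add: mult_ac)
  from mult_right_mono[OF this norm_ge_zero[of k]] show ?thesis using f_bnds(3)[of n k] by linarith
 qed
 then have "edens (b * B ^ Suc n * 3 ^ (n + 2)) (f n)"
  using edens_support[of "n + 2" "f n" "b * B ^ Suc n"] f_bnds(1)[of n] p by (simp add: add.commute)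
 moreover have "b * B ^ Suc n * 3 ^ (n + 2) = 9 * b * B * (3 * B) ^ n" by (simp add: power_mult_distrib)
 moreover have "9 * b * B * (3 * B) ^ n <= cc * (3 * B) ^ n" using ab B_ge by (intro mult_right_mono) (auto simp: cc_def)
 ultimately show ?thesis by (metis edens_mono)
qed

lemma edens_power:
 fixes h :: "real^3 => real^3"
 assumes h: "edens (cc * (3 * B) ^ n) h" and t: "\<bar>t\<bar> <= K"
 shows "edens (cc * (3 / 8) ^ n) (%k. t ^ n *\<^sub>R h k)"
proof -
 have "\<bar>t ^ n\<bar> * (cc * (3 * B) ^ n) <= K ^ n * (cc * (3 * B) ^ n)"
  using t cc_nonneg B_ge by (intro mult_right_mono) (auto simp: power_abs intro: power_mono)
 also have "... = cc * (K * (3 * B)) ^ n" by (simp add: power_mult_distrib)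
 also have "K * (3 * B) = 3 / 8" using B_ge by (simp add: K_def)
 finally show ?thesis by (rule edens_mono[OF edens_scaleR[OF h, of "t ^ n"]])
qed

lemma g_series:
 assumes t: "\<bar>t\<bar> <= K"
 shows "edens CC (gt t)" (is ?g1) and "!!k. summable (%n. norm (t ^ n *\<^sub>R g n k))"
  and "(%n. t ^ n *\<^sub>R hart (g n) x) sums u t x" (is ?g3)
  and "(%n. t ^ n *\<^sub>R hart (dirmult v (g n)) x) sums hart (dirmult v (gt t)) x" (is ?g4)
proof -
 note S = edens_series[OF edens_power[OF edens_g t] cc_summable]
 have gt: "gt t = (%k. \<Sum>n. t ^ n *\<^sub>R g n k)" by (simp add: gt_def fun_eq_iff)
 show ?g1 unfolding gt CC_def by (rule S(1))
 show "!!k. summable (%n. norm (t ^ n *\<^sub>R g n k))" by (rule S(2))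
 have r: "rapid (g n)" for n by (rule edens_rapid[OF edens_g])
 show ?g3 using S(3)[of x] unfolding gt[symmetric] u_def by (simp add: hart_scaleR[OF rapid_integrable[OF r]])
 have d: "dirmult v (%k. t ^ n *\<^sub>R g n k) = (%k. t ^ n *\<^sub>R dirmult v (g n) k)" for n by (simp add: dirmult_def fun_eq_iff)
 show ?g4 using S(4)[of v x] unfolding gt[symmetric] d by (simp add: hart_scaleR[OF rapid_integrable[OF rapid_dirmult[OF r]]])
qed

lemma f_series:
 assumes t: "\<bar>t\<bar> <= K"
 shows "edens CC (ft t)" (is ?g1) and "!!k. summable (%n. norm (t ^ n *\<^sub>R f n k))"
  and "(%n. t ^ n *\<^sub>R hart (f n) x) sums hart (ft t) x" (is ?g3)
proof -
 note S = edens_series[OF edens_power[OF edens_f t] cc_summable]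
 have ft: "ft t = (%k. \<Sum>n. t ^ n *\<^sub>R f n k)" by (simp add: ft_def fun_eq_iff)
 show ?g1 unfolding ft CC_def by (rule S(1))
 show "!!k. summable (%n. norm (t ^ n *\<^sub>R f n k))" by (rule S(2))
 have r: "rapid (f n)" for n by (rule edens_rapid[OF edens_f])
 show ?g3 using S(3)[of x] unfolding ft[symmetric] by (simp add: hart_scaleR[OF rapid_integrable[OF r]])
qed

lemma gt_div: "\<bar>t\<bar> <= K ==> k \<bullet> gt t k = 0"
proof -
 assume t: "\<bar>t\<bar> <= K"
 have "(%n. k \<bullet> (t ^ n *\<^sub>R g n k)) sums (k \<bullet> gt t k)" unfolding gt_def
  by (rule bounded_linear.sums[OF bounded_linear_inner_right summable_sums[OF summable_norm_cancel[OF g_series(2)[OF t]]]])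
 then show ?thesis by (simp add: g_div sums_iff)
qed

lemma hart_f:
 "hart (f n) x = \<Omega> *\<^sub>R cross3 e3 (hart (g n) x) + (\<Sum>j\<le>n. hart (dirmult (hart (g j) x) (g (n - j))) x)"
proof -
 have r: "rapid (g n)" for n by (rule edens_rapid[OF edens_g])
 have ba: "band (\<eta> * (real j + 1) + \<eta> * (real (n - j) + 1)) (advm (g j) (g (n - j)))" for j
  using advm_bounds(3)[OF g_band g_band] eta by simp
 have i1: "integrable lborel (%k. \<Omega> *\<^sub>R cross3 e3 (g n k))"
  by (rule integrable_bounded_linear[OF bounded_linear_cross_e3 rapid_integrable[OF r]])
 have i2: "integrable lborel (advm (g j) (g (n - j)))" for j by (rule rapid_integrable[OF band_rapid[OF ba]])
 have "hart (f n) x = hart (%k. \<Omega> *\<^sub>R cross3 e3 (g n k) + (\<Sum>j\<le>n. advm (g j) (g (n - j)) k)) x" by (simp add: fs_def[abs_def])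
 also have "... = hart (%k. \<Omega> *\<^sub>R cross3 e3 (g n k)) x + hart (%k. \<Sum>j\<le>n. advm (g j) (g (n - j)) k) x"
  by (rule hart_add[OF i1]) (use i2 in auto)
 also have "hart (%k. \<Omega> *\<^sub>R cross3 e3 (g n k)) x = \<Omega> *\<^sub>R cross3 e3 (hart (g n) x)"
  by (rule hart_bounded_linear[OF bounded_linear_cross_e3 rapid_integrable[OF r]])
 also have "hart (%k. \<Sum>j\<le>n. advm (g j) (g (n - j)) k) x = (\<Sum>j\<le>n. hart (advm (g j) (g (n - j))) x)"
  unfolding hart_def scaleR_sum_right by (rule Bochner_Integration.integral_sum) (rule integrable_cas[OF i2])
 also have "... = (\<Sum>j\<le>n. hart (dirmult (hart (g j) x) (g (n - j))) x)"
  by (intro sum.cong refl hart_advm[OF g_band g_band] g_div) (use eta in auto)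
 finally show ?thesis .
qed

text \<open>Summation in \<open>n\<close>: the convolution over \<open>j\<close> in the recursion becomes the Cauchy product of the
 series of \<open>u\<close> and of its derivative.\<close>
lemma hart_ft:
 assumes t: "\<bar>t\<bar> <= K"
 shows "hart (ft t) x = \<Omega> *\<^sub>R cross3 e3 (u t x) + hart (dirmult (u t x) (gt t)) x"
proof -
 have r: "rapid (g n)" for n by (rule edens_rapid[OF edens_g])
 have rt: "rapid (gt t)" by (rule edens_rapid[OF g_series(1)[OF t]])
 define U where "U i n = t ^ n * hart (g n) x $ i" for i n
 define D where "D i c n = t ^ n * hart (dirmult (axis i 1) (g n)) x $ c" for i c n
 have eq: "t ^ n *\<^sub>R hart h x = hart (%k. t ^ n *\<^sub>R h k) x" if "rapid h" for h :: "real^3 => real^3" and n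
  by (rule hart_scaleR[OF rapid_integrable[OF that], symmetric])
 have sU: "summable (%n. norm (U i n))" for i
 proof (rule summable_comparison_test'[OF summable_mult[OF cc_summable, of "2 * W0"]])
  fix n :: nat
  have "norm (U i n) = \<bar>(t ^ n *\<^sub>R hart (g n) x) $ i\<bar>" by (simp add: U_def)
  also have "... <= norm (t ^ n *\<^sub>R hart (g n) x)" by (rule component_le_norm_cart)
  also have "... <= 2 * W0 * (cc * (3 / 8) ^ n)" unfolding eq[OF r] by (rule edens_hart_bounds(1)[OF edens_power[OF edens_g t]])
  finally show "norm (norm (U i n)) <= 2 * W0 * (cc * (3 / 8) ^ n)" by simp
 qed
 have sD: "summable (%n. norm (D i c n))" for i c
 proof (rule summable_comparison_test'[OF summable_mult[OF cc_summable, of "2 * W1"]])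
  fix n :: nat
  have d: "(%k. t ^ n *\<^sub>R dirmult (axis i 1) (g n) k) = dirmult (axis i 1) (%k. t ^ n *\<^sub>R g n k)" by (simp add: dirmult_def fun_eq_iff)
  have "norm (D i c n) = \<bar>(t ^ n *\<^sub>R hart (dirmult (axis i 1) (g n)) x) $ c\<bar>" by (simp add: D_def)
  also have "... <= norm (t ^ n *\<^sub>R hart (dirmult (axis i 1) (g n)) x)" by (rule component_le_norm_cart)
  also have "... <= 2 * W1 * norm (axis i 1 :: real^3) * (cc * (3 / 8) ^ n)"
   unfolding eq[OF rapid_dirmult[OF r]] d by (rule edens_hart_bounds(2)[OF edens_power[OF edens_g t]])
  finally show "norm (norm (D i c n)) <= 2 * W1 * (cc * (3 / 8) ^ n)" by simp
 qed
 have lU: "(\<Sum>n. U i n) = u t x $ i" for i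
  using bounded_linear.sums[OF bounded_linear_vec_nth[of i] g_series(3)[OF t, of x]] by (simp add: U_def sums_iff)
 have lD: "(\<Sum>n. D i c n) = hart (dirmult (axis i 1) (gt t)) x $ c" for i c
  using bounded_linear.sums[OF bounded_linear_vec_nth[of c] g_series(4)[OF t, of "axis i 1" x]] by (simp add: D_def sums_iff)
 have conv: "(%n. \<Sum>j\<le>n. U i j * D i c (n - j)) sums (u t x $ i * hart (dirmult (axis i 1) (gt t)) x $ c)" for i c
  using Cauchy_product_sums[OF sU[of i] sD[of i c]] by (simp add: lU lD)
 have "hart (ft t) x $ c = (\<Omega> *\<^sub>R cross3 e3 (u t x) + hart (dirmult (u t x) (gt t)) x) $ c" for c
 proof -
  have 1: "(%n. (t ^ n *\<^sub>R hart (f n) x) $ c) sums (hart (ft t) x $ c)"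
   by (rule bounded_linear.sums[OF bounded_linear_vec_nth f_series(3)[OF t]])
  have "(%n. \<Omega> *\<^sub>R cross3 e3 (t ^ n *\<^sub>R hart (g n) x)) sums (\<Omega> *\<^sub>R cross3 e3 (u t x))"
   by (rule bounded_linear.sums[OF bounded_linear_cross_e3 g_series(3)[OF t]])
  then have 2: "(%n. (\<Omega> *\<^sub>R cross3 e3 (t ^ n *\<^sub>R hart (g n) x)) $ c) sums ((\<Omega> *\<^sub>R cross3 e3 (u t x)) $ c)"
   by (rule bounded_linear.sums[OF bounded_linear_vec_nth])
  have 3: "(%n. \<Sum>i\<in>UNIV. \<Sum>j\<le>n. U i j * D i c (n - j)) sums (\<Sum>i\<in>UNIV. u t x $ i * hart (dirmult (axis i 1) (gt t)) x $ c)"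
   by (rule sums_sum) (rule conv)
  have "(t ^ n *\<^sub>R hart (f n) x) $ c = (\<Omega> *\<^sub>R cross3 e3 (t ^ n *\<^sub>R hart (g n) x)) $ c + (\<Sum>i\<in>UNIV. \<Sum>j\<le>n. U i j * D i c (n - j))" for n
  proof -
   have "t ^ n * (\<Sum>j\<le>n. hart (dirmult (hart (g j) x) (g (n - j))) x) $ c = (\<Sum>j\<le>n. \<Sum>i\<in>UNIV. U i j * D i c (n - j))"
    unfolding sum_component sum_distrib_left
   proof (rule sum.cong[OF refl])
    fix j assume "j \<in> {..n}"
    then have "t ^ n = t ^ j * t ^ (n - j)" by (simp flip: power_add)
    then show "t ^ n * hart (dirmult (hart (g j) x) (g (n - j))) x $ c = (\<Sum>i\<in>UNIV. U i j * D i c (n - j))"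
     unfolding hart_dirmult_linear[OF r, of "hart (g j) x"] by (simp add: U_def D_def sum_distrib_left mult_ac)
   qed
   also have "... = (\<Sum>i\<in>UNIV. \<Sum>j\<le>n. U i j * D i c (n - j))" by (rule sum.swap)
   finally show ?thesis unfolding hart_f[of n x]
    using linear_simps(5)[OF bounded_linear_cross_e3[of 1], of "t ^ n" "hart (g n) x"] by (simp add: distrib_left)
  qed
  then have "(%n. (t ^ n *\<^sub>R hart (f n) x) $ c) sums ((\<Omega> *\<^sub>R cross3 e3 (u t x)) $ c + (\<Sum>i\<in>UNIV. u t x $ i * hart (dirmult (axis i 1) (gt t)) x $ c))"
   using sums_add[OF 2 3] by simp
  from sums_unique2[OF 1 this] show ?thesis unfolding hart_dirmult_linear[OF rt, of "u t x"] by simp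
 qed
 then show ?thesis by (simp add: vec_eq_iff)
qed

text \<open>Termwise: \<open>t^n - s^n\<close> is at most \<open>n |t - s| T^(n-1)\<close>, and \<open>T = K / 2\<close> makes up for the factor \<open>n\<close>.\<close>
lemma gt_continuous:
 assumes t: "\<bar>t\<bar> <= T" and s: "\<bar>s\<bar> <= T"
 shows "edens (2 / K * CC * \<bar>t - s\<bar>) (%k. gt t k - gt s k)"
proof -
 have tK: "\<bar>t\<bar> <= K" "\<bar>s\<bar> <= K" using t s KT by auto
 have pw: "\<bar>t ^ n - s ^ n\<bar> <= \<bar>t - s\<bar> * (2 / K) * K ^ n" for n
 proof (cases n)
  case (Suc m)
  have "\<bar>\<Sum>i<n. s ^ (n - Suc i) * t ^ i\<bar> <= (\<Sum>i<n. T ^ m)"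
  proof (rule order_trans[OF sum_abs], rule sum_mono)
   fix i assume i: "i \<in> {..<n}"
   have "\<bar>s ^ (n - Suc i) * t ^ i\<bar> <= T ^ (n - Suc i) * T ^ i"
    unfolding abs_mult power_abs using t s KT by (intro mult_mono power_mono) auto
   also have "... = T ^ m" using i Suc by (simp flip: power_add)
   finally show "\<bar>s ^ (n - Suc i) * t ^ i\<bar> <= T ^ m" .
  qed
  also have "... = real n * T ^ m" by simp
  also have "real n * T ^ m <= 2 * K ^ m"
  proof -
   have "n <= 2 ^ n" using less_exp[of n] by simp
   then have "real n <= 2 ^ n" by (metis of_nat_le_iff of_nat_numeral of_nat_power)
   then have "real n * T ^ m <= 2 ^ n * T ^ m" using KT by (intro mult_right_mono) auto
   also have "... = 2 * K ^ m" unfolding Suc KT(3) by (simp add: power_divide)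
   finally show ?thesis .
  qed
  finally have "\<bar>t - s\<bar> * \<bar>\<Sum>i<n. s ^ (n - Suc i) * t ^ i\<bar> <= \<bar>t - s\<bar> * (2 * K ^ m)" by (intro mult_left_mono) auto
  then show ?thesis using KT(1) unfolding power_diff_sumr2[of t n s] by (simp add: abs_mult Suc)
 qed (use KT in simp)
 define c where "c n = \<bar>t - s\<bar> * (2 / K) * (cc * (3 / 8) ^ n)" for n
 have e: "edens (c n) (%k. (t ^ n - s ^ n) *\<^sub>R g n k)" for n
 proof -
  have "\<bar>t ^ n - s ^ n\<bar> * (cc * (3 * B) ^ n) <= \<bar>t - s\<bar> * (2 / K) * K ^ n * (cc * (3 * B) ^ n)"
   using pw cc_nonneg B_ge by (intro mult_right_mono) auto
  also have "... = \<bar>t - s\<bar> * (2 / K) * (cc * (K * (3 * B)) ^ n)" by (simp add: power_mult_distrib)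
  also have "K * (3 * B) = 3 / 8" using B_ge by (simp add: K_def)
  finally show ?thesis unfolding c_def by (rule edens_mono[OF edens_scaleR[OF edens_g]])
 qed
 have "summable c" unfolding c_def by (intro summable_mult cc_summable)
 from edens_series(1)[OF e this]
 have "edens (suminf c) (%k. \<Sum>n. (t ^ n - s ^ n) *\<^sub>R g n k)" .
 moreover have "suminf c = 2 / K * CC * \<bar>t - s\<bar>" unfolding c_def CC_def by (subst suminf_mult[OF cc_summable]) (simp add: mult_ac)
 moreover have "(\<Sum>n. (t ^ n - s ^ n) *\<^sub>R g n k) = gt t k - gt s k" for k unfolding gt_def scaleR_diff_left
  by (rule suminf_diff[symmetric]; rule summable_norm_cancel; rule g_series(2); rule tK)
 ultimately show ?thesis by simp
qed

definition "Pf t k = ft t k - gradm k (ft t k)"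

text \<open>Tested against a fixed field, the solution is a power series in time, and the recursion
 defining the coefficients says that its derivative is the tested right-hand side.\<close>
lemma weak_equation:
 assumes \<phi>: "test_fun \<phi>"
 shows "continuous_on {0..T} (%s. LBINT x. hart (Pf s) x \<bullet> \<phi> x)" (is ?g1)
  and "!!t. t \<in> {0..T} ==> (LBINT x. u t x \<bullet> \<phi> x) = (LBINT x. u 0 x \<bullet> \<phi> x)
    - (LBINT s. indicator {0..t} s *\<^sub>R (LBINT x. hart (Pf s) x \<bullet> \<phi> x))"
proof -
 define m where "m n = (LBINT x. hart (g n) x \<bullet> \<phi> x)" for n
 have r: "rapid (g n)" "rapid (f n)" for n using edens_rapid edens_g edens_f by blast+
 have hs: "(LBINT x. hart (%k. c *\<^sub>R h k) x \<bullet> \<phi> x) = c * (LBINT x. hart h x \<bullet> \<phi> x)" if "rapid h" for c and h :: "real^3 => real^3"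
  by (simp add: hart_scaleR[OF rapid_integrable[OF that]])
 have mu: "(%n. m n * t ^ n) sums (LBINT x. u t x \<bullet> \<phi> x)" if t: "\<bar>t\<bar> <= K" for t
  using hart_test_sums[OF edens_power[OF edens_g t] cc_summable \<phi>] by (simp add: hs[OF r(1)] m_def u_def gt_def[abs_def] mult.commute)
 have mP: "(%n. - (diffs m n * t ^ n)) sums (LBINT x. hart (Pf t) x \<bullet> \<phi> x)" if t: "\<bar>t\<bar> <= K" for t
 proof -
  have e: "edens (2 * (cc * (3 / 8) ^ n)) (%k. t ^ n *\<^sub>R f n k - gradm k (t ^ n *\<^sub>R f n k))" for n
   by (rule edens_leray[OF edens_power[OF edens_f t]])
  have "(%n. LBINT x. hart (%k. t ^ n *\<^sub>R f n k - gradm k (t ^ n *\<^sub>R f n k)) x \<bullet> \<phi> x) sums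
    (LBINT x. hart (%k. \<Sum>n. t ^ n *\<^sub>R f n k - gradm k (t ^ n *\<^sub>R f n k)) x \<bullet> \<phi> x)"
   by (rule hart_test_sums[OF e summable_mult[OF cc_summable] \<phi>])
  moreover have "(%k. \<Sum>n. t ^ n *\<^sub>R f n k - gradm k (t ^ n *\<^sub>R f n k)) = Pf t"
  proof
   fix k
   have s: "(%n. t ^ n *\<^sub>R f n k) sums ft t k" unfolding ft_def by (rule summable_sums[OF summable_norm_cancel[OF f_series(2)[OF t]]])
   from sums_diff[OF s bounded_linear.sums[OF gradm_linear[of k] s]]
   show "(\<Sum>n. t ^ n *\<^sub>R f n k - gradm k (t ^ n *\<^sub>R f n k)) = Pf t k" by (simp add: sums_iff Pf_def)
  qed
  moreover have "(LBINT x. hart (%k. t ^ n *\<^sub>R f n k - gradm k (t ^ n *\<^sub>R f n k)) x \<bullet> \<phi> x) = - (diffs m n * t ^ n)" for n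
  proof -
   have "(%k. t ^ n *\<^sub>R f n k - gradm k (t ^ n *\<^sub>R f n k)) = (%k. (- (t ^ n * real (Suc n))) *\<^sub>R g (Suc n) k)"
   proof
    fix k
    have "t ^ n *\<^sub>R f n k - gradm k (t ^ n *\<^sub>R f n k) = t ^ n *\<^sub>R (f n k - gradm k (f n k))"
     using linear_simps(5)[OF gradm_linear[of k]] by (simp add: scaleR_diff_right)
    also have "f n k - gradm k (f n k) = (- real (Suc n)) *\<^sub>R g (Suc n) k"
    proof -
     have "(- real (Suc n)) * (- (1 / real (Suc n))) = 1" by (simp del: of_nat_Suc)
     then show ?thesis unfolding gs_Suc scaleR_scaleR by (simp only: scaleR_one)
    qed
    finally show "t ^ n *\<^sub>R f n k - gradm k (t ^ n *\<^sub>R f n k) = (- (t ^ n * real (Suc n))) *\<^sub>R g (Suc n) k"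
     by (simp only: scaleR_scaleR mult_minus_right)
   qed
   then show ?thesis by (simp only: hs[OF r(1)]) (simp add: m_def diffs_def)
  qed
  ultimately show ?thesis by simp
 qed
 define M where "M t = (\<Sum>n. m n * t ^ n)" for t
 define M' where "M' t = (\<Sum>n. diffs m n * t ^ n)" for t
 have MK: "summable (%n. m n * K ^ n)" using mu[of K] KT by (simp add: sums_iff)
 have Mu: "M t = (LBINT x. u t x \<bullet> \<phi> x)" if "\<bar>t\<bar> <= K" for t using mu[OF that] by (simp add: M_def sums_iff)
 have MP: "M' t = - (LBINT x. hart (Pf t) x \<bullet> \<phi> x)" if "\<bar>t\<bar> <= K" for t
  using sums_minus[OF mP[OF that]] by (simp add: M'_def sums_iff)
 have D: "(M has_real_derivative M' t) (at t)" if "\<bar>t\<bar> < K" for t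
  unfolding M_def[abs_def] M'_def by (rule termdiffs_strong[OF MK]) (use that KT in simp)
 have cont: "continuous_on {0..T} M'"
 proof (rule continuous_at_imp_continuous_on, rule ballI)
  fix t assume t: "t \<in> {0..T}"
  define L where "L = 3 / 4 * K"
  have sL: "summable (%n. diffs m n * L ^ n)" using sums_minus[OF mP[of L]] KT by (simp add: L_def sums_iff)
  show "isCont M' t" unfolding M'_def[abs_def] by (rule isCont_powser[OF sL]) (use t KT in "simp add: L_def")
 qed
 have ev: "(LBINT x. hart (Pf s) x \<bullet> \<phi> x) = - M' s" if "s \<in> {0..T}" for s using MP[of s] that KT by simp
 show ?g1 using continuous_on_minus[OF cont] by (rule continuous_on_eq) (use ev in simp)
 fix t assume t: "t \<in> {0..T}"
 have "(LBINT s. indicator {0..t} s *\<^sub>R M' s) = M t - M 0"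
 proof (rule integral_FTC_Icc)
  show "0 <= t" using t by simp
  show "continuous_on {0..t} M'" by (rule continuous_on_subset[OF cont]) (use t in auto)
  fix s assume "0 <= s" "s <= t"
  then have "\<bar>s\<bar> < K" using t KT by auto
  from D[OF this] show "(M has_vector_derivative M' s) (at s within {0..t})"
   by (simp add: has_real_derivative_iff_has_vector_derivative has_vector_derivative_at_within)
 qed
 moreover have "(LBINT s. indicator {0..t} s *\<^sub>R (LBINT x. hart (Pf s) x \<bullet> \<phi> x)) = (LBINT s. - (indicator {0..t} s *\<^sub>R M' s))"
  by (intro Bochner_Integration.integral_cong refl) (use ev t in "auto simp: indicator_def")
 ultimately show "(LBINT x. u t x \<bullet> \<phi> x) = (LBINT x. u 0 x \<bullet> \<phi> x)
    - (LBINT s. indicator {0..t} s *\<^sub>R (LBINT x. hart (Pf s) x \<bullet> \<phi> x))" using Mu[of t] Mu[of 0] t KT by simp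
qed

lemma gt_0: "gt 0 = g0"
proof
 fix k
 have "(%n. (0::real) ^ n *\<^sub>R g n k) = (%n. if n = 0 then g0 k else 0)" by (auto simp: fun_eq_iff)
 then show "gt 0 k = g0 k" using sums_single[of 0 "%_. g0 k"] by (simp add: gt_def sums_iff)
qed

text \<open>The linear term of the time series is the projected Coriolis force and the projected nonlinearity of the
initial datum. The latter is quadratic in \<open>a\<close> but carries a derivative, hence a factor \<open>\<eta>\<close>; the terms from the
second order on form a geometric series.\<close>
lemma first_order:
 assumes t: "t \<in> {0..T}"
 shows "norm (u t x - hart g0 x + (t * \<Omega>) *\<^sub>R hart (%k. cross3 e3 (g0 k) - gradm k (cross3 e3 (g0 k))) x)
  <= 4 * a * (B * t)^2 + 16 * t * \<eta> * a^2"
proof -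
 have tK: "\<bar>t\<bar> <= K" using t KT by auto
 have r: "rapid (g n)" for n by (rule edens_rapid[OF edens_g])
 have Bt: "0 <= B * t" "B * t <= 1 / 2" using t B_ge by (auto simp: T_def field_simps)
 have s: "(%n. t ^ n *\<^sub>R hart (g n) x) sums u t x" by (rule g_series(3)[OF tK])
 have le: "norm (t ^ n *\<^sub>R hart (g n) x) <= 2 * a * (B * t) ^ n" for n
 proof -
  have "norm (hart (g n) x) <= 2 * (a * B ^ n)"
   using norm_hart_le[OF rapid_integrable[OF r], of n x] g_L1[of n] mult_left_mono[OF q_le_power[of n] ab(1)] by linarith
  then have "t ^ n * norm (hart (g n) x) <= t ^ n * (2 * (a * B ^ n))" using t by (intro mult_left_mono) auto
  then show ?thesis using t by (simp add: power_mult_distrib mult_ac)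
 qed
 have geo: "(%n. 2 * a * (B * t) ^ (n + 2)) sums (2 * a * (B * t)^2 * (1 / (1 - B * t)))"
 proof -
  have "(%n. (B * t) ^ n) sums (1 / (1 - B * t))" using Bt by (intro geometric_sums) auto
  from sums_mult[OF this, of "2 * a * (B * t)^2"] show ?thesis by (simp add: power_add power2_eq_square mult_ac)
 qed
 have s2: "(%n. t ^ (n + 2) *\<^sub>R hart (g (n + 2)) x) sums (u t x - (hart g0 x + t *\<^sub>R hart (g 1) x))"
  using sums_split_initial_segment[OF s, of 2] by (simp add: numeral_2_eq_2)
 have sn: "summable (%n. norm (t ^ (n + 2) *\<^sub>R hart (g (n + 2)) x))"
  by (rule summable_comparison_test'[OF sums_summable[OF geo]]) (use le[of "_ + 2"] in auto)
 have "norm (u t x - (hart g0 x + t *\<^sub>R hart (g 1) x)) <= (\<Sum>n. norm (t ^ (n + 2) *\<^sub>R hart (g (n + 2)) x))"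
  using summable_norm[OF sn] s2 by (simp add: sums_iff)
 also have "... <= 2 * a * (B * t)^2 * (1 / (1 - B * t))" using suminf_le[OF le[of "_ + 2"] sn sums_summable[OF geo]] geo by (simp add: sums_iff)
 also have "... <= 2 * a * (B * t)^2 * 2" using Bt ab by (intro mult_left_mono) (auto simp: divide_le_eq)
 finally have 1: "norm (u t x - (hart g0 x + t *\<^sub>R hart (g 1) x)) <= 4 * a * (B * t)^2" by simp
 define C where "C k = cross3 e3 (g0 k)" for k
 define N where "N = advm g0 g0"
 have r0: "rapid g0" using r[of 0] by simp
 have mC: "C \<in> borel_measurable borel" unfolding C_def[abs_def] using rapid_measurable[OF r0] by measurable
 have rC: "rapid C" by (rule rapid_bound[OF r0 mC, where C=1 and j=0]) (simp add: C_def norm_cross_e3)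
 have bN: "band (\<eta> + \<eta>) N" unfolding N_def by (rule advm_bounds(3)[OF g0_band g0_band]) (use eta in auto)
 have rN: "rapid N" by (rule band_rapid[OF bN])
 note iC = rapid_integrable[OF rC] rapid_integrable[OF rapid_gradm[OF rC]]
 note iN = rapid_integrable[OF rN] rapid_integrable[OF rapid_gradm[OF rN]]
 have g1: "g 1 = (%k. (- \<Omega>) *\<^sub>R (C k - gradm k (C k)) - (N k - gradm k (N k)))"
 proof
  fix k
  have "g (Suc 0) k = - (f 0 k - gradm k (f 0 k))" unfolding gs_Suc by simp
  moreover have "f 0 k = \<Omega> *\<^sub>R C k + N k" by (simp add: fs_def C_def N_def)
  moreover have "gradm k (\<Omega> *\<^sub>R C k + N k) = \<Omega> *\<^sub>R gradm k (C k) + gradm k (N k)"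
   using linear_simps(1,5)[OF gradm_linear[of k]] by simp
  ultimately show "g 1 k = (- \<Omega>) *\<^sub>R (C k - gradm k (C k)) - (N k - gradm k (N k))" by (simp add: algebra_simps)
 qed
 have h1: "hart (g 1) x = (- \<Omega>) *\<^sub>R hart (%k. C k - gradm k (C k)) x - hart (%k. N k - gradm k (N k)) x" unfolding g1 using iC iN
  by (subst hart_diff) (auto intro!: integrable_scaleR_right Bochner_Integration.integrable_diff simp: hart_scaleR simp del: scaleR_minus_left)
 have n1: "norm (hart (%k. N k - gradm k (N k)) x) <= 16 * \<eta> * a^2"
 proof -
  have "(LBINT k. norm (N k - gradm k (N k))) <= (LBINT k. 2 * norm (N k))"
  proof (rule integral_mono)
   show "norm (N k - gradm k (N k)) <= 2 * norm (N k)" for k using norm_triangle_ineq4[of "N k" "gradm k (N k)"] norm_gradm[of k "N k"] by simp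
  qed (use iN in auto)
  also have "... <= 2 * (2 * (\<eta> + \<eta>) * (LBINT k. norm (g0 k)) * (LBINT k. norm (g0 k)))"
   using advm_bounds(4)[OF g0_band g0_band] eta by (simp add: N_def)
  also have "... <= 2 * (2 * (\<eta> + \<eta>) * a * a)" using eta ab g0_L1 by (intro mult_left_mono mult_mono) auto
  finally show ?thesis using norm_hart_le[of "%k. N k - gradm k (N k)" x] iN by (simp add: power2_eq_square)
 qed
 have "u t x - hart g0 x + (t * \<Omega>) *\<^sub>R hart (%k. C k - gradm k (C k)) x
   = (u t x - (hart g0 x + t *\<^sub>R hart (g 1) x)) - t *\<^sub>R hart (%k. N k - gradm k (N k)) x" unfolding h1 by (simp add: algebra_simps)
 also have "norm ... <= 4 * a * (B * t)^2 + t * (16 * \<eta> * a^2)"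
  using norm_triangle_ineq4[of "u t x - (hart g0 x + t *\<^sub>R hart (g 1) x)" "t *\<^sub>R hart (%k. N k - gradm k (N k)) x"]
   1 mult_left_mono[OF n1, of t] t by simp
 finally show ?thesis by (simp add: C_def mult_ac)
qed

end

section \<open>The Banach space of the solutions\<close>

text \<open>Solenoidal fields with density bounded by \<open>M |k| exp (- |k|)\<close>. Estimates are stated with an explicit
admissible \<open>M\<close>, since the infimum \<open>YN\<close> is not known to be attained.\<close>
definition Yd :: "real => vfield => bool" where
 "Yd M f \<longleftrightarrow> (\<exists>g. edens M g \<and> (\<forall>k. k \<bullet> g k = 0) \<and> f = hart g)"

definition YS :: "vfield set" where "YS = {f. \<exists>M. Yd M f}"

definition YN :: "vfield => real" where "YN f = Inf {M. Yd M f}"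

lemma Yd_nonneg: "Yd M f ==> 0 <= M" by (auto simp: Yd_def edens_def)

lemma YN_le: "Yd M f ==> YN f <= M" unfolding YN_def by (rule cInf_lower) (auto intro: bdd_belowI[of _ 0] dest: Yd_nonneg)

lemma YN_nonneg: "f \<in> YS ==> 0 <= YN f" unfolding YN_def YS_def by (rule cInf_greatest) (auto dest: Yd_nonneg)

lemma YN_less: assumes "f \<in> YS" "YN f < M" shows "Yd M f"
proof -
 have "{M. Yd M f} \<noteq> {}" using assms(1) by (auto simp: YS_def)
 from cInf_lessD[OF this assms(2)[unfolded YN_def]] obtain N where "Yd N f" "N < M" by blast
 then show ?thesis unfolding Yd_def using edens_mono by (metis less_imp_le)
qed

lemma YN_greatest: "f \<in> YS ==> (!!M. Yd M f ==> c <= M) ==> c <= YN f" unfolding YN_def YS_def by (rule cInf_greatest) auto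

lemma Yd_zero: "Yd 0 (%x. 0)" unfolding Yd_def by (rule exI[of _ "%k. 0"]) (auto simp: edens_def hart_def)

lemma Yd_add: assumes "Yd M f" "Yd N h" shows "Yd (M + N) (%x. f x + h x)"
proof -
 obtain g g' where g: "edens M g" "\<forall>k. k \<bullet> g k = 0" "f = hart g" and g': "edens N g'" "\<forall>k. k \<bullet> g' k = 0" "h = hart g'"
  using assms unfolding Yd_def by auto
 show ?thesis unfolding Yd_def by (rule exI[of _ "%k. g k + g' k"])
    (use edens_add[OF g(1) g'(1)] g(2) g'(2) in "auto simp: g(3) g'(3) inner_add_right fun_eq_iff
     hart_add[OF rapid_integrable[OF edens_rapid[OF g(1)]] rapid_integrable[OF edens_rapid[OF g'(1)]]]")
qed

lemma Yd_scaleR: assumes "Yd M f" shows "Yd (\<bar>a\<bar> * M) (%x. a *\<^sub>R f x)"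
proof -
 obtain g where g: "edens M g" "\<forall>k. k \<bullet> g k = 0" "f = hart g" using assms unfolding Yd_def by auto
 show ?thesis unfolding Yd_def by (rule exI[of _ "%k. a *\<^sub>R g k"])
    (use edens_scaleR[OF g(1)] g(2) in "auto simp: g(3) fun_eq_iff hart_scaleR[OF rapid_integrable[OF edens_rapid[OF g(1)]]]")
qed

lemma Yd_diff: assumes "Yd M f" "Yd N h" shows "Yd (M + N) (%x. f x - h x)" using Yd_add[OF assms(1) Yd_scaleR[OF assms(2), of "-1"]] by simp

lemma YS_add: "f \<in> YS ==> h \<in> YS ==> (%x. f x + h x) \<in> YS" unfolding YS_def using Yd_add by blast

lemma YS_diff: "f \<in> YS ==> h \<in> YS ==> (%x. f x - h x) \<in> YS" unfolding YS_def using Yd_diff by blast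

lemma YS_scaleR: "f \<in> YS ==> (%x. a *\<^sub>R f x) \<in> YS" unfolding YS_def using Yd_scaleR by blast

lemma YdD: "Yd M f ==> f \<in> YS" unfolding YS_def by blast

lemma Yd_bound: "Yd M f ==> norm (f x) <= 2 * W0 * M" unfolding Yd_def using edens_hart_bounds(1) by blast

lemma Yd_Ck: "Yd M f ==> Ck k f" unfolding Yd_def using rapid_Ck_hart edens_rapid by blast

lemma Yd_pd_bound: "Yd M f ==> norm (pd i f x) <= 2 * W1 * M"
 unfolding Yd_def using edens_hart_bounds(2)[of M _ "axis i 1" x] by (auto simp: pd_hart[OF edens_rapid])

lemma Yd_norms:
 assumes "Yd M f"
 shows "f \<in> C1b" "f \<in> W1inf" "W1inf_norm f <= (2 * W0 + 18 * W1) * M" "norm (f x) <= W1inf_norm f"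
 using C1_norms[OF Yd_Ck[OF assms, of 1] Yd_bound[OF assms] Yd_pd_bound[OF assms]] by (auto simp: algebra_simps)

lemma continuous_AE_zero:
 fixes f :: vfield
 assumes c: "continuous_on UNIV f" and z: "AE x in lebesgue. f x = 0" shows "f x = 0"
proof (rule ccontr)
 assume n: "f x \<noteq> 0"
 have U: "open {x. f x \<noteq> 0}" using c by (intro open_Collect_neq) auto
 have "{x. f x \<noteq> 0} \<in> null_sets lebesgue" using z U by (subst AE_iff_null_sets) (auto intro: borel_open)
 then have "{x. f x \<noteq> 0} = {}" using open_not_negligible[OF U] by (auto simp: negligible_iff_null_sets)
 then show False using n by simp
qed

lemma Yd_series:
 assumes D: "!!j. Yd (c j) (D j)" and c: "summable c"
 shows "\<exists>h. (\<forall>x. (%j. D j x) sums h x) \<and> Yd (suminf c) h"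
proof -
 have "\<forall>j. \<exists>g. edens (c j) g \<and> (\<forall>k. k \<bullet> g k = 0) \<and> D j = hart g" using D unfolding Yd_def by blast
 then obtain g where g: "!!j. edens (c j) (g j)" "!!j k. k \<bullet> g j k = 0" "!!j. D j = hart (g j)" by metis
 note S = edens_series[OF g(1) c]
 have "k \<bullet> (\<Sum>j. g j k) = 0" for k
 proof -
  have "(%j. k \<bullet> g j k) sums (k \<bullet> (\<Sum>j. g j k))"
   by (rule bounded_linear.sums[OF bounded_linear_inner_right summable_sums[OF summable_norm_cancel[OF S(2)]]])
  then show ?thesis by (simp add: g(2) sums_iff)
 qed
 then have "Yd (suminf c) (hart (%k. \<Sum>j. g j k))" unfolding Yd_def using S(1) by blast
 then show ?thesis using S(3) unfolding g(3) by blast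
qed

text \<open>Completeness: a subsequence with increments below \<open>2^(- j)\<close> has absolutely convergent densities, whose
sum is the density of the limit.\<close>
lemma banach_fields_Y: "banach_fields YS YN" unfolding banach_fields_def
proof (intro conjI ballI allI impI)
 show "(%x. 0) \<in> YS" using Yd_zero by (auto simp: YS_def)
next
 fix f g assume f: "f \<in> YS" and g: "g \<in> YS"
 then show s: "(%x. f x + g x) \<in> YS" by (rule YS_add)
 show "YN (%x. f x + g x) <= YN f + YN g"
 proof (rule field_le_epsilon)
  fix e :: real assume "e > 0"
  then have "Yd (YN f + e / 2) f" "Yd (YN g + e / 2) g" using f g by (auto intro: YN_less)
  from YN_le[OF Yd_add[OF this]] show "YN (%x. f x + g x) <= YN f + YN g + e" by simp
 qed
next
 fix f and a :: real assume f: "f \<in> YS"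
 show s: "(%x. a *\<^sub>R f x) \<in> YS" for a using YS_scaleR[OF f] .
 have le: "YN (%x. a *\<^sub>R f x) <= \<bar>a\<bar> * YN f" if f: "f \<in> YS" for a :: real and f
 proof (cases "a = 0")
  case True then show ?thesis using YN_le[OF Yd_zero] by simp
 next
  case False
  have "YN (%x. a *\<^sub>R f x) / \<bar>a\<bar> <= YN f"
   by (rule YN_greatest[OF f]) (use YN_le[OF Yd_scaleR] False in "simp add: divide_le_eq mult.commute")
  then show ?thesis using False by (simp add: divide_le_eq mult.commute)
 qed
 show "YN (%x. a *\<^sub>R f x) = \<bar>a\<bar> * YN f"
 proof (cases "a = 0")
  case True
  then show ?thesis using YN_le[OF Yd_zero] YN_nonneg[OF s[of 0]] by simp
 next
  case False
  have "YN f <= \<bar>1 / a\<bar> * YN (%x. a *\<^sub>R f x)" using le[OF s[of a], of "1 / a"] False by simp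
  then have "\<bar>a\<bar> * YN f <= YN (%x. a *\<^sub>R f x)" using False by (simp add: field_simps)
  then show ?thesis using le[OF f, of a] by simp
 qed
next
 fix f assume f: "f \<in> YS"
 show "0 <= YN f" by (rule YN_nonneg[OF f])
 obtain M where M: "Yd M f" using f by (auto simp: YS_def)
 show "(YN f = 0) = (AE x in lebesgue. f x = 0)"
 proof
  assume "YN f = 0"
  then have "Yd e f" if "e > 0" for e using YN_less[OF f] that by simp
  then have b: "norm (f x) <= 2 * W0 * e" if "e > 0" for e x using Yd_bound that by blast
  have "norm (f x) <= 0" for x
  proof (rule field_le_epsilon)
   fix e :: real assume e: "e > 0"
   have "2 * W0 * (e / (2 * W0 + 1)) <= e" using e W_nonneg(1) by (simp add: divide_le_eq mult.commute mult_left_mono)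
   moreover have "e / (2 * W0 + 1) > 0" using e W_nonneg(1) by simp
   ultimately show "norm (f x) <= 0 + e" using b[of "e / (2 * W0 + 1)" x] by linarith
  qed
  then show "AE x in lebesgue. f x = 0" by simp
 next
  assume z: "AE x in lebesgue. f x = 0"
  have "f x = 0" for x by (rule continuous_AE_zero[OF Ck_continuous[OF Yd_Ck[OF M, of 0]] z])
  then have "f = (%x. 0)" by auto
  then have "YN f <= 0" using YN_le[OF Yd_zero] by simp
  then show "YN f = 0" using YN_nonneg[OF f] by simp
 qed
next
 fix F :: "nat => vfield"
 assume A: "(\<forall>n. F n \<in> YS) \<and> (\<forall>e>0. \<exists>n0. \<forall>m\<ge>n0. \<forall>n\<ge>n0. YN (%x. F m x - F n x) < e)"
 have FS: "(%x. F m x - F n x) \<in> YS" for m n using A YS_diff by blast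
 have "\<exists>n0. \<forall>m\<ge>n0. \<forall>n\<ge>n0. YN (%x. F m x - F n x) < (1 / 2) ^ j" for j :: nat using A by simp
 then obtain r0 where r0: "!!j m n. m >= r0 j ==> n >= r0 j ==> YN (%x. F m x - F n x) < (1 / 2) ^ j" by metis
 define r where "r j = (\<Sum>i\<le>j. r0 i)" for j
 have rr0: "r j >= r0 j" for j unfolding r_def by (rule member_le_sum) auto
 have rS: "r (Suc j) >= r0 j" for j unfolding r_def by (rule member_le_sum) auto
 have rY: "Yd ((1 / 2) ^ j) (%x. F m x - F n x)" if "m >= r0 j" "n >= r0 j" for j m n by (rule YN_less[OF FS r0[OF that]])
 define D where "D j x = F (r (Suc j)) x - F (r j) x" for j x
 have D: "Yd ((1 / 2) ^ j) (D j)" for j unfolding D_def[abs_def] by (rule rY[OF rS rr0])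
 have sg: "summable (%j. (1 / 2 :: real) ^ j)" by (rule summable_geometric) simp
 obtain h where h: "!!x. (%j. D j x) sums h x" and Yh: "Yd (\<Sum>j. (1 / 2) ^ j) h" using Yd_series[OF D sg] by blast
 have tele: "(\<Sum>j<J. D j x) = F (r J) x - F (r 0) x" for J x unfolding D_def by (rule sum_lessThan_telescope)
 define f where "f x = F (r 0) x + h x" for x
 have "f \<in> YS" unfolding f_def[abs_def] using A YS_add[OF _ YdD[OF Yh]] by blast
 have tail: "Yd (2 * (1 / 2) ^ J) (%x. f x - F (r J) x)" for J
 proof -
  have sJ: "(%j. (1 / 2 :: real) ^ (j + J)) sums (2 * (1 / 2) ^ J)"
   using sums_mult2[OF geometric_sums[of "1 / 2 :: real"], of "(1 / 2) ^ J"] by (simp add: power_add)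
  obtain h' where h': "!!x. (%j. D (j + J) x) sums h' x" and Yh': "Yd (\<Sum>j. (1 / 2) ^ (j + J)) h'"
   using Yd_series[OF D sums_summable[OF sJ]] by blast
  have "h' x = f x - F (r J) x" for x
   using sums_unique2[OF h'[of x] sums_split_initial_segment[OF h[of x], of J]] unfolding tele by (simp add: f_def)
  then have "h' = (%x. f x - F (r J) x)" by auto
  then show ?thesis using Yh' sJ by (simp add: sums_iff)
 qed
 have "(%n. YN (%x. F n x - f x)) \<longlonglongrightarrow> 0"
 proof (rule LIMSEQ_I)
  fix e :: real assume e: "e > 0"
  obtain J where J: "(1 / 2 :: real) ^ J < e / 3" using real_arch_pow_inv[of "e / 3" "1 / 2"] e by auto
  have "norm (YN (%x. F n x - f x) - 0) < e" if n: "n >= r0 J" for n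
  proof -
   have "Yd ((1 / 2) ^ J + 2 * (1 / 2) ^ J) (%x. (F n x - F (r J) x) - (f x - F (r J) x))" by (rule Yd_diff[OF rY[OF n rr0] tail])
   then have Y: "Yd (3 * (1 / 2) ^ J) (%x. F n x - f x)" by simp
   then have "YN (%x. F n x - f x) < e" using YN_le[OF Y] J by linarith
   moreover have "0 <= YN (%x. F n x - f x)" using Y by (intro YN_nonneg) (auto simp: YS_def)
   ultimately show ?thesis by simp
  qed
  then show "\<exists>n0. \<forall>n\<ge>n0. norm (YN (%x. F n x - f x) - 0) < e" by blast
 qed
 then show "\<exists>f\<in>YS. (%n. YN (%x. F n x - f x)) \<longlonglongrightarrow> 0" using \<open>f \<in> YS\<close> by blast
qed

lemma cont_embedded_Y:
 assumes "C1b \<subseteq> X \<or> W1inf \<subseteq> X" shows "cont_embedded YS YN X W1inf_norm" unfolding cont_embedded_def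
proof
 show "YS \<subseteq> X" using assms Yd_norms(1,2) by (fastforce simp: YS_def)
 show "\<exists>C. \<forall>f\<in>YS. W1inf_norm f <= C * YN f"
 proof (intro exI ballI)
  fix f assume f: "f \<in> YS"
  define c where "c = 2 * W0 + 18 * W1 + 1"
  have c: "c > 0" using W_nonneg by (simp add: c_def add_nonneg_pos)
  have "W1inf_norm f / c <= YN f"
  proof (rule YN_greatest[OF f])
   fix M assume M: "Yd M f"
   have "W1inf_norm f <= (2 * W0 + 18 * W1) * M" by (rule Yd_norms(3)[OF M])
   also have "... <= c * M" using Yd_nonneg[OF M] by (intro mult_right_mono) (auto simp: c_def)
   finally show "W1inf_norm f / c <= M" using c by (simp add: divide_le_eq mult.commute)
  qed
  then show "W1inf_norm f <= c * YN f" using c by (simp add: divide_le_eq mult.commute)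
 qed
qed

text \<open>A Lipschitz curve is strongly measurable: sample it on a grid.\<close>
lemma Linf_in_time_Lipschitz:
 assumes T: "0 < T" and b: "!!t. t \<in> {0..T} ==> Yd M (u t)"
  and l: "!!t s. t \<in> {0..T} ==> s \<in> {0..T} ==> Yd (L * \<bar>t - s\<bar>) (%x. u t x - u s x)"
 shows "Linf_in_time T YS YN u" unfolding Linf_in_time_def
proof (intro conjI)
 have "AE t in lebesgue_on {0..T}. u t \<in> YS \<and> YN (u t) <= M" by (rule AE_I2) (use b YN_le in "auto simp: YS_def")
 then show "\<exists>M. AE t in lebesgue_on {0..T}. u t \<in> YS \<and> YN (u t) <= M" by blast
 define j where "j n t = \<lfloor>t * real (Suc n)\<rfloor>" for n and t :: real
 define s where "s n t = u (of_int (j n t) / real (Suc n))" for n and t :: real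
 have grid: "of_int (j n t) / real (Suc n) \<in> {0..T}" (is ?g1) "\<bar>t - of_int (j n t) / real (Suc n)\<bar> <= 1 / real (Suc n)" (is ?g2)
  if t: "t \<in> {0..T}" for n t
 proof -
  have p: "real (Suc n) > 0" by simp
  have 1: "of_int (j n t) <= t * real (Suc n)" "t * real (Suc n) < of_int (j n t) + 1" "0 <= j n t"
   unfolding j_def using t by (auto simp del: of_nat_Suc)
  have "of_int (j n t) / real (Suc n) <= t" using 1(1) p by (simp add: divide_le_eq del: of_nat_Suc)
  moreover have "t < of_int (j n t) / real (Suc n) + 1 / real (Suc n)"
   using 1(2) p by (simp add: add_divide_distrib[symmetric] less_divide_eq del: of_nat_Suc)
  moreover have "0 <= of_int (j n t) / real (Suc n)" using 1(3) p by (simp del: of_nat_Suc)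
  ultimately show ?g1 ?g2 using t by auto
 qed
 show "\<exists>s. (\<forall>n. finite (s n ` {0..T}) \<and> s n ` {0..T} \<subseteq> YS \<and> (\<forall>g. {t \<in> {0..T}. s n t = g} \<in> sets lebesgue)) \<and>
    (AE t in lebesgue_on {0..T}. (%n. YN (%x. u t x - s n t x)) \<longlonglongrightarrow> 0)"
 proof (intro exI[of _ s] conjI allI)
  fix n
  have "s n ` {0..T} \<subseteq> (%i. u (of_int i / real (Suc n))) ` {0..\<lfloor>T * real (Suc n)\<rfloor>}"
  proof
   fix w assume "w \<in> s n ` {0..T}"
   then obtain t where t: "t \<in> {0..T}" "w = s n t" by auto
   have "j n t \<in> {0..\<lfloor>T * real (Suc n)\<rfloor>}"
    unfolding j_def using t(1) by (auto intro!: floor_mono mult_right_mono simp del: of_nat_Suc)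
   then show "w \<in> (%i. u (of_int i / real (Suc n))) ` {0..\<lfloor>T * real (Suc n)\<rfloor>}" using t(2) by (auto simp: s_def)
  qed
  then show "finite (s n ` {0..T})" by (rule finite_subset) simp
  show "s n ` {0..T} \<subseteq> YS"
  proof
   fix w assume "w \<in> s n ` {0..T}"
   then obtain t where t: "t \<in> {0..T}" "w = s n t" by auto
   show "w \<in> YS" using b[OF grid(1)[OF t(1)]] unfolding t(2) s_def YS_def by blast
  qed
  fix g
  have "(%t. j n t) \<in> borel \<rightarrow>\<^sub>M count_space UNIV" unfolding j_def by measurable
  then have "(%t. j n t) -` {i. u (of_int i / real (Suc n)) = g} \<inter> space borel \<in> sets borel" by (rule measurable_sets) simp
  moreover have "{t \<in> {0..T}. s n t = g} = {0..T} \<inter> ((%t. j n t) -` {i. u (of_int i / real (Suc n)) = g} \<inter> space borel)"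
   by (auto simp: s_def)
  ultimately have "{t \<in> {0..T}. s n t = g} \<in> sets borel" by auto
  then show "{t \<in> {0..T}. s n t = g} \<in> sets lebesgue" by (intro sets_completionI_sets) simp
 next
  show "AE t in lebesgue_on {0..T}. (%n. YN (%x. u t x - s n t x)) \<longlonglongrightarrow> 0"
  proof (rule AE_I2)
   fix t assume "t \<in> space (lebesgue_on {0..T})"
   then have t: "t \<in> {0..T}" by simp
   have Y: "Yd (L * \<bar>t - of_int (j n t) / real (Suc n)\<bar>) (%x. u t x - s n t x)" for n unfolding s_def by (rule l[OF t grid(1)[OF t]])
   have nb: "norm (YN (%x. u t x - s n t x)) <= \<bar>L\<bar> * (1 / real (Suc n))" for n
   proof -
    have "0 <= YN (%x. u t x - s n t x)" using Y[of n] by (intro YN_nonneg) (auto simp: YS_def)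
    moreover have "L * \<bar>t - of_int (j n t) / real (Suc n)\<bar> <= \<bar>L\<bar> * (1 / real (Suc n))" by (intro mult_mono grid(2) t) auto
    ultimately show ?thesis using YN_le[OF Y[of n]] by simp
   qed
   have "(%n. \<bar>L\<bar> * (1 / real (Suc n))) \<longlonglongrightarrow> \<bar>L\<bar> * 0"
    by (intro tendsto_intros LIMSEQ_Suc[OF lim_const_over_n])
   then have "(%n. \<bar>L\<bar> * (1 / real (Suc n))) \<longlonglongrightarrow> 0" by simp
   then show "(%n. YN (%x. u t x - s n t x)) \<longlonglongrightarrow> 0" by (rule Lim_null_comparison[OF always_eventually[OF allI[OF nb]]])
  qed
 qed
qed

section \<open>The series solves the rotating Euler equations\<close>

lemma hart_sum:
 fixes h :: "'i => real^3 => 'b::euclidean_space"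
 assumes "!!i. i \<in> S ==> integrable lborel (h i)"
 shows "hart (%k. \<Sum>i\<in>S. h i k) x = (\<Sum>i\<in>S. hart (h i) x)" unfolding hart_def scaleR_sum_right
 by (rule Bochner_Integration.integral_sum) (rule integrable_cas[OF assms])

lemma pd_hart_component:
 fixes g :: "real^3 => real^3"
 assumes "rapid g" shows "pd i (hart g) x $ j = hart (%k. - (k $ i) * g (- k) $ j) x"
 unfolding pd_hart[OF assms] hart_component[OF rapid_dirmult[OF assms]] by (simp add: dirmult_def inner_axis)

lemma rapid_pd_component:
 fixes g :: "real^3 => real^3"
 assumes "rapid g" shows "integrable lborel (%k. - (k $ i) * g (- k) $ j)"
 using rapid_integrable[OF rapid_component[OF rapid_dirmult[OF assms, of "axis i 1"], of j]] by (simp add: dirmult_def inner_axis)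

lemma hart_dvg:
 assumes r: "rapid g" and div: "!!k. k \<bullet> g k = 0" shows "dvg (hart g) x = 0"
proof -
 have "dvg (hart g) x = hart (%k. \<Sum>i\<in>UNIV. - (k $ i) * g (- k) $ i) x"
  unfolding dvg_def pd_hart_component[OF r] by (rule hart_sum[symmetric]) (rule rapid_pd_component[OF r])
 also have "(%k. \<Sum>i\<in>UNIV. - (k $ i) * g (- k) $ i) = (%k. (- k) \<bullet> g (- k))" by (simp add: fun_eq_iff inner_vec3[of _ "g _"])
 finally show ?thesis by (simp add: div hart_zero del: inner_minus_left)
qed

lemma pairing_hart:
 assumes "rapid g" "\<psi> \<in> borel_measurable borel"
 shows "pairing (hart g) \<psi> = (LBINT x. hart g x \<bullet> \<psi> x)" unfolding pairing_def using hart_measurable[OF assms(1)] assms(2)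
 by (intro integral_lebesgue_lborel borel_measurable_inner)

lemma test_fun_measurable: "test_fun \<phi> ==> \<phi> \<in> borel_measurable borel"
 for \<phi> :: "real^3 => 'b::real_normed_vector" by (rule borel_measurable_continuous_onI, rule Ck_continuous, rule test_fun_Ck)

lemma weakly_div_free_hart:
 assumes g: "rapid g" and div: "!!k. k \<bullet> g k = 0"
 shows "weakly_div_free (hart g)" unfolding weakly_div_free_def
proof (intro conjI allI impI)
 show "loc_integrable (hart g)" by (rule loc_integrable_continuous[OF hart_continuous[OF g]])
 fix \<phi> :: "real^3 => real" assume t: "test_fun \<phi>"
 obtain R where R: "!!x. norm x >= R ==> \<phi> x = 0" using test_fun_vanishes[OF t] by metis
 have C: "Ck 1 (hart g)" by (rule rapid_Ck_hart[OF g])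
 note P = integration_by_parts[OF Ck_component[OF C] test_fun_Ck[OF t] R]
 have "pairing (hart g) (grad \<phi>) = (LBINT x. hart g x \<bullet> grad \<phi> x)"
  by (rule pairing_hart[OF g test_fun_measurable[OF test_fun_grad[OF t]]])
 also have "... = (LBINT x. (\<Sum>i\<in>UNIV. hart g x $ i *\<^sub>R pd i \<phi> x))" by (simp add: inner_vec3 grad_def)
 also have "... = - (LBINT x. (\<Sum>i\<in>UNIV. pd i (%x. hart g x $ i) x *\<^sub>R \<phi> x))" using P by (simp add: sum_negf)
 also have "... = - (LBINT x. dvg (hart g) x * \<phi> x)" unfolding pd_component[OF C] dvg_def by (simp add: sum_distrib_right)
 finally show "pairing (hart g) (grad \<phi>) = 0" by (simp add: hart_dvg[OF g div])
qed

lemma advect_measurable: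
 assumes "Ck 1 f" shows "advect f \<in> borel_measurable lebesgue"
proof -
 have m: "weak_jac f \<in> borel_measurable lebesgue" by (rule weak_jac_measurable[OF assms])
 have fm: "f \<in> borel_measurable lebesgue" by (rule continuous_lebesgue_measurable[OF Ck_continuous[OF assms]])
 have c: "(%x. weak_jac f x $ j $ i) \<in> borel_measurable lebesgue" for i j
 proof -
  have "(%x. weak_jac f x \<bullet> axis j (axis i 1)) \<in> borel_measurable lebesgue" using m by (intro borel_measurable_inner) auto
  then show ?thesis by (simp add: inner_axis)
 qed
 have fi: "(%x. f x $ i) \<in> borel_measurable lebesgue" for i
 proof -
  have "(%x. f x \<bullet> axis i 1) \<in> borel_measurable lebesgue" using fm by (intro borel_measurable_inner) auto
  then show ?thesis by (simp add: inner_axis)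
 qed
 have "(%x. advect f x \<bullet> b) \<in> borel_measurable lebesgue" if bb: "b \<in> Basis" for b :: "real^3"
 proof -
  obtain j where b: "b = axis j 1" using bb by (auto simp: Basis_vec_def)
  show ?thesis unfolding advect_def b using c fi by (simp add: inner_axis matrix_vector_mult_def borel_measurable_sum borel_measurable_times)
 qed
 then show ?thesis by (subst borel_measurable_euclidean_space) auto
qed

lemma pairing_AE:
 fixes f g \<psi> :: vfield
 assumes "f \<in> borel_measurable lebesgue" "g \<in> borel_measurable borel" "\<psi> \<in> borel_measurable borel"
  and ae: "AE x in lebesgue. f x = g x"
 shows "pairing f \<psi> = (LBINT x. g x \<bullet> \<psi> x)" (is ?g1)
  and "integrable lborel (%x. g x \<bullet> \<psi> x) ==> integrable lebesgue (%x. f x \<bullet> \<psi> x)"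
proof -
 have m: "(%x. f x \<bullet> \<psi> x) \<in> borel_measurable lebesgue" "(%x. g x \<bullet> \<psi> x) \<in> borel_measurable lebesgue"
  using borel_measurable_inner[OF assms(1) measurable_completion[of \<psi> lborel borel]]
   measurable_completion[OF borel_measurable_inner[of g lborel \<psi>]] assms(2,3) by auto
 have mb: "(%x. g x \<bullet> \<psi> x) \<in> borel_measurable borel" using assms by (intro borel_measurable_inner)
 have "pairing f \<psi> = (LINT x|lebesgue. g x \<bullet> \<psi> x)" unfolding pairing_def by (rule integral_cong_AE[OF m]) (use ae in auto)
 then show ?g1 using integral_lebesgue_lborel[OF mb] by simp
 assume "integrable lborel (%x. g x \<bullet> \<psi> x)"
 then have "integrable lebesgue (%x. g x \<bullet> \<psi> x)" using integrable_lebesgue_lborel[OF mb] by simp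
 then show "integrable lebesgue (%x. f x \<bullet> \<psi> x)" by (rule integrable_cong_AE_imp[OF _ m(1)]) (use ae in auto)
qed

lemma time_integral:
 fixes F H :: "real => real"
 assumes H: "continuous_on {0..T} H" and eq: "!!s. s \<in> {0..T} ==> F s = H s"
 shows "set_integrable lebesgue {0..T} F" (is ?g1)
  and "!!t. t \<in> {0..T} ==> (LINT s:{0..t}|lebesgue. F s) = (LBINT s. indicator {0..t} s *\<^sub>R H s)"
proof -
 have i: "integrable lborel (%s. indicator {0..t} s *\<^sub>R H s)" if "t \<in> {0..T}" for t
  by (rule borel_integrable_compact) (use that in "auto intro: continuous_on_subset[OF H]")
 have e: "(%s. indicator {0..t} s *\<^sub>R F s) = (%s. indicator {0..t} s *\<^sub>R H s)" if "t \<in> {0..T}" for t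
  using eq that by (auto simp: fun_eq_iff indicator_def)
 show ?g1
 proof (cases "0 <= T")
  case True
  then have T: "T \<in> {0..T}" by simp
  show ?thesis unfolding set_integrable_def e[OF T]
   using i[OF T] integrable_lebesgue_lborel[OF borel_measurable_integrable[OF i[OF T], simplified]] by simp
 next
  case False
  then show ?thesis by (simp add: set_integrable_def)
 qed
 fix t assume t: "t \<in> {0..T}"
 show "(LINT s:{0..t}|lebesgue. F s) = (LBINT s. indicator {0..t} s *\<^sub>R H s)" unfolding set_lebesgue_integral_def e[OF t]
  using integral_lebesgue_lborel[OF borel_measurable_integrable[OF i[OF t], simplified]] by simp
qed

lemma rapid_exp: "rapid (%k. exp (- norm k))" unfolding rapid_def
proof (intro conjI allI)
 fix m
 have "norm (exp (- norm k)) * (1 + norm k) ^ m <= fact m * exp 1" for k :: "real^3"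
 proof -
  have "exp (- norm k) * (1 + norm k) ^ m <= exp (- norm k) * (fact m * exp (1 + norm k))" by (intro mult_left_mono power_le_fact_exp) auto
  moreover have "exp (- norm k) * (fact m * exp (1 + norm k)) = fact m * exp 1" by (simp add: exp_add exp_minus)
  ultimately show ?thesis by simp
 qed
 then show "\<exists>C. \<forall>k::real^3. norm (exp (- norm k)) * (1 + norm k) ^ m <= C" by blast
qed simp

text \<open>The density of the pressure: its gradient is the part of the force that the projection removes. It is
bounded by \<open>exp (- |k|)\<close> although the numerator is only divided by \<open>|k|^2\<close>, because the densities of
the solution vanish at the origin.\<close>
definition pressm :: "(real^3 => real^3) => real^3 => real" where
 "pressm f k = - ((k \<bullet> f (- k)) / (k \<bullet> k))"

lemma rapid_pressm: assumes "edens C f" shows "rapid (pressm f)"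
proof (rule rapid_bound[OF rapid_exp, where C=C and j=0])
 have [measurable]: "f \<in> borel_measurable borel" by (rule edens_measurable[OF assms])
 show "pressm f \<in> borel_measurable borel" unfolding pressm_def[abs_def] by measurable
 fix k
 show "norm (pressm f k) <= C * (1 + norm k) ^ 0 * norm (exp (- norm k))"
 proof (cases "k = 0")
  case True then show ?thesis using assms by (simp add: pressm_def edens_def)
 next
  case False
  have "\<bar>k \<bullet> f (- k)\<bar> <= norm k * (C * (norm k * exp (- norm k)))"
   using Cauchy_Schwarz_ineq2[of k "f (- k)"] mult_left_mono[OF edens_bound[OF assms, of "- k"] norm_ge_zero[of k]] by simp
  then show ?thesis using False by (simp add: pressm_def dot_square_norm power2_eq_square divide_le_eq mult_ac)
 qed
qed

lemma integral_pressure_dvg: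
 assumes f: "edens C f" and \<phi>: "test_fun \<phi>"
 shows "(LBINT x. hart (pressm f) x * dvg \<phi> x) = (LBINT x. hart (%k. gradm k (f k)) x \<bullet> \<phi> x)"
proof -
 note rq = rapid_pressm[OF f]
 have rg: "rapid (%k. gradm k (f k))" by (rule rapid_gradm[OF edens_rapid[OF f]])
 obtain R where R: "!!x. norm x >= R ==> \<phi> x = 0" using test_fun_vanishes[OF \<phi>] by metis
 note P = integration_by_parts[OF rapid_Ck_hart[OF rq, where k=1] Ck_component[OF test_fun_Ck[OF \<phi>]], of R]
 have dj: "pd j (hart (pressm f)) x = - (hart (%k. gradm k (f k)) x $ j)" for j x
 proof -
  have "pd j (hart (pressm f)) x = hart (dirmult (axis j 1) (pressm f)) x" by (rule pd_hart[OF rq])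
  also have "dirmult (axis j 1) (pressm f) = (%k. - 1 *\<^sub>R (gradm k (f k) $ j))"
   by (simp add: fun_eq_iff pressm_def dirmult_def inner_axis gradm_def)
  also have "hart ... x = - hart (%k. gradm k (f k) $ j) x"
   using hart_scaleR[OF rapid_integrable[OF rapid_component[OF rg, of j]], of "- 1" x] by simp
  finally show ?thesis using hart_component[OF rg] by simp
 qed
 have "(LBINT x. hart (pressm f) x * dvg \<phi> x) = (LBINT x. (\<Sum>j\<in>UNIV. hart (pressm f) x *\<^sub>R pd j (%x. \<phi> x $ j) x))"
  by (simp add: dvg_def pd_component[OF test_fun_Ck[OF \<phi>]] sum_distrib_left)
 also have "... = - (\<Sum>j\<in>UNIV. LBINT x. pd j (hart (pressm f)) x *\<^sub>R \<phi> x $ j)" using P R by (simp add: sum_negf)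
 also have "... = - (LBINT x. (\<Sum>j\<in>UNIV. pd j (hart (pressm f)) x *\<^sub>R \<phi> x $ j))" using P(2) R by simp
 also have "... = (LBINT x. hart (%k. gradm k (f k)) x \<bullet> \<phi> x)" by (simp add: dj inner_vec3[of "hart _ _"] sum_negf)
 finally show ?thesis .
qed

context euler_series
begin

definition "ct s k = \<Omega> *\<^sub>R cross3 e3 (gt s k)"

lemma u_Yd: "\<bar>t\<bar> <= K ==> Yd CC (u t)" unfolding Yd_def u_def using g_series(1) gt_div by blast

lemma u_Lipschitz:
 assumes "t \<in> {0..T}" "s \<in> {0..T}" shows "Yd (2 / K * CC * \<bar>t - s\<bar>) (%x. u t x - u s x)"
proof -
 have ts: "\<bar>t\<bar> <= T" "\<bar>s\<bar> <= T" "\<bar>t\<bar> <= K" "\<bar>s\<bar> <= K" using assms KT by auto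
 have "edens (2 / K * CC * \<bar>t - s\<bar>) (%k. gt t k - gt s k)" by (rule gt_continuous[OF ts(1,2)])
 moreover have "k \<bullet> (gt t k - gt s k) = 0" for k using gt_div[OF ts(3)] gt_div[OF ts(4)] by (simp add: inner_diff_right)
 moreover have "(%x. u t x - u s x) = hart (%k. gt t k - gt s k)" unfolding u_def using g_series(1)[OF ts(3)] g_series(1)[OF ts(4)]
  by (intro ext hart_diff[symmetric] rapid_integrable edens_rapid)
 ultimately show ?thesis unfolding Yd_def by blast
qed

lemma u_Linf_in_time: "Linf_in_time T YS YN u" by (rule Linf_in_time_Lipschitz[OF KT(2) u_Yd u_Lipschitz]) (use KT in auto)

context
 fixes s assumes s: "s \<in> {0..T}"
begin

lemma sK: "\<bar>s\<bar> <= K" using s KT by auto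

lemma ct_edens: "edens (\<bar>\<Omega>\<bar> * CC) (ct s)"
proof -
 have "edens CC (%k. cross3 e3 (gt s k))" using g_series(1)[OF sK] unfolding edens_def by (auto intro: order_trans[OF norm_cross_e3])
 from edens_scaleR[OF this, of \<Omega>] show ?thesis by (simp add: ct_def[abs_def])
qed

lemma coriolis_u: "coriolis \<Omega> (u s) = hart (ct s)" unfolding coriolis_def u_def ct_def
 by (rule ext) (rule hart_bounded_linear[OF bounded_linear_cross_e3 rapid_integrable[OF edens_rapid[OF g_series(1)[OF sK]]], symmetric])

lemma at_rapid: "rapid (%k. ft s k - ct s k)" using edens_rapid[OF edens_diff[OF f_series(1)[OF sK] ct_edens]] .

lemma hart_at: "hart (%k. ft s k - ct s k) x = hart (ft s) x - hart (ct s) x"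
 by (rule hart_diff[OF rapid_integrable[OF edens_rapid[OF f_series(1)[OF sK]]] rapid_integrable[OF edens_rapid[OF ct_edens]]])

lemma advect_u: "AE x in lebesgue. advect (u s) x = hart (%k. ft s k - ct s k) x"
proof -
 have rt: "rapid (gt s)" by (rule edens_rapid[OF g_series(1)[OF sK]])
 have c1: "Ck 1 (u s)" unfolding u_def by (rule rapid_Ck_hart[OF rt])
 have fd: "frechet_derivative (u s) (at x) = (%v. hart (dirmult v (gt s)) x)" for x
  unfolding u_def using hart_has_derivative[OF rt] by (metis frechet_derivative_at)
 have "hart (%k. ft s k - ct s k) x = frechet_derivative (u s) (at x) (u s x)" for x
  unfolding fd hart_at hart_ft[OF sK] fun_cong[OF coriolis_u, symmetric] by (simp add: coriolis_def)
 then show ?thesis using advect_classical[OF c1] by simp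
qed

lemma pairing_terms:
 assumes "\<psi> \<in> borel_measurable borel"
 shows "pairing (coriolis \<Omega> (u s)) \<psi> = (LBINT x. hart (ct s) x \<bullet> \<psi> x)" (is ?g1)
  and "pairing (advect (u s)) \<psi> = (LBINT x. hart (%k. ft s k - ct s k) x \<bullet> \<psi> x)" (is ?g2)
  and "integrable lborel (%x. hart (%k. ft s k - ct s k) x \<bullet> \<psi> x) ==> integrable lebesgue (%x. advect (u s) x \<bullet> \<psi> x)"
  and "integrable lborel (%x. hart (ct s) x \<bullet> \<psi> x) ==> integrable lebesgue (%x. coriolis \<Omega> (u s) x \<bullet> \<psi> x)"
proof -
 show ?g1 unfolding coriolis_u by (rule pairing_hart[OF edens_rapid[OF ct_edens] assms])
 have c1: "Ck 1 (u s)" by (rule Yd_Ck[OF u_Yd[OF sK]])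
 note P = pairing_AE[OF advect_measurable[OF c1] hart_measurable[OF at_rapid] assms advect_u]
 show ?g2 by (rule P(1))
 show "integrable lborel (%x. hart (%k. ft s k - ct s k) x \<bullet> \<psi> x) ==> integrable lebesgue (%x. advect (u s) x \<bullet> \<psi> x)" by (rule P(2))
 have "(%x. hart (ct s) x \<bullet> \<psi> x) \<in> borel_measurable borel"
  using hart_measurable[OF edens_rapid[OF ct_edens]] assms by (intro borel_measurable_inner)
 then show "integrable lborel (%x. hart (ct s) x \<bullet> \<psi> x) ==> integrable lebesgue (%x. coriolis \<Omega> (u s) x \<bullet> \<psi> x)"
  unfolding coriolis_u by (simp add: integrable_lebesgue_lborel)
qed

lemma pressure_form:
 assumes \<phi>: "test_fun \<phi>"
 shows "pairing (coriolis \<Omega> (u s)) \<phi> + pairing (advect (u s)) \<phi> - (LINT x|lebesgue. hart (pressm (ft s)) x * dvg \<phi> x)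
  = (LBINT x. hart (Pf s) x \<bullet> \<phi> x)"
proof -
 have rf: "rapid (ft s)" by (rule edens_rapid[OF f_series(1)[OF sK]])
 have rg: "rapid (%k. gradm k (ft s k))" by (rule rapid_gradm[OF rf])
 have rc: "rapid (ct s)" by (rule edens_rapid[OF ct_edens])
 have "(LINT x|lebesgue. hart (pressm (ft s)) x * dvg \<phi> x) = (LBINT x. hart (pressm (ft s)) x * dvg \<phi> x)"
  using hart_measurable[OF rapid_pressm[OF f_series(1)[OF sK]]] test_fun_measurable[OF test_fun_dvg[OF \<phi>]]
  by (intro integral_lebesgue_lborel borel_measurable_times)
 also have "... = (LBINT x. hart (%k. gradm k (ft s k)) x \<bullet> \<phi> x)" by (rule integral_pressure_dvg[OF f_series(1)[OF sK] \<phi>])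
 finally have p: "(LINT x|lebesgue. hart (pressm (ft s)) x * dvg \<phi> x) = (LBINT x. hart (%k. gradm k (ft s k)) x \<bullet> \<phi> x)" .
 have hP: "hart (Pf s) x = hart (ft s) x - hart (%k. gradm k (ft s k)) x" for x
  unfolding Pf_def[abs_def] by (rule hart_diff[OF rapid_integrable[OF rf] rapid_integrable[OF rg]])
 show ?thesis unfolding pairing_terms(1,2)[OF test_fun_measurable[OF \<phi>]] p hP hart_at
  using hart_test_integrable[OF rf \<phi>] hart_test_integrable[OF rg \<phi>] hart_test_integrable[OF rc \<phi>] by (simp add: inner_diff_left)
qed

lemma projected_form:
 assumes \<phi>: "test_fun \<phi>"
 shows "integrable lebesgue (%x. coriolis \<Omega> (u s) x \<bullet> leray_P \<phi> x)" (is ?g1)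
  and "integrable lebesgue (%x. advect (u s) x \<bullet> leray_Q \<phi> x)" (is ?g2)
  and "- pairing (advect (u s)) \<phi> - pairing (coriolis \<Omega> (u s)) (leray_P \<phi>) + pairing (advect (u s)) (leray_Q \<phi>)
   = - (LBINT x. hart (Pf s) x \<bullet> \<phi> x)" (is ?g3)
proof -
 have rf: "rapid (ft s)" by (rule edens_rapid[OF f_series(1)[OF sK]])
 have rc: "rapid (ct s)" by (rule edens_rapid[OF ct_edens])
 note ra = at_rapid
 note LP = leray_P_adjoint[OF _ \<phi>]
 have mP: "leray_P \<phi> \<in> borel_measurable borel" by (rule LP(3)[OF rf])
 have mphi: "\<phi> \<in> borel_measurable borel" by (rule test_fun_measurable[OF \<phi>])
 have mQ: "leray_Q \<phi> \<in> borel_measurable borel" unfolding leray_Q_def[abs_def] using mP mphi by simp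
 have iQ: "integrable lborel (%x. hart (%k. ft s k - ct s k) x \<bullet> leray_Q \<phi> x)"
  unfolding leray_Q_def inner_diff_right using hart_test_integrable[OF ra \<phi>] LP(1)[OF ra] by simp
 show ?g1 by (rule pairing_terms(4)[OF mP LP(1)[OF rc]])
 show ?g2 by (rule pairing_terms(3)[OF mQ iQ])
 have q: "(LBINT x. hart (%k. ft s k - ct s k) x \<bullet> leray_Q \<phi> x)
  = (LBINT x. hart (%k. ft s k - ct s k) x \<bullet> \<phi> x) - (LBINT x. hart (%k. ft s k - ct s k) x \<bullet> leray_P \<phi> x)"
  unfolding leray_Q_def inner_diff_right using hart_test_integrable[OF ra \<phi>] LP(1)[OF ra] by simp
 have "(LBINT x. hart (%k. ft s k - ct s k) x \<bullet> leray_P \<phi> x) + (LBINT x. hart (ct s) x \<bullet> leray_P \<phi> x)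
  = (LBINT x. hart (ft s) x \<bullet> leray_P \<phi> x)" unfolding hart_at inner_diff_left using LP(1)[OF rf] LP(1)[OF rc] by simp
 also have "... = (LBINT x. hart (Pf s) x \<bullet> \<phi> x)" unfolding LP(2)[OF rf] Pf_def[abs_def] ..
 finally show ?g3 unfolding pairing_terms(1)[OF mP] pairing_terms(2)[OF mphi] pairing_terms(2)[OF mQ] q by simp
qed

end

lemma u_admissible: "admissible T (u 0) u" unfolding admissible_def
proof (intro conjI ballI)
 have r: "rapid (gt t)" if "t \<in> {0..T}" for t using edens_rapid[OF g_series(1)[OF sK[OF that]]] .
 show "loc_integrable (u 0)" unfolding u_def by (rule loc_integrable_continuous[OF hart_continuous[OF r]]) (use KT in auto)
 show "weakly_div_free (u t)" if "t \<in> {0..T}" for t unfolding u_def by (rule weakly_div_free_hart[OF r[OF that] gt_div[OF sK[OF that]]])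
 show "AE t in lebesgue_on {0..T}. u t \<in> W1inf" by (rule AE_I2) (use Yd_norms(2)[OF u_Yd[OF sK]] in auto)
qed

lemma pairing_u:
 assumes "t \<in> {0..T}" "test_fun \<phi>" shows "pairing (u t) \<phi> = (LBINT x. u t x \<bullet> \<phi> x)"
 unfolding u_def by (rule pairing_hart[OF edens_rapid[OF g_series(1)[OF sK[OF assms(1)]]] test_fun_measurable[OF assms(2)]])

lemma u_solves_pressure: "rot_euler_pressure \<Omega> T (u 0) u" unfolding rot_euler_pressure_def
proof (intro conjI u_admissible exI[of _ "%t. hart (pressm (ft t))"] allI impI)
 show "AE t in lebesgue_on {0..T}. loc_integrable (hart (pressm (ft t)))"
  by (rule AE_I2) (use loc_integrable_continuous[OF hart_continuous[OF rapid_pressm[OF f_series(1)[OF sK]]]] in auto)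
 fix \<phi> :: vfield assume \<phi>: "test_fun \<phi>"
 have 0: "0 \<in> {0..T}" using KT by simp
 have pf: "!!s. s \<in> {0..T} ==> pairing (coriolis \<Omega> (u s)) \<phi> + pairing (advect (u s)) \<phi>
   - (LINT x|lebesgue. hart (pressm (ft s)) x * dvg \<phi> x) = (LBINT x. hart (Pf s) x \<bullet> \<phi> x)" by (rule pressure_form[OF _ \<phi>])
 note TI = time_integral[OF weak_equation(1)[OF \<phi>] pf]
 show "let F = (%s. pairing (coriolis \<Omega> (u s)) \<phi> + pairing (advect (u s)) \<phi> - (LINT x|lebesgue. hart (pressm (ft s)) x * dvg \<phi> x))
    in set_integrable lebesgue {0..T} F \<and> (\<forall>t\<in>{0..T}. pairing (u t) \<phi> = pairing (u 0) \<phi> - (LINT s:{0..t}|lebesgue. F s))"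
  unfolding Let_def
 proof (intro conjI ballI TI(1))
  fix t assume t: "t \<in> {0..T}"
  have e: "(LINT s:{0..t}|lebesgue. pairing (coriolis \<Omega> (u s)) \<phi> + pairing (advect (u s)) \<phi> - (LINT x|lebesgue. hart (pressm (ft s)) x * dvg \<phi> x))
   = (LBINT s. indicator {0..t} s *\<^sub>R (LBINT x. hart (Pf s) x \<bullet> \<phi> x))" by (rule TI(2)[OF _ t])
  show "pairing (u t) \<phi> = pairing (u 0) \<phi> - (LINT s:{0..t}|lebesgue. pairing (coriolis \<Omega> (u s)) \<phi> + pairing (advect (u s)) \<phi> - (LINT x|lebesgue. hart (pressm (ft s)) x * dvg \<phi> x))"
   unfolding e pairing_u[OF t \<phi>] pairing_u[OF 0 \<phi>] by (rule weak_equation(2)[OF \<phi> t])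
 qed
qed

lemma u_solves_projected: "rot_euler_projected \<Omega> T (u 0) u" unfolding rot_euler_projected_def
proof (intro conjI u_admissible allI impI)
 fix \<phi> :: vfield assume \<phi>: "test_fun \<phi>"
 have 0: "0 \<in> {0..T}" using KT by simp
 show "AE t in lebesgue_on {0..T}. integrable lebesgue (%x. coriolis \<Omega> (u t) x \<bullet> leray_P \<phi> x) \<and>
   integrable lebesgue (%x. advect (u t) x \<bullet> leray_Q \<phi> x)" by (rule AE_I2) (use projected_form(1,2)[OF _ \<phi>] in auto)
 have pf: "!!s. s \<in> {0..T} ==> - pairing (advect (u s)) \<phi> - pairing (coriolis \<Omega> (u s)) (leray_P \<phi>)
   + pairing (advect (u s)) (leray_Q \<phi>) = - (LBINT x. hart (Pf s) x \<bullet> \<phi> x)" by (rule projected_form(3)[OF _ \<phi>])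
 note TI = time_integral[OF continuous_on_minus[OF weak_equation(1)[OF \<phi>]] pf]
 have m: "(LBINT s. indicator {0..t} s *\<^sub>R - h s) = - (LBINT s. indicator {0..t} s *\<^sub>R h s)" for t and h :: "real => real"
  unfolding scaleR_minus_right by (rule integral_minus)
 show "let G = (%s. - pairing (advect (u s)) \<phi> - pairing (coriolis \<Omega> (u s)) (leray_P \<phi>) + pairing (advect (u s)) (leray_Q \<phi>))
    in set_integrable lebesgue {0..T} G \<and> (\<forall>t\<in>{0..T}. pairing (u t) \<phi> = pairing (u 0) \<phi> + (LINT s:{0..t}|lebesgue. G s))"
  unfolding Let_def
 proof (intro conjI ballI TI(1))
  fix t assume t: "t \<in> {0..T}"
  have e: "(LINT s:{0..t}|lebesgue. - pairing (advect (u s)) \<phi> - pairing (coriolis \<Omega> (u s)) (leray_P \<phi>) + pairing (advect (u s)) (leray_Q \<phi>))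
   = (LBINT s. indicator {0..t} s *\<^sub>R - (LBINT x. hart (Pf s) x \<bullet> \<phi> x))" by (rule TI(2)[OF _ t])
  show "pairing (u t) \<phi> = pairing (u 0) \<phi> + (LINT s:{0..t}|lebesgue. - pairing (advect (u s)) \<phi> - pairing (coriolis \<Omega> (u s)) (leray_P \<phi>) + pairing (advect (u s)) (leray_Q \<phi>))"
   unfolding e pairing_u[OF t \<phi>] pairing_u[OF 0 \<phi>] m using weak_equation(2)[OF \<phi> t] by simp
 qed
qed

end

section \<open>Solenoidal test fields\<close>

lemma norm_cross_le: "norm (cross3 x y) <= norm x * norm y" by (rule power2_le_imp_le) (simp_all add: norm_cross power_mult_distrib)

lemma Yd_dvg: "Yd M f ==> dvg f x = 0" unfolding Yd_def using hart_dvg[OF edens_rapid] by blast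

text \<open>The Biot--Savart law in frequency space. The potential has density bounded by \<open>M exp (- |k|)\<close>, again
because densities in \<open>Y\<close> vanish at the origin.\<close>
lemma Yd_vector_potential:
 assumes "Yd M z"
 obtains \<alpha> :: vfield where "rapid \<alpha>"
  "!!x. pd 2 (hart \<alpha>) x $ 3 - pd 3 (hart \<alpha>) x $ 2 = z x $ 1"
  "!!x. pd 3 (hart \<alpha>) x $ 1 - pd 1 (hart \<alpha>) x $ 3 = z x $ 2"
  "!!x. pd 1 (hart \<alpha>) x $ 2 - pd 2 (hart \<alpha>) x $ 1 = z x $ 3"
proof -
 obtain g where g: "edens M g" "!!k. k \<bullet> g k = 0" "z = hart g" using assms unfolding Yd_def by auto
 define \<alpha> where "\<alpha> k = (- 1 / (k \<bullet> k)) *\<^sub>R cross3 k (g (- k))" for k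
 have [measurable]: "g \<in> borel_measurable borel" by (rule edens_measurable[OF g(1)])
 have r: "rapid \<alpha>"
 proof (rule rapid_bound[OF rapid_exp, where C=M and j=0])
  show "\<alpha> \<in> borel_measurable borel" unfolding \<alpha>_def[abs_def]
  proof (rule borel_measurable_scaleR)
   show "(%k. cross3 k (g (- k))) \<in> borel_measurable borel" by (rule borel_measurable_continuous_Pair[where H=cross3])
      (auto intro!: bounded_bilinear.continuous_on[OF bounded_bilinear_cross3] continuous_intros)
  qed measurable
  fix k :: "real^3"
  show "norm (\<alpha> k) <= M * (1 + norm k) ^ 0 * norm (exp (- norm k))"
  proof (cases "k = 0")
   case True then show ?thesis using g(1) by (simp add: \<alpha>_def edens_def)
  next
   case False
   have "norm (cross3 k (g (- k))) <= norm k * norm (g (- k))" by (rule norm_cross_le)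
   also have "... <= norm k * (M * (norm k * exp (- norm k)))"
    using mult_left_mono[OF edens_bound[OF g(1), of "- k"] norm_ge_zero[of k]] by simp
   finally show ?thesis using False by (simp add: \<alpha>_def dot_square_norm power2_eq_square divide_le_eq mult_ac)
  qed
 qed
 have key: "- (k $ i) * \<alpha> (- k) $ j - - (k $ j) * \<alpha> (- k) $ i = g k $ l"
  if "(i, j, l) \<in> {(2,3,1), (3,1,2), (1,2,3)}" for i j l :: 3 and k
 proof (cases "k = 0")
  case True
  then have "g k = 0" using edens_bound[OF g(1), of k] by simp
  then show ?thesis using True by simp
 next
  case False
  then have n: "k \<bullet> k \<noteq> 0" by simp
  define s where "s = k \<bullet> k"
  have d: "k $ 1 * g k $ 1 + k $ 2 * g k $ 2 + k $ 3 * g k $ 3 = 0" using g(2)[of k] by (simp add: inner_vec3 sum_3)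
  have s: "s = k $ 1 * k $ 1 + k $ 2 * k $ 2 + k $ 3 * k $ 3" by (simp add: s_def inner_vec3 sum_3)
  have a: "s * \<alpha> (- k) $ i = cross3 k (g k) $ i" for i using n by (simp add: \<alpha>_def s_def cross_minus_left)
  have triple: "- a * (b * p - a * q) + c * (c * q - b * r) = (b * b + a * a + c * c) * q"
   if "b * q + a * p + c * r = 0" for a b c p q r :: real
  proof -
   have "- a * (b * p - a * q) + c * (c * q - b * r) - (b * b + a * a + c * c) * q = - b * (b * q + a * p + c * r)" by (simp add: algebra_simps)
   then show ?thesis using that by simp
  qed
  have "s * (- (k $ i) * \<alpha> (- k) $ j - - (k $ j) * \<alpha> (- k) $ i) = - (k $ i) * (s * \<alpha> (- k) $ j) + k $ j * (s * \<alpha> (- k) $ i)"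
   by (simp add: algebra_simps)
  also have "... = s * g k $ l" unfolding a using that d unfolding s
  proof (elim insertE emptyE)
   assume "(i, j, l) = (2, 3, 1)"
   then show "- (k $ i) * cross3 k (g k) $ j + k $ j * cross3 k (g k) $ i = (k $ 1 * k $ 1 + k $ 2 * k $ 2 + k $ 3 * k $ 3) * g k $ l"
    using triple[of "k $ 1" "g k $ 1" "k $ 2" "g k $ 2" "k $ 3" "g k $ 3"] d by (simp add: cross3_def algebra_simps)
  next
   assume "(i, j, l) = (3, 1, 2)"
   then show "- (k $ i) * cross3 k (g k) $ j + k $ j * cross3 k (g k) $ i = (k $ 1 * k $ 1 + k $ 2 * k $ 2 + k $ 3 * k $ 3) * g k $ l"
    using triple[of "k $ 2" "g k $ 2" "k $ 3" "g k $ 3" "k $ 1" "g k $ 1"] d by (simp add: cross3_def algebra_simps)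
  next
   assume "(i, j, l) = (1, 2, 3)"
   then show "- (k $ i) * cross3 k (g k) $ j + k $ j * cross3 k (g k) $ i = (k $ 1 * k $ 1 + k $ 2 * k $ 2 + k $ 3 * k $ 3) * g k $ l"
    using triple[of "k $ 3" "g k $ 3" "k $ 1" "g k $ 1" "k $ 2" "g k $ 2"] d by (simp add: cross3_def algebra_simps)
  qed
  finally show ?thesis using n by (simp add: s_def)
 qed
 have "pd i (hart \<alpha>) x $ j - pd j (hart \<alpha>) x $ i = z x $ l"
  if "(i, j, l) \<in> {(2,3,1), (3,1,2), (1,2,3)}" for i j l :: 3 and x
 proof -
  have "pd i (hart \<alpha>) x $ j - pd j (hart \<alpha>) x $ i = hart (%k. - (k $ i) * \<alpha> (- k) $ j - - (k $ j) * \<alpha> (- k) $ i) x"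
   unfolding pd_hart_component[OF r] by (rule hart_diff[OF rapid_pd_component[OF r] rapid_pd_component[OF r], symmetric])
  also have "... = z x $ l" unfolding key[OF that] g(3) hart_component[OF edens_rapid[OF g(1)]] ..
  finally show ?thesis .
 qed
 from that[OF r this this this] show ?thesis by simp
qed

text \<open>The gradient of the cutoff at radius \<open>n\<close> is \<open>cutoff_slope n x\<close> times \<open>x\<close>.\<close>
definition cutoff_slope :: "nat => real^3 => real" where
 "cutoff_slope n x = - 2 / (real n)^2 * dbump ([:0, 0, 1:] * (1 - pderiv 1)) (real n) x"

lemma cutoff_derivative: "(dbump 1 (real n) has_derivative (%v. (x \<bullet> v) * cutoff_slope n x)) (at x)"
 using has_derivative_dbump[of 1 "real n" x] by (simp add: cutoff_slope_def)

lemma cutoff_slope_tendsto: "(%n. cutoff_slope (Suc n) x) \<longlonglongrightarrow> 0"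
proof -
 have "(%n. - 2 / (real n)^2) \<longlonglongrightarrow> 0" by real_asymp
 from tendsto_mult[OF this dbump_tendsto[of "[:0, 0, 1:] * (1 - pderiv 1)" x]]
 show ?thesis unfolding cutoff_slope_def[abs_def] by (intro LIMSEQ_Suc) simp
qed

lemma cutoff_slope_bound: "\<exists>C>0. \<forall>n x. \<bar>cutoff_slope (Suc n) x\<bar> * norm x <= C"
proof -
 obtain C where C: "C > 0" "!!R x. \<bar>dbump ([:0, 0, 1:] * (1 - pderiv 1)) R (x :: real^3)\<bar> <= C" using dbump_bounded by blast
 have "\<bar>cutoff_slope (Suc n) x\<bar> * norm x <= 2 * C" for n and x :: "real^3"
 proof (cases "norm x >= real (Suc n)")
  case True then show ?thesis using dbump_zero[of "real (Suc n)" x] C(1) by (simp add: cutoff_slope_def)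
 next
  case False
  have "\<bar>cutoff_slope (Suc n) x\<bar> = 2 / (real (Suc n))^2 * \<bar>dbump ([:0, 0, 1:] * (1 - pderiv 1)) (real (Suc n)) x\<bar>"
   by (simp add: cutoff_slope_def abs_mult del: of_nat_Suc)
  also have "... <= 2 / (real (Suc n))^2 * C" by (intro mult_left_mono C) simp
  finally have "\<bar>cutoff_slope (Suc n) x\<bar> * norm x <= 2 / (real (Suc n))^2 * C * real (Suc n)"
   using False C(1) by (intro mult_mono) auto
  also have "... = 2 * C / real (Suc n)" by (simp add: power2_eq_square del: of_nat_Suc)
  also have "... <= 2 * C" using C(1) by (simp add: divide_le_eq)
  finally show ?thesis .
 qed
 then show ?thesis using C(1) by (intro exI[of _ "2 * C"]) auto
qed

lemma cutoff_bounds: "0 <= dbump 1 R x" "dbump 1 R x <= 1" using flat_one_bounds by (auto simp: dbump_def)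

lemma cutoff_limit: "(%n. dbump 1 (real (Suc n)) x) \<longlonglongrightarrow> exp (- 1)"
 using LIMSEQ_Suc[OF dbump_tendsto[of 1 x]] by (simp add: flat_def)

lemma Ck_cutoff_slope: "Ck k (cutoff_slope n)" unfolding cutoff_slope_def[abs_def] by (rule Ck_mult[OF Ck_const Ck_dbump])

lemma cutoff_slope_derivative: "\<exists>c. (cutoff_slope n has_derivative (%v. (x \<bullet> v) * c)) (at x)"
proof -
 note D = has_derivative_mult_right[OF has_derivative_dbump[of "[:0, 0, 1:] * (1 - pderiv 1)" "real n" x], of "- 2 / (real n)^2"]
 show ?thesis unfolding cutoff_slope_def[abs_def]
  by (rule exI[of _ "- 2 / (real n)^2 * (- 2 / (real n)^2 * dbump ([:0, 0, 1:] * ([:0, 0, 1:] * (1 - pderiv 1) - pderiv ([:0, 0, 1:] * (1 - pderiv 1)))) (real n) x)"],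
    rule has_derivative_eq_rhs[OF D]) (simp only: fun_eq_iff mult_ac simp_thms)
qed

text \<open>Up to the constant \<open>c\<close> the field is the curl of the cutoff times \<open>A\<close>.\<close>
lemma solenoidal_cutoff:
 assumes z: "Ck 1 z" "!!x. dvg z x = 0" and A: "Ck 1 A"
  and curl: "!!x. pd 2 A x $ 3 - pd 3 A x $ 2 = z x $ 1" "!!x. pd 3 A x $ 1 - pd 1 A x $ 3 = z x $ 2"
   "!!x. pd 1 A x $ 2 - pd 2 A x $ 1 = z x $ 3"
 shows "dvg (%x. c *\<^sub>R (dbump 1 (real n) x *\<^sub>R z x + cross3 (cutoff_slope n x *\<^sub>R x) (A x))) x = 0"
proof -
 obtain d where d: "(cutoff_slope n has_derivative (%v. (x \<bullet> v) * d)) (at x)" using cutoff_slope_derivative by blast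
 note zd = Ck1_has_derivative[OF z(1), of x] and Ad = Ck1_has_derivative[OF A, of x]
 note D = has_derivative_scaleR_right[OF has_derivative_add[OF has_derivative_scaleR[OF cutoff_derivative[of n x] zd]
   bounded_bilinear.FDERIV[OF bounded_bilinear_cross3 has_derivative_scaleR[OF d has_derivative_ident] Ad]], of c]
 have div: "pd 1 z x $ 1 + pd 2 z x $ 2 + pd 3 z x $ 3 = 0" using z(2)[of x] by (simp add: dvg_def sum_3)
 show ?thesis unfolding dvg_def pd_eq[OF D] sum_3 pd_def[symmetric] using div curl[of x]
  unfolding inner_axis' inner_axis by (simp add: cross3_def axis_def) algebra
qed

lemma Yd_square_integrable:
 assumes "Yd M f"
 shows "integrable lborel (%x. (norm (f x))^2)" (is ?g1) "(LBINT x. (norm (f x))^2) <= (2 * pi) ^ 3 * W2 * M^2" (is ?g2)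
  "integrable lborel (%x. (norm (pd i f x))^2)" (is ?g3) "(LBINT x. (norm (pd i f x))^2) <= (2 * pi) ^ 3 * W3 * M^2" (is ?g4)
proof -
 obtain g where g: "edens M g" "f = hart g" using assms unfolding Yd_def by auto
 note r = edens_rapid[OF g(1)]
 have p: "pd i f x = hart (dirmult (axis i 1) g) x" for x unfolding g(2) by (rule pd_hart[OF r])
 show ?g1 unfolding g(2) by (rule hart_square_integrable[OF r])
 show ?g2 unfolding g(2) by (rule edens_hart_bounds(3)[OF g(1)])
 show ?g3 unfolding p by (rule hart_square_integrable[OF rapid_dirmult[OF r]])
 show ?g4 unfolding p using edens_hart_bounds(4)[OF g(1), of "axis i 1"] by (simp add: norm_axis_1)
qed

lemma sum_square_le_double: "(a + b)^2 <= 2 * a^2 + 2 * (b::real)^2" using zero_le_power2[of "a - b"] by (simp add: power2_eq_square algebra_simps)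

lemma Yd_measurable: "Yd M f ==> f \<in> borel_measurable borel" "Yd M f ==> pd i f \<in> borel_measurable borel"
 by (rule borel_measurable_continuous_onI, rule Ck_continuous, erule Yd_Ck)
   (rule borel_measurable_continuous_onI, rule pd_continuous, erule Yd_Ck)

text \<open>Cut off the vector potential rather than the field, so that the divergence stays zero. The error term
with the derivative of the cutoff is the square integrable potential times a bounded factor that tends to zero; the constant
\<open>exp 1\<close> normalises the cutoff.\<close>
lemma solenoidal_test_fields_dense:
 assumes "Yd M z"
 obtains \<phi> where "!!n. test_fun (\<phi> n)" "!!n x. dvg (\<phi> n) x = 0"
  "!!n. integrable lborel (%x. (norm (\<phi> n x - z x))^2)"
  "(%n. LBINT x. (norm (\<phi> n x - z x))^2) \<longlonglongrightarrow> 0"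
proof -
 obtain \<alpha> :: vfield where a: "rapid \<alpha>" and curl:
  "!!x. pd 2 (hart \<alpha>) x $ 3 - pd 3 (hart \<alpha>) x $ 2 = z x $ 1"
  "!!x. pd 3 (hart \<alpha>) x $ 1 - pd 1 (hart \<alpha>) x $ 3 = z x $ 2"
  "!!x. pd 1 (hart \<alpha>) x $ 2 - pd 2 (hart \<alpha>) x $ 1 = z x $ 3" using Yd_vector_potential[OF assms] by metis
 define A where "A = hart \<alpha>"
 define \<phi> where "\<phi> n x = exp 1 *\<^sub>R (dbump 1 (real (Suc n)) x *\<^sub>R z x + cross3 (cutoff_slope (Suc n) x *\<^sub>R x) (A x))" for n x
 obtain C where C: "C > 0" "!!n x. \<bar>cutoff_slope (Suc n) x\<bar> * norm x <= C" using cutoff_slope_bound by blast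
 have CkA: "Ck k A" for k unfolding A_def by (rule rapid_Ck_hart[OF a])
 have Ckz: "Ck k z" for k by (rule Yd_Ck[OF assms])
 have t: "test_fun (\<phi> n)" for n
 proof (rule test_funI)
  show "Ck k (\<phi> n)" for k unfolding \<phi>_def[abs_def]
   by (rule Ck_scaleR[OF Ck_const], rule Ck_add, rule Ck_scaleR[OF Ck_dbump Ckz], rule Ck_cross3,
     rule Ck_scaleR[OF Ck_cutoff_slope], rule Ck_linear, rule bounded_linear_ident, rule CkA)
  show "\<phi> n x = 0" if "norm x > real (Suc n)" for x
   using that dbump_zero[of "real (Suc n)" x] by (simp add: \<phi>_def cutoff_slope_def cross_zero_left)
 qed
 have m[measurable]: "\<phi> n \<in> borel_measurable borel" "z \<in> borel_measurable borel" for n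
  by (rule test_fun_measurable[OF t], rule Yd_measurable(1)[OF assms])
 define w where "w x = 2 * (exp 1 + 1)^2 * (norm (z x))^2 + 2 * (exp 1 * C)^2 * (norm (A x))^2" for x
 have w: "integrable lborel w" unfolding w_def[abs_def] A_def
  by (intro Bochner_Integration.integrable_add integrable_mult_right Yd_square_integrable(1)[OF assms] hart_square_integrable(1)[OF a])
 have b: "(norm (\<phi> n x - z x))^2 <= w x" for n x
 proof -
  have "\<phi> n x - z x = (exp 1 * dbump 1 (real (Suc n)) x - 1) *\<^sub>R z x + exp 1 *\<^sub>R cross3 (cutoff_slope (Suc n) x *\<^sub>R x) (A x)"
   by (simp add: \<phi>_def algebra_simps del: of_nat_Suc)
  then have "norm (\<phi> n x - z x) <= norm ((exp 1 * dbump 1 (real (Suc n)) x - 1) *\<^sub>R z x) + norm (exp 1 *\<^sub>R cross3 (cutoff_slope (Suc n) x *\<^sub>R x) (A x))"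
   by (metis norm_triangle_ineq)
  moreover have "norm ((exp 1 * dbump 1 (real (Suc n)) x - 1) *\<^sub>R z x) <= (exp 1 + 1) * norm (z x)"
  proof -
   have "exp 1 * dbump 1 (real (Suc n)) x <= exp 1 * 1" by (intro mult_left_mono cutoff_bounds) simp
   moreover have "0 <= exp 1 * dbump 1 (real (Suc n)) x" by (intro mult_nonneg_nonneg cutoff_bounds) simp
   ultimately have "\<bar>exp 1 * dbump 1 (real (Suc n)) x - 1\<bar> <= exp 1 + 1" by linarith
   then show ?thesis by (simp add: mult_right_mono)
  qed
  moreover have "norm (exp 1 *\<^sub>R cross3 (cutoff_slope (Suc n) x *\<^sub>R x) (A x)) <= (exp 1 * C) * norm (A x)"
  proof -
   have "norm (cross3 (cutoff_slope (Suc n) x *\<^sub>R x) (A x)) <= norm (cutoff_slope (Suc n) x *\<^sub>R x) * norm (A x)"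
    by (rule norm_cross_le)
   also have "... <= C * norm (A x)" using C(2) by (intro mult_right_mono) auto
   finally show ?thesis by simp
  qed
  ultimately have "norm (\<phi> n x - z x) <= (exp 1 + 1) * norm (z x) + (exp 1 * C) * norm (A x)" by linarith
  then have "(norm (\<phi> n x - z x))^2 <= ((exp 1 + 1) * norm (z x) + (exp 1 * C) * norm (A x))^2" by (rule power_mono) simp
  also have "... <= 2 * ((exp 1 + 1) * norm (z x))^2 + 2 * ((exp 1 * C) * norm (A x))^2" by (rule sum_square_le_double)
  finally show ?thesis by (simp add: w_def power_mult_distrib mult.assoc)
 qed
 have l: "(%n. (norm (\<phi> n x - z x))^2) \<longlonglongrightarrow> 0" for x
 proof -
  have "(%n. exp 1 *\<^sub>R (dbump 1 (real (Suc n)) x *\<^sub>R z x + cutoff_slope (Suc n) x *\<^sub>R cross3 x (A x)) - z x)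
    \<longlonglongrightarrow> exp 1 *\<^sub>R (exp (- 1) *\<^sub>R z x + 0 *\<^sub>R cross3 x (A x)) - z x"
   by (intro tendsto_diff tendsto_scaleR tendsto_add tendsto_const cutoff_limit cutoff_slope_tendsto)
  then have "(%n. \<phi> n x - z x) \<longlonglongrightarrow> 0" by (simp add: \<phi>_def cross_mult_left exp_minus del: of_nat_Suc)
  from tendsto_power[OF tendsto_norm[OF this], of 2] show ?thesis by simp
 qed
 have i: "integrable lborel (%x. (norm (\<phi> n x - z x))^2)" for n
  by (rule dominated_integrable[OF w]) (use b in "auto intro: order_trans[OF _ abs_ge_self]")
 have "(%n. LBINT x. (norm (\<phi> n x - z x))^2) \<longlonglongrightarrow> (\<integral>x. 0 \<partial>(lborel :: (real^3) measure))"
  by (rule integral_dominated_convergence[OF _ _ w]) (use b l in auto)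
 then have lim: "(%n. LBINT x. (norm (\<phi> n x - z x))^2) \<longlonglongrightarrow> 0" by simp
 have "dvg (\<phi> n) x = 0" for n x unfolding \<phi>_def[abs_def] by (rule solenoidal_cutoff[OF Ckz Yd_dvg[OF assms] CkA curl[folded A_def]])
 from that[OF t this i lim] show ?thesis .
qed

section \<open>The energy of the difference of two solutions\<close>

text \<open>Insert the cutoff and let its radius tend to infinity; the term with its derivative disappears since
that derivative tends to zero boundedly.\<close>
lemma integral_pd_integrable:
 fixes F :: "real^3 => real"
 assumes F: "Ck 1 F" and i: "integrable lborel F" "integrable lborel (pd i F)"
 shows "(LBINT x. pd i F x) = 0"
proof -
 define h where "h n x = x $ i * cutoff_slope (Suc n) x * F x + dbump 1 (real (Suc n)) x * pd i F x" for n x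
 obtain C where C: "C > 0" "!!n x. \<bar>cutoff_slope (Suc n) x\<bar> * norm x <= C" using cutoff_slope_bound by blast
 have "(LBINT x. h n x) = 0" for n
 proof -
  have "pd i (%x. dbump 1 (real (Suc n)) x *\<^sub>R F x) x = h n x" for x
   using pd_eq[OF has_derivative_scaleR[OF cutoff_derivative[of "Suc n" x] Ck1_has_derivative[OF F, of x]], of i]
   by (simp add: h_def inner_axis pd_def del: of_nat_Suc)
  moreover have "(LBINT x. pd i (%x. dbump 1 (real (Suc n)) x *\<^sub>R F x) x) = 0"
   by (rule integral_pd_eq_0[OF Ck_scaleR[OF Ck_dbump F], of "real (Suc n)"]) (simp add: dbump_zero del: of_nat_Suc)
  ultimately show ?thesis by simp
 qed
 moreover have "(%n. LBINT x. h n x) \<longlonglongrightarrow> (LBINT x. exp (- 1) * pd i F x)"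
 proof (rule integral_dominated_convergence[where w="%x. C * \<bar>F x\<bar> + \<bar>pd i F x\<bar>"])
  have m[measurable]: "F \<in> borel_measurable borel" "pd i F \<in> borel_measurable borel"
   using borel_measurable_continuous_onI[OF Ck_continuous[OF F]] borel_measurable_continuous_onI[OF pd_continuous[OF F]] by auto
  have [measurable]: "cutoff_slope n \<in> borel_measurable borel" for n
   by (rule borel_measurable_continuous_onI[OF Ck_continuous[OF Ck_cutoff_slope[of 0 n]]])
  have [measurable]: "dbump 1 R \<in> borel_measurable (borel :: (real^3) measure)" for R
   by (rule borel_measurable_continuous_onI[OF Ck_continuous[OF Ck_dbump[of 0 1 R]]])
  have [measurable]: "(%x::real^3. x $ i) \<in> borel_measurable borel" by (rule borel_measurable_continuous_onI) (intro continuous_intros)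
  show "(%x. exp (- 1) * pd i F x) \<in> borel_measurable lborel" by measurable
  show "h n \<in> borel_measurable lborel" for n unfolding h_def[abs_def] by measurable
  show "integrable lborel (%x. C * \<bar>F x\<bar> + \<bar>pd i F x\<bar>)"
   by (intro Bochner_Integration.integrable_add integrable_mult_right integrable_abs i)
  show "AE x in lborel. (%n. h n x) \<longlonglongrightarrow> exp (- 1) * pd i F x"
  proof (rule AE_I2)
   fix x
   have "(%n. h n x) \<longlonglongrightarrow> x $ i * 0 * F x + exp (- 1) * pd i F x"
    unfolding h_def by (intro tendsto_add tendsto_mult tendsto_const cutoff_limit cutoff_slope_tendsto)
   then show "(%n. h n x) \<longlonglongrightarrow> exp (- 1) * pd i F x" by simp
  qed
  show "AE x in lborel. norm (h n x) <= C * \<bar>F x\<bar> + \<bar>pd i F x\<bar>" for n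
  proof (rule AE_I2)
   fix x
   have "\<bar>x $ i\<bar> * \<bar>cutoff_slope (Suc n) x\<bar> <= norm x * \<bar>cutoff_slope (Suc n) x\<bar>"
    by (intro mult_right_mono component_le_norm_cart) simp
   then have "\<bar>x $ i * cutoff_slope (Suc n) x\<bar> <= C" using C(2)[of n x] by (simp add: abs_mult mult.commute)
   from mult_right_mono[OF this abs_ge_zero[of "F x"]]
   have "\<bar>x $ i * cutoff_slope (Suc n) x * F x\<bar> <= C * \<bar>F x\<bar>" by (simp add: abs_mult)
   moreover have "\<bar>dbump 1 (real (Suc n)) x * pd i F x\<bar> <= 1 * \<bar>pd i F x\<bar>"
    unfolding abs_mult using cutoff_bounds[of "real (Suc n)" x] by (intro mult_right_mono) (simp_all del: of_nat_Suc)
   ultimately show "norm (h n x) <= C * \<bar>F x\<bar> + \<bar>pd i F x\<bar>" unfolding h_def real_norm_def by linarith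
  qed
 qed
 ultimately have "(%n::nat. 0) \<longlonglongrightarrow> exp (- 1) * (LBINT x. pd i F x)" by simp
 then have "exp (- 1) * (LBINT x. pd i F x) = 0" using LIMSEQ_unique tendsto_const by blast
 then show ?thesis by simp
qed

lemma frechet_derivative_expand:
 fixes f :: vfield
 assumes "Ck 1 f" shows "frechet_derivative f (at x) v = (\<Sum>i\<in>UNIV. v $ i *\<^sub>R pd i f x)"
proof -
 have l: "linear (frechet_derivative f (at x))" by (rule bounded_linear.linear[OF has_derivative_bounded_linear[OF Ck1_has_derivative[OF assms]]])
 have "v = (\<Sum>i\<in>UNIV. v $ i *\<^sub>R axis i 1)" by (simp add: vec_eq_iff axis_def if_distrib cong: if_cong)
 then have "frechet_derivative f (at x) v = frechet_derivative f (at x) (\<Sum>i\<in>UNIV. v $ i *\<^sub>R axis i 1)" by simp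
 also have "... = (\<Sum>i\<in>UNIV. v $ i *\<^sub>R pd i f x)" unfolding pd_def by (simp add: linear_sum[OF l] linear_scale[OF l])
 finally show ?thesis .
qed

lemma integrable_mult_bounded:
 fixes f g :: "real^3 => real"
 assumes "integrable lborel f" "g \<in> borel_measurable borel" "!!x. \<bar>g x\<bar> <= c"
 shows "integrable lborel (%x. f x * g x)"
proof (rule dominated_integrable[OF integrable_mult_right[OF integrable_abs[OF assms(1)], of c]])
 show "(%x. f x * g x) \<in> borel_measurable lborel" using assms(1,2) by measurable
 show "AE x in lborel. norm (f x * g x) <= norm (c * \<bar>f x\<bar>)"
 proof (rule AE_I2)
  fix x
  have "\<bar>f x * g x\<bar> <= \<bar>f x\<bar> * c" unfolding abs_mult using assms(3) by (intro mult_left_mono) auto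
  also have "... <= \<bar>c * \<bar>f x\<bar>\<bar>" by (simp add: mult.commute)
  finally show "norm (f x * g x) <= norm (c * \<bar>f x\<bar>)" by simp
 qed
qed

text \<open>Since \<open>v\<close> is solenoidal, the integrand is half the divergence of \<open>|w|^2 v\<close>.\<close>
lemma transport_orthogonal:
 assumes v: "Yd M v" and w: "Yd N w"
 shows "integrable lborel (%x. frechet_derivative w (at x) (v x) \<bullet> w x)" (is ?g1)
  and "(LBINT x. frechet_derivative w (at x) (v x) \<bullet> w x) = 0" (is ?g2)
proof -
 define F where "F i x = (w x \<bullet> w x) * v x $ i" for i x
 have vc: "Ck 1 (%x. v x $ i)" for i by (rule Ck_component[OF Yd_Ck[OF v]])
 have ww: "Ck 1 (%x. w x \<bullet> w x)" by (rule Ck_inner[OF Yd_Ck[OF w] Yd_Ck[OF w]])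
 have CF: "Ck 1 (F i)" for i unfolding F_def[abs_def] by (rule Ck_mult[OF ww vc])
 have pF: "pd i (F i) x = 2 * ((pd i w x \<bullet> w x) * v x $ i) + (w x \<bullet> w x) * pd i v x $ i" for i x
 proof -
  note D = has_derivative_mult[OF has_derivative_inner[OF Ck1_has_derivative[OF Yd_Ck[OF w], of x] Ck1_has_derivative[OF Yd_Ck[OF w], of x]]
    Ck1_has_derivative[OF vc[of i], of x]]
  show ?thesis unfolding F_def[abs_def] pd_eq[OF D] pd_def[symmetric] by (simp add: pd_component[OF Yd_Ck[OF v]] inner_commute algebra_simps)
 qed
 have vb: "\<bar>v x $ i\<bar> <= 2 * W0 * M" "\<bar>pd i v x $ i\<bar> <= 2 * W1 * M" for x i
  using component_le_norm_cart[of "v x" i] component_le_norm_cart[of "pd i v x" i] Yd_bound[OF v, of x] Yd_pd_bound[OF v, of i x] by linarith+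
 have mv: "(%x. v x $ i) \<in> borel_measurable borel" "(%x. pd i v x $ i) \<in> borel_measurable borel" for i
  using borel_measurable_continuous_onI[OF Ck_continuous[OF vc]] borel_measurable_continuous_onI[OF Ck_continuous[OF Ck_component[OF Ck_pd[OF Yd_Ck[OF v, where k="Suc 0"]]]]]
  by auto
 have iw: "integrable lborel (%x. w x \<bullet> w x)" "integrable lborel (%x. pd i w x \<bullet> w x)" for i using Yd_square_integrable(1)[OF w]
   square_integrable_product[OF Yd_measurable(2)[OF w] Yd_measurable(1)[OF w] Yd_square_integrable(3,1)[OF w]]
  by (simp_all add: dot_square_norm)
 have i1: "integrable lborel (F i)" for i unfolding F_def[abs_def] by (rule integrable_mult_bounded[OF iw(1) mv(1) vb(1)])
 have i2: "integrable lborel (%x. (pd i w x \<bullet> w x) * v x $ i)" for i by (rule integrable_mult_bounded[OF iw(2) mv(1) vb(1)])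
 have i3: "integrable lborel (%x. (w x \<bullet> w x) * pd i v x $ i)" for i by (rule integrable_mult_bounded[OF iw(1) mv(2) vb(2)])
 have ip: "integrable lborel (pd i (F i))" for i
  unfolding pF[abs_def] using i2 i3 by (intro Bochner_Integration.integrable_add integrable_mult_right)
 note z = integral_pd_integrable[OF CF i1 ip]
 have e: "frechet_derivative w (at x) (v x) \<bullet> w x = (\<Sum>i\<in>UNIV. (pd i w x \<bullet> w x) * v x $ i)" for x
  unfolding frechet_derivative_expand[OF Yd_Ck[OF w]] by (simp add: inner_sum_left mult.commute)
 show I: ?g1 unfolding e by (intro Bochner_Integration.integrable_sum i2)
 have "(\<Sum>i\<in>UNIV. (w x \<bullet> w x) * pd i v x $ i) = 0" for x
  unfolding sum_distrib_left[symmetric] using Yd_dvg[OF v, of x] by (simp add: dvg_def)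
 then have "(\<Sum>i\<in>UNIV. pd i (F i) x) = 2 * (frechet_derivative w (at x) (v x) \<bullet> w x)" for x
  unfolding pF e sum.distrib sum_distrib_left[symmetric] by simp
 then have "2 * (LBINT x. frechet_derivative w (at x) (v x) \<bullet> w x) = (LBINT x. (\<Sum>i\<in>UNIV. pd i (F i) x))" by simp
 also have "... = (\<Sum>i\<in>UNIV. LBINT x. pd i (F i) x)" by (rule Bochner_Integration.integral_sum) (rule ip)
 finally show ?g2 by (simp add: z)
qed

text \<open>\<open>- tendency \<Omega> u v w\<close> is, up to a gradient, the time derivative of \<open>w = v - u\<close> for two solutions \<open>u\<close> and \<open>v\<close>:
the nonlinearity is split as \<open>v \<cdot> \<nabla>w + w \<cdot> \<nabla>u\<close>.\<close>
definition tendency :: "real => vfield => vfield => vfield => vfield" where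
 "tendency \<Omega> u v w x = \<Omega> *\<^sub>R cross3 e3 (w x) + frechet_derivative w (at x) (v x) + frechet_derivative u (at x) (w x)"

lemma tendency_measurable:
 assumes "Yd M u" "Yd M' v" "Yd N w" shows "tendency \<Omega> u v w \<in> borel_measurable borel"
proof -
 have [measurable]: "u \<in> borel_measurable borel" "v \<in> borel_measurable borel" "w \<in> borel_measurable borel"
  "pd i u \<in> borel_measurable borel" "pd i w \<in> borel_measurable borel" for i using Yd_measurable assms by blast+
 have c: "(%x. f x $ i) \<in> borel_measurable borel" if "f \<in> borel_measurable borel" for i and f :: vfield
  by (rule measurable_compose[OF that]) (intro borel_measurable_continuous_onI continuous_intros)
 show ?thesis unfolding tendency_def[abs_def] frechet_derivative_expand[OF Yd_Ck[OF assms(3)]] frechet_derivative_expand[OF Yd_Ck[OF assms(1)]]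
  by (intro borel_measurable_add borel_measurable_scaleR borel_measurable_const cross3_measurable borel_measurable_sum c) measurable
qed

lemma norm_frechet_derivative_le:
 fixes f :: vfield assumes "Ck 1 f"
 shows "norm (frechet_derivative f (at x) v) <= norm v * (norm (pd 1 f x) + norm (pd 2 f x) + norm (pd 3 f x))"
proof -
 have "norm (frechet_derivative f (at x) v) <= (\<Sum>i\<in>UNIV. norm (v $ i *\<^sub>R pd i f x))"
  unfolding frechet_derivative_expand[OF assms] by (rule norm_sum)
 also have "... <= (\<Sum>i\<in>UNIV. norm v * norm (pd i f x))"
  unfolding norm_scaleR by (intro sum_mono mult_right_mono) (simp_all add: component_le_norm_cart)
 finally show ?thesis by (simp add: sum_3 algebra_simps)
qed

lemma tendency_bound:
 assumes u: "Yd M u" and v: "Yd M v" and w: "Yd N w"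
 shows "integrable lborel (%x. (norm (tendency \<Omega> u v w x))^2)" (is ?g1)
  and "(LBINT x. (norm (tendency \<Omega> u v w x))^2)
   <= (2 * pi) ^ 3 * (4 * (\<bar>\<Omega>\<bar> + 6 * W1 * M)^2 * W2 + 12 * (2 * W0 * M)^2 * W3) * N^2" (is ?g2)
proof -
 define P where "P = \<bar>\<Omega>\<bar> + 6 * W1 * M"
 define c where "c = 2 * W0 * M"
 define D where "D x = 4 * P^2 * (norm (w x))^2 + 4 * c^2 * ((norm (pd 1 w x))^2 + (norm (pd 2 w x))^2 + (norm (pd 3 w x))^2)" for x
 have le: "(norm (tendency \<Omega> u v w x))^2 <= D x" for x
 proof -
  have "norm (tendency \<Omega> u v w x) <= norm (\<Omega> *\<^sub>R cross3 e3 (w x)) + norm (frechet_derivative w (at x) (v x)) + norm (frechet_derivative u (at x) (w x))"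
   unfolding tendency_def by (meson norm_triangle_ineq norm_triangle_mono order_refl)
  moreover have "norm (\<Omega> *\<^sub>R cross3 e3 (w x)) <= \<bar>\<Omega>\<bar> * norm (w x)"
   unfolding norm_scaleR by (intro mult_left_mono norm_cross_e3) simp
  moreover have "norm (frechet_derivative w (at x) (v x)) <= c * (norm (pd 1 w x) + norm (pd 2 w x) + norm (pd 3 w x))"
   using norm_frechet_derivative_le[OF Yd_Ck[OF w], of x "v x"] mult_right_mono[OF Yd_bound[OF v, of x], of "norm (pd 1 w x) + norm (pd 2 w x) + norm (pd 3 w x)"]
   by (simp add: c_def)
  moreover have "norm (frechet_derivative u (at x) (w x)) <= norm (w x) * (6 * W1 * M)"
  proof -
   have "norm (pd 1 u x) + norm (pd 2 u x) + norm (pd 3 u x) <= 6 * W1 * M"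
    using Yd_pd_bound[OF u, of 1 x] Yd_pd_bound[OF u, of 2 x] Yd_pd_bound[OF u, of 3 x] by linarith
   from mult_left_mono[OF this norm_ge_zero[of "w x"]] show ?thesis using norm_frechet_derivative_le[OF Yd_Ck[OF u], of x "w x"] by linarith
  qed
  ultimately have "norm (tendency \<Omega> u v w x) <= P * norm (w x) + c * norm (pd 1 w x) + c * norm (pd 2 w x) + c * norm (pd 3 w x)"
   unfolding P_def by (simp add: algebra_simps)
  then have "(norm (tendency \<Omega> u v w x))^2 <= (P * norm (w x) + c * norm (pd 1 w x) + c * norm (pd 2 w x) + c * norm (pd 3 w x))^2"
   by (rule power_mono) simp
  also have "... <= 2 * (P * norm (w x) + c * norm (pd 1 w x))^2 + 2 * (c * norm (pd 2 w x) + c * norm (pd 3 w x))^2"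
   using sum_square_le_double[of "P * norm (w x) + c * norm (pd 1 w x)" "c * norm (pd 2 w x) + c * norm (pd 3 w x)"] by (simp add: add.assoc)
  also have "... <= D x"
   using sum_square_le_double[of "P * norm (w x)" "c * norm (pd 1 w x)"] sum_square_le_double[of "c * norm (pd 2 w x)" "c * norm (pd 3 w x)"]
   unfolding D_def by (simp add: power_mult_distrib algebra_simps)
  finally show ?thesis .
 qed
 have iD: "integrable lborel D" unfolding D_def[abs_def]
  by (intro Bochner_Integration.integrable_add integrable_mult_right Yd_square_integrable[OF w])
 have m: "(%x. (norm (tendency \<Omega> u v w x))^2) \<in> borel_measurable lborel" using tendency_measurable[OF u v w] by measurable
 show i: ?g1 by (rule dominated_integrable[OF iD m]) (use le in "auto intro: order_trans[OF _ abs_ge_self]")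
 have "(LBINT x. (norm (tendency \<Omega> u v w x))^2) <= (LBINT x. D x)" by (rule integral_mono[OF i iD le])
 also have "... = 4 * P^2 * (LBINT x. (norm (w x))^2) + 4 * c^2 * ((LBINT x. (norm (pd 1 w x))^2) + (LBINT x. (norm (pd 2 w x))^2) + (LBINT x. (norm (pd 3 w x))^2))"
  unfolding D_def using Yd_square_integrable(1,3)[OF w] by simp
 also have "... <= 4 * P^2 * ((2 * pi) ^ 3 * W2 * N^2) + 4 * c^2 * ((2 * pi) ^ 3 * W3 * N^2 + (2 * pi) ^ 3 * W3 * N^2 + (2 * pi) ^ 3 * W3 * N^2)"
  by (intro add_mono mult_left_mono Yd_square_integrable[OF w]) auto
 finally show ?g2 by (simp add: P_def c_def algebra_simps)
qed

text \<open>The Coriolis term is pointwise orthogonal to \<open>w\<close>, the transport term is orthogonal in the mean, and the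
remaining term involves no derivative of \<open>w\<close>.\<close>
lemma tendency_energy:
 assumes u: "Yd M u" and v: "Yd M v" and w: "Yd N w"
 shows "\<bar>LBINT x. tendency \<Omega> u v w x \<bullet> w x\<bar> <= 6 * W1 * M * (LBINT x. (norm (w x))^2)"
proof -
 have i: "integrable lborel (%x. tendency \<Omega> u v w x \<bullet> w x)"
  by (rule square_integrable_product[OF tendency_measurable[OF u v w] Yd_measurable(1)[OF w] tendency_bound(1)[OF u v w] Yd_square_integrable(1)[OF w]])
 have e: "tendency \<Omega> u v w x \<bullet> w x = frechet_derivative w (at x) (v x) \<bullet> w x + frechet_derivative u (at x) (w x) \<bullet> w x" for x
  by (simp add: tendency_def inner_add_left dot_cross_self)
 have i2: "integrable lborel (%x. frechet_derivative u (at x) (w x) \<bullet> w x)"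
  using Bochner_Integration.integrable_diff[OF i transport_orthogonal(1)[OF v w]] by (simp add: e)
 have "(LBINT x. tendency \<Omega> u v w x \<bullet> w x) = (LBINT x. frechet_derivative u (at x) (w x) \<bullet> w x)"
  unfolding e using transport_orthogonal[OF v w] i2 by simp
 also have "\<bar>...\<bar> <= (LBINT x. \<bar>frechet_derivative u (at x) (w x) \<bullet> w x\<bar>)" by (rule integral_abs_bound)
 also have "... <= (LBINT x. 6 * W1 * M * (norm (w x))^2)"
 proof (rule integral_mono)
  fix x
  have "norm (pd 1 u x) + norm (pd 2 u x) + norm (pd 3 u x) <= 6 * W1 * M"
   using Yd_pd_bound[OF u, of 1 x] Yd_pd_bound[OF u, of 2 x] Yd_pd_bound[OF u, of 3 x] by linarith
  from mult_left_mono[OF this norm_ge_zero[of "w x"]] have "norm (frechet_derivative u (at x) (w x)) <= norm (w x) * (6 * W1 * M)"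
   using norm_frechet_derivative_le[OF Yd_Ck[OF u], of x "w x"] by linarith
  from mult_right_mono[OF this norm_ge_zero[of "w x"]]
  show "\<bar>frechet_derivative u (at x) (w x) \<bullet> w x\<bar> <= 6 * W1 * M * (norm (w x))^2"
   using Cauchy_Schwarz_ineq2[of "frechet_derivative u (at x) (w x)" "w x"] by (simp add: power2_eq_square mult_ac)
 qed (use i2 Yd_square_integrable(1)[OF w] in auto)
 finally show ?thesis by simp
qed

lemma L2_Cauchy_Schwarz:
 fixes f g :: "real^3 => real^3"
 assumes m: "f \<in> borel_measurable borel" "g \<in> borel_measurable borel"
  and i: "integrable lborel (%x. (norm (f x))^2)" "integrable lborel (%x. (norm (g x))^2)"
 shows "\<bar>LBINT x. f x \<bullet> g x\<bar> <= sqrt (LBINT x. (norm (f x))^2) * sqrt (LBINT x. (norm (g x))^2)"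
proof -
 define A where "A = (LBINT x. (norm (f x))^2)"
 define B where "B = (LBINT x. (norm (g x))^2)"
 define c where "c = (LBINT x. f x \<bullet> g x)"
 note ifg = square_integrable_product[OF m i]
 have q: "0 <= A + 2 * r * c + r^2 * B" for r :: real
 proof -
  have "0 <= (LBINT x. (norm (f x + r *\<^sub>R g x))^2)" by (rule Bochner_Integration.integral_nonneg) simp
  also have "(%x. (norm (f x + r *\<^sub>R g x))^2) = (%x. (norm (f x))^2 + 2 * r * (f x \<bullet> g x) + r^2 * (norm (g x))^2)"
   unfolding power2_norm_eq_inner
   by (simp add: fun_eq_iff inner_add_left inner_add_right inner_commute[of "g _" "f _"] power2_eq_square algebra_simps)
  finally show ?thesis using i ifg by (simp add: A_def B_def c_def)
 qed
 have "c^2 <= A * B"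
 proof (cases "B = 0")
  case True
  have "c = 0"
  proof (rule ccontr)
   assume "c \<noteq> 0"
   then show False using q[of "- (A + 1) / (2 * c)"] True by (simp add: field_simps)
  qed
  then show ?thesis using True by simp
 next
  case False
  have "0 <= B" unfolding B_def by (rule Bochner_Integration.integral_nonneg) simp
  then have B: "B > 0" using False by simp
  have "0 <= B * (A + 2 * (- c / B) * c + (- c / B)^2 * B)" using q[of "- c / B"] B by simp
  also have "... = A * B - c^2" using B by (simp add: field_simps power2_eq_square)
  finally show ?thesis by simp
 qed
 then show ?thesis unfolding A_def[symmetric] B_def[symmetric] c_def[symmetric]
  using real_sqrt_le_mono[of "c^2" "A * B"] by (simp add: real_sqrt_mult)
qed

section \<open>Uniqueness\<close>

lemma full_measure_dense:
 fixes E :: "real set"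
 assumes null: "AE s in lebesgue. s \<in> {0..T} --> s \<in> E" and ab: "0 <= a" "a < b" "b <= T"
 shows "\<exists>s\<in>E. a < s \<and> s < b"
proof (rule ccontr)
 assume n: "\<not> (\<exists>s\<in>E. a < s \<and> s < b)"
 have "AE s in lebesgue. s \<notin> {a<..<b}" using null by eventually_elim (use n ab in auto)
 then have "{a<..<b} \<in> null_sets lebesgue" by (subst AE_iff_null_sets) auto
 then have "{a<..<b} = {}" using open_not_negligible[of "{a<..<b}"] by (auto simp: negligible_iff_null_sets)
 then show False using ab(2) by (metis dense greaterThanLessThan_iff empty_iff)
qed

text \<open>The quadratic error in the hypothesis sums to \<open>O(1/n)\<close> along a partition into \<open>n\<close> intervals. Partition
points can be moved into \<open>S\<close> at the cost of doubling the mesh.\<close>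
lemma gronwall_on_dense_set:
 fixes y :: "real => real"
 assumes S: "0 \<in> S" "t \<in> S" "0 <= t" and y: "y 0 = 0" "!!s. s \<in> S ==> 0 <= y s" and ab: "0 <= a" "0 <= b"
  and dense: "!!c d. 0 <= c ==> c < d ==> d <= t ==> \<exists>s\<in>S. c < s \<and> s < d"
  and step: "!!r s. r \<in> S ==> s \<in> S ==> 0 <= r ==> r <= s ==> s <= t ==> y s <= y r * (1 + a * (s - r)) + b * (s - r)^2"
 shows "y t = 0"
proof (cases "t = 0")
 case True then show ?thesis using y by simp
next
 case False
 then have t: "t > 0" using S by simp
 have "y t <= 4 * b * t^2 * exp (2 * a * t) * inverse (real (Suc n))" for n
 proof -
  define N where "N = Suc n"
  define h where "h = t / real N"
  have N: "real N > 0" "N > 0" and h: "h > 0" "real N * h = t" using t by (auto simp: N_def h_def)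
  have jt: "real j * h <= t" if "j <= N" for j using mult_right_mono[of "real j" "real N" h] that h by simp
  have "\<exists>s. s \<in> S \<and> 0 <= s \<and> real j * h - h <= s \<and> s <= real j * h \<and> (j = 0 --> s = 0) \<and> (j = N --> s = t)" if j: "j <= N" for j
  proof -
   consider "j = 0" | "j = N" | "0 < j" "j < N" using j by linarith
   then show ?thesis
   proof cases
    case 1 then show ?thesis using S(1) h(1) N(2) by (intro exI[of _ 0]) auto
   next
    case 2 then show ?thesis using S(2,3) h N(2) by (intro exI[of _ t]) auto
   next
    case 3
    have "0 <= (real j - 1) * h" using 3 h(1) by (intro mult_nonneg_nonneg) auto
    then have "0 <= real j * h - h" by (simp add: algebra_simps)
    moreover have "real j * h - h < real j * h" using h(1) by simp
    ultimately obtain s where "s \<in> S" "real j * h - h < s" "s < real j * h" using dense jt[OF j] by metis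
    moreover from this have "0 <= s" using \<open>0 <= real j * h - h\<close> by linarith
    ultimately show ?thesis using 3 by (intro exI[of _ s]) auto
   qed
  qed
  then obtain \<tau> where \<tau>: "!!j. j <= N ==> \<tau> j \<in> S \<and> 0 <= \<tau> j \<and> real j * h - h <= \<tau> j \<and> \<tau> j <= real j * h \<and> (j = 0 --> \<tau> j = 0) \<and> (j = N --> \<tau> j = t)"
   by metis
  have "y (\<tau> j) <= real j * (b * (2 * h)^2) * exp (a * (2 * h) * real j)" if "j <= N" for j using that
  proof (induction j)
   case 0 then show ?case using \<tau>[of 0] y(1) by simp
  next
   case (Suc j)
   have j: "j <= N" using Suc by simp
   note p = \<tau>[OF j] and q = \<tau>[OF Suc.prems]
   define H where "H = 2 * h"
   have d: "0 <= \<tau> (Suc j) - \<tau> j" "\<tau> (Suc j) - \<tau> j <= H" using p q by (auto simp: algebra_simps H_def)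
   have H: "0 <= H" using h by (simp add: H_def)
   have "\<tau> (Suc j) <= t" using q jt[OF Suc.prems] by linarith
   then have "y (\<tau> (Suc j)) <= y (\<tau> j) * (1 + a * (\<tau> (Suc j) - \<tau> j)) + b * (\<tau> (Suc j) - \<tau> j)^2"
    using step[of "\<tau> j" "\<tau> (Suc j)"] p q d by simp
   also have "... <= y (\<tau> j) * (1 + a * H) + b * H^2" using p y(2) ab d by (intro add_mono mult_left_mono power_mono) auto
   also have "... <= (real j * (b * H^2) * exp (a * H * real j)) * exp (a * H) + b * H^2"
   proof (intro add_mono mult_mono)
    show "y (\<tau> j) <= real j * (b * H^2) * exp (a * H * real j)" using Suc.IH[OF j] by (simp add: H_def)
    show "1 + a * H <= exp (a * H)" by (rule exp_ge_add_one_self)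
   qed (use ab H in auto)
   also have "... <= real (Suc j) * (b * H^2) * exp (a * H * real (Suc j))"
   proof -
    have e: "exp (a * H * real j) * exp (a * H) = exp (a * H * real (Suc j))" unfolding exp_add[symmetric] by (simp add: distrib_left)
    have "real j * (b * H^2) * exp (a * H * real j) * exp (a * H) = real j * (b * H^2) * exp (a * H * real (Suc j))"
     unfolding e[symmetric] by (simp only: mult.assoc)
    moreover have "b * H^2 * 1 <= b * H^2 * exp (a * H * real (Suc j))" by (intro mult_left_mono mult_nonneg_nonneg) (use ab H in auto)
    moreover have "real (Suc j) * (b * H^2) * exp (a * H * real (Suc j))
     = real j * (b * H^2) * exp (a * H * real (Suc j)) + b * H^2 * exp (a * H * real (Suc j))"
     unfolding of_nat_Suc[of j] by (simp only: distrib_right mult_1_left add.commute)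
    ultimately show ?thesis by linarith
   qed
   finally show ?case by (simp add: H_def)
  qed
  from this[of N] have "y t <= real N * (b * (2 * h)^2) * exp (a * (2 * h) * real N)" using \<tau>[of N] by simp
  also have "a * (2 * h) * real N = 2 * a * t" using h(2) by (simp add: algebra_simps)
  also have "real N * (b * (2 * h)^2) = 4 * b * t^2 * inverse (real N)" using N(1) by (simp add: h_def power2_eq_square field_simps)
  finally show ?thesis by (simp add: N_def mult_ac)
 qed
 moreover have "(%n. 4 * b * t^2 * exp (2 * a * t) * inverse (real (Suc n))) \<longlonglongrightarrow> 4 * b * t^2 * exp (2 * a * t) * 0"
  by (intro tendsto_mult tendsto_const LIMSEQ_inverse_real_of_nat)
 ultimately have "y t <= 0" using LIMSEQ_le_const[of _ "4 * b * t^2 * exp (2 * a * t) * 0" "y t"] by auto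
 then show ?thesis using y(2)[OF S(2)] by simp
qed

lemma Yd_mono: "Yd M f ==> M <= N ==> Yd N f" unfolding Yd_def using edens_mono by blast

lemma integral_increment_le:
 fixes k :: "real => real"
 assumes k: "set_integrable lebesgue {0..T} k" and st: "0 <= s" "s <= t" "t <= T"
  and le: "AE r in lebesgue. r \<in> {s..t} --> - k r <= L"
 shows "(LINT r:{0..s}|lebesgue. k r) - (LINT r:{0..t}|lebesgue. k r) <= L * (t - s)"
proof -
 have i: "set_integrable lebesgue {0..r} k" if "r <= T" for r by (rule set_integrable_subset[OF k]) (use that in auto)
 have "(LINT r:{0..s}|lebesgue. k r) - (LINT r:{0..t}|lebesgue. k r)
  = (LINT r|lebesgue. indicator {0..s} r *\<^sub>R k r - indicator {0..t} r *\<^sub>R k r)" unfolding set_lebesgue_integral_def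
  by (rule Bochner_Integration.integral_diff[symmetric]) (use i[of s] i[of t] st in "auto simp: set_integrable_def")
 also have "... <= (LINT r|lebesgue. L * indicator {s<..t} r)"
 proof (rule integral_mono_AE)
  show "integrable lebesgue (%r. indicator {0..s} r *\<^sub>R k r - indicator {0..t} r *\<^sub>R k r)"
   using i[of s] i[of t] st by (auto simp: set_integrable_def)
  have "integrable lebesgue (indicator {s<..t} :: real => real)" by (intro integrable_real_indicator) (use st in auto)
  then show "integrable lebesgue (%r. L * indicator {s<..t} r)" by (rule integrable_mult_right)
  show "AE r in lebesgue. indicator {0..s} r *\<^sub>R k r - indicator {0..t} r *\<^sub>R k r <= L * indicator {s<..t} r"
   using le by eventually_elim (use st in "auto simp: indicator_def")
 qed
 also have "... = L * (t - s)" using st by (simp add: measure_completion)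
 finally show ?thesis .
qed

lemma L2_limit:
 fixes \<psi> :: vfield
 assumes f: "f \<in> borel_measurable borel" "integrable lborel (%x. (norm (f x))^2)"
  and z: "z \<in> borel_measurable borel" "integrable lborel (%x. (norm (z x))^2)"
  and p: "\<psi> \<in> borel_measurable borel" "integrable lborel (%x. (norm (\<psi> x - z x))^2)"
 shows "\<bar>(LBINT x. f x \<bullet> \<psi> x) - (LBINT x. f x \<bullet> z x)\<bar>
  <= sqrt (LBINT x. (norm (f x))^2) * sqrt (LBINT x. (norm (\<psi> x - z x))^2)" (is ?g1)
  and "integrable lborel (%x. f x \<bullet> \<psi> x)" (is ?g2)
proof -
 have m: "(%x. \<psi> x - z x) \<in> borel_measurable borel" using p(1) z(1) by simp
 note i1 = square_integrable_product[OF f(1) m f(2) p(2)] and i2 = square_integrable_product[OF f(1) z(1) f(2) z(2)]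
 have e: "f x \<bullet> \<psi> x = f x \<bullet> (\<psi> x - z x) + f x \<bullet> z x" for x by (simp add: inner_diff_right)
 show ?g2 unfolding e by (rule Bochner_Integration.integrable_add[OF i1 i2])
 have "(LBINT x. f x \<bullet> \<psi> x) - (LBINT x. f x \<bullet> z x) = (LBINT x. f x \<bullet> (\<psi> x - z x))"
  unfolding e[of x for x] Bochner_Integration.integral_add[OF i1 i2] by simp
 then show ?g1 using L2_Cauchy_Schwarz[OF f(1) m f(2) p(2)] by simp
qed

text \<open>The initial difference is put to zero by definition, since nothing is known about membership in \<open>Y\<close> at
the single time \<open>0\<close>. Time derivatives are avoided: increments of \<open>w\<close> over short intervals are tested against
fixed fields.\<close>
lemma energy_uniqueness:
 fixes u v w :: "real => vfield"
 assumes E: "E \<subseteq> {0<..T}" and null: "AE s in lebesgue. s \<in> {0..T} --> s \<in> E"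
  and u: "!!t. t \<in> E ==> Yd M (u t)" and v: "!!t. t \<in> E ==> Yd M (v t)"
  and w: "!!t. t \<in> E ==> w t = (%x. v t x - u t x)" and w0: "w 0 = (%x. 0)"
  and eq: "!!\<phi>. test_fun \<phi> ==> (!!x. dvg \<phi> x = 0) ==> \<exists>k. set_integrable lebesgue {0..T} k \<and>
    (\<forall>s\<in>E. k s = (LBINT x. tendency \<Omega> (u s) (v s) (w s) x \<bullet> \<phi> x)) \<and>
    (\<forall>t\<in>insert 0 E. (LBINT x. w t x \<bullet> \<phi> x) = - (LINT s:{0..t}|lebesgue. k s))"
  and t0: "t0 \<in> E"
 shows "w t0 x = 0"
proof -
 define S where "S = insert 0 E"
 have S: "S \<subseteq> {0..T}" "E \<subseteq> S" "0 \<in> S" using E t0 by (auto simp: S_def)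
 have M: "0 <= M" by (rule Yd_nonneg[OF u[OF t0]])
 have wY: "Yd (2 * M) (w t)" if "t \<in> S" for t using that Yd_mono[OF Yd_zero, of "2 * M"] Yd_diff[OF v u, of t t] M by (auto simp: S_def w0 w)
 define Cb where "Cb = sqrt ((2 * pi) ^ 3 * (4 * (\<bar>\<Omega>\<bar> + 6 * W1 * M)^2 * W2 + 12 * (2 * W0 * M)^2 * W3) * (2 * M)^2)"
 have Cb: "0 <= Cb" using W_nonneg by (simp add: Cb_def)
 let ?B = "%r. tendency \<Omega> (u r) (v r) (w r)"
 have rS: "r \<in> S" if "r \<in> E" for r using that S by auto
 have Bm: "?B r \<in> borel_measurable borel" if "r \<in> E" for r by (rule tendency_measurable[OF u v wY]) (use that rS in auto)
 have Bi: "integrable lborel (%x. (norm (?B r x))^2)" if "r \<in> E" for r by (rule tendency_bound(1)[OF u v wY]) (use that rS in auto)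
 have Bb: "sqrt (LBINT x. (norm (?B r x))^2) <= Cb" if "r \<in> E" for r
  unfolding Cb_def by (rule real_sqrt_le_mono) (rule tendency_bound(2)[OF u v wY], use that rS in auto)
 \<comment> \<open>Every \<open>z\<close> in \<open>Y\<close> is an admissible test field: the error of its approximation is uniform in time.\<close>
 have incr: "(LBINT x. (w t x - w s x) \<bullet> z x) <= L * (t - s)"
  if st: "s \<in> S" "t \<in> S" "s <= t" and z: "Yd N z" and L: "!!r. r \<in> E ==> s <= r ==> r <= t ==> - (LBINT x. ?B r x \<bullet> z x) <= L"
  for s t z N L
 proof -
  obtain \<phi> where \<phi>: "!!n. test_fun (\<phi> n)" "!!n x. dvg (\<phi> n) x = 0"
   "!!n. integrable lborel (%x. (norm (\<phi> n x - z x))^2)"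
   "(%n. LBINT x. (norm (\<phi> n x - z x))^2) \<longlonglongrightarrow> 0" by (rule solenoidal_test_fields_dense[OF z], rule that)
  define e where "e n = sqrt (LBINT x. (norm (\<phi> n x - z x))^2)" for n
  have e0: "e \<longlonglongrightarrow> 0" unfolding e_def[abs_def] using tendsto_real_sqrt[OF \<phi>(4)] by simp
  have en: "0 <= e n" for n unfolding e_def by (intro real_sqrt_ge_zero Bochner_Integration.integral_nonneg) simp
  have dY: "Yd (2 * M + 2 * M) (%x. w t x - w s x)" by (rule Yd_diff[OF wY[OF st(2)] wY[OF st(1)]])
  note lim = L2_limit[OF _ _ Yd_measurable(1)[OF z] Yd_square_integrable(1)[OF z] test_fun_measurable[OF \<phi>(1)] \<phi>(3), folded e_def]
  define d where "d = sqrt (LBINT x. (norm (w t x - w s x))^2)"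
  have a: "(LBINT x. (w t x - w s x) \<bullet> z x) - d * e n <= (LBINT x. (w t x - w s x) \<bullet> \<phi> n x)" for n
   using lim(1)[OF Yd_measurable(1)[OF dY] Yd_square_integrable(1)[OF dY], of n] unfolding d_def by linarith
  have b: "(LBINT x. (w t x - w s x) \<bullet> \<phi> n x) <= (L + Cb * e n) * (t - s)" for n
  proof -
   obtain k where k': "set_integrable lebesgue {0..T} k \<and> (\<forall>r\<in>E. k r = (LBINT x. ?B r x \<bullet> \<phi> n x)) \<and>
     (\<forall>t\<in>insert 0 E. (LBINT x. w t x \<bullet> \<phi> n x) = - (LINT s:{0..t}|lebesgue. k s))"
    using eq[OF \<phi>(1)[of n] \<phi>(2)[of n]] by (rule exE)
   have k1: "set_integrable lebesgue {0..T} k" by (rule conjunct1[OF k'])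
   have k2: "k r = (LBINT x. ?B r x \<bullet> \<phi> n x)" if "r \<in> E" for r by (rule bspec[OF conjunct1[OF conjunct2[OF k']] that])
   have k3: "(LBINT x. w t x \<bullet> \<phi> n x) = - (LINT s:{0..t}|lebesgue. k s)" if "t \<in> S" for t
    by (rule bspec[OF conjunct2[OF conjunct2[OF k']] that[unfolded S_def]])
   have kL: "- k r <= L + Cb * e n" if r: "r \<in> E" "s <= r" "r <= t" for r
   proof -
    have "\<bar>k r - (LBINT x. ?B r x \<bullet> z x)\<bar> <= sqrt (LBINT x. (norm (?B r x))^2) * e n"
     unfolding k2[OF r(1)] by (rule lim(1)[OF Bm[OF r(1)] Bi[OF r(1)]])
    also have "... <= Cb * e n" by (rule mult_right_mono[OF Bb[OF r(1)] en])
    finally show ?thesis using L[OF r] by linarith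
   qed
   have ae: "AE r in lebesgue. r \<in> {s..t} --> - k r <= L + Cb * e n" using null by eventually_elim (use S st kL in auto)
   have i: "integrable lborel (%x. w r x \<bullet> \<phi> n x)" if "r \<in> S" for r
    by (rule lim(2)[OF Yd_measurable(1)[OF wY[OF that]] Yd_square_integrable(1)[OF wY[OF that]]])
   have "(LBINT x. (w t x - w s x) \<bullet> \<phi> n x) = (LBINT x. w t x \<bullet> \<phi> n x) - (LBINT x. w s x \<bullet> \<phi> n x)"
    unfolding inner_diff_left by (rule Bochner_Integration.integral_diff[OF i[OF st(2)] i[OF st(1)]])
   also have "... = (LINT r:{0..s}|lebesgue. k r) - (LINT r:{0..t}|lebesgue. k r)" using k3[OF st(1)] k3[OF st(2)] by simp
   also have "... <= (L + Cb * e n) * (t - s)" by (rule integral_increment_le[OF k1 _ st(3) _ ae]) (use S st in auto)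
   finally show ?thesis .
  qed
  have "(%n. (L + Cb * e n) * (t - s) + d * e n) \<longlonglongrightarrow> (L + Cb * 0) * (t - s) + d * 0"
   by (intro tendsto_add tendsto_mult tendsto_const e0)
  moreover have "(LBINT x. (w t x - w s x) \<bullet> z x) <= (L + Cb * e n) * (t - s) + d * e n" for n using a[of n] b[of n] by linarith
  ultimately show ?thesis by (intro LIMSEQ_le_const[where a="LBINT x. (w t x - w s x) \<bullet> z x"]) auto
 qed
 define D where "D s t = sqrt (LBINT x. (norm (w t x - w s x))^2)" for s t
 have D2: "(D s t)^2 = (LBINT x. (norm (w t x - w s x))^2)" "0 <= D s t" for s t
  unfolding D_def by (auto intro!: real_sqrt_pow2 Bochner_Integration.integral_nonneg)
 have BD: "\<bar>LBINT x. ?B r x \<bullet> (w t x - w s x)\<bar> <= Cb * D s t" if "r \<in> E" "s \<in> S" "t \<in> S" for r s t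
 proof -
  have dY: "Yd (2 * M + 2 * M) (%x. w t x - w s x)" by (rule Yd_diff[OF wY[OF that(3)] wY[OF that(2)]])
  have "\<bar>LBINT x. ?B r x \<bullet> (w t x - w s x)\<bar> <= sqrt (LBINT x. (norm (?B r x))^2) * D s t"
   unfolding D_def by (rule L2_Cauchy_Schwarz[OF Bm[OF that(1)] Yd_measurable(1)[OF dY] Bi[OF that(1)] Yd_square_integrable(1)[OF dY]])
  also have "... <= Cb * D s t" by (rule mult_right_mono[OF Bb[OF that(1)] D2(2)])
  finally show ?thesis .
 qed
 \<comment> \<open>Testing the increment against itself.\<close>
 have lip: "D s t <= Cb * (t - s)" if st: "s \<in> S" "t \<in> S" "s <= t" for s t
 proof -
  have dY: "Yd (2 * M + 2 * M) (%x. w t x - w s x)" by (rule Yd_diff[OF wY[OF st(2)] wY[OF st(1)]])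
  have "(LBINT x. (w t x - w s x) \<bullet> (w t x - w s x)) <= (Cb * D s t) * (t - s)"
   by (rule incr[OF st dY]) (use BD[OF _ st(1,2)] in fastforce)
  then have "(D s t)^2 <= (Cb * (t - s)) * D s t" by (simp add: D2(1) power2_norm_eq_inner mult_ac)
  then have "D s t * D s t <= (Cb * (t - s)) * D s t" by (simp add: power2_eq_square)
  then show ?thesis using D2(2)[of s t] Cb st(3) by (cases "D s t = 0") (auto simp: mult_le_cancel_right)
 qed
 define y where "y t = (LBINT x. (norm (w t x))^2)" for t
 have y0: "0 <= y t" for t unfolding y_def by (rule Bochner_Integration.integral_nonneg) simp
 have wi: "integrable lborel (%x. (norm (w t x))^2)" if "t \<in> S" for t by (rule Yd_square_integrable(1)[OF wY[OF that]])
 have wwi: "integrable lborel (%x. (w t x - w s x) \<bullet> w s x)" if "s \<in> S" "t \<in> S" for s t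
  by (rule square_integrable_product[OF Yd_measurable(1)[OF Yd_diff[OF wY wY]] Yd_measurable(1)[OF wY] Yd_square_integrable(1)[OF Yd_diff[OF wY wY]] wi])
    (use that in auto)
 have di: "integrable lborel (%x. (norm (w t x - w s x))^2)" if "s \<in> S" "t \<in> S" for s t
  by (rule Yd_square_integrable(1)[OF Yd_diff[OF wY[OF that(2)] wY[OF that(1)]]])
 have expand: "y t = y s + 2 * (LBINT x. (w t x - w s x) \<bullet> w s x) + (D s t)^2" if "s \<in> S" "t \<in> S" for s t
 proof -
  have "(norm (w t x))^2 = (norm (w s x))^2 + 2 * ((w t x - w s x) \<bullet> w s x) + (norm (w t x - w s x))^2" for x
   unfolding power2_norm_eq_inner by (simp add: inner_diff_left inner_diff_right inner_commute)
  then have "y t = (LBINT x. (norm (w s x))^2 + 2 * ((w t x - w s x) \<bullet> w s x) + (norm (w t x - w s x))^2)" by (simp add: y_def)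
  also have "... = y s + 2 * (LBINT x. (w t x - w s x) \<bullet> w s x) + (D s t)^2"
   unfolding D2(1) y_def using wi[OF that(1)] wwi[OF that] di[OF that] by simp
  finally show ?thesis .
 qed
 have crude: "y t <= 2 * y s + 2 * (D s t)^2" if "s \<in> S" "t \<in> S" for s t
 proof -
  have "(norm (w t x))^2 <= 2 * (norm (w s x))^2 + 2 * (norm (w t x - w s x))^2" for x
  proof -
   have "(norm (w t x))^2 <= (norm (w s x) + norm (w t x - w s x))^2"
    by (intro power_mono) (use norm_triangle_ineq[of "w s x" "w t x - w s x"] in auto)
   then show ?thesis using sum_square_le_double[of "norm (w s x)" "norm (w t x - w s x)"] by linarith
  qed
  then have "y t <= (LBINT x. 2 * (norm (w s x))^2 + 2 * (norm (w t x - w s x))^2)"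
   unfolding y_def using wi[OF that(1)] wi[OF that(2)] di[OF that] by (intro integral_mono) auto
  then show ?thesis unfolding D2(1) y_def using wi[OF that(1)] di[OF that] by simp
 qed
 define c where "c = 6 * W1 * M"
 have c: "0 <= c" using W_nonneg M by (simp add: c_def)
 have T: "0 <= T" using E t0 by auto
 have step: "y t <= y s * (1 + 4 * c * (t - s)) + (4 * c * Cb^2 * T + 3 * Cb^2) * (t - s)^2"
  if st: "s \<in> S" "t \<in> S" "s <= t" for s t
 proof -
  define h where "h = t - s"
  have "s \<in> {0..T}" "t \<in> {0..T}" using st S by auto
  then have h: "0 <= h" "h <= T" using st(3) by (auto simp: h_def)
  define L where "L = c * (2 * y s + 2 * (Cb^2 * (T * h))) + Cb * (Cb * h)"
  have "- (LBINT x. ?B r x \<bullet> w s x) <= L" if r: "r \<in> E" "s <= r" "r <= t" for r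
  proof -
   have dr: "D s r <= Cb * h" using lip[OF st(1) rS[OF r(1)] r(2)] mult_left_mono[of "r - s" h Cb] Cb r(3) by (simp add: h_def)
   have dr2: "(D s r)^2 <= Cb^2 * (T * h)"
   proof -
    have "(D s r)^2 <= (Cb * h)^2" by (rule power_mono[OF dr D2(2)])
    also have "... = Cb^2 * (h * h)" by (simp add: power2_eq_square)
    also have "... <= Cb^2 * (T * h)" using h by (intro mult_left_mono mult_right_mono) auto
    finally show ?thesis .
   qed
   have i: "integrable lborel (%x. ?B r x \<bullet> w q x)" if "q \<in> S" for q
    by (rule square_integrable_product[OF Bm[OF r(1)] Yd_measurable(1)[OF wY[OF that]] Bi[OF r(1)] wi[OF that]])
   have "(LBINT x. ?B r x \<bullet> (w r x - w s x)) = (LBINT x. ?B r x \<bullet> w r x) - (LBINT x. ?B r x \<bullet> w s x)"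
    unfolding inner_diff_right by (rule Bochner_Integration.integral_diff[OF i[OF rS[OF r(1)]] i[OF st(1)]])
   moreover have "\<bar>LBINT x. ?B r x \<bullet> w r x\<bar> <= c * y r"
    unfolding c_def y_def by (rule tendency_energy[OF u[OF r(1)] v[OF r(1)] wY[OF rS[OF r(1)]]])
   moreover have "c * y r <= c * (2 * y s + 2 * (Cb^2 * (T * h)))" using crude[OF st(1) rS[OF r(1)]] dr2 by (intro mult_left_mono c) linarith
   moreover have "\<bar>LBINT x. ?B r x \<bullet> (w r x - w s x)\<bar> <= Cb * (Cb * h)"
    using BD[OF r(1) st(1) rS[OF r(1)]] mult_left_mono[OF dr Cb] by linarith
   ultimately show ?thesis unfolding L_def by linarith
  qed
  from incr[OF st wY[OF st(1)] this] have 1: "(LBINT x. (w t x - w s x) \<bullet> w s x) <= L * h" by (simp add: h_def)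
  have 2: "(D s t)^2 <= (Cb * h)^2" unfolding h_def by (rule power_mono[OF lip[OF st] D2(2)])
  have "y t <= y s + 2 * (L * h) + (Cb * h)^2" using expand[OF st(1,2)] 1 2 by linarith
  also have "... = y s * (1 + 4 * c * h) + (4 * c * Cb^2 * T + 3 * Cb^2) * h^2" by (simp add: L_def power2_eq_square algebra_simps)
  finally show ?thesis by (simp add: h_def)
 qed
 have "y t0 = 0"
 proof (rule gronwall_on_dense_set[where S=S and y=y and t=t0 and a="4 * c" and b="4 * c * Cb^2 * T + 3 * Cb^2"])
  show "\<exists>s\<in>S. a < s \<and> s < b" if "0 <= a" "a < b" "b <= t0" for a b
   using full_measure_dense[OF null, of a b] that E t0 S(2) by fastforce
  show "y 0 = 0" by (simp add: y_def w0)
 qed (use S t0 E y0 c T step in auto)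
 then have "AE x in lborel. (norm (w t0 x))^2 = 0" unfolding y_def using integral_nonneg_eq_0_iff_AE[OF wi[OF rS[OF t0]]] by simp
 then have "AE x in lebesgue. w t0 x = 0" by (intro AE_completion) auto
 then show ?thesis by (rule continuous_AE_zero[OF Ck_continuous[OF Yd_Ck[OF wY[OF rS[OF t0]]]]])
qed

text \<open>The common content of both forms of the equations. For general test fields only the integrability of some
tendency is kept, which is what continuity in time needs.\<close>
definition solenoidal_euler :: "real => real => vfield => (real => vfield) => bool" where
 "solenoidal_euler \<Omega> T u0 u \<longleftrightarrow> admissible T u0 u \<and>
   (\<forall>\<phi>. test_fun \<phi> --> (\<exists>k. set_integrable lebesgue {0..T} k \<and>
    (\<forall>t\<in>{0..T}. pairing (u t) \<phi> = pairing u0 \<phi> - (LINT s:{0..t}|lebesgue. k s)) \<and>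
    ((\<forall>x. dvg \<phi> x = 0) --> (\<forall>s. k s = pairing (coriolis \<Omega> (u s)) \<phi> + pairing (advect (u s)) \<phi>))))"

lemma pressure_solenoidal: assumes "rot_euler_pressure \<Omega> T u0 u" shows "solenoidal_euler \<Omega> T u0 u" unfolding solenoidal_euler_def
proof (intro conjI allI impI)
 show "admissible T u0 u" using assms by (simp add: rot_euler_pressure_def)
 fix \<phi> :: vfield assume t: "test_fun \<phi>"
 obtain p where p: "\<forall>\<phi> :: vfield. test_fun \<phi> -->
     (let F = (%s. pairing (coriolis \<Omega> (u s)) \<phi> + pairing (advect (u s)) \<phi>
            - (LINT x|lebesgue. p s x * dvg \<phi> x))
      in set_integrable lebesgue {0..T} F \<and>
       (\<forall>t\<in>{0..T}. pairing (u t) \<phi> = pairing u0 \<phi> - (LINT s:{0..t}|lebesgue. F s)))"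
  using assms unfolding rot_euler_pressure_def by blast
 show "\<exists>k. set_integrable lebesgue {0..T} k \<and>
    (\<forall>t\<in>{0..T}. pairing (u t) \<phi> = pairing u0 \<phi> - (LINT s:{0..t}|lebesgue. k s)) \<and>
    ((\<forall>x. dvg \<phi> x = 0) --> (\<forall>s. k s = pairing (coriolis \<Omega> (u s)) \<phi> + pairing (advect (u s)) \<phi>))"
  by (rule exI[of _ "%s. pairing (coriolis \<Omega> (u s)) \<phi> + pairing (advect (u s)) \<phi> - (LINT x|lebesgue. p s x * dvg \<phi> x)"])
    (use p[rule_format, OF t] in "simp add: Let_def")
qed

text \<open>For a solenoidal test field \<open>grad (dvg \<phi>)\<close> vanishes, so \<open>leray_P \<phi> = \<phi>\<close> and \<open>leray_Q \<phi> = 0\<close>.\<close>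
lemma projected_solenoidal: assumes "rot_euler_projected \<Omega> T u0 u" shows "solenoidal_euler \<Omega> T u0 u" unfolding solenoidal_euler_def
proof (intro conjI allI impI)
 show "admissible T u0 u" using assms by (simp add: rot_euler_projected_def)
 fix \<phi> :: vfield assume t: "test_fun \<phi>"
 define G where "G s = - pairing (advect (u s)) \<phi> - pairing (coriolis \<Omega> (u s)) (leray_P \<phi>) + pairing (advect (u s)) (leray_Q \<phi>)" for s
 have G: "set_integrable lebesgue {0..T} G" "\<forall>t\<in>{0..T}. pairing (u t) \<phi> = pairing u0 \<phi> + (LINT s:{0..t}|lebesgue. G s)"
  using assms t unfolding rot_euler_projected_def G_def[abs_def] by (auto simp: Let_def)
 have "set_integrable lebesgue {0..T} (%s. - G s)"
  using G(1) unfolding set_integrable_def by (simp only: scaleR_minus_right) (rule Bochner_Integration.integrable_minus)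
 moreover have "(LINT s:{0..t}|lebesgue. - G s) = - (LINT s:{0..t}|lebesgue. G s)" for t
  unfolding set_lebesgue_integral_def scaleR_minus_right by (rule integral_minus)
 moreover have "- G s = pairing (coriolis \<Omega> (u s)) \<phi> + pairing (advect (u s)) \<phi>" if d: "\<forall>x. dvg \<phi> x = 0" for s
 proof -
  have dz: "dvg \<phi> = (%x. 0)" using d by auto
  have "pd i (%x. 0 :: real) x = 0" for i x by (rule trans[OF pd_eq[OF has_derivative_const]]) simp
  then have "grad (dvg \<phi>) = (%x. 0)" unfolding dz by (simp add: grad_def fun_eq_iff vec_eq_iff)
  then have "leray_P \<phi> = \<phi>" "leray_Q \<phi> = (%x. 0)" by (auto simp: leray_Q_def leray_P_def inv_neg_laplacian_def fun_eq_iff)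
  then show ?thesis by (simp add: G_def pairing_def[of _ "%x. 0"])
 qed
 ultimately show "\<exists>k. set_integrable lebesgue {0..T} k \<and>
    (\<forall>t\<in>{0..T}. pairing (u t) \<phi> = pairing u0 \<phi> - (LINT s:{0..t}|lebesgue. k s)) \<and>
    ((\<forall>x. dvg \<phi> x = 0) --> (\<forall>s. k s = pairing (coriolis \<Omega> (u s)) \<phi> + pairing (advect (u s)) \<phi>))"
  using G(2) by (intro exI[of _ "%s. - G s"]) auto
qed

lemma Ck1_diff_derivative:
 assumes "Ck 1 f" "Ck 1 g"
 shows "frechet_derivative (%x. f x - g x) (at x) h = frechet_derivative f (at x) h - frechet_derivative g (at x) h"
 using frechet_derivative_at[OF has_derivative_diff[OF Ck1_has_derivative[OF assms(1)] Ck1_has_derivative[OF assms(2)]], of x] by metis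

lemma self_advection_continuous:
 fixes f :: vfield
 assumes "Ck 1 f" shows "continuous_on UNIV (%x. frechet_derivative f (at x) (f x))" unfolding frechet_derivative_expand[OF assms]
 by (intro continuous_on_sum continuous_on_scaleR pd_continuous assms Ck_continuous[OF Ck_component[OF assms]])

lemma solenoidal_terms:
 assumes u: "Yd M u" and v: "Yd M v" and \<phi>: "test_fun \<phi>"
 shows "(pairing (coriolis \<Omega> v) \<phi> + pairing (advect v) \<phi>) - (pairing (coriolis \<Omega> u) \<phi> + pairing (advect u) \<phi>)
  = (LBINT x. tendency \<Omega> u v (%x. v x - u x) x \<bullet> \<phi> x)"
proof -
 obtain R where R: "!!x. norm x >= R ==> \<phi> x = 0" using test_fun_vanishes[OF \<phi>] by metis
 have mphi: "\<phi> \<in> borel_measurable borel" by (rule test_fun_measurable[OF \<phi>])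
 have I: "integrable lborel (%x. f x \<bullet> \<phi> x)" if "continuous_on UNIV f" for f :: vfield
  by (rule integrable_continuous_compact_support[of _ R])
    (use R in "auto intro!: continuous_on_inner that Ck_continuous[OF test_fun_Ck[OF \<phi>]]")
 have cc: "continuous_on UNIV (coriolis \<Omega> f)" if "Ck 1 f" for f unfolding coriolis_def[abs_def]
  by (intro continuous_on_scaleR continuous_on_const bounded_bilinear.continuous_on[OF bounded_bilinear_cross3] Ck_continuous[OF that])
 have P: "pairing (coriolis \<Omega> f) \<phi> + pairing (advect f) \<phi>
   = (LBINT x. (coriolis \<Omega> f x + frechet_derivative f (at x) (f x)) \<bullet> \<phi> x)" (is ?g1)
  "integrable lborel (%x. (coriolis \<Omega> f x + frechet_derivative f (at x) (f x)) \<bullet> \<phi> x)" (is ?g2) if f: "Ck 1 f" for f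
 proof -
  note sc = self_advection_continuous[OF f]
  have 1: "pairing (coriolis \<Omega> f) \<phi> = (LBINT x. coriolis \<Omega> f x \<bullet> \<phi> x)" unfolding pairing_def
   by (rule integral_lebesgue_lborel[OF borel_measurable_inner[OF borel_measurable_continuous_onI[OF cc[OF f]] mphi]])
  have 2: "pairing (advect f) \<phi> = (LBINT x. frechet_derivative f (at x) (f x) \<bullet> \<phi> x)"
   by (rule pairing_AE(1)[OF advect_measurable[OF f] borel_measurable_continuous_onI[OF sc] mphi advect_classical[OF f]])
  show ?g1 unfolding 1 2 inner_add_left by (rule Bochner_Integration.integral_add[OF I[OF cc[OF f]] I[OF sc], symmetric])
  show ?g2 unfolding inner_add_left by (rule Bochner_Integration.integrable_add[OF I[OF cc[OF f]] I[OF sc]])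
 qed
 have cu: "Ck 1 u" and cv: "Ck 1 v" by (rule Yd_Ck[OF u], rule Yd_Ck[OF v])
 have lin: "frechet_derivative u (at x) (a - b) = frechet_derivative u (at x) a - frechet_derivative u (at x) b" for x a b
  by (rule linear_diff[OF bounded_linear.linear[OF has_derivative_bounded_linear[OF Ck1_has_derivative[OF cu]]]])
 have "tendency \<Omega> u v (%x. v x - u x) x
   = (coriolis \<Omega> v x + frechet_derivative v (at x) (v x)) - (coriolis \<Omega> u x + frechet_derivative u (at x) (u x))" for x
  unfolding tendency_def Ck1_diff_derivative[OF cv cu] lin coriolis_def
  by (simp add: right_diff_distrib bounded_bilinear.diff_right[OF bounded_bilinear_cross3] scaleR_diff_right)
 then show ?thesis unfolding P(1)[OF cu] P(1)[OF cv]
  by (simp only: inner_diff_left) (rule Bochner_Integration.integral_diff[OF P(2)[OF cv] P(2)[OF cu], symmetric])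
qed

text \<open>At almost all times the energy argument applies. For a fixed test field the difference of the pairings
is continuous in time, so it vanishes at the exceptional times as well; there the fields need not lie in \<open>Y\<close>
and are identified by duality.\<close>
theorem solenoidal_uniqueness:
 assumes T: "0 < T" and u: "Linf_in_time T YS YN u" "solenoidal_euler \<Omega> T u0 u"
  and v: "Linf_in_time T YS YN v" "solenoidal_euler \<Omega> T u0 v"
  and t: "t \<in> {0..T}"
 shows "AE x in lebesgue. v t x = u t x"
proof -
 have Yb: "\<exists>M. AE t in lebesgue. t \<in> {0..T} --> f t \<in> YS \<and> YN (f t) <= M" if "Linf_in_time T YS YN f" for f
 proof -
  obtain M where "AE t in lebesgue_on {0..T}. f t \<in> YS \<and> YN (f t) <= M" using \<open>Linf_in_time T YS YN f\<close> unfolding Linf_in_time_def by blast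
  then have "AE t in lebesgue. t \<in> {0..T} --> f t \<in> YS \<and> YN (f t) <= M" by (subst (asm) AE_restrict_space_iff) auto
  then show ?thesis by blast
 qed
 obtain M1 M2 where M: "AE t in lebesgue. t \<in> {0..T} --> u t \<in> YS \<and> YN (u t) <= M1"
  "AE t in lebesgue. t \<in> {0..T} --> v t \<in> YS \<and> YN (v t) <= M2" using Yb[OF u(1)] Yb[OF v(1)] by blast
 define M where "M = max M1 M2 + 1"
 define E where "E = {t. 0 < t \<and> t <= T \<and> Yd M (u t) \<and> Yd M (v t)}"
 have null: "AE s in lebesgue. s \<in> {0..T} --> s \<in> E"
 proof -
  have "{0::real} \<in> null_sets lebesgue" by (intro null_sets_completionI finite_imp_null_set_lborel) simp
  then have "AE s in lebesgue. s \<noteq> (0::real)" by (subst (asm) AE_iff_null_sets) auto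
  with M show ?thesis
  proof eventually_elim
   case (elim s)
   show ?case
   proof
    assume s: "s \<in> {0..T}"
    have "Yd M (u s)" "Yd M (v s)" using elim(1,2) s by (auto intro!: YN_less simp: M_def)
    then show "s \<in> E" using s elim(3) by (auto simp: E_def)
   qed
  qed
 qed
 have K: "\<exists>k. set_integrable lebesgue {0..T} k \<and> (\<forall>t\<in>{0..T}. pairing (v t) \<phi> - pairing (u t) \<phi> = - (LINT s:{0..t}|lebesgue. k s)) \<and>
   ((\<forall>x. dvg \<phi> x = 0) --> (\<forall>s\<in>E. k s = (LBINT x. tendency \<Omega> (u s) (v s) (%x. v s x - u s x) x \<bullet> \<phi> x)))"
  if \<phi>: "test_fun \<phi>" for \<phi>
 proof -
  obtain a where a: "set_integrable lebesgue {0..T} a" "\<forall>t\<in>{0..T}. pairing (u t) \<phi> = pairing u0 \<phi> - (LINT s:{0..t}|lebesgue. a s)"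
    "(\<forall>x. dvg \<phi> x = 0) --> (\<forall>s. a s = pairing (coriolis \<Omega> (u s)) \<phi> + pairing (advect (u s)) \<phi>)"
   using u(2) \<phi> unfolding solenoidal_euler_def by blast
  obtain b where b: "set_integrable lebesgue {0..T} b" "\<forall>t\<in>{0..T}. pairing (v t) \<phi> = pairing u0 \<phi> - (LINT s:{0..t}|lebesgue. b s)"
    "(\<forall>x. dvg \<phi> x = 0) --> (\<forall>s. b s = pairing (coriolis \<Omega> (v s)) \<phi> + pairing (advect (v s)) \<phi>)"
   using v(2) \<phi> unfolding solenoidal_euler_def by blast
  have sub: "set_integrable lebesgue {0..t} a" "set_integrable lebesgue {0..t} b" if "t \<in> {0..T}" for t
   by (rule set_integrable_subset[OF a(1)], use that in auto) (rule set_integrable_subset[OF b(1)], use that in auto)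
  show ?thesis
  proof (intro exI[of _ "%s. b s - a s"] conjI ballI impI)
   show "set_integrable lebesgue {0..T} (%s. b s - a s)" by (rule set_integral_diff(1)[OF b(1) a(1)])
   show "pairing (v t) \<phi> - pairing (u t) \<phi> = - (LINT s:{0..t}|lebesgue. b s - a s)" if "t \<in> {0..T}" for t
    unfolding set_integral_diff(2)[OF sub(2)[OF that] sub(1)[OF that]] bspec[OF a(2) that] bspec[OF b(2) that] by simp
   show "b s - a s = (LBINT x. tendency \<Omega> (u s) (v s) (%x. v s x - u s x) x \<bullet> \<phi> x)" if "\<forall>x. dvg \<phi> x = 0" "s \<in> E" for s
    using solenoidal_terms[of M "u s" "v s" \<phi> \<Omega>] that a(3) b(3) \<phi> by (simp add: E_def)
  qed
 qed
 define w where "w t = (if t = 0 then (%x. 0) else (%x. v t x - u t x))" for t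
 have "v s x - u s x = 0" if s: "s \<in> E" for s x
 proof -
  have "w s x = 0"
  proof (rule energy_uniqueness[OF _ null _ _ _ _ _ s, where M=M and u=u and v=v and w=w and \<Omega>=\<Omega>])
   fix \<phi> :: vfield assume \<phi>: "test_fun \<phi>" "!!x. dvg \<phi> x = 0"
   obtain k where k: "set_integrable lebesgue {0..T} k" "\<forall>t\<in>{0..T}. pairing (v t) \<phi> - pairing (u t) \<phi> = - (LINT s:{0..t}|lebesgue. k s)"
    "\<forall>s\<in>E. k s = (LBINT x. tendency \<Omega> (u s) (v s) (%x. v s x - u s x) x \<bullet> \<phi> x)" using K[OF \<phi>(1)] \<phi>(2) by blast
   have mphi: "\<phi> \<in> borel_measurable borel" by (rule test_fun_measurable[OF \<phi>(1)])
   obtain R where R: "!!x. norm x >= R ==> \<phi> x = 0" using test_fun_vanishes[OF \<phi>(1)] by metis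
   have pr: "pairing f \<phi> = (LBINT x. f x \<bullet> \<phi> x)" "integrable lborel (%x. f x \<bullet> \<phi> x)" if "Yd M f" for f
    unfolding pairing_def by (rule integral_lebesgue_lborel[OF borel_measurable_inner[OF Yd_measurable(1)[OF that] mphi]])
      (rule integrable_continuous_compact_support[of _ R],
      use R in "auto intro!: continuous_on_inner Ck_continuous[OF Yd_Ck[OF that]] Ck_continuous[OF test_fun_Ck[OF \<phi>(1)]]")
   show "\<exists>k. set_integrable lebesgue {0..T} k \<and>
     (\<forall>s\<in>E. k s = (LBINT x. tendency \<Omega> (u s) (v s) (w s) x \<bullet> \<phi> x)) \<and>
     (\<forall>t\<in>insert 0 E. (LBINT x. w t x \<bullet> \<phi> x) = - (LINT s:{0..t}|lebesgue. k s))"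
   proof (intro exI[of _ k] conjI ballI k(1))
    show "k s = (LBINT x. tendency \<Omega> (u s) (v s) (w s) x \<bullet> \<phi> x)" if "s \<in> E" for s
     using bspec[OF k(3) that] that by (simp add: w_def E_def)
    show "(LBINT x. w t x \<bullet> \<phi> x) = - (LINT s:{0..t}|lebesgue. k s)" if t: "t \<in> insert 0 E" for t
    proof (cases "t = 0")
     case True
     have z: "{0::real} \<in> null_sets lebesgue" by (intro null_sets_completionI finite_imp_null_set_lborel) simp
     have "(LINT s:{0..0}|lebesgue. k s) = 0" unfolding set_lebesgue_integral_def
      by (rule integral_eq_zero_AE) (use AE_not_in[OF z] in "eventually_elim, auto")
     then show ?thesis using True by (simp add: w_def)
    next
     case False
     then have t: "t \<in> E" "t \<in> {0..T}" using t by (auto simp: E_def)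
     then have Y: "Yd M (v t)" "Yd M (u t)" by (auto simp: E_def)
     have "(LBINT x. w t x \<bullet> \<phi> x) = pairing (v t) \<phi> - pairing (u t) \<phi>"
      unfolding pr(1)[OF Y(1)] pr(1)[OF Y(2)] Bochner_Integration.integral_diff[OF pr(2)[OF Y(1)] pr(2)[OF Y(2)], symmetric]
      using False by (simp add: w_def inner_diff_left)
     then show ?thesis using bspec[OF k(2) t(2)] by simp
    qed
   qed
  qed (auto simp: E_def w_def)
  then show ?thesis using s by (simp add: w_def E_def)
 qed
 then have vu: "v s = u s" if "s \<in> E" for s using that by (auto simp: fun_eq_iff)
 have clos: "t \<in> closure E" (is ?g1) "closure E \<subseteq> {0..T}" (is ?g2)
 proof -
  show ?g2 by (rule closure_minimal) (auto simp: E_def)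
  show ?g1 unfolding closure_approachable
  proof (intro allI impI)
   fix e :: real assume e: "0 < e"
   have "\<exists>s\<in>E. max 0 (t - e) < s \<and> s < min T (t + e)" by (rule full_measure_dense[OF null]) (use t T e in auto)
   then obtain s where "s \<in> E" "max 0 (t - e) < s" "s < min T (t + e)" by blast
   then show "\<exists>y\<in>E. dist y t < e" by (intro bexI[of _ s]) (auto simp: dist_real_def)
  qed
 qed
 show ?thesis
 proof (rule pairing_determines)
  show "loc_integrable (v t)" "loc_integrable (u t)" using t u(2) v(2) by (auto simp: solenoidal_euler_def admissible_def weakly_div_free_def)
  fix \<phi> :: vfield assume \<phi>: "test_fun \<phi>"
  obtain k where k: "set_integrable lebesgue {0..T} k" "\<forall>t\<in>{0..T}. pairing (v t) \<phi> - pairing (u t) \<phi> = - (LINT s:{0..t}|lebesgue. k s)"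
   using K[OF \<phi>] by blast
  have e: "pairing (v t) \<phi> - pairing (u t) \<phi> = - integral {0..t} k" if "t \<in> {0..T}" for t
  proof -
   have "set_integrable lebesgue {0..t} k" by (rule set_integrable_subset[OF k(1)]) (use that in auto)
   from set_lebesgue_integral_eq_integral(2)[OF this] show ?thesis using bspec[OF k(2) that] by simp
  qed
  have c: "continuous_on {0..T} (%t. - integral {0..t} k)"
   by (intro continuous_on_minus indefinite_integral_continuous_1 set_lebesgue_integral_eq_integral(1)[OF k(1)])
  have z: "- integral {0..s} k = 0" if "s \<in> E" for s using e[of s] that vu[OF that] by (simp add: E_def)
  have "- integral {0..t} k = 0" by (rule continuous_constant_on_closure[OF continuous_on_subset[OF c clos(2)] z clos(1)])
  then show "pairing (v t) \<phi> = pairing (u t) \<phi>" using e[OF t] by simp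
 qed
qed

section \<open>Lacunary initial data\<close>

text \<open>\<open>k $ 3 * cutoff_slope 1 k\<close> is the derivative of the unit cutoff in the third direction and \<open>k \<times> e3\<close> does not
depend on the third coordinate; so the density is itself a derivative in that direction.\<close>
definition ring_dens :: "real^3 => real^3" where
 "ring_dens k = (k $ 3 * cutoff_slope 1 k) *\<^sub>R cross3 k e3"

lemma ring_dens_Ck: "Ck m ring_dens"
proof -
 have "Ck m (%k::real^3. k $ 3)" by (rule Ck_linear[OF bounded_linear_vec_nth])
 moreover have "Ck m (%k::real^3. k)" by (rule Ck_linear[OF bounded_linear_ident])
 ultimately show ?thesis unfolding ring_dens_def[abs_def] by (intro Ck_scaleR Ck_mult Ck_cutoff_slope Ck_cross3 Ck_const)
qed

lemma ring_dens_zero: "norm k >= 1 ==> ring_dens k = 0" using dbump_zero[of 1 k] by (simp add: ring_dens_def cutoff_slope_def)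

lemma ring_dens_measurable[measurable]: "ring_dens \<in> borel_measurable borel"
 by (rule borel_measurable_continuous_onI[OF Ck_continuous[OF ring_dens_Ck[of 0]]])

lemma ring_dens_linear_bound: "\<exists>C>0. \<forall>k. norm (ring_dens k) <= C * norm k"
proof -
 obtain C where C: "C > 0" "!!x. \<bar>cutoff_slope 1 x\<bar> * norm x <= C" using cutoff_slope_bound by force
 have "norm (ring_dens k) <= C * norm k" for k
 proof -
  have "\<bar>k $ 3 * cutoff_slope 1 k\<bar> <= C"
   using C(2)[of k] mult_right_mono[OF component_le_norm_cart[of k 3] abs_ge_zero[of "cutoff_slope 1 k"]] by (simp add: abs_mult mult.commute)
  moreover have "norm (cross3 k e3) <= norm k" using norm_cross_le[of k e3] by (simp add: e3_def norm_axis_1)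
  ultimately show ?thesis using C(1) unfolding ring_dens_def norm_scaleR by (intro mult_mono) auto
 qed
 then show ?thesis using C(1) by blast
qed

lemma ring_dens_band: "band 1 ring_dens" unfolding band_def
proof (intro conjI allI impI)
 obtain C where C: "C > 0" "!!k. norm (ring_dens k) <= C * norm k" using ring_dens_linear_bound by blast
 have "norm (ring_dens k) <= C" for k
 proof (cases "norm k >= 1")
  case False
  then have "C * norm k <= C * 1" using C(1) by (intro mult_left_mono) auto
  then show ?thesis using C(2)[of k] by simp
 qed (use C(1) in "simp add: ring_dens_zero")
 then show "\<exists>b. \<forall>k. norm (ring_dens k) <= b" by blast
qed (auto simp: ring_dens_zero)

lemma ring_dens_div: "k \<bullet> ring_dens k = 0" by (simp add: ring_dens_def dot_cross_self)

lemma cas_has_derivative: "(cas has_derivative (%h. h * cas (- \<theta>))) (at \<theta>)"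
 unfolding cas_def[abs_def] by (auto intro!: derivative_eq_intros simp: algebra_simps)

lemma cas_phase_Ck: "Ck 1 (%k::real^3. - cas (- (k \<bullet> x)))" (is ?g1)
 and cas_phase_pd: "pd i (%k. - cas (- (k \<bullet> x))) k = x $ i * cas (k \<bullet> x)" (is ?g2)
proof -
 have D: "((%k. - cas (- (k \<bullet> x))) has_derivative (%h. (h \<bullet> x) * cas (k \<bullet> x))) (at k)" for k :: "real^3"
 proof -
  have "((%k. - (k \<bullet> x)) has_derivative (%h. - (h \<bullet> x))) (at k)" by (auto intro!: derivative_eq_intros)
  from has_derivative_minus[OF has_derivative_compose[OF this cas_has_derivative]] show ?thesis by simp
 qed
 have c: "continuous_on UNIV (%k. (b \<bullet> x) * cas (k \<bullet> x))" for b unfolding cas_def by (intro continuous_intros)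
 have "Ck (Suc 0) (%k::real^3. - cas (- (k \<bullet> x)))" by (rule Ck_SucI[OF D]) (simp add: c)
 then show ?g1 by simp
 show ?g2 unfolding pd_eq[OF D] by (simp add: inner_axis')
qed

lemma ring_dens_mean: "(LBINT k. ring_dens k) = 0"
proof -
 have c1: "Ck 1 (%k. cross3 k e3)" by (rule Ck_cross3[OF Ck_linear[OF bounded_linear_ident] Ck_const])
 have p: "pd 3 (%k. cross3 k e3) k = 0" for k
  by (rule trans[OF pd_eq[OF bounded_bilinear.FDERIV[OF bounded_bilinear_cross3 has_derivative_ident has_derivative_const]]])
    (simp add: e3_def bounded_bilinear.zero_right[OF bounded_bilinear_cross3])
 have "pd 3 (dbump 1 (real 1)) k = k $ 3 * cutoff_slope 1 k" for k unfolding pd_eq[OF cutoff_derivative] by (simp add: inner_axis)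
 then have "(LBINT k. ring_dens k) = (LBINT k. pd 3 (dbump 1 (real 1)) k *\<^sub>R cross3 k e3)" by (simp add: ring_dens_def)
 also have "... = - (LBINT k. dbump 1 (real 1) k *\<^sub>R pd 3 (%k. cross3 k e3) k)"
  by (rule integration_by_parts_left[OF Ck_dbump _ c1, of 1]) (simp add: dbump_zero)
 finally show ?thesis by (simp add: p)
qed

text \<open>The profile vanishes at the origin because its density has mean zero.\<close>
lemma ring_small: "norm (hart ring_dens x) <= 3 * (LBINT k. norm (ring_dens k)) * norm x"
proof -
 note i = rapid_integrable[OF band_rapid[OF ring_dens_band]]
 have "hart ring_dens x = (LBINT k. (cas (k \<bullet> x) - 1) *\<^sub>R ring_dens k)" unfolding hart_def scaleR_diff_left scaleR_one
  by (subst Bochner_Integration.integral_diff[OF integrable_cas[OF i] i]) (simp add: ring_dens_mean)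
 also have "norm ... <= (LBINT k. norm ((cas (k \<bullet> x) - 1) *\<^sub>R ring_dens k))" by (rule integral_norm_bound)
 also have "... <= (LBINT k. 3 * norm x * norm (ring_dens k))"
 proof (rule integral_mono)
  show "integrable lborel (%k. norm ((cas (k \<bullet> x) - 1) *\<^sub>R ring_dens k))"
   unfolding scaleR_diff_left scaleR_one by (intro integrable_norm Bochner_Integration.integrable_diff integrable_cas i)
  show "integrable lborel (%k. 3 * norm x * norm (ring_dens k))" by (intro integrable_mult_right integrable_norm i)
  have c: "\<bar>cas \<theta> - 1\<bar> <= 3 * \<bar>\<theta>\<bar>" for \<theta>
  proof (cases "\<bar>\<theta>\<bar> <= 1")
   case True
   have "\<bar>cas \<theta> - 1 - \<theta>\<bar> <= 2 * \<theta>^2" using cas_expansion[of 0 \<theta>] by (simp add: cas_def)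
   moreover have "\<theta>^2 = \<bar>\<theta>\<bar> * \<bar>\<theta>\<bar>" by (metis power2_abs power2_eq_square)
   moreover have "\<bar>\<theta>\<bar> * \<bar>\<theta>\<bar> <= \<bar>\<theta>\<bar> * 1" using True by (intro mult_left_mono) auto
   ultimately show ?thesis by linarith
  next
   case False then show ?thesis using abs_cas_le[of \<theta>] by linarith
  qed
  show "norm ((cas (k \<bullet> x) - 1) *\<^sub>R ring_dens k) <= 3 * norm x * norm (ring_dens k)" for k
  proof (cases "norm k >= 1")
   case False
   have "norm k * norm x <= 1 * norm x" using False by (intro mult_right_mono) auto
   then have "\<bar>cas (k \<bullet> x) - 1\<bar> <= 3 * norm x" using c[of "k \<bullet> x"] Cauchy_Schwarz_ineq2[of k x] by linarith
   then show ?thesis unfolding norm_scaleR real_norm_def by (rule mult_right_mono) simp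
  qed (simp add: ring_dens_zero)
 qed
 finally show ?thesis by (simp add: mult_ac)
qed

text \<open>Integration by parts in frequency: \<open>x $ i * cas (k \<bullet> x)\<close> is a derivative in \<open>k\<close>.\<close>
lemma ring_decay: "\<exists>D\<ge>0. \<forall>x. norm x * norm (hart ring_dens x) <= D"
proof -
 define D where "D i = 2 * (LBINT k. norm (pd i ring_dens k))" for i
 have z: "ring_dens k = 0" if "norm k >= 1" for k using ring_dens_zero[OF that] .
 have "\<bar>x $ i\<bar> * norm (hart ring_dens x) <= D i" for x i
 proof -
  note P = integration_by_parts[OF cas_phase_Ck[of x] ring_dens_Ck z, where i=i]
  have c: "continuous_on UNIV (pd i ring_dens)" by (rule pd_continuous[OF ring_dens_Ck])
  have i: "integrable lborel (pd i ring_dens)"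
   by (rule integrable_continuous_compact_support[OF c, of 2]) (rule pd_zero_outside[OF ring_dens_Ck z], auto)
  have "x $ i *\<^sub>R hart ring_dens x = (LBINT k. pd i (%k. - cas (- (k \<bullet> x))) k *\<^sub>R ring_dens k)"
   unfolding hart_def cas_phase_pd scaleR_scaleR[symmetric] by (rule integral_scaleR_right[symmetric])
  also have "... = - (LBINT k. - cas (- (k \<bullet> x)) *\<^sub>R pd i ring_dens k)" by (simp only: P(3) minus_minus)
  also have "... = hart (pd i ring_dens) (- x)" by (simp add: hart_def)
  finally have "\<bar>x $ i\<bar> * norm (hart ring_dens x) = norm (hart (pd i ring_dens) (- x))" by (metis norm_scaleR)
  then show ?thesis using norm_hart_le[OF i] by (simp add: D_def)
 qed
 then have "(\<Sum>i\<in>UNIV. \<bar>x $ i\<bar>) * norm (hart ring_dens x) <= (\<Sum>i\<in>UNIV. D i)" for x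
  unfolding sum_distrib_right by (rule sum_mono)
 moreover have "norm x * norm (hart ring_dens x) <= (\<Sum>i\<in>UNIV. \<bar>x $ i\<bar>) * norm (hart ring_dens x)" for x
  by (intro mult_right_mono norm_le_l1_cart) simp
 ultimately have "norm x * norm (hart ring_dens x) <= (\<Sum>i\<in>UNIV. D i)" for x using order_trans by blast
 moreover have "0 <= (\<Sum>i\<in>UNIV. D i)" unfolding D_def by (intro sum_nonneg mult_nonneg_nonneg Bochner_Integration.integral_nonneg) auto
 ultimately show ?thesis by blast
qed

text \<open>\<open>min (r, 1/r)\<close> is at most six times the increment of \<open>r / (1 + r)\<close> from \<open>r\<close> to \<open>2 r\<close>, so the sum over
dyadic scales telescopes.\<close>
lemma ring_lacunary_bound: "\<exists>C>0. \<forall>n x. (\<Sum>j<n. norm (hart ring_dens ((1 / 2 ^ j) *\<^sub>R x))) <= C"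
proof -
 obtain D where D: "D >= 0" "!!x. norm x * norm (hart ring_dens x) <= D" using ring_decay by blast
 define A where "A = max D (3 * (LBINT k. norm (ring_dens k)))"
 have A: "A >= 0" using D(1) by (simp add: A_def)
 \<comment> \<open>Its increments from \<open>r\<close> to \<open>2 r\<close> dominate \<open>min (r, 1/r)\<close>.\<close>
 define \<phi> where "\<phi> r = r / (1 + r)" for r :: real
 have ph: "\<phi> (2 * r) - \<phi> r = r / ((1 + r) * (1 + 2 * r))" if "0 <= r" for r
  using that by (simp add: \<phi>_def divide_simps) (simp add: algebra_simps)
 have b: "norm (hart ring_dens x) <= 6 * A * (\<phi> (2 * norm x) - \<phi> (norm x))" for x
 proof -
  define r where "r = norm x"
  have r: "0 <= r" by (simp add: r_def)
  have pos: "0 < (1 + r) * (1 + 2 * r)" using r by (intro mult_pos_pos) auto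
  show ?thesis
  proof (cases "r <= 1")
   case True
   have "3 * (LBINT k. norm (ring_dens k)) * r <= A * r" by (rule mult_right_mono[OF _ r]) (simp add: A_def)
   then have "norm (hart ring_dens x) <= A * r" using ring_small[of x] by (simp add: r_def)
   also have "... <= A * (6 * (r / ((1 + r) * (1 + 2 * r))))"
   proof (rule mult_left_mono[OF _ A])
    have "(1 + r) * (1 + 2 * r) <= 2 * 3" using True r by (intro mult_mono) auto
    then have "r * ((1 + r) * (1 + 2 * r)) <= r * 6" using r by (intro mult_left_mono) auto
    then show "r <= 6 * (r / ((1 + r) * (1 + 2 * r)))" using pos by (simp add: pos_le_divide_eq mult_ac)
   qed
   finally show ?thesis using ph[OF r] by (simp add: r_def mult_ac)
  next
   case False
   have "r * norm (hart ring_dens x) <= A" using D(2)[of x] by (simp add: r_def A_def)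
   then have "norm (hart ring_dens x) <= A * (1 / r)" using False by (simp add: pos_le_divide_eq mult.commute)
   also have "... <= A * (6 * (r / ((1 + r) * (1 + 2 * r))))"
   proof (rule mult_left_mono[OF _ A])
    have "1 <= r * r" "r <= r * r" using False mult_mono[of 1 r 1 r] by auto
    then have "(1 + r) * (1 + 2 * r) <= 6 * (r * r)" by (simp add: algebra_simps)
    then show "1 / r <= 6 * (r / ((1 + r) * (1 + 2 * r)))" using pos False by (simp add: divide_le_eq pos_le_divide_eq mult_ac)
   qed
   finally show ?thesis using ph[OF r] by (simp add: r_def mult_ac)
  qed
 qed
 have T1: "(\<Sum>j<n. norm (hart ring_dens ((1 / 2 ^ j) *\<^sub>R x))) <= 6 * A * (\<phi> (2 * norm x) - \<phi> (2 * norm x / 2 ^ n))" for n x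
 proof (induction n)
  case (Suc n)
  have "norm ((1 / 2 ^ n) *\<^sub>R x) = norm x / 2 ^ n" by simp
  then have "norm (hart ring_dens ((1 / 2 ^ n) *\<^sub>R x)) <= 6 * A * (\<phi> (2 * norm x / 2 ^ n) - \<phi> (2 * norm x / 2 ^ Suc n))"
   using b[of "(1 / 2 ^ n) *\<^sub>R x"] by simp
  then have "(\<Sum>j<Suc n. norm (hart ring_dens ((1 / 2 ^ j) *\<^sub>R x)))
    <= 6 * A * (\<phi> (2 * norm x) - \<phi> (2 * norm x / 2 ^ n)) + 6 * A * (\<phi> (2 * norm x / 2 ^ n) - \<phi> (2 * norm x / 2 ^ Suc n))"
   unfolding sum.lessThan_Suc using Suc by linarith
  also have "... = 6 * A * (\<phi> (2 * norm x) - \<phi> (2 * norm x / 2 ^ Suc n))" unfolding distrib_left[symmetric] by simp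
  finally show ?case .
 qed simp
 have T2: "6 * A * (\<phi> (2 * norm x) - \<phi> (2 * norm x / 2 ^ n)) <= 6 * A * 1" for n and x :: "real^3"
 proof (rule mult_left_mono)
  have "\<phi> (2 * norm x) <= 1" by (simp add: \<phi>_def divide_le_eq add_pos_nonneg)
  moreover have "0 <= \<phi> (2 * norm x / 2 ^ n)" unfolding \<phi>_def by simp
  ultimately show "\<phi> (2 * norm x) - \<phi> (2 * norm x / 2 ^ n) <= 1" by linarith
 qed (use A in simp)
 have "(\<Sum>j<n. norm (hart ring_dens ((1 / 2 ^ j) *\<^sub>R x))) <= 6 * A + 1" for n x
  using T1[where n=n and x=x] T2[where n=n and x=x] by linarith
 then show ?thesis using A by (intro exI[of _ "6 * A + 1"]) auto
qed

definition rescale :: "real => (real^3 => real^3) => real^3 => real^3" where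
 "rescale l g k = (1 / l ^ 3) *\<^sub>R g ((1 / l) *\<^sub>R k)"

lemma integral_rescale:
 fixes g :: "real^3 => 'b::{banach, second_countable_topology}"
 assumes "l > 0" "g \<in> borel_measurable borel"
 shows "(LBINT k. (1 / l ^ 3) *\<^sub>R g ((1 / l) *\<^sub>R k)) = (LBINT k. g k)"
 unfolding integral_scaleR_right using integral_affine[of "1 / l" g 0] assms by (simp add: power_divide)

lemma hart_rescale:
 assumes "l > 0" "g \<in> borel_measurable borel" shows "hart (rescale l g) x = hart g (l *\<^sub>R x)"
proof -
 have "hart (rescale l g) x = (LBINT k. (1 / l ^ 3) *\<^sub>R (%k. cas (k \<bullet> (l *\<^sub>R x)) *\<^sub>R g k) ((1 / l) *\<^sub>R k))"
  unfolding hart_def rescale_def using assms(1) by (simp add: mult.commute)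
 also have "... = hart g (l *\<^sub>R x)" unfolding hart_def by (rule integral_rescale[OF assms(1)]) (use assms(2) in measurable)
 finally show ?thesis .
qed

definition coriolis_dens :: "(real^3 => real^3) => real^3 => real^3" where
 "coriolis_dens g k = cross3 e3 (g k) - gradm k (cross3 e3 (g k))"

lemma gradm_homogeneous: "c \<noteq> 0 ==> gradm (c *\<^sub>R k) v = gradm k v" by (simp add: gradm_def)

lemma coriolis_dens_sum:
 shows "coriolis_dens (%k. \<Sum>j\<in>S. c j *\<^sub>R h j k) k = (\<Sum>j\<in>S. c j *\<^sub>R coriolis_dens (h j) k)"
proof -
 have l: "linear (%v. cross3 e3 v - gradm k (cross3 e3 v))"
  by (intro linear_compose_sub linear_compose[OF _ bounded_linear.linear[OF gradm_linear], unfolded o_def]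
    bounded_linear.linear[OF bounded_bilinear.bounded_linear_right[OF bounded_bilinear_cross3]])
 show ?thesis unfolding coriolis_dens_def linear_sum[OF l] linear_scale[OF l] ..
qed

text \<open>The projection multiplier is homogeneous of degree zero, hence commutes with dilations.\<close>
lemma coriolis_dens_rescale:
 assumes "l > 0" shows "coriolis_dens (rescale l g) k = (1 / l ^ 3) *\<^sub>R coriolis_dens g ((1 / l) *\<^sub>R k)"
 unfolding coriolis_dens_def rescale_def using assms gradm_homogeneous[of "1 / l" k]
 by (simp add: linear_scale[OF bounded_linear.linear[OF gradm_linear]] linear_scale[OF bounded_linear.linear[OF bounded_bilinear.bounded_linear_right[OF bounded_bilinear_cross3]]] scaleR_diff_right)

lemma coriolis_dens_band:
 assumes "band R g" shows "band R (coriolis_dens g)"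
proof (rule band_mult_bounded(1)[OF assms, where C=2])
 have [measurable]: "g \<in> borel_measurable borel" by (rule band_measurable[OF assms])
 show "coriolis_dens g \<in> borel_measurable borel" unfolding coriolis_dens_def[abs_def]
  by (intro borel_measurable_diff gradm_measurable cross3_measurable) measurable
 show "norm (coriolis_dens g k) <= 2 * norm (g k)" for k unfolding coriolis_dens_def
  using norm_triangle_ineq4[of "cross3 e3 (g k)" "gradm k (cross3 e3 (g k))"] norm_gradm[of k "cross3 e3 (g k)"] norm_cross_e3[of "g k"] by linarith
qed simp

lemma ring_coriolis_component:
 "coriolis_dens ring_dens k $ 3 = (k $ 3)^2 * - cutoff_slope 1 k * ((k $ 1)^2 + (k $ 2)^2) / (k \<bullet> k)"
proof -
 have c: "cross3 e3 (ring_dens k) = (k $ 3 * cutoff_slope 1 k) *\<^sub>R (\<chi> i. if i = 3 then 0 else k $ i)"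
  by (simp add: ring_dens_def cross3_def e3_def axis_def vec_eq_iff forall_3)
 have i: "k \<bullet> (\<chi> i. if i = 3 then 0 else k $ i) = (k $ 1)^2 + (k $ 2)^2" by (simp add: inner_vec3 sum_3 power2_eq_square)
 show ?thesis unfolding coriolis_dens_def c by (simp add: gradm_def i power2_eq_square)
qed

lemma cutoff_slope_sign: "cutoff_slope 1 k <= 0" (is ?g1) "norm k < 1 ==> cutoff_slope 1 k < 0"
proof -
 have e: "poly ([:0, 0, 1:] * (1 - pderiv 1)) y = y^2" for y :: real by (simp add: power2_eq_square)
 show ?g1 by (simp add: cutoff_slope_def dbump_def flat_def e)
 assume "norm k < 1"
 then have "(norm k)^2 < 1" by (simp add: power_less_one_iff abs_square_less_1)
 then have "1 - k \<bullet> k > 0" by (simp add: dot_square_norm)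
 then show "cutoff_slope 1 k < 0" by (simp add: cutoff_slope_def dbump_def flat_def e)
qed

text \<open>The third component comes from the projection alone and equals a nonnegative function that is positive
on an open set of frequencies.\<close>
lemma ring_coriolis_positive: "(LBINT k. coriolis_dens ring_dens k $ 3) > 0"
proof -
 have b: "band 1 (coriolis_dens ring_dens)" by (rule coriolis_dens_band[OF ring_dens_band])
 have i: "integrable lborel (%k. coriolis_dens ring_dens k $ 3)" by (rule rapid_integrable[OF rapid_component[OF band_rapid[OF b]]])
 have nn: "0 <= coriolis_dens ring_dens k $ 3" for k unfolding ring_coriolis_component using cutoff_slope_sign(1)[of k]
  by (intro divide_nonneg_nonneg mult_nonneg_nonneg) auto
 have "(LBINT k. coriolis_dens ring_dens k $ 3) \<noteq> 0"
 proof
  assume "(LBINT k. coriolis_dens ring_dens k $ 3) = 0"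
  then have "AE k in lborel. coriolis_dens ring_dens k $ 3 = 0" using integral_nonneg_eq_0_iff_AE[OF i] nn by simp
  then have ae: "AE k in lebesgue. coriolis_dens ring_dens k $ 3 = 0" by (intro AE_completion) auto
  define O' where "O' = {k::real^3. norm k < 1 \<and> 0 < k $ 1 \<and> 0 < k $ 3}"
  have op: "open O'" unfolding O'_def by (intro open_Collect_conj open_Collect_less continuous_intros)
  have pos: "coriolis_dens ring_dens k $ 3 \<noteq> 0" if "k \<in> O'" for k
  proof -
   have "k \<noteq> 0" using that by (auto simp: O'_def)
   then have p1: "k \<bullet> k > 0" by simp
   have p2: "0 < (k $ 1)^2 + (k $ 2)^2" using that by (intro add_pos_nonneg) (auto simp: O'_def)
   have p3: "0 < (k $ 3)^2 * - cutoff_slope 1 k" using that cutoff_slope_sign(2)[of k] by (intro mult_pos_pos) (auto simp: O'_def)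
   have "0 < coriolis_dens ring_dens k $ 3" unfolding ring_coriolis_component by (rule divide_pos_pos[OF mult_pos_pos[OF p3 p2] p1])
   then show ?thesis by simp
  qed
  have "AE k in lebesgue. k \<notin> O'" using ae by eventually_elim (use pos in auto)
  then have "O' \<in> null_sets lebesgue" using op by (subst AE_iff_null_sets) auto
  then have "O' = {}" using open_not_negligible[OF op] by (auto simp: negligible_iff_null_sets)
  moreover define e :: "real^3" where "e = (\<chi> i. if i = 2 then 0 else 1 / 2)"
  have "e \<in> O'"
  proof -
   have "(norm e)^2 < 1" unfolding power2_norm_eq_inner by (simp add: inner_vec3 sum_3 e_def)
   then have "norm e < 1" by (simp add: abs_square_less_1)
   then show ?thesis by (simp add: O'_def e_def)
  qed
  ultimately show False by blast
 qed
 moreover have "0 <= (LBINT k. coriolis_dens ring_dens k $ 3)" using nn by (intro Bochner_Integration.integral_nonneg) auto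
 ultimately show ?thesis by simp
qed

definition lacunary :: "real => real => nat => real^3 => real^3" where
 "lacunary s \<eta> n k = (\<Sum>j<n. s *\<^sub>R rescale (\<eta> / 2 ^ j) ring_dens k)"

lemma rescale_band:
 assumes l: "0 < l" "l <= \<eta>" and g: "band 1 g"
 shows "band \<eta> (rescale l g)" unfolding band_def
proof (intro conjI allI impI)
 have [measurable]: "g \<in> borel_measurable borel" by (rule band_measurable[OF g])
 show "rescale l g \<in> borel_measurable borel" unfolding rescale_def[abs_def] by measurable
 obtain b where b: "!!k. norm (g k) <= b" using g unfolding band_def by blast
 have "norm (rescale l g k) <= (1 / l ^ 3) * b" for k unfolding rescale_def norm_scaleR using b l(1) by (simp add: divide_right_mono)
 then show "\<exists>b. \<forall>k. norm (rescale l g k) <= b" by blast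
 fix k :: "real^3" assume "norm k > \<eta>"
 then have "norm k / l > 1" using l by (simp add: less_divide_eq)
 then show "rescale l g k = 0" using band_zero[OF g, of "(1 / l) *\<^sub>R k"] l(1) by (simp add: rescale_def)
qed

lemma scales: fixes \<eta> :: real assumes "0 < \<eta>" shows "0 < \<eta> / 2 ^ j" "\<eta> / 2 ^ j <= \<eta>"
 using assms by (auto simp: divide_le_eq)

lemma lacunary_summand_band:
 assumes "0 < \<eta>" shows "band \<eta> (%k. s *\<^sub>R rescale (\<eta> / 2 ^ j) ring_dens k)" (is ?g1)
  "(LBINT k. norm (s *\<^sub>R rescale (\<eta> / 2 ^ j) ring_dens k)) = \<bar>s\<bar> * (LBINT k. norm (ring_dens k))" (is ?g2)
proof -
 note b = rescale_band[OF scales[OF assms, of j] ring_dens_band]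
 have [measurable]: "rescale (\<eta> / 2 ^ j) ring_dens \<in> borel_measurable borel" by (rule band_measurable[OF b])
 show ?g1 by (rule band_mult_bounded(1)[OF b, where C="\<bar>s\<bar>"]) auto
 define l where "l = \<eta> / 2 ^ j"
 have l: "l > 0" using assms by (simp add: l_def)
 have "(LBINT k. norm (s *\<^sub>R rescale l ring_dens k)) = \<bar>s\<bar> * (LBINT k. (1 / l ^ 3) *\<^sub>R norm (ring_dens ((1 / l) *\<^sub>R k)))"
  using l by (simp add: rescale_def)
 also have "... = \<bar>s\<bar> * (LBINT k. norm (ring_dens k))" by (subst integral_rescale[OF l]) auto
 finally show ?g2 by (simp add: l_def)
qed

lemma lacunary_band:
 assumes "0 < \<eta>"
 shows "band \<eta> (lacunary s \<eta> n)" (is ?g1) "(LBINT k. norm (lacunary s \<eta> n k)) <= real n * (\<bar>s\<bar> * (LBINT k. norm (ring_dens k)))" (is ?g2)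
proof -
 have "finite {..<n}" by simp
 note b = band_sum[OF this lacunary_summand_band(1)[OF assms, of s]]
 show ?g1 unfolding lacunary_def[abs_def] by (rule conjunct1[OF b])
 have "(LBINT k. norm (lacunary s \<eta> n k)) <= (\<Sum>j<n. LBINT k. norm (s *\<^sub>R rescale (\<eta> / 2 ^ j) ring_dens k))"
  unfolding lacunary_def[abs_def] by (rule conjunct2[OF b])
 also have "... = (\<Sum>j<n. \<bar>s\<bar> * (LBINT k. norm (ring_dens k)))" by (rule sum.cong[OF refl lacunary_summand_band(2)[OF assms]])
 finally show ?g2 by simp
qed

lemma lacunary_div: "k \<bullet> lacunary s \<eta> n k = 0"
proof -
 have "k \<bullet> rescale l ring_dens k = 0" for l using ring_dens_div[of "(1 / l) *\<^sub>R k"] by (cases "l = 0") (auto simp: rescale_def)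
 then show ?thesis by (simp add: lacunary_def inner_sum_right)
qed

lemma lacunary_linear_bound:
 assumes "0 < \<eta>" shows "\<exists>b\<ge>0. \<forall>k. norm (lacunary s \<eta> n k) <= b * norm k"
proof -
 obtain C where C: "C > 0" "!!k. norm (ring_dens k) <= C * norm k" using ring_dens_linear_bound by blast
 define b where "b j = \<bar>s\<bar> * (1 / (\<eta> / 2 ^ j) ^ 3 * (C * (1 / (\<eta> / 2 ^ j))))" for j :: nat
 have "norm (s *\<^sub>R rescale (\<eta> / 2 ^ j) ring_dens k) <= b j * norm k" for j k
 proof -
  define l where "l = \<eta> / 2 ^ j"
  have l: "l > 0" using assms by (simp add: l_def)
  have "norm (ring_dens ((1 / l) *\<^sub>R k)) <= C * (1 / l * norm k)" using C(2)[of "(1 / l) *\<^sub>R k"] l by simp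
  then have "\<bar>s\<bar> * ((1 / l ^ 3) * norm (ring_dens ((1 / l) *\<^sub>R k))) <= \<bar>s\<bar> * ((1 / l ^ 3) * (C * (1 / l * norm k)))"
   using l by (intro mult_left_mono) auto
  then show ?thesis using l by (simp add: rescale_def b_def l_def[symmetric] mult.assoc)
 qed
 then have "norm (lacunary s \<eta> n k) <= (\<Sum>j<n. b j) * norm k" for k unfolding lacunary_def sum_distrib_right by (rule sum_norm_le)
 moreover have "0 <= (\<Sum>j<n. b j)" unfolding b_def using assms C(1) by (intro sum_nonneg) auto
 ultimately show ?thesis by blast
qed

lemma hart_lacunary: assumes "0 < \<eta>" shows "hart (lacunary s \<eta> n) x = (\<Sum>j<n. s *\<^sub>R hart ring_dens ((\<eta> / 2 ^ j) *\<^sub>R x))"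
proof -
 have "hart (lacunary s \<eta> n) x = (\<Sum>j<n. hart (%k. s *\<^sub>R rescale (\<eta> / 2 ^ j) ring_dens k) x)"
  unfolding lacunary_def[abs_def] by (rule hart_sum) (rule rapid_integrable[OF band_rapid[OF lacunary_summand_band(1)[OF assms]]])
 also have "... = (\<Sum>j<n. s *\<^sub>R hart ring_dens ((\<eta> / 2 ^ j) *\<^sub>R x))"
 proof (rule sum.cong[OF refl])
  fix j
  have "hart (%k. s *\<^sub>R rescale (\<eta> / 2 ^ j) ring_dens k) x = s *\<^sub>R hart (rescale (\<eta> / 2 ^ j) ring_dens) x"
   by (rule hart_scaleR[OF rapid_integrable[OF band_rapid[OF rescale_band[OF scales[OF assms] ring_dens_band]]]])
  then show "hart (%k. s *\<^sub>R rescale (\<eta> / 2 ^ j) ring_dens k) x = s *\<^sub>R hart ring_dens ((\<eta> / 2 ^ j) *\<^sub>R x)"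
   using hart_rescale[OF scales(1)[OF assms] ring_dens_measurable] by simp
 qed
 finally show ?thesis .
qed

lemma hart_lacunary_origin: assumes "0 < \<eta>" shows "hart (lacunary s \<eta> n) 0 = 0"
 unfolding hart_lacunary[OF assms] using ring_small[of 0] by simp

lemma hart_lacunary_bound: "\<exists>C>0. \<forall>s\<ge>0. \<forall>\<eta>>0. \<forall>n x. norm (hart (lacunary s \<eta> n) x) <= C * s"
proof -
 obtain C where C: "C > 0" "!!n x. (\<Sum>j<n. norm (hart ring_dens ((1 / 2 ^ j) *\<^sub>R x))) <= C" using ring_lacunary_bound by blast
 have "norm (hart (lacunary s \<eta> n) x) <= C * s" if "s >= 0" "\<eta> > 0" for s \<eta> n x
 proof -
  have "norm (hart (lacunary s \<eta> n) x) <= (\<Sum>j<n. norm (s *\<^sub>R hart ring_dens ((1 / 2 ^ j) *\<^sub>R (\<eta> *\<^sub>R x))))"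
   unfolding hart_lacunary[OF that(2)] by (rule order_trans[OF norm_sum]) simp
  also have "... = s * (\<Sum>j<n. norm (hart ring_dens ((1 / 2 ^ j) *\<^sub>R (\<eta> *\<^sub>R x))))"
   unfolding norm_scaleR sum_distrib_left[symmetric] using that(1) by simp
  also have "... <= s * C" by (rule mult_left_mono[OF C(2) that(1)])
  finally show ?thesis by (simp add: mult.commute)
 qed
 then show ?thesis using C(1) by blast
qed

lemma hart_lacunary_coriolis:
 assumes "0 < \<eta>"
 shows "hart (coriolis_dens (lacunary s \<eta> n)) 0 $ 3 = real n * s * (LBINT k. coriolis_dens ring_dens k $ 3)"
proof -
 define V where "V = (LBINT k. coriolis_dens ring_dens k)"
 have b: "band 1 (coriolis_dens ring_dens)" by (rule coriolis_dens_band[OF ring_dens_band])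
 have e: "coriolis_dens (lacunary s \<eta> n) = (%k. \<Sum>j<n. s *\<^sub>R coriolis_dens (rescale (\<eta> / 2 ^ j) ring_dens) k)"
  unfolding lacunary_def[abs_def] by (rule ext) (rule coriolis_dens_sum)
 have bj: "band \<eta> (coriolis_dens (rescale (\<eta> / 2 ^ j) ring_dens))" for j
  by (rule coriolis_dens_band[OF rescale_band[OF scales[OF assms] ring_dens_band]])
 have ij: "integrable lborel (coriolis_dens (rescale (\<eta> / 2 ^ j) ring_dens))" for j by (rule rapid_integrable[OF band_rapid[OF bj]])
 have "hart (coriolis_dens (lacunary s \<eta> n)) 0 = (LBINT k. (\<Sum>j<n. s *\<^sub>R coriolis_dens (rescale (\<eta> / 2 ^ j) ring_dens) k))"
  unfolding hart_def e by (simp add: cas_def)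
 also have "... = (\<Sum>j<n. s *\<^sub>R (LBINT k. coriolis_dens (rescale (\<eta> / 2 ^ j) ring_dens) k))"
  by (subst Bochner_Integration.integral_sum) (auto intro: ij)
 also have "... = (\<Sum>j<n. s *\<^sub>R V)"
  unfolding V_def coriolis_dens_rescale[OF scales(1)[OF assms]] integral_rescale[OF scales(1)[OF assms] band_measurable[OF b]] ..
 also have "... $ 3 = real n * s * V $ 3" by (simp only: sum_component vector_scaleR_component) simp
 also have "V $ 3 = (LBINT k. coriolis_dens ring_dens k $ 3)"
  unfolding V_def by (rule integral_bounded_linear[OF bounded_linear_vec_nth rapid_integrable[OF band_rapid[OF b]], symmetric])
 finally show ?thesis .
qed

lemma norm_dirmult_band:
 fixes g :: "real^3 => real^3"
 assumes g: "band \<eta> g" and "0 <= \<eta>"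
 shows "norm (pd i (hart g) x) <= 2 * \<eta> * (LBINT k. norm (g k))"
proof -
 have [measurable]: "g \<in> borel_measurable borel" by (rule band_measurable[OF g])
 note r = band_rapid[OF g]
 have "norm (pd i (hart g) x) <= 2 * (LBINT k. norm (dirmult (axis i 1) g k))"
  unfolding pd_hart[OF r] by (rule norm_hart_le[OF rapid_integrable[OF rapid_dirmult[OF r]]])
 also have "(LBINT k. norm (dirmult (axis i 1) g k)) <= (LBINT k. \<eta> * norm (g (0 - k)))"
 proof (rule integral_mono)
  show "integrable lborel (%k. norm (dirmult (axis i 1) g k))" by (rule rapid_integrable_norm[OF rapid_dirmult[OF r]])
  show "integrable lborel (%k. \<eta> * norm (g (0 - k)))" using rapid_integrable_norm[OF rapid_reflect[OF r]] by simp
  show "norm (dirmult (axis i 1) g k) <= \<eta> * norm (g (0 - k))" for k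
  proof (cases "norm k > \<eta>")
   case True then show ?thesis using band_zero[OF g, of "- k"] by (simp add: dirmult_def)
  next
   case False
   then have "\<bar>k $ i\<bar> <= \<eta>" using component_le_norm_cart[of k i] by linarith
   then show ?thesis by (simp add: dirmult_def inner_axis mult_right_mono)
  qed
 qed
 also have "(LBINT k. \<eta> * norm (g (0 - k))) = \<eta> * (LBINT k. norm (g k))" using integral_reflect[of "%k. norm (g k)" 0] by simp
 finally show ?thesis by simp
qed

section \<open>Norm inflation\<close>

text \<open>The order of choices matters: \<open>s\<close> from \<open>\<epsilon>\<close>, then \<open>t\<close> from \<open>\<delta>\<close> and \<open>\<Omega>\<close>, then the number \<open>n\<close> of scales so that the
linear gain \<open>t |\<Omega>| \<kappa> s n\<close> exceeds \<open>2\<close>, and last the frequency bound \<open>\<eta>\<close>. The quadratic error is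
proportional to \<open>n\<close> as well and is controlled by \<open>t\<close>.\<close>
lemma lacunary_inflation:
 assumes Om: "\<Omega> \<noteq> 0" and e: "\<epsilon> > 0" "\<delta> > 0"
 obtains \<eta> a b t :: real and g0 where "euler_series \<eta> a b g0" "W1inf_norm (hart g0) <= \<epsilon>" "0 < t" "t < \<delta>"
  "t <= euler_series.T \<Omega>" "1 <= norm (euler_series.u \<Omega> g0 t 0)"
proof -
 obtain C where C: "C > 0" "!!s \<eta> n x. s >= 0 ==> \<eta> > 0 ==> norm (hart (lacunary s \<eta> n) x) <= C * s"
  using hart_lacunary_bound by blast
 define \<kappa> where "\<kappa> = (LBINT k. coriolis_dens ring_dens k $ 3)"
 have \<kappa>: "\<kappa> > 0" unfolding \<kappa>_def by (rule ring_coriolis_positive)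
 define m where "m = (LBINT k. norm (ring_dens k)) + 1"
 have m: "m >= 1" "(LBINT k. norm (ring_dens k)) <= m" by (auto simp: m_def intro!: Bochner_Integration.integral_nonneg)
 define B where "B = 8 * \<bar>\<Omega>\<bar> + 128"
 have B: "B > 0" by (simp add: B_def)
 define q where "q = \<bar>\<Omega>\<bar> * \<kappa>"
 have q: "q > 0" using Om \<kappa> by (simp add: q_def)
 define s where "s = \<epsilon> / (2 * C)"
 have s: "s > 0" "C * s = \<epsilon> / 2" using e C by (auto simp: s_def)
 \<comment> \<open>The time is small enough for the quadratic remainder to be a quarter of the linear gain.\<close>
 define t where "t = min (\<delta> / 2) (min (1 / (16 * B)) (q / (16 * m * B^2)))"
 have t: "t > 0" "t < \<delta>" "t <= 1 / (16 * B)" "t <= q / (16 * m * B^2)" using e B q m by (auto simp: t_def min_def)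
 have tq: "4 * m * (B * t)^2 <= t * q / 4"
 proof -
  have "t * (16 * m * B^2) <= q" using t(4) m B by (simp add: pos_le_divide_eq)
  from mult_left_mono[OF this, of t] t(1) show ?thesis by (simp add: power2_eq_square algebra_simps)
 qed
 \<comment> \<open>The number of scales makes the linear gain large, and the frequencies are chosen last.\<close>
 obtain n :: nat where n: "2 / (t * q * s) < real n" using reals_Archimedean2 by blast
 have n1: "2 < t * q * s * real n" using n t(1) q s(1) by (simp add: divide_less_eq mult_ac)
 have n0: "real n > 0" using n t(1) q s(1) by (meson divide_pos_pos less_trans mult_pos_pos zero_less_numeral)
 define a where "a = s * real n * m"
 have a: "a > 0" using s n0 m by (simp add: a_def)
 define \<eta> where "\<eta> = min 1 (min (1 / a) (min (\<epsilon> / (36 * a)) (q * s * real n / (64 * a^2))))"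
 have eta: "0 < \<eta>" "\<eta> <= 1" "\<eta> <= 1 / a" "\<eta> <= \<epsilon> / (36 * a)" "\<eta> <= q * s * real n / (64 * a^2)"
  using a e q s n0 by (auto simp: \<eta>_def)
 have ea: "\<eta> * a <= 1" "18 * \<eta> * a <= \<epsilon> / 2" "16 * \<eta> * a^2 <= q * s * real n / 4"
  using eta(3,4,5) a by (simp_all add: pos_le_divide_eq)
 define g0 where "g0 = lacunary s \<eta> n"
 obtain b where b: "b >= 0" "!!k. norm (g0 k) <= b * norm k" using lacunary_linear_bound[OF eta(1)] unfolding g0_def by blast
 have L1: "(LBINT k. norm (g0 k)) <= a"
 proof -
  have "(LBINT k. norm (g0 k)) <= real n * (\<bar>s\<bar> * (LBINT k. norm (ring_dens k)))"
   unfolding g0_def by (rule lacunary_band(2)[OF eta(1)])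
  also have "... <= real n * (\<bar>s\<bar> * m)" using m(2) by (intro mult_left_mono) auto
  finally show ?thesis using s(1) by (simp add: a_def mult_ac)
 qed
 have gb: "band \<eta> g0" unfolding g0_def by (rule lacunary_band(1)[OF eta(1)])
 interpret S: euler_series \<Omega> \<eta> a b g0 by unfold_locales (use eta ea a b L1 gb lacunary_div in "auto simp: g0_def")
 have ser: "euler_series \<eta> a b g0" by unfold_locales
 have norm0: "W1inf_norm (hart g0) <= \<epsilon>"
 proof -
  have "norm (pd i (hart g0) x) <= 2 * \<eta> * a" for i x
   using norm_dirmult_band[OF gb, of i x] eta(1) mult_left_mono[OF L1, of "2 * \<eta>"] by linarith
  moreover have "norm (hart g0 x) <= C * s" for x using C(2)[of s \<eta> n x] s eta by (simp add: g0_def)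
  ultimately have "W1inf_norm (hart g0) <= C * s + 9 * (2 * \<eta> * a)" by (intro C1_norms(3)[OF rapid_Ck_hart[OF band_rapid[OF gb]]])
  then show ?thesis using s(2) ea(2) by simp
 qed
 have BT: "S.B = B" "S.T = 1 / (16 * B)" by (simp_all add: S.B_def S.T_def B_def)
 define P where "P = hart (coriolis_dens g0) 0"
 have "norm (S.u t 0 - hart g0 0 + (t * \<Omega>) *\<^sub>R P) <= 4 * a * (B * t)^2 + 16 * t * \<eta> * a^2"
  using S.first_order[of t 0] t BT unfolding P_def coriolis_dens_def[abs_def] by simp
 then have 1: "norm (S.u t 0 + (t * \<Omega>) *\<^sub>R P) <= 4 * a * (B * t)^2 + 16 * t * \<eta> * a^2"
  using hart_lacunary_origin[OF eta(1), of s n] by (simp add: g0_def)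
 have 2: "norm ((t * \<Omega>) *\<^sub>R P) >= t * q * s * real n"
 proof -
  have "P $ 3 = real n * s * \<kappa>" unfolding P_def g0_def \<kappa>_def by (rule hart_lacunary_coriolis[OF eta(1)])
  then have "real n * s * \<kappa> <= norm P" using component_le_norm_cart[of P 3] by linarith
  then have "(t * \<bar>\<Omega>\<bar>) * (real n * s * \<kappa>) <= (t * \<bar>\<Omega>\<bar>) * norm P" using t(1) by (intro mult_left_mono) auto
  then show ?thesis using t(1) by (simp add: q_def abs_mult mult_ac)
 qed
 have 3: "4 * a * (B * t)^2 <= t * q * s * real n / 4" using mult_left_mono[OF tq, of "s * real n"] s(1) n0 by (simp add: a_def mult_ac)
 have 4: "16 * t * \<eta> * a^2 <= t * q * s * real n / 4" using mult_left_mono[OF ea(3), of t] t(1) by (simp add: mult_ac)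
 have "norm ((t * \<Omega>) *\<^sub>R P) <= norm (S.u t 0 + (t * \<Omega>) *\<^sub>R P) + norm (S.u t 0)"
  using norm_triangle_ineq4[of "S.u t 0 + (t * \<Omega>) *\<^sub>R P" "S.u t 0"] by simp
 then have "1 <= norm (S.u t 0)" using 1 2 3 4 n1 by linarith
 then show ?thesis using that[OF ser norm0 t(1,2)] t(3) BT(2) by simp
qed

text \<open>The same space \<open>Y\<close> serves all four cases, with \<open>c = 1\<close>. It consists of smooth fields lying in both spaces,
and the norm of the solution is bounded below by its value at the origin.\<close>
lemma mildly_ill_posed_criterion:
 assumes Om: "\<Omega> \<noteq> 0" and X: "C1b \<subseteq> X \<or> W1inf \<subseteq> X"
  and weak: "!!T u0 u. sol T u0 u ==> solenoidal_euler \<Omega> T u0 u"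
  and series: "!!\<eta> a b g0. euler_series \<eta> a b g0 ==>
    sol (euler_series.T \<Omega>) (euler_series.u \<Omega> g0 0) (euler_series.u \<Omega> g0)"
 shows "mildly_ill_posed X W1inf_norm sol" unfolding mildly_ill_posed_def
proof (intro exI[of _ YS] exI[of _ YN] exI[of _ "1 :: real"] conjI allI impI banach_fields_Y cont_embedded_Y[OF X])
 fix \<epsilon> \<delta> :: real assume e: "\<epsilon> > 0" "\<delta> > 0"
 obtain \<eta> a b t g0 where D: "euler_series \<eta> a b g0" "W1inf_norm (hart g0) <= \<epsilon>" "0 < t" "t < \<delta>"
  "t <= euler_series.T \<Omega>" "1 <= norm (euler_series.u \<Omega> g0 t 0)" by (rule lacunary_inflation[OF Om e], rule that)
 interpret S: euler_series \<Omega> \<eta> a b g0 by (rule D(1))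
 have u0: "S.u 0 = hart g0" by (simp add: S.u_def S.gt_0)
 have Y: "Yd S.CC (S.u r)" if "0 <= r" "r <= S.T" for r by (rule S.u_Yd) (use that S.KT in auto)
 have uX: "S.u t \<in> X" using Yd_norms(1,2)[OF Y[of t]] X D by auto
 have inflation: "\<exists>t. 0 < t \<and> t < \<delta> \<and> t <= S.T \<and> S.u t \<in> X \<and> 1 <= W1inf_norm (S.u t)"
 proof (intro exI[of _ t] conjI D(3,4,5) uX)
  show "1 <= W1inf_norm (S.u t)" using Yd_norms(4)[OF Y[of t], of 0] D(3,5,6) by linarith
 qed
 have unique: "\<forall>v. Linf_in_time S.T YS YN v \<and> sol S.T (S.u 0) v --> (\<forall>r\<in>{0..S.T}. AE x in lebesgue. v r x = S.u r x)"
 proof (intro allI impI ballI)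
  fix v r assume v: "Linf_in_time S.T YS YN v \<and> sol S.T (S.u 0) v" and r: "r \<in> {0..S.T}"
  show "AE x in lebesgue. v r x = S.u r x"
   by (rule solenoidal_uniqueness[OF S.KT(2) S.u_Linf_in_time weak[OF series[OF D(1)]] conjunct1[OF v] weak[OF conjunct2[OF v]] r])
 qed
 have "\<exists>T>0. \<exists>u. Linf_in_time T YS YN u \<and> sol T (S.u 0) u \<and>
      (\<forall>v. Linf_in_time T YS YN v \<and> sol T (S.u 0) v --> (\<forall>t\<in>{0..T}. AE x in lebesgue. v t x = u t x)) \<and>
      (\<exists>t. 0 < t \<and> t < \<delta> \<and> t <= T \<and> u t \<in> X \<and> 1 <= W1inf_norm (u t))"
  by (rule exI[of _ S.T], rule conjI[OF S.KT(2)], rule exI[of _ S.u])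
    (rule conjI[OF S.u_Linf_in_time conjI[OF series[OF D(1)] conjI[OF unique inflation]]])
 moreover have "S.u 0 \<in> YS" by (rule YdD[OF Y]) (use S.KT in auto)
 moreover have "W1inf_norm (S.u 0) <= \<epsilon>" using D(2) u0 by simp
 ultimately show "\<exists>u0\<in>YS. W1inf_norm u0 <= \<epsilon> \<and> (\<exists>T>0. \<exists>u. Linf_in_time T YS YN u \<and> sol T u0 u \<and>
      (\<forall>v. Linf_in_time T YS YN v \<and> sol T u0 v --> (\<forall>t\<in>{0..T}. AE x in lebesgue. v t x = u t x)) \<and>
      (\<exists>t. 0 < t \<and> t < \<delta> \<and> t <= T \<and> u t \<in> X \<and> 1 <= W1inf_norm (u t)))" by blast
qed simp

theorem corollary1p2:
 fixes \<Omega> :: real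
 assumes "\<Omega> \<noteq> 0"
 shows "mildly_ill_posed W1inf W1inf_norm (rot_euler_pressure \<Omega>) \<and>
     mildly_ill_posed C1b W1inf_norm (rot_euler_pressure \<Omega>) \<and>
     mildly_ill_posed W1inf W1inf_norm (rot_euler_projected \<Omega>) \<and>
     mildly_ill_posed C1b W1inf_norm (rot_euler_projected \<Omega>)"
proof (intro conjI)
 have W: "C1b \<subseteq> W1inf \<or> W1inf \<subseteq> W1inf" and C: "C1b \<subseteq> C1b \<or> W1inf \<subseteq> C1b" by simp_all
 show "mildly_ill_posed W1inf W1inf_norm (rot_euler_pressure \<Omega>)"
  by (rule mildly_ill_posed_criterion[OF assms W]) (erule pressure_solenoidal, erule euler_series.u_solves_pressure)
 show "mildly_ill_posed C1b W1inf_norm (rot_euler_pressure \<Omega>)"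
  by (rule mildly_ill_posed_criterion[OF assms C]) (erule pressure_solenoidal, erule euler_series.u_solves_pressure)
 show "mildly_ill_posed W1inf W1inf_norm (rot_euler_projected \<Omega>)"
  by (rule mildly_ill_posed_criterion[OF assms W]) (erule projected_solenoidal, erule euler_series.u_solves_projected)
 show "mildly_ill_posed C1b W1inf_norm (rot_euler_projected \<Omega>)"
  by (rule mildly_ill_posed_criterion[OF assms C]) (erule projected_solenoidal, erule euler_series.u_solves_projected)
qed

end
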